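(* Let $q$ be an odd prime power, $A_{q^2}=\bigoplus_{n\ge0}\mathcal C(\mathfrak{gl}(n,\mathbb F_{q^2}))$ and $B_{q^2}=\bigoplus_{n\ge0}\mathcal C(\mathfrak u(2n,\mathbb F_{q^2}))$. The map $\widetilde\Delta:B_{q^2}\to A_{q^2}\otimes B_{q^2}$ intertwines the left action of $A_{q^2}$ on $B_{q^2}$ with the twisted action $\odot$ of $A_{q^2}$ on $A_{q^2}\otimes B_{q^2}$; that is, for all $a\in A_{q^2}$ and $b\in B_{q^2}$, $$\widetilde\Delta\big(\widetilde\nabla(a\otimes b)\big)=a\odot\widetilde\Delta(b).$$
   Context: Notation. For a matrix $A=(a_{rs})$ over $\mathbb F_{q^2}$, $A^*$ is the transpose of $(a_{rs}^q)$. $J_m$ is the $m\times m$ matrix with $1$'s on the antidiagonal and $0$ elsewhere. $\mathrm U(2n,\mathbb F_{q^2})=\{g\in\mathrm{GL}(2n,\mathbb F_{q^2}):g^*J_{2n}g=J_{2n}\}$ and $\mathfrak u(2n,\mathbb F_{q^2})=\{X\in\mathfrak{gl}(2n,\mathbb F_{q^2}):X^*J_{2n}+J_{2n}X=0\}$. $\mathcal C(\cdot)$ denotes the real vector space of real-valued functions on a matrix Lie algebra invariant under conjugation by the corresponding group ($\mathrm{GL}(n,\mathbb F_{q^2})$ for $\mathfrak{gl}(n,\mathbb F_{q^2})$, $\mathrm U(2n,\mathbb F_{q^2})$ for $\mathfrak u(2n,\mathbb F_{q^2})$); for $n=0$ it is $\mathbb R$. $\mathcal C(\mathfrak{gl}(n,\mathbb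 F_{q^2}))$ and $\mathcal C(\mathfrak u(2n,\mathbb F_{q^2}))$ are the $n$-th graded parts of $A_{q^2}$ and $B_{q^2}$. Parabolic restriction and induction. For a finite matrix group $G$ with Lie algebra $\mathcal G$ and a parabolic subgroup $P=LU$ with Lie algebra $\mathcal P=\mathcal L\oplus\mathcal U$ (Levi part, nilradical): $(\downarrow^{\mathcal G}_{\mathcal L}\Psi)(Y)=|\mathcal U|^{-1}\sum_{Z\in\mathcal U}\Psi(Y+Z)$ for $\Psi\in\mathcal C(\mathcal G)$, $Y\in\mathcal L$; and $(\uparrow^{\mathcal G}_{\mathcal L}\Phi)(X)=\sum_{g\in[G/P]}\Phi'(g^{-1}Xg)$ for $\Phi\in\mathcal C(\mathcal L)$, $X\in\mathcal G$, where the sum is over representatives of left cosets, $\Phi'$ equals $\Phi$ composed with the projection $\mathcal P\to\mathcal L$ on $\mathcal P$, and $\Phi'=0$ outside $\mathcal P$. The maps $\nabla$, $\Delta$ on $A_{q^2}$. For $i+j=n$, $i,j\ge0$, take $G=\mathrm{GL}(n,\mathbb F_{q^2})$ and $P_{i,j}$ = invertible block upper triangular matrices with respect to $n=i+j$, with Levi Lie algebra $\{\mathrm{diag}(A,B)\}\cong\mathfrak{gl}(i,\mathbb F_{q^2})\oplus\mathfrak{gl}(j,\mathbb F_{q^2})$ and nilradical the strictly block upper triangular matrices. $\nabla:A_{q^2}\otimes A_{q^2}\to A_{q^2}$ is the sum of the resulting parabolic inductions $\mathcal C(\mathfrak{gl}(i,\mathbb F_{q^2}))\otimes\mathcal C(\mathfrak{gl}(j,\mathbb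 F_{q^2}))\to\mathcal C(\mathfrak{gl}(i+j,\mathbb F_{q^2}))$, and $\Delta:A_{q^2}\to A_{q^2}\otimes A_{q^2}$ restricted to degree $n$ is the sum over $i+j=n$ of the parabolic restrictions. With these maps $A_{q^2}$ is a graded commutative and cocommutative bialgebra (unit and counit: inclusion of and projection onto the degree-$0$ part $\mathbb R$). The maps $\widetilde\nabla$, $\widetilde\Delta$. For $i+j=n$, $i,j\ge0$, take $G=\mathrm U(2n,\mathbb F_{q^2})$ and $\widetilde P_{i,j}$ = the subgroup of matrices in $\mathrm U(2n,\mathbb F_{q^2})$ that are block upper triangular with respect to $2n=i+2j+i$. Its Levi subgroup is $\{\mathrm{diag}(A,B,J_i(A^* )^{-1}J_i):A\in\mathrm{GL}(i,\mathbb F_{q^2}),B\in\mathrm U(2j,\mathbb F_{q^2})\}$, with Lie algebra $\{\mathrm{diag}(A,B,-J_iA^*J_i)\}\cong\mathfrak{gl}(i,\mathbb F_{q^2})\oplus\mathfrak u(2j,\mathbb F_{q^2})$ via $(A,B)$; the nilradical is the set of strictly block upper triangular matrices in $\mathfrak u(2n,\mathbb F_{q^2})$. $\widetilde\nabla:A_{q^2}\otimes B_{q^2}\to B_{q^2}$ is the sum of the parabolic inductions $\mathcal C(\mathfrak{gl}(i,\mathbb F_{q^2}))\otimes\mathcal C(\mathfrak u(2j,\mathbb F_{q^2}))\to\mathcal C(\mathfrak u(2(i+j),\mathbb F_{q^2}))$, and $\widetilde\Delta:B_{q^2}\to A_{q^2}\otimes B_{q^2}$ restricted to degree $n$ is the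 sum over $i+j=n$ of the parabolic restrictions. The left action of $A_{q^2}$ on $B_{q^2}$ is $a\cdot b:=\widetilde\nabla(a\otimes b)$. The twist. Let $\omega_n:\mathfrak{gl}(n,\mathbb F_{q^2})\to\mathfrak{gl}(n,\mathbb F_{q^2})$, $\omega_n(X)=-J_nX^*J_n$, i.e. $(\omega_n(X))_{r,s}=-(X_{n+1-s,\,n+1-r})^q$ (an involution). The $\omega_n$ induce linear maps $f\mapsto f\circ\omega_n$ on $\mathcal C(\mathfrak{gl}(n,\mathbb F_{q^2}))$, hence a graded linear map $\omega:A_{q^2}\to A_{q^2}$. The twisted action is the linear map $\odot:A_{q^2}\otimes(A_{q^2}\otimes B_{q^2})\to A_{q^2}\otimes B_{q^2}$, $$a\odot(a'\otimes b):=\sum\big(a_{(1)}\,\omega(a_{(2)})\,a'\big)\otimes\big(a_{(3)}\cdot b\big),\qquad\text{where }(\Delta\otimes\mathrm{id})\Delta(a)=(\mathrm{id}\otimes\Delta)\Delta(a)=\sum a_{(1)}\otimes a_{(2)}\otimes a_{(3)},$$ and products of elements of $A_{q^2}$ are taken with respect to $\nabla$. *)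

theory Defs
  imports
    "Jordan_Normal_Form.Matrix"
    "HOL-Algebra.Left_Coset"
    "HOL-Library.Cardinality"
    "HOL-Number_Theory.Prime_Powers"
begin

section \<open>The groups and their Lie algebras\<close>

text \<open>
  The field \<open>F\<^bsub>q\<^sup>2\<^esub>\<close> is an arbitrary finite field type of cardinality \<open>q\<^sup>2\<close>, so that \<open>x \<mapsto> x ^ q\<close> is
  its involution. Matrix indices start at 0.
\<close>

definition GL :: "nat \<Rightarrow> 'k::field mat monoid" where
  "GL n = units_of (ring_mat TYPE('k) n ())"

definition gl :: "nat \<Rightarrow> 'k::field mat set" where
  "gl n = carrier_mat n n"

definition herm :: "nat \<Rightarrow> 'k::field mat \<Rightarrow> 'k mat" where
  "herm q A = transpose_mat (map_mat (\<lambda>x. x ^ q) A)"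

definition J :: "nat \<Rightarrow> 'k::field mat" where
  "J m = mat m m (\<lambda>(r, s). if r + s + 1 = m then 1 else 0)"

text \<open>\<open>U q n\<close> and \<open>u q n\<close> are the unitary group and Lie algebra of \<open>2n \<times> 2n\<close> matrices.\<close>

definition U :: "nat \<Rightarrow> nat \<Rightarrow> 'k::field mat monoid" where
  "U q n = (GL (2 * n)) \<lparr>carrier :=
     {g \<in> carrier (GL (2 * n)). herm q g * J (2 * n) * g = J (2 * n)}\<rparr>"

definition u :: "nat \<Rightarrow> nat \<Rightarrow> 'k::field mat set" where
  "u q n = {X \<in> gl (2 * n). herm q X * J (2 * n) + J (2 * n) * X = 0\<^sub>m (2 * n) (2 * n)}"


section \<open>The graded spaces of invariant functions\<close>

text \<open>
  A function on a set \<open>\<G>\<close> of matrices is represented by its extension by 0 to all matrices.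
  The sets \<open>gl n\<close> are pairwise disjoint, and so are the sets \<open>u q n\<close>; hence the direct sum of
  the spaces of invariant functions is the internal direct sum inside \<open>'k mat \<Rightarrow> real\<close>.
\<close>

definition class_funs :: "'k::field mat monoid \<Rightarrow> 'k mat set \<Rightarrow> ('k mat \<Rightarrow> real) set" where
  "class_funs G \<G> =
    {f. (\<forall>X. X \<notin> \<G> \<longrightarrow> f X = 0) \<and>
        (\<forall>g \<in> carrier G. \<forall>X \<in> \<G>. f (g * X * inv\<^bsub>G\<^esub> g) = f X)}"

definition direct_sum :: "(nat \<Rightarrow> ('x \<Rightarrow> real) set) \<Rightarrow> ('x \<Rightarrow> real) set" where
  "direct_sum C =
    {f. \<exists>N h. finite N \<and> (\<forall>n \<in> N. h n \<in> C n) \<and> f = (\<lambda>X. \<Sum>n\<in>N. h n X)}"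

definition A_space :: "('k::field mat \<Rightarrow> real) set" where
  "A_space = direct_sum (\<lambda>n. class_funs (GL n) (gl n))"

definition B_space :: "nat \<Rightarrow> ('k::field mat \<Rightarrow> real) set" where
  "B_space q = direct_sum (\<lambda>n. class_funs (U q n) (u q n))"


section \<open>Parabolic restriction and induction\<close>

text \<open>
  A block decomposition of the index set is given by the list \<open>ns\<close> of block sizes, some of which
  may be 0; \<open>block_of ns r\<close> is the number of the block containing the index \<open>r\<close>.
\<close>

fun block_of :: "nat list \<Rightarrow> nat \<Rightarrow> nat" where
  "block_of [] r = 0"
| "block_of (m # ns) r = (if r < m then 0 else Suc (block_of ns (r - m)))"

definition block_upper :: "nat list \<Rightarrow> 'k::field mat \<Rightarrow> bool" where
  "block_upper ns X \<longleftrightarrow> (\<forall>r < dim_row X. \<forall>s < dim_col X.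
     block_of ns s < block_of ns r \<longrightarrow> X $$ (r, s) = 0)"

definition strictly_block_upper :: "nat list \<Rightarrow> 'k::field mat \<Rightarrow> bool" where
  "strictly_block_upper ns X \<longleftrightarrow> (\<forall>r < dim_row X. \<forall>s < dim_col X.
     block_of ns s \<le> block_of ns r \<longrightarrow> X $$ (r, s) = 0)"

definition parabolic :: "'k::field mat monoid \<Rightarrow> nat list \<Rightarrow> 'k mat set" where
  "parabolic G ns = {g \<in> carrier G. block_upper ns g}"

definition parabolic_lie :: "'k::field mat set \<Rightarrow> nat list \<Rightarrow> 'k mat set" where
  "parabolic_lie \<G> ns = {X \<in> \<G>. block_upper ns X}"

definition nilradical :: "'k::field mat set \<Rightarrow> nat list \<Rightarrow> 'k mat set" where
  "nilradical \<G> ns = {X \<in> \<G>. strictly_block_upper ns X}"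

text \<open>The projection of the parabolic subalgebra onto its Levi part along the nilradical.\<close>

definition levi_proj :: "nat list \<Rightarrow> 'k::field mat \<Rightarrow> 'k mat" where
  "levi_proj ns X = mat (dim_row X) (dim_col X)
     (\<lambda>(r, s). if block_of ns r = block_of ns s then X $$ (r, s) else 0)"

definition par_res ::
  "'k::field mat set \<Rightarrow> nat list \<Rightarrow> ('k mat \<Rightarrow> real) \<Rightarrow> 'k mat \<Rightarrow> real" where
  "par_res \<G> ns \<Psi> Y = (\<Sum>Z \<in> nilradical \<G> ns. \<Psi> (Y + Z)) / real (card (nilradical \<G> ns))"

text \<open>
  The sum runs over left cosets with a chosen representative in each. The choice is immaterial
  for functions on the Levi algebra that are invariant under the Levi subgroup.
\<close>

definition par_ind ::
  "'k::field mat monoid \<Rightarrow> 'k mat set \<Rightarrow> nat list \<Rightarrow> ('k mat \<Rightarrow> real) \<Rightarrow> 'k mat \<Rightarrow> real" where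
  "par_ind G \<G> ns \<Phi> X =
    (\<Sum>C \<in> lcosets\<^bsub>G\<^esub> (parabolic G ns).
       let g = (SOME g. g \<in> C); W = inv\<^bsub>G\<^esub> g * X * g
       in if W \<in> parabolic_lie \<G> ns then \<Phi> (levi_proj ns W) else 0)"


section \<open>Tensor products\<close>

text \<open>
  For spaces \<open>V\<close> and \<open>W\<close> of functions on sets \<open>S\<close> and \<open>T\<close>, the canonical map from the tensor
  product of \<open>V\<close> and \<open>W\<close> to the functions on \<open>S \<times> T\<close> is injective (see \<open>tens_sum_eq_0\<close>). Tensors
  are therefore represented as functions of several variables. In degree \<open>(i, j)\<close> this is the
  identification of \<open>\<C>(\<L>\<^sub>1 \<oplus> \<L>\<^sub>2)\<close> with \<open>\<C>(\<L>\<^sub>1) \<otimes> \<C>(\<L>\<^sub>2)\<close> that is implicit in regarding parabolic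
  induction and restriction as maps from and to a tensor product. For a linear map \<open>T\<close>, the maps
  \<open>left_map T\<close> and \<open>right_map T\<close> are \<open>T \<otimes> id\<close> and \<open>id \<otimes> T\<close>.
\<close>

definition tens :: "('x \<Rightarrow> real) \<Rightarrow> ('y \<Rightarrow> real) \<Rightarrow> 'x \<times> 'y \<Rightarrow> real" where
  "tens f g = (\<lambda>(x, y). f x * g y)"

definition left_map ::
  "(('x \<Rightarrow> real) \<Rightarrow> 'y \<Rightarrow> real) \<Rightarrow> ('x \<times> 'z \<Rightarrow> real) \<Rightarrow> 'y \<times> 'z \<Rightarrow> real" where
  "left_map T F = (\<lambda>(y, z). T (\<lambda>x. F (x, z)) y)"

definition right_map ::
  "(('x \<Rightarrow> real) \<Rightarrow> 'y \<Rightarrow> real) \<Rightarrow> ('z \<times> 'x \<Rightarrow> real) \<Rightarrow> 'z \<times> 'y \<Rightarrow> real" where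
  "right_map T F = (\<lambda>(z, y). T (\<lambda>x. F (z, x)) y)"

text \<open>\<open>(v \<otimes> v') \<otimes> (w \<otimes> w') \<mapsto> (v \<otimes> w) \<otimes> (v' \<otimes> w')\<close>\<close>

definition middle_swap ::
  "(('v \<times> 'v') \<times> ('w \<times> 'w') \<Rightarrow> real) \<Rightarrow> ('v \<times> 'w) \<times> ('v' \<times> 'w') \<Rightarrow> real" where
  "middle_swap F = (\<lambda>((v, w), (v', w')). F ((v, v'), (w, w')))"


section \<open>The bialgebra structure on A\<close>

definition diag_part :: "nat \<Rightarrow> nat \<Rightarrow> 'k mat \<Rightarrow> 'k mat" where
  "diag_part k m X = mat m m (\<lambda>(r, s). X $$ (k + r, k + s))"

definition nabla :: "('k::{field,finite} mat \<times> 'k mat \<Rightarrow> real) \<Rightarrow> 'k mat \<Rightarrow> real" where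
  "nabla F X =
    (let n = dim_row X in
     if X \<in> gl n then
       \<Sum>(i, j) \<in> {(i, j). i + j = n}.
         par_ind (GL n) (gl n) [i, j] (\<lambda>Y. F (diag_part 0 i Y, diag_part i j Y)) X
     else 0)"

definition Delta :: "('k::{field,finite} mat \<Rightarrow> real) \<Rightarrow> 'k mat \<times> 'k mat \<Rightarrow> real" where
  "Delta f = (\<lambda>(A, B).
    let i = dim_row A; j = dim_row B in
    if A \<in> gl i \<and> B \<in> gl j then par_res (gl (i + j)) [i, j] f (diag_block_mat [A, B])
    else 0)"


section \<open>The module and comodule structure on B\<close>

text \<open>
  The Levi algebra of type \<open>(i, j)\<close> consists of the matrices \<open>diag(A, B, -J\<^sub>i A\<^sup>* J\<^sub>i)\<close>, from which
  \<open>A\<close> and \<open>B\<close> are recovered as the first two diagonal blocks.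
\<close>

definition nabla_u ::
  "nat \<Rightarrow> ('k::{field,finite} mat \<times> 'k mat \<Rightarrow> real) \<Rightarrow> 'k mat \<Rightarrow> real" where
  "nabla_u q F X =
    (let n = dim_row X div 2 in
     if X \<in> u q n then
       \<Sum>(i, j) \<in> {(i, j). i + j = n}.
         par_ind (U q n) (u q n) [i, 2 * j, i]
           (\<lambda>Y. F (diag_part 0 i Y, diag_part i (2 * j) Y)) X
     else 0)"

definition Delta_u ::
  "nat \<Rightarrow> ('k::{field,finite} mat \<Rightarrow> real) \<Rightarrow> 'k mat \<times> 'k mat \<Rightarrow> real" where
  "Delta_u q f = (\<lambda>(A, B).
    let i = dim_row A; j = dim_row B div 2 in
    if A \<in> gl i \<and> B \<in> u q j then
      par_res (u q (i + j)) [i, 2 * j, i] f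
        (diag_block_mat [A, B, - (J i * herm q A * J i)])
    else 0)"


section \<open>The twisted action\<close>

definition omega :: "nat \<Rightarrow> ('k::{field,finite} mat \<Rightarrow> real) \<Rightarrow> 'k mat \<Rightarrow> real" where
  "omega q f X =
    (let n = dim_row X in if X \<in> gl n then f (- (J n * herm q X * J n)) else 0)"

text \<open>
  \<open>twist_coeff q a\<close> is \<open>\<Sum> a\<^sub>1 \<omega>(a\<^sub>2) \<otimes> a\<^sub>3\<close> in Sweedler notation. The description of
  \<open>twisted_act\<close> on pure tensors is \<open>twisted_act_tens\<close> below.
\<close>

definition twist_coeff ::
  "nat \<Rightarrow> ('k::{field,finite} mat \<Rightarrow> real) \<Rightarrow> 'k mat \<times> 'k mat \<Rightarrow> real" where
  "twist_coeff q a = left_map nabla (left_map (right_map (omega q)) (left_map Delta (Delta a)))"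

definition twisted_act ::
  "nat \<Rightarrow> ('k::{field,finite} mat \<Rightarrow> real) \<Rightarrow> ('k mat \<times> 'k mat \<Rightarrow> real) \<Rightarrow>
   'k mat \<times> 'k mat \<Rightarrow> real" where
  "twisted_act q a t =
    left_map nabla (right_map (nabla_u q) (middle_swap (tens (twist_coeff q a) t)))"


section \<open>Compatibility of the tensor representation with pure tensors\<close>

lemma tens_sum_eq_0:
  assumes indep: "\<And>c. (\<forall>y. (\<Sum>k\<in>K. c k * g k y) = 0) \<Longrightarrow> \<forall>k\<in>K. c k = 0"
    and zero: "\<And>p. (\<Sum>k\<in>K. tens (f k) (g k) p) = 0"
    and k: "k \<in> K"
  shows "f k = (\<lambda>_. 0)"
proof
  fix x
  have "\<forall>y. (\<Sum>k\<in>K. f k x * g k y) = 0"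
    using zero[of "(x, _)"] by (simp add: tens_def)
  from indep[OF this] k show "f k x = 0" by blast
qed

definition lin :: "(('x \<Rightarrow> real) \<Rightarrow> 'y \<Rightarrow> real) \<Rightarrow> bool" where
  "lin T \<longleftrightarrow> (\<forall>f g y. T (\<lambda>x. f x + g x) y = T f y + T g y) \<and>
             (\<forall>c f y. T (\<lambda>x. c * f x) y = c * T f y)"

lemma lin_zero:
  assumes "lin T"
  shows "T (\<lambda>_. 0) y = 0"
proof -
  have "T (\<lambda>x. 0 * (\<lambda>_. 0) x) y = 0 * T (\<lambda>_. 0) y"
    using assms unfolding lin_def by (elim conjE allE)
  then show ?thesis by simp
qed

lemma lin_sum:
  assumes "lin T"
  shows "T (\<lambda>x. \<Sum>k\<in>K. f k x) y = (\<Sum>k\<in>K. T (f k) y)"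
proof (induction K rule: infinite_finite_induct)
  case (insert k K)
  then show ?case using assms by (simp add: lin_def)
next
  case empty
  show ?case using lin_zero[OF assms] by simp
next
  case (infinite K)
  then show ?case using lin_zero[OF assms] by simp
qed

lemma lin_sum_ext: "lin T \<Longrightarrow> T (\<lambda>x. \<Sum>k\<in>K. f k x) = (\<lambda>y. \<Sum>k\<in>K. T (f k) y)"
  by (rule ext) (rule lin_sum)

lemma par_ind_add:
  "par_ind G \<G> ns (\<lambda>Y. f Y + g Y) X = par_ind G \<G> ns f X + par_ind G \<G> ns g X"
  unfolding par_ind_def Let_def sum.distrib[symmetric] by (rule sum.cong) auto

lemma par_ind_cmult: "par_ind G \<G> ns (\<lambda>Y. c * f Y) X = c * par_ind G \<G> ns f X"
  unfolding par_ind_def Let_def sum_distrib_left by (rule sum.cong) auto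

lemma lin_nabla: "lin nabla"
  unfolding lin_def nabla_def Let_def
  by (simp add: par_ind_add par_ind_cmult sum_distrib_left case_prod_unfold sum.distrib)

lemma lin_nabla_u: "lin (nabla_u q)"
  unfolding lin_def nabla_u_def Let_def
  by (simp add: par_ind_add par_ind_cmult sum_distrib_left case_prod_unfold sum.distrib)

lemma lin_omega: "lin (omega q)"
  by (auto simp: lin_def omega_def Let_def)

lemma lin_Delta: "lin Delta"
  by (auto simp: lin_def Delta_def par_res_def Let_def sum.distrib add_divide_distrib
      simp flip: sum_distrib_left)

lemma lin_Delta_u: "lin (Delta_u q)"
  by (auto simp: lin_def Delta_u_def par_res_def Let_def sum.distrib add_divide_distrib
      simp flip: sum_distrib_left)

lemma lin_left_map: "lin T \<Longrightarrow> lin (left_map T)"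
  by (auto simp: lin_def left_map_def)

lemma lin_right_map: "lin T \<Longrightarrow> lin (right_map T)"
  by (auto simp: lin_def right_map_def)

lemma left_map_tens:
  assumes "lin T"
  shows "left_map T (tens f g) = tens (T f) g"
proof -
  have "T (\<lambda>x. f x * c) y = T f y * c" for c y
    using assms by (simp add: lin_def mult.commute[of _ c])
  then show ?thesis by (auto simp: left_map_def tens_def)
qed

lemma right_map_tens: "lin T \<Longrightarrow> right_map T (tens f g) = tens f (T g)"
  unfolding lin_def right_map_def tens_def by auto

lemma middle_swap_tens:
  "middle_swap (tens (tens f f') (tens g g')) = tens (tens f g) (tens f' g')"
  by (auto simp: middle_swap_def tens_def)

lemma lin_comp:
  assumes "lin S" "lin T"
  shows "lin (\<lambda>t. S (T t))"
proof -
  have "T (\<lambda>x. f x + g x) = (\<lambda>y. T f y + T g y)" "T (\<lambda>x. c * f x) = (\<lambda>y. c * T f y)" for f g c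
    using assms(2) by (auto simp: lin_def)
  then show ?thesis using assms(1) by (auto simp: lin_def)
qed

lemma lin_twisted_act: "lin (twisted_act q a)"
proof -
  have "lin (\<lambda>t. middle_swap (tens (twist_coeff q a) t))"
    by (auto simp: lin_def middle_swap_def tens_def algebra_simps)
  then show ?thesis
    unfolding twisted_act_def
    by (rule lin_comp[OF lin_left_map[OF lin_nabla]
          lin_comp[OF lin_right_map[OF lin_nabla_u]]])
qed

lemma twisted_act_tens:
  assumes "left_map Delta (Delta a) = (\<lambda>p. \<Sum>k\<in>K. tens (tens (a1 k) (a2 k)) (a3 k) p)"
  shows "twisted_act q a (tens a' b) =
    (\<lambda>p. \<Sum>k\<in>K. tens (nabla (tens (nabla (tens (a1 k) (omega q (a2 k)))) a'))
                     (nabla_u q (tens (a3 k) b)) p)"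
proof -
  have "twist_coeff q a =
      (\<lambda>p. \<Sum>k\<in>K. tens (nabla (tens (a1 k) (omega q (a2 k)))) (a3 k) p)"
    unfolding twist_coeff_def assms
    by (simp only: lin_sum_ext[OF lin_left_map[OF lin_nabla]]
        lin_sum_ext[OF lin_left_map[OF lin_right_map[OF lin_omega]]]
        left_map_tens[OF lin_nabla] left_map_tens[OF lin_right_map[OF lin_omega]]
        right_map_tens[OF lin_omega])
  then have "middle_swap (tens (twist_coeff q a) (tens a' b)) =
      (\<lambda>p. \<Sum>k\<in>K. tens (tens (nabla (tens (a1 k) (omega q (a2 k)))) a') (tens (a3 k) b) p)"
    by (simp add: fun_eq_iff middle_swap_def tens_def sum_distrib_left sum_distrib_right mult_ac)

  then show ?thesis
    unfolding twisted_act_def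
    by (simp only: lin_sum_ext[OF lin_left_map[OF lin_nabla]]
        lin_sum_ext[OF lin_right_map[OF lin_nabla_u]]
        left_map_tens[OF lin_nabla] right_map_tens[OF lin_nabla_u] middle_swap_tens)
qed

end

theory Submission
  imports Defs "Jordan_Normal_Form.Determinant"
begin

text \<open>
  Mackey's formula for \<open>Q = P~\<^bsub>i,j\<^esub>\<close> and \<open>P = P~\<^bsub>k,l\<^esub>\<close>. Induction is an average over the whole group and
  restriction an average over the matrices with given diagonal blocks, so the composite is a sum over
  the double cosets \<open>Q g P\<close> in the unitary group. These are represented by permutation matrices \<open>w\<close> indexed by
  \<open>(k\<^sub>1, k\<^sub>2, k\<^sub>3)\<close> with \<open>k\<^sub>1 + k\<^sub>2 + k\<^sub>3 = k\<close>, \<open>k\<^sub>1 + k\<^sub>3 \<le> i\<close> and \<open>k\<^sub>2 \<le> j\<close>, the numbers in which a totally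
  isotropic subspace meets the three steps of the flag of \<open>Q\<close>. On each double coset, the average over the
  matrices of the flag type of \<open>Q \<inter> w P w\<^sup>-\<^sup>1\<close> splits into the averages defining \<open>\<Delta>\<close> and \<open>\<Delta>~\<close>, and the
  third component appears twisted by \<open>\<omega>\<close>. The order of the factors is corrected by commutativity of
  \<open>\<nabla>\<close> and cocommutativity of \<open>\<Delta>\<close>, which hold because every matrix is similar to its transpose.
\<close>

section \<open>Square matrices with block structures\<close>

text \<open>The order of the factors is what shapes the last part. On the cell of \<open>w\<close>
  the \<open>gl\<close> block of \<open>Q\<close> is cut into pieces of sizes
  \<open>k1, m, k3\<close> and the \<open>gl\<close> block of \<open>P\<close> into
  \<open>k1, k2, k3\<close>; the geometry twists the third piece of \<open>a\<close> and puts it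
  last on the \<open>gl\<close> side. The definition of the twisted action instead twists the second
  Sweedler factor and multiplies it in before \<open>a'\<close>. The two formulas differ by one
  transposition in a threefold restriction and one in a threefold induction. The twist arises
  because matrices in \<open>u\<close> are fixed by \<open>X \<mapsto> -J X^* J\<close>: the last
  diagonal block is the twist of the first, and the piece of size \<open>k3\<close> is read off from
  that last block. Group orders need not be computed. They cancel once it is known that fibres are
  equidistributed and that the unipotent part of \<open>Q \<inter> w P w\<inverse>\<close> has as
  many elements as its Lie algebra; a Cayley transform gives the latter, which is why
  \<open>q\<close> is odd.\<close>

lemma finite_carrier_mat [simp]: "finite (carrier_mat n m :: 'k::finite mat set)"
proof -
  let ?F = "{f :: nat \<times> nat \<Rightarrow> 'k. \<forall>x. (x \<in> {..<n} \<times> {..<m} \<longrightarrow> f x \<in> UNIV) \<and> (x \<notin> {..<n} \<times> {..<m} \<longrightarrow> f x = undefined)}"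
  have "X \<in> mat n m ` ?F" if "X \<in> carrier_mat n m" for X :: "'k mat"
    by (rule image_eqI[where x = "\<lambda>x. if x \<in> {..<n} \<times> {..<m} then X $$ x else undefined"])
      (use that in \<open>auto intro!: eq_matI\<close>)
  moreover have "finite ?F" by (rule finite_set_of_finite_funs) auto
  ultimately show ?thesis by (meson finite_imageI finite_subset subsetI)
qed

lemma mult_mat_entry:
  assumes "A \<in> carrier_mat n n" "B \<in> carrier_mat n n" "r < n" "s < n"
  shows "(A * B) $$ (r, s) = (\<Sum>t<n. A $$ (r, t) * B $$ (t, s))"
  using assms by (auto simp: scalar_prod_def lessThan_atLeast0)

text \<open>Serves two purposes: with \<open>\<iota>\<close> a shift it cuts out a diagonal block,
  with \<open>\<iota>\<close> a permutation it is conjugation by a permutation matrix. Determinants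
  are not involved.\<close>

definition minor :: "nat \<Rightarrow> (nat \<Rightarrow> nat) \<Rightarrow> 'k mat \<Rightarrow> 'k mat" where
  "minor m \<iota> X = mat m m (\<lambda>(r, s). X $$ (\<iota> r, \<iota> s))"

text \<open>Reflection in the antidiagonal with \<open>f\<close> applied to the entries. For
  \<open>f\<close> the identity this is \<open>J X^T J\<close>, for the field involution it is
  \<open>J X^* J\<close>. Unlike transposition it preserves block upper triangular shape and only
  reverses the order of the blocks.\<close>

definition flip :: "('k \<Rightarrow> 'k) \<Rightarrow> 'k mat \<Rightarrow> 'k mat" where
  "flip f X = mat (dim_row X) (dim_row X)
     (\<lambda>(r, s). f (X $$ (dim_row X - Suc s, dim_row X - Suc r)))"

text \<open>The levels \<open>\<beta>\<close> are an arbitrary function, since the conjugate of a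
  parabolic subgroup by a permutation matrix belongs to levels that need not be monotone in the
  index.\<close>

definition upper :: "(nat \<Rightarrow> nat) \<Rightarrow> 'k::zero mat \<Rightarrow> bool" where
  "upper \<beta> X \<longleftrightarrow> (\<forall>r < dim_row X. \<forall>s < dim_col X. \<beta> s < \<beta> r \<longrightarrow> X $$ (r, s) = 0)"

lemma block_upper_eq: "block_upper ns = upper (block_of ns)"
  by (auto simp: fun_eq_iff block_upper_def upper_def)

lemma minor_carrier [simp]: "minor m \<iota> X \<in> carrier_mat m m"
  by (simp add: minor_def)

lemma diag_part_eq_minor: "diag_part k m X = minor m (\<lambda>r. k + r) X"
  by (simp add: diag_part_def minor_def)

lemma diag_part_carrier [simp]: "diag_part k m X \<in> carrier_mat m m"
  by (simp add: diag_part_def)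

lemma diag_part_dim [simp]: "dim_row (diag_part k m X) = m" "dim_col (diag_part k m X) = m"
  by (simp_all add: diag_part_def)

lemma diag_part_index [simp]:
  "r < m \<Longrightarrow> s < m \<Longrightarrow> diag_part k m X $$ (r, s) = X $$ (k + r, k + s)"
  by (simp add: diag_part_def)

lemma diag_part_diag_part: "k + m \<le> m' \<Longrightarrow> diag_part k m (diag_part k' m' X) = diag_part (k' + k) m X"
  by (auto intro!: eq_matI simp: add.assoc)

lemma diag_part_one: "k + m \<le> n \<Longrightarrow> diag_part k m (1\<^sub>m n) = 1\<^sub>m m"
  by (auto intro!: eq_matI)

lemma flip_carrier [simp]: "X \<in> carrier_mat n n \<Longrightarrow> flip f X \<in> carrier_mat n n"
  by (auto simp: flip_def)

lemma flip_dim [simp]: "dim_row (flip f X) = dim_row X" "dim_col (flip f X) = dim_row X"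
  by (simp_all add: flip_def)

lemma flip_index [simp]:
  "r < dim_row X \<Longrightarrow> s < dim_row X \<Longrightarrow>
    flip f X $$ (r, s) = f (X $$ (dim_row X - Suc s, dim_row X - Suc r))"
  by (simp add: flip_def)

lemma flip_flip: "X \<in> carrier_mat n n \<Longrightarrow> (\<And>x. f (g x) = x) \<Longrightarrow> flip f (flip g X) = X"
  by (auto intro!: eq_matI)

lemma flip_mult:
  fixes f :: "'k::comm_ring_1 \<Rightarrow> 'k"
  assumes A: "A \<in> carrier_mat n n" and B: "B \<in> carrier_mat n n"
    and f: "\<And>x y. f (x + y) = f x + f y" "\<And>x y. f (x * y) = f x * f y" "f 0 = 0"
  shows "flip f (A * B) = flip f B * flip f A"
proof (rule eq_matI)
  have fs: "f (sum h S) = (\<Sum>x\<in>S. f (h x))" for h :: "nat \<Rightarrow> 'k" and S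
    by (induction S rule: infinite_finite_induct) (auto simp: f)
  fix r s assume "r < dim_row (flip f B * flip f A)" "s < dim_col (flip f B * flip f A)"
  then have rs: "r < n" "s < n" using A B by auto
  have "flip f (A * B) $$ (r, s) =
      (\<Sum>t<n. f (A $$ (n - Suc s, t)) * f (B $$ (t, n - Suc r)))"
    using rs A B mult_mat_entry[OF A B, of "n - Suc s" "n - Suc r"] by (auto simp: fs f)
  also have "\<dots> = (\<Sum>t<n. f (A $$ (n - Suc s, n - Suc t)) * f (B $$ (n - Suc t, n - Suc r)))"
    by (rule sum.nat_diff_reindex[symmetric])
  also have "\<dots> = (flip f B * flip f A) $$ (r, s)"
    using rs A B by (subst mult_mat_entry[where n = n]) (auto simp: mult.commute)
  finally show "flip f (A * B) $$ (r, s) = (flip f B * flip f A) $$ (r, s)" .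
qed (use A B in auto)

lemma flip_one: "f 1 = 1 \<Longrightarrow> f 0 = 0 \<Longrightarrow> flip f (1\<^sub>m n) = 1\<^sub>m n"
  by (auto intro!: eq_matI)

lemma diag_part_flip:
  assumes "X \<in> carrier_mat n n" "k + m + k' = n"
  shows "diag_part k m (flip f X) = flip f (diag_part k' m X)"
proof (rule eq_matI)
  fix r s assume "r < dim_row (flip f (diag_part k' m X))" "s < dim_col (flip f (diag_part k' m X))"
  then have "r < m" "s < m" by auto
  moreover from this have "n - Suc (k + s) = k' + (m - Suc s)" "n - Suc (k + r) = k' + (m - Suc r)"
    using assms by auto
  ultimately show "diag_part k m (flip f X) $$ (r, s) = flip f (diag_part k' m X) $$ (r, s)"
    using assms by auto
qed auto

lemma upper_flip:
  assumes "X \<in> carrier_mat n n" and "upper \<beta> X" and "f 0 = 0"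
    and "\<And>r s. r < n \<Longrightarrow> s < n \<Longrightarrow> \<beta>' s < \<beta>' r \<Longrightarrow> \<beta> (n - Suc r) < \<beta> (n - Suc s)"
  shows "upper \<beta>' (flip f X)"
  using assms by (auto simp: upper_def)

lemma upper_one [simp]: "upper \<beta> (1\<^sub>m n)"
  by (auto simp: upper_def)

lemma upper_mult:
  fixes A :: "'k::comm_ring_1 mat"
  assumes "A \<in> carrier_mat n n" "B \<in> carrier_mat n n" "upper \<beta> A" "upper \<beta> B"
  shows "upper \<beta> (A * B)"
proof -
  have "A $$ (r, t) * B $$ (t, s) = 0" if "r < n" "s < n" "t < n" "\<beta> s < \<beta> r" for r s t
    using that assms unfolding upper_def
    by (cases "\<beta> t < \<beta> r") (auto dest!: less_le_trans[of "\<beta> s" "\<beta> r" "\<beta> t"])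
  then show ?thesis
    using assms(1,2) unfolding upper_def
    by (auto simp: mult_mat_entry[OF assms(1,2)] simp del: index_mult_mat(1) intro!: sum.neutral)
qed

text \<open>A term with \<open>t\<close> off the level \<open>l\<close> has a vanishing factor: the
  left one if \<open>t\<close> lies on a lower level, the right one if on a higher. Hence passing to
  one diagonal block is multiplicative on block triangular matrices.\<close>

lemma minor_mult:
  fixes A :: "'k::comm_ring_1 mat"
  assumes A: "A \<in> carrier_mat n n" "upper \<beta> A" and B: "B \<in> carrier_mat n n" "upper \<beta> B"
    and \<iota>: "bij_betw \<iota> {..<m} {t. t < n \<and> \<beta> t = l}"
  shows "minor m \<iota> (A * B) = minor m \<iota> A * minor m \<iota> B"
proof (rule eq_matI)
  fix r s assume "r < dim_row (minor m \<iota> A * minor m \<iota> B)" "s < dim_col (minor m \<iota> A * minor m \<iota> B)"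
  then have rs: "r < m" "s < m" by (auto simp: minor_def)
  have im: "\<iota> r < n" "\<beta> (\<iota> r) = l" if "r < m" for r
    using bij_betwE[OF \<iota>] that by auto
  have "A $$ (\<iota> r, t) * B $$ (t, \<iota> s) = 0" if "t < n" "\<beta> t \<noteq> l" for t
    using that im[OF rs(1)] im[OF rs(2)] A B unfolding upper_def
    by (cases "\<beta> t < l") auto
  then have "(A * B) $$ (\<iota> r, \<iota> s) = (\<Sum>t \<in> {t. t < n \<and> \<beta> t = l}. A $$ (\<iota> r, t) * B $$ (t, \<iota> s))"
    using im rs A(1) B(1) by (subst mult_mat_entry[OF A(1) B(1)]) (auto intro!: sum.mono_neutral_right)
  also have "\<dots> = (\<Sum>t<m. A $$ (\<iota> r, \<iota> t) * B $$ (\<iota> t, \<iota> s))"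
    by (rule sum.reindex_bij_betw[OF \<iota>, symmetric])
  finally show "minor m \<iota> (A * B) $$ (r, s) = (minor m \<iota> A * minor m \<iota> B) $$ (r, s)"
    using rs by (subst mult_mat_entry[where n = m]) (auto simp: minor_def)
qed (auto simp: minor_def)

lemma diag_part_mult:
  fixes A :: "'k::comm_ring_1 mat"
  assumes "A \<in> carrier_mat n n" "upper \<beta> A" "B \<in> carrier_mat n n" "upper \<beta> B"
    and "{t. t < n \<and> \<beta> t = l} = {k..<k + m}"
  shows "diag_part k m (A * B) = diag_part k m A * diag_part k m B"
  unfolding diag_part_eq_minor
  by (rule minor_mult[OF assms(1-4), where l = l], unfold assms(5))
    (rule bij_betwI[where g = "\<lambda>r. r - k"], auto)


section \<open>The general linear group\<close>

lemma GL_iff: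
  "g \<in> carrier (GL n) \<longleftrightarrow> g \<in> carrier_mat n n \<and> (\<exists>h \<in> carrier_mat n n. h * g = 1\<^sub>m n \<and> g * h = 1\<^sub>m n)"
  by (simp add: GL_def units_of_def Units_def ring_mat_def)

lemma GL_carrier: "g \<in> carrier (GL n) \<Longrightarrow> g \<in> carrier_mat n n"
  by (simp add: GL_iff)

lemma GL_I:
  "g \<in> carrier_mat n n \<Longrightarrow> h \<in> carrier_mat n n \<Longrightarrow> h * g = 1\<^sub>m n \<Longrightarrow> g \<in> carrier (GL n)"
  using mat_mult_left_right_inverse[of h n g] by (auto simp: GL_iff)

lemma group_GL: "group (GL n :: 'k::field mat monoid)"
proof -
  interpret ring "ring_mat TYPE('k) n ()" by (rule ring_mat)
  show ?thesis unfolding GL_def by (rule units_group)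
qed

lemma GL_simps [simp]: "x \<otimes>\<^bsub>GL n\<^esub> y = x * y" "\<one>\<^bsub>GL n\<^esub> = 1\<^sub>m n"
  by (simp_all add: GL_def units_of_def ring_mat_def)

lemma finite_GL [simp]: "finite (carrier (GL n :: 'k::{field,finite} mat monoid))"
  by (rule finite_subset[OF _ finite_carrier_mat[of n n]]) (auto dest: GL_carrier)

text \<open>The size is read off from the matrix, so that one inverse serves the general linear and
  the unitary groups of all sizes.\<close>

definition mat_inv :: "'k::field mat \<Rightarrow> 'k mat" where
  "mat_inv g = inv\<^bsub>GL (dim_row g)\<^esub> g"

lemma mat_inv_props:
  assumes g: "g \<in> carrier (GL n)"
  shows "mat_inv g \<in> carrier (GL n)" "mat_inv g \<in> carrier_mat n n"
    "mat_inv g * g = 1\<^sub>m n" "g * mat_inv g = 1\<^sub>m n"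
proof -
  interpret group "GL n" by (rule group_GL)
  have d: "dim_row g = n" using GL_carrier[OF g] by auto
  show 1: "mat_inv g \<in> carrier (GL n)" using g d by (simp add: mat_inv_def)
  show "mat_inv g \<in> carrier_mat n n" using GL_carrier[OF 1] .
  show "mat_inv g * g = 1\<^sub>m n" "g * mat_inv g = 1\<^sub>m n"
    using l_inv[OF g] r_inv[OF g] d by (simp_all add: mat_inv_def)
qed

lemma GL_mult: "g \<in> carrier (GL n) \<Longrightarrow> h \<in> carrier (GL n) \<Longrightarrow> g * h \<in> carrier (GL n)"
  using monoid.m_closed[OF group.is_monoid[OF group_GL]] by force

lemma one_GL: "1\<^sub>m n \<in> carrier (GL n)"
  by (rule GL_I[of _ _ "1\<^sub>m n"]) auto

lemma GL_cancel_left: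
  assumes "g \<in> carrier (GL n)" "X \<in> carrier_mat n n" "Y \<in> carrier_mat n n" "g * X = g * Y"
  shows "X = Y"
proof -
  have "mat_inv g * (g * X) = mat_inv g * (g * Y)" using assms by simp
  then show ?thesis
    using assms(2,3) mat_inv_props[OF assms(1)] GL_carrier[OF assms(1)]
    by (simp flip: assoc_mult_mat[of _ n n _ n _ n])
qed

text \<open>The convention \<open>g\<inverse> X g\<close> is that of parabolic induction; it makes
  conjugation a right action (\<open>conj_by_mult\<close>).\<close>

definition conj_by :: "'k::field mat \<Rightarrow> 'k mat \<Rightarrow> 'k mat" where
  "conj_by g X = mat_inv g * X * g"

lemma conj_by_carrier:
  "g \<in> carrier (GL n) \<Longrightarrow> X \<in> carrier_mat n n \<Longrightarrow> conj_by g X \<in> carrier_mat n n"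
  using mat_inv_props[of g n] GL_carrier[of g n] by (auto simp: conj_by_def)

lemma conj_by_eq:
  assumes "g \<in> carrier (GL n)" "X \<in> carrier_mat n n"
  shows "g * conj_by g X = X * g"
proof -
  have "g * (mat_inv g * X * g) = (g * mat_inv g) * X * g"
    using assms(2) mat_inv_props(2)[OF assms(1)] GL_carrier[OF assms(1)]
    by (simp add: assoc_mult_mat[of _ n n _ n _ n])
  then show ?thesis
    using assms(2) mat_inv_props(4)[OF assms(1)] by (simp add: conj_by_def)
qed

lemma conj_by_eqI:
  assumes "g \<in> carrier (GL n)" "X \<in> carrier_mat n n" "Y \<in> carrier_mat n n" "X * g = g * Y"
  shows "conj_by g X = Y"
  by (rule GL_cancel_left[OF assms(1) conj_by_carrier[OF assms(1,2)] assms(3)])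
    (simp add: conj_by_eq[OF assms(1,2)] assms(4))

lemma conj_by_mult:
  assumes "g \<in> carrier (GL n)" "h \<in> carrier (GL n)" "X \<in> carrier_mat n n"
  shows "conj_by (g * h) X = conj_by h (conj_by g X)"
proof (rule conj_by_eqI[OF GL_mult[OF assms(1,2)] assms(3)])
  note c = GL_carrier[OF assms(1)] GL_carrier[OF assms(2)] assms(3) conj_by_carrier[OF assms(1,3)]
    conj_by_carrier[OF assms(2) conj_by_carrier[OF assms(1,3)]]
  show "conj_by h (conj_by g X) \<in> carrier_mat n n" by (rule c)
  have "X * (g * h) = X * g * h" using c by simp
  also have "\<dots> = g * conj_by g X * h" by (simp add: conj_by_eq[OF assms(1,3)])
  also have "\<dots> = g * (h * conj_by h (conj_by g X))"
    using c by (simp add: conj_by_eq[OF assms(2)])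
  also have "\<dots> = g * h * conj_by h (conj_by g X)" using c by simp
  finally show "X * (g * h) = g * h * conj_by h (conj_by g X)" .
qed

lemma conj_by_one: "X \<in> carrier_mat n n \<Longrightarrow> conj_by (1\<^sub>m n) X = X"
  by (rule conj_by_eqI[OF one_GL]) auto

lemma conj_by_inv:
  assumes "g \<in> carrier (GL n)" "X \<in> carrier_mat n n"
  shows "conj_by (mat_inv g) (conj_by g X) = X" "conj_by g (conj_by (mat_inv g) X) = X"
  using assms mat_inv_props[OF assms(1)]
  by (simp_all flip: conj_by_mult add: conj_by_one)

text \<open>On a finite set closed under products, left multiplication by one of its elements is
  injective, hence onto, hence takes the value 1; this yields the inverse.\<close>

lemma finite_closed_imp_subgroup:
  assumes "group G" "finite (carrier G)" "H \<subseteq> carrier G" "\<one>\<^bsub>G\<^esub> \<in> H"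
    and closed: "\<And>x y. x \<in> H \<Longrightarrow> y \<in> H \<Longrightarrow> x \<otimes>\<^bsub>G\<^esub> y \<in> H"
  shows "subgroup H G"
proof -
  interpret group G by fact
  have fin: "finite H" using assms finite_subset by blast
  have "inv\<^bsub>G\<^esub> x \<in> H" if x: "x \<in> H" for x
  proof -
    have "inj_on ((\<otimes>\<^bsub>G\<^esub>) x) H"
      using assms(3) x by (intro inj_onI) (metis Units_eq Units_l_cancel subsetD)
    then have "(\<otimes>\<^bsub>G\<^esub>) x ` H = H"
      using closed[OF x] by (intro endo_inj_surj[OF fin]) auto
    then obtain y where "y \<in> H" "x \<otimes>\<^bsub>G\<^esub> y = \<one>\<^bsub>G\<^esub>" using assms(4) by (metis imageE)
    then show ?thesis using x assms(3) inv_equality[of y x] inv_comm[of x y] by auto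
  qed
  then show ?thesis using assms closed by (intro subgroupI) auto
qed

text \<open>The common frame of the general linear and the unitary groups. The Lie algebra is
  recorded only as a set of matrices stable under conjugation.\<close>

locale mat_group =
  fixes N :: nat and G :: "'k::{field,finite} mat monoid" and \<G> :: "'k mat set"
  assumes group: "group G" and sub_GL: "carrier G \<subseteq> carrier (GL N)"
    and mult_eq [simp]: "x \<otimes>\<^bsub>G\<^esub> y = x * y" and one_eq [simp]: "\<one>\<^bsub>G\<^esub> = 1\<^sub>m N"
    and lie_carrier: "\<G> \<subseteq> carrier_mat N N"
    and lie_closed: "g \<in> carrier G \<Longrightarrow> X \<in> \<G> \<Longrightarrow> conj_by g X \<in> \<G>"
begin

sublocale group G by (rule group)

lemma finite_G [simp]: "finite (carrier G)"
  using finite_subset[OF sub_GL] by simp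

lemma inv_eq: "g \<in> carrier G \<Longrightarrow> inv\<^bsub>G\<^esub> g = mat_inv g"
proof -
  assume g: "g \<in> carrier G"
  then have c: "g \<in> carrier (GL N)" using sub_GL by auto
  have "g * inv\<^bsub>G\<^esub> g = g * mat_inv g"
    using r_inv[OF g] mat_inv_props(4)[OF c] by simp
  then show "inv\<^bsub>G\<^esub> g = mat_inv g"
    using GL_carrier[OF subsetD[OF sub_GL inv_closed[OF g]]] mat_inv_props(2)[OF c]
    by (metis GL_cancel_left[OF c])
qed

lemma subgroup_upper: "subgroup {g \<in> carrier G. upper \<beta> g} G"
  using subsetD[OF sub_GL, THEN GL_carrier] m_closed one_closed
  by (intro finite_closed_imp_subgroup) (auto intro!: upper_mult[of _ N] group)

lemma inv_closed': "g \<in> carrier G \<Longrightarrow> mat_inv g \<in> carrier G"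
  using inv_eq inv_closed by metis

lemma upper_inv: "g \<in> carrier G \<Longrightarrow> upper \<beta> g \<Longrightarrow> upper \<beta> (mat_inv g)"
  using subgroup.m_inv_closed[OF subgroup_upper, of g \<beta>] inv_eq by auto

lemma upper_conj:
  assumes "g \<in> carrier G" "upper \<beta> g" "X \<in> carrier_mat N N" "upper \<beta> X"
  shows "upper \<beta> (conj_by g X)"
  using assms upper_inv[OF assms(1,2)] mat_inv_props[of g N] sub_GL GL_carrier[of g N]
  unfolding conj_by_def by (auto intro!: upper_mult[of _ N])

lemma upper_conj_iff:
  assumes "g \<in> carrier G" "upper \<beta> g" "X \<in> carrier_mat N N"
  shows "upper \<beta> (conj_by g X) \<longleftrightarrow> upper \<beta> X"
  using upper_conj[OF assms] upper_conj[of "mat_inv g" \<beta> "conj_by g X"] assms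
    conj_by_inv[of g N X] conj_by_carrier[of g N X] sub_GL inv_closed'[of g] upper_inv[of g \<beta>] by auto

text \<open>The hypothesis makes the summand constant on left cosets of the parabolic subgroup, so
  the chosen representatives disappear: each term is the sum over its coset divided by the order of
  the subgroup.\<close>

lemma par_ind_eq_sum:
  assumes inv: "\<And>p W. p \<in> carrier G \<Longrightarrow> upper (block_of ns) p \<Longrightarrow> W \<in> \<G> \<Longrightarrow> upper (block_of ns) W \<Longrightarrow>
      \<Phi> (levi_proj ns (conj_by p W)) = \<Phi> (levi_proj ns W)"
    and X: "X \<in> \<G>"
  shows "par_ind G \<G> ns \<Phi> X =
    (\<Sum>g \<in> carrier G. if upper (block_of ns) (conj_by g X) then \<Phi> (levi_proj ns (conj_by g X)) else 0)
      / real (card (parabolic G ns))"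
proof -
  let ?P = "parabolic G ns"
  define f where "f g = (if upper (block_of ns) (conj_by g X) then \<Phi> (levi_proj ns (conj_by g X)) else 0)" for g
  have P: "?P = {g \<in> carrier G. upper (block_of ns) g}"
    by (simp add: parabolic_def block_upper_eq)
  have sub: "subgroup ?P G" unfolding P by (rule subgroup_upper)
  have Xc: "X \<in> carrier_mat N N" using X lie_carrier by auto
  have f_inv: "f (g \<otimes>\<^bsub>G\<^esub> p) = f g" if "g \<in> carrier G" "p \<in> ?P" for g p
  proof -
    have gp: "g \<in> carrier (GL N)" "p \<in> carrier (GL N)" using that sub_GL P by auto
    have "conj_by g X \<in> \<G>" using lie_closed that X by auto
    then show ?thesis
      using that(2) lie_carrier
      unfolding f_def P by (auto simp: conj_by_mult[OF gp Xc] upper_conj_iff inv)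
  qed
  have fin: "finite (lcosets\<^bsub>G\<^esub> ?P)"
    using finite_subset[OF lcosets_subset_PowG[OF sub]] by simp
  have "(\<Sum>g\<in>carrier G. f g) = (\<Sum>g\<in>\<Union>(lcosets\<^bsub>G\<^esub> ?P). f g)"
    by (simp add: lcosets_part_G[OF sub])
  also have "\<dots> = (\<Sum>C\<in>lcosets\<^bsub>G\<^esub> ?P. \<Sum>g\<in>C. f g)"
    using lcosets_subset_PowG[OF sub] lcos_disjoint[OF sub]
    by (intro sum.Union_disjoint[unfolded o_def]) (auto intro: finite_subset[OF _ finite_G])
  also have "\<dots> = (\<Sum>C\<in>lcosets\<^bsub>G\<^esub> ?P. real (card ?P) * f (SOME g. g \<in> C))"
  proof (rule sum.cong[OF refl])
    fix C assume C: "C \<in> lcosets\<^bsub>G\<^esub> ?P"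
    then obtain x where x: "x \<in> carrier G" "C = x <#\<^bsub>G\<^esub> ?P" by (auto simp: LCOSETS_def)
    have fC: "f g = f x" if "g \<in> C" for g
      using that x f_inv unfolding l_coset_def by auto
    have "x \<in> C" using lcos_self[OF x(1) sub] x by auto
    then have "f (SOME g. g \<in> C) = f x" by (intro fC someI[of "\<lambda>g. g \<in> C"])
    moreover have "card C = card ?P"
      using l_card_cosets_equal[OF C subgroup.subset[OF sub] finite_G] by simp
    ultimately show "(\<Sum>g\<in>C. f g) = real (card ?P) * f (SOME g. g \<in> C)" using fC by simp
  qed
  also have "\<dots> = real (card ?P) * par_ind G \<G> ns \<Phi> X"
    unfolding sum_distrib_left[symmetric] par_ind_def
  proof (intro arg_cong[of _ _ "\<lambda>x. real (card ?P) * x"] sum.cong refl)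
    fix C assume C: "C \<in> lcosets\<^bsub>G\<^esub> ?P"
    then obtain x where x: "x \<in> carrier G" "C = x <#\<^bsub>G\<^esub> ?P" by (auto simp: LCOSETS_def)
    then have "(SOME g. g \<in> C) \<in> C" using lcos_self[OF x(1) sub] by (metis someI)
    then have g: "(SOME g. g \<in> C) \<in> carrier G"
      using C lcosets_subset_PowG[OF sub] by auto
    then have "inv\<^bsub>G\<^esub> (SOME g. g \<in> C) * X * (SOME g. g \<in> C) = conj_by (SOME g. g \<in> C) X"
      by (simp add: inv_eq conj_by_def)
    then show "f (SOME g. g \<in> C) = (let g = SOME g. g \<in> C; W = inv\<^bsub>G\<^esub> g * X * g
        in if W \<in> parabolic_lie \<G> ns then \<Phi> (levi_proj ns W) else 0)"
      using lie_closed[OF g X] by (simp add: f_def Let_def parabolic_lie_def block_upper_eq)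
  qed
  finally have "(\<Sum>g\<in>carrier G. f g) = real (card ?P) * par_ind G \<G> ns \<Phi> X" .
  moreover have "card ?P > 0"
    using sub finite_subset[OF subgroup.subset[OF sub]] subgroup.one_closed[OF sub] by (auto simp: card_gt_0_iff)
  ultimately show ?thesis unfolding f_def by (simp add: field_simps)
qed

end

lemma mat_group_GL: "mat_group n (GL n) (gl n)"
  using group_GL by (auto simp: mat_group_def gl_def conj_by_carrier)

section \<open>Every matrix is similar to its transpose\<close>

text \<open>Elimination, one column at a time. If the new column depends on the others, the
  alternative carries over. Otherwise a functional \<open>\<chi>\<close> that kills the others and
  is 1 on the new column is used to project along that column.\<close>

lemma fredholm_alternative:
  fixes K :: "'k::field mat"
  assumes "K \<in> carrier_mat n d" "w \<in> carrier_vec n"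
  shows "(\<exists>x \<in> carrier_vec d. w = K *\<^sub>v x) \<or>
    (\<exists>\<psi> \<in> carrier_vec n. (\<forall>j < d. \<psi> \<bullet> col K j = 0) \<and> \<psi> \<bullet> w = 1)"
  using assms
proof (induction d arbitrary: K w)
  case 0
  show ?case
  proof (cases "w = 0\<^sub>v n")
    case True
    then have "w = K *\<^sub>v 0\<^sub>v 0" using 0 by (auto simp: scalar_prod_def)
    then show ?thesis by auto
  next
    case False
    then obtain r where r: "r < n" "w $ r \<noteq> 0" using 0(2) by (metis eq_vecI carrier_vecD index_zero_vec)
    then have "((1 / w $ r) \<cdot>\<^sub>v unit_vec n r) \<bullet> w = 1"
      using 0 by (simp add: scalar_prod_smult_left)
    then show ?thesis using 0 by (intro disjI2 bexI[of _ "(1 / w $ r) \<cdot>\<^sub>v unit_vec n r"]) auto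
  qed
next
  case (Suc d)
  let ?K = "mat n d (\<lambda>(r, s). K $$ (r, s))" and ?k = "col K d"
  have colK: "col ?K j = col K j" if "j < d" for j
    using that Suc.prems by (auto intro!: eq_vecI)
  have Kx: "?K *\<^sub>v x + a \<cdot>\<^sub>v ?k = K *\<^sub>v vec (Suc d) (\<lambda>t. if t < d then x $ t else a)"
    if "x \<in> carrier_vec d" for x a
    using that Suc.prems by (auto intro!: eq_vecI sum.cong simp: scalar_prod_def)
  note k = col_carrier_vec[OF lessI[of d] Suc.prems(1)]
  note IH = Suc.IH[of ?K, simplified]
  show ?case
  proof (cases "\<exists>x \<in> carrier_vec d. ?k = ?K *\<^sub>v x")
    case True
    then obtain x where x: "x \<in> carrier_vec d" "?k = ?K *\<^sub>v x" by auto
    consider (sol) y where "y \<in> carrier_vec d" "w = ?K *\<^sub>v y"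
      | (sep) \<psi> where "\<psi> \<in> carrier_vec n" "\<forall>j<d. \<psi> \<bullet> col ?K j = 0" "\<psi> \<bullet> w = 1"
      using IH[OF Suc.prems(2)] by auto
    then show ?thesis
    proof cases
      case sol
      have "w = ?K *\<^sub>v y + 0 \<cdot>\<^sub>v ?k" using sol k Suc.prems by (auto intro!: eq_vecI)
      then show ?thesis unfolding Kx[OF sol(1)] by auto
    next
      case sep
      have "\<psi> \<bullet> ?k = (\<Sum>t<d. \<psi> \<bullet> col ?K t * x $ t)"
      proof -
        have "\<psi> \<bullet> ?k = (\<Sum>r<n. \<Sum>t<d. \<psi> $ r * (K $$ (r, t) * x $ t))"
          unfolding x(2) using x sep(1) by (simp add: scalar_prod_def sum_distrib_left lessThan_atLeast0)
        also have "\<dots> = (\<Sum>t<d. \<psi> \<bullet> col ?K t * x $ t)"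
          by (subst sum.swap) (simp add: scalar_prod_def sum_distrib_right lessThan_atLeast0 mult.assoc)
        finally show ?thesis .
      qed
      then have "\<psi> \<bullet> ?k = 0" using sep by simp
      then show ?thesis
        using sep colK by (intro disjI2 bexI[of _ \<psi>]) (auto simp: less_Suc_eq)
    qed
  next
    case False
    then obtain \<chi> where \<chi>: "\<chi> \<in> carrier_vec n" "\<forall>j<d. \<chi> \<bullet> col ?K j = 0" "\<chi> \<bullet> ?k = 1"
      using IH[OF k] by auto
    let ?w = "w - (\<chi> \<bullet> w) \<cdot>\<^sub>v ?k"
    have wc: "?w \<in> carrier_vec n" using k Suc.prems by auto
    consider (sol) y where "y \<in> carrier_vec d" "?w = ?K *\<^sub>v y"
      | (sep) \<psi> where "\<psi> \<in> carrier_vec n" "\<forall>j<d. \<psi> \<bullet> col ?K j = 0" "\<psi> \<bullet> ?w = 1"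
      using IH[OF wc] by auto
    then show ?thesis
    proof cases
      case sol
      have "w = ?w + (\<chi> \<bullet> w) \<cdot>\<^sub>v ?k" using Suc.prems k by (auto intro!: eq_vecI)
      then show ?thesis unfolding sol(2) Kx[OF sol(1)] by auto
    next
      case sep
      \<comment> \<open>The correction by a multiple of \<open>\<chi>\<close> makes the functional
        vanish on the new column too; its value at \<open>w\<close> becomes the old value at
        \<open>?w\<close>, which is 1.\<close>
      let ?\<psi> = "\<psi> - (\<psi> \<bullet> ?k) \<cdot>\<^sub>v \<chi>"
      have dot: "?\<psi> \<bullet> v = \<psi> \<bullet> v - (\<psi> \<bullet> ?k) * (\<chi> \<bullet> v)" if "v \<in> carrier_vec n" for v
        using that \<chi> sep by (simp add: minus_scalar_prod_distrib[of _ n])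
      have "\<psi> \<bullet> ?w = \<psi> \<bullet> w - (\<chi> \<bullet> w) * (\<psi> \<bullet> ?k)"
        using k Suc.prems sep by (simp add: scalar_prod_minus_distrib[of _ n])
      then have "?\<psi> \<bullet> w = 1" using sep Suc.prems by (simp add: dot mult.commute)
      moreover have "?\<psi> \<bullet> col K j = 0" if "j < Suc d" for j
      proof (cases "j = d")
        case True
        then show ?thesis using \<chi> k by (simp add: dot)
      next
        case False
        then have "\<chi> \<bullet> col K j = 0" "\<psi> \<bullet> col K j = 0"
          using \<chi>(2) sep(2) colK[of j] that False by (metis less_antisym)+
        then show ?thesis using col_carrier_vec[OF that Suc.prems(1)] by (simp add: dot)
      qed
      ultimately show ?thesis using \<chi> sep by (intro disjI2 bexI[of _ ?\<psi>]) auto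
    qed
  qed
qed


section \<open>Krylov spaces, Hankel matrices and splitting off a cyclic summand\<close>

lemma mult_assoc_dim:
  "dim_col A = dim_row B \<Longrightarrow> dim_col B = dim_row C \<Longrightarrow> A * B * C = A * (B * (C :: 'k::comm_ring_1 mat))"
  by (rule assoc_mult_mat[OF carrier_matI carrier_matI carrier_matI]) auto

lemma mult_one_dim: "dim_row A = n \<Longrightarrow> 1\<^sub>m n * A = (A :: 'k::comm_ring_1 mat)"
  by (rule left_mult_one_mat[OF carrier_matI]) auto

lemma transpose_mult_dim:
  "dim_col A = dim_row B \<Longrightarrow> transpose_mat (A * B) = transpose_mat B * transpose_mat (A :: 'k::comm_ring_1 mat)"
  by (rule transpose_mult[OF carrier_matI carrier_matI]) auto

definition cols_mat :: "nat \<Rightarrow> nat \<Rightarrow> (nat \<Rightarrow> 'k vec) \<Rightarrow> 'k mat" where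
  "cols_mat n d f = mat n d (\<lambda>(r, s). f s $ r)"

lemma cols_mat_dim [simp]: "dim_row (cols_mat n d f) = n" "dim_col (cols_mat n d f) = d"
  "cols_mat n d f \<in> carrier_mat n d"
  by (simp_all add: cols_mat_def)

lemma col_cols_mat: "f j \<in> carrier_vec n \<Longrightarrow> j < d \<Longrightarrow> col (cols_mat n d f) j = f j"
  by (auto simp: cols_mat_def)

lemma mult_cols_mat:
  assumes "A \<in> carrier_mat n m" "\<And>k. k < d \<Longrightarrow> f k \<in> carrier_vec m"
  shows "A * cols_mat m d f = cols_mat n d (\<lambda>k. A *\<^sub>v f k)"
  using assms(1) carrier_vecD[OF assms(2)]
  by (auto intro!: eq_matI sum.cong simp: cols_mat_def scalar_prod_def)

lemma finite_carrier_vec [simp]: "finite (carrier_vec n :: 'k::finite vec set)"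
proof -
  have "carrier_vec n \<subseteq> (\<lambda>A. col A 0) ` (carrier_mat n 1 :: 'k mat set)"
  proof
    fix w :: "'k vec" assume w: "w \<in> carrier_vec n"
    then show "w \<in> (\<lambda>A. col A 0) ` (carrier_mat n 1)"
      by (intro image_eqI[of _ _ "cols_mat n 1 (\<lambda>_. w)"]) (auto simp: col_cols_mat)
  qed
  then show ?thesis by (rule finite_subset) simp
qed

text \<open>The witness is the companion matrix of the relation in the last hypothesis: a shift with
  \<open>x\<close> as last column.\<close>

lemma krylov_invariant:
  fixes X :: "'k::field mat"
  assumes X: "X \<in> carrier_mat n n" and f: "\<And>k. f k \<in> carrier_vec n" "\<And>k. f (Suc k) = X *\<^sub>v f k"
    and x: "x \<in> carrier_vec d" "f d = cols_mat n d f *\<^sub>v x"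
  shows "\<exists>C \<in> carrier_mat d d. X * cols_mat n d f = cols_mat n d f * C"
proof -
  let ?y = "\<lambda>k. if Suc k = d then x else unit_vec d (Suc k)"
  have y: "?y k \<in> carrier_vec d" for k using x by auto
  have "f (Suc k) = cols_mat n d f *\<^sub>v ?y k" if "k < d" for k
  proof (cases "Suc k = d")
    case False
    then have "cols_mat n d f *\<^sub>v unit_vec d (Suc k) = f (Suc k)"
      using that f(1)[of "Suc k"] by (auto intro!: eq_vecI simp: cols_mat_def)
    then show ?thesis using False by simp
  qed (use x in auto)
  then have "X * cols_mat n d f = cols_mat n d f * cols_mat d d ?y"
    unfolding mult_cols_mat[OF X f(1)] mult_cols_mat[OF cols_mat_dim(3) y]
    using f(2) by (auto intro!: eq_matI simp: cols_mat_def[of n d])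
  then show ?thesis by (intro bexI[of _ "cols_mat d d ?y"]) simp_all
qed

text \<open>The matrix vanishes above the antidiagonal and has ones on it, so a kernel vector is
  seen to be zero entry by entry, starting from its last entry.\<close>

lemma hankel_invertible:
  fixes h :: "nat \<Rightarrow> 'k::field"
  assumes h: "\<And>k. Suc k < d \<Longrightarrow> h k = 0" "h (d - 1) = 1"
  shows "\<exists>Hi \<in> carrier_mat d d. mat d d (\<lambda>(a, b). h (a + b)) * Hi = 1\<^sub>m d \<and>
    Hi * mat d d (\<lambda>(a, b). h (a + b)) = 1\<^sub>m d"
proof -
  let ?H = "mat d d (\<lambda>(a, b). h (a + b))"
  have "x = 0\<^sub>v d" if x: "x \<in> carrier_vec d" "?H *\<^sub>v x = 0\<^sub>v d" for x
  proof -
    have "x $ (d - Suc a) = 0" if "a < d" for a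
      using that
    proof (induction a rule: less_induct)
      case (less a)
      have "0 = (?H *\<^sub>v x) $ a" using x(2) less.prems by (metis index_zero_vec(1))
      also have "\<dots> = (\<Sum>b<d. h (a + b) * x $ b)"
        using x(1) less.prems by (simp add: scalar_prod_def lessThan_atLeast0)
      also have "\<dots> = (\<Sum>b \<in> {d - Suc a}. h (a + b) * x $ b)"
      proof (rule sum.mono_neutral_right)
        show "\<forall>b\<in>{..<d} - {d - Suc a}. h (a + b) * x $ b = 0"
        proof
          fix b assume b: "b \<in> {..<d} - {d - Suc a}"
          show "h (a + b) * x $ b = 0"
          proof (cases "Suc (a + b) < d")
            case False
            then have "d - Suc b < a" "d - Suc (d - Suc b) = b" using b less.prems by auto
            then show ?thesis using less.IH[of "d - Suc b"] b by auto
          qed (use h in auto)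
        qed
      qed (use less.prems in auto)
      also have "\<dots> = x $ (d - Suc a)" using less.prems h(2) by simp
      finally show ?case by simp
    qed
    then have "x $ b = 0" if "b < d" for b
    proof -
      have "d - Suc (d - Suc b) = b" "d - Suc b < d" using that by auto
      then show ?thesis using \<open>\<And>a. a < d \<Longrightarrow> x $ (d - Suc a) = 0\<close>[of "d - Suc b"] by simp
    qed
    then show ?thesis using x by auto
  qed
  then have "det ?H \<noteq> 0"
    using det_0_iff_vec_prod_zero_field[of ?H d] by auto
  then have "?H \<in> Units (ring_mat TYPE('k) d ())" by (intro det_non_zero_imp_unit) auto
  then show ?thesis by (auto simp: Units_def ring_mat_def)
qed


text \<open>
  The pair \<open>v\<close>, \<open>\<phi>\<close> is chosen with a longest possible Krylov pairing; then the spans \<open>K\<close> and \<open>F\<close> of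
  the iterates are invariant, and \<open>K H\<inverse> F\<^sup>T\<close> is an idempotent that splits off a cyclic summand, on
  which \<open>F H\<inverse> F\<^sup>T\<close> intertwines \<open>X\<close> with its transpose.
\<close>

lemma cyclic_summand:
  fixes X :: "'k::{field,finite} mat"
  assumes X: "X \<in> carrier_mat n n" and P: "P \<in> carrier_mat n n" "P * P = P" "P * X = X * P"
    and nz: "P \<noteq> 0\<^sub>m n n"
  shows "\<exists>S A E v. S \<in> carrier_mat n n \<and> A \<in> carrier_mat n n \<and> E \<in> carrier_mat n n \<and>
    v \<in> carrier_vec n \<and> v \<noteq> 0\<^sub>v n \<and> P *\<^sub>v v = v \<and> E *\<^sub>v v = v \<and>
    E * P = E \<and> P * E = E \<and> E * E = E \<and> E * X = X * E \<and>
    S * X = transpose_mat X * S \<and> A * S = E \<and> A * transpose_mat E = A \<and> transpose_mat E * S = S"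
proof -
  note assoc_mult_mat [simp del]
  let ?X = "transpose_mat X" and ?P = "transpose_mat P"
  define xs where "xs v k = ((\<lambda>v. X *\<^sub>v v) ^^ k) v" for v k
  define ys where "ys \<phi> k = ((\<lambda>v. ?X *\<^sub>v v) ^^ k) \<phi>" for \<phi> k
  have Xt: "?X \<in> carrier_mat n n" and Pt: "?P \<in> carrier_mat n n" using X P by auto
  have xs_Suc: "xs v (Suc k) = X *\<^sub>v xs v k" and ys_Suc: "ys v (Suc k) = ?X *\<^sub>v ys v k" for v k
    by (simp_all add: xs_def ys_def)
  have xs_0: "xs v 0 = v" and ys_0: "ys v 0 = v" for v by (simp_all add: xs_def ys_def)
  have xs_c: "xs v k \<in> carrier_vec n" if "v \<in> carrier_vec n" for v k
    using that by (induction k) (auto simp: xs_0 xs_Suc intro: mult_mat_vec_carrier[OF X])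
  have ys_c: "ys v k \<in> carrier_vec n" if "v \<in> carrier_vec n" for v k
    using that by (induction k) (auto simp: ys_0 ys_Suc intro: mult_mat_vec_carrier[OF Xt])
  have adj: "(transpose_mat A *\<^sub>v \<phi>) \<bullet> v = \<phi> \<bullet> (A *\<^sub>v v)"
    if "A \<in> carrier_mat n n" "\<phi> \<in> carrier_vec n" "v \<in> carrier_vec n" for \<phi> v and A :: "'k mat"
    using transpose_vec_mult_scalar[OF that(1,3,2)] by simp
  have shift: "ys \<phi> a \<bullet> xs v b = \<phi> \<bullet> xs v (a + b)"
    if "\<phi> \<in> carrier_vec n" "v \<in> carrier_vec n" for \<phi> v a b
  proof (induction a arbitrary: b)
    case (Suc a)
    have "ys \<phi> (Suc a) \<bullet> xs v b = ys \<phi> a \<bullet> xs v (Suc b)"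
      unfolding ys_Suc xs_Suc using that by (intro adj X ys_c xs_c)
    then show ?case using Suc[of "Suc b"] by simp
  qed (simp add: ys_0)
  have P_xs: "P *\<^sub>v xs v k = xs (P *\<^sub>v v) k" if "v \<in> carrier_vec n" for v k
  proof (induction k)
    case (Suc k)
    have "P *\<^sub>v (X *\<^sub>v xs v k) = X *\<^sub>v (P *\<^sub>v xs v k)"
      using X P(1,3) xs_c[OF that, of k] by (metis assoc_mult_mat_vec)
    then show ?case by (simp add: xs_Suc Suc)
  qed (simp add: xs_0)
  have P_ys: "?P *\<^sub>v ys v k = ys (?P *\<^sub>v v) k" if "v \<in> carrier_vec n" for v k
  proof (induction k)
    case (Suc k)
    have "?P * ?X = ?X * ?P"
      using P X by (metis transpose_mult)
    then have "?P *\<^sub>v (?X *\<^sub>v ys v k) = ?X *\<^sub>v (?P *\<^sub>v ys v k)"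
      using Xt Pt ys_c[OF that, of k] by (metis assoc_mult_mat_vec)
    then show ?case by (simp add: ys_Suc Suc)
  qed (simp add: ys_0)
  have P_idem: "P *\<^sub>v (P *\<^sub>v w) = P *\<^sub>v w" if "w \<in> carrier_vec n" for w
    using assoc_mult_mat_vec[OF P(1) P(1) that] P(2) by simp
  have Pt_idem: "?P *\<^sub>v (?P *\<^sub>v w) = ?P *\<^sub>v w" if "w \<in> carrier_vec n" for w
    using assoc_mult_mat_vec[OF Pt Pt that] P(2) transpose_mult[OF P(1) P(1)] by simp
  \<comment> \<open>\<open>d\<close> is the length of the pairing: \<open>\<phi> X^k v\<close> is
    zero for \<open>k < d - 1\<close> and one for \<open>k = d - 1\<close>. Asking \<open>P\<close>
    and its transpose to fix the two vectors keeps the summand inside the image of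
    \<open>P\<close>.\<close>
  define good where "good d v \<phi> \<longleftrightarrow> v \<in> carrier_vec n \<and> \<phi> \<in> carrier_vec n \<and> P *\<^sub>v v = v \<and> ?P *\<^sub>v \<phi> = \<phi> \<and>
    d > 0 \<and> (\<forall>k. Suc k < d \<longrightarrow> \<phi> \<bullet> xs v k = 0) \<and> \<phi> \<bullet> xs v (d - 1) = 1" for d v \<phi>
  define D where "D = {d. \<exists>v \<phi>. good d v \<phi>}"
  have "d \<le> card (carrier_vec n :: 'k vec set)" if dD: "d \<in> D" for d
  proof -
    obtain v \<phi> where g: "good d v \<phi>" using dD unfolding D_def by blast
    \<comment> \<open>Applying \<open>X\<close> another \<open>d - 1 - b\<close> times and pairing
      with \<open>\<phi>\<close> gives 0 for \<open>a\<close> and 1 for \<open>b\<close>. So there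
      are \<open>d\<close> distinct vectors, which bounds \<open>d\<close>.\<close>
    have "xs v a \<noteq> xs v b" if "a < b" "b < d" for a b
    proof
      assume "xs v a = xs v b"
      then have "ys \<phi> (d - 1 - b) \<bullet> xs v a = ys \<phi> (d - 1 - b) \<bullet> xs v b" by simp
      then have "\<phi> \<bullet> xs v (d - 1 - b + a) = \<phi> \<bullet> xs v (d - 1 - b + b)"
        using g unfolding good_def by (simp add: shift)
      then show False using g that unfolding good_def by auto
    qed
    then have "inj_on (xs v) {..<d}" by (auto intro!: inj_onI) (metis nat_neq_iff)
    moreover have "xs v ` {..<d} \<subseteq> carrier_vec n" using g xs_c good_def by auto
    ultimately show ?thesis using card_inj_on_le[of "xs v" "{..<d}"] finite_carrier_vec by simp
  qed
  then have finD: "finite D" by (meson finite_nat_set_iff_bounded_le)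
  have "D \<noteq> {}"
  proof -
    obtain i j where ij: "i < n" "j < n" "P $$ (i, j) \<noteq> 0"
      using nz P(1) by (metis eq_matI carrier_matD index_zero_mat)
    let ?v = "P *\<^sub>v unit_vec n j" and ?\<phi> = "?P *\<^sub>v ((1 / P $$ (i, j)) \<cdot>\<^sub>v unit_vec n i)"
    have v: "?v \<in> carrier_vec n" "?\<phi> \<in> carrier_vec n" "P *\<^sub>v ?v = ?v" "?P *\<^sub>v ?\<phi> = ?\<phi>"
      using P(1) Pt by (auto simp: P_idem Pt_idem)
    have "?\<phi> \<bullet> ?v = ((1 / P $$ (i, j)) \<cdot>\<^sub>v unit_vec n i) \<bullet> ?v"
      using P(1) v by (subst adj) auto
    also have "\<dots> = 1" using ij P(1) by (simp add: scalar_prod_smult_left)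
    finally have "good 1 ?v ?\<phi>" using v by (simp add: good_def xs_0)
    then show ?thesis by (auto simp: D_def)
  qed
  define d where "d = Max D"
  have "d \<in> D" and dmax: "Suc d \<notin> D"
    using Max_in[OF finD \<open>D \<noteq> {}\<close>] Max_ge[OF finD, of "Suc d"] unfolding d_def by auto
  then obtain v \<phi> where g: "good d v \<phi>" unfolding D_def by blast
  then have v: "v \<in> carrier_vec n" "P *\<^sub>v v = v" and \<phi>: "\<phi> \<in> carrier_vec n" "?P *\<^sub>v \<phi> = \<phi>" and d: "d > 0"
    and h0: "\<And>k. Suc k < d \<Longrightarrow> \<phi> \<bullet> xs v k = 0" and h1: "\<phi> \<bullet> xs v (d - 1) = 1"
    by (auto simp: good_def)
  define K where "K = cols_mat n d (xs v)"
  define F where "F = cols_mat n d (ys \<phi>)"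
  have Kc: "K \<in> carrier_mat n d" and Fc: "F \<in> carrier_mat n d" by (simp_all add: K_def F_def)
  \<comment> \<open>Such a functional, moved by the transpose of \<open>P\<close>, would give a
    pairing of length \<open>d + 1\<close>. So \<open>xs v d\<close> lies in the span of the earlier
    iterates.\<close>
  have "\<nexists>\<psi>. \<psi> \<in> carrier_vec n \<and> (\<forall>j<d. \<psi> \<bullet> col K j = 0) \<and> \<psi> \<bullet> xs v d = 1"
  proof
    assume "\<exists>\<psi>. \<psi> \<in> carrier_vec n \<and> (\<forall>j<d. \<psi> \<bullet> col K j = 0) \<and> \<psi> \<bullet> xs v d = 1"
    then obtain \<psi> where \<psi>: "\<psi> \<in> carrier_vec n" "\<forall>j<d. \<psi> \<bullet> xs v j = 0" "\<psi> \<bullet> xs v d = 1"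
      using xs_c[OF v(1)] by (auto simp: K_def col_cols_mat)
    have "(?P *\<^sub>v \<psi>) \<bullet> xs v k = \<psi> \<bullet> xs v k" for k
      using P_xs[OF v(1), of k] v xs_c[OF v(1), of k] \<psi>(1) P(1) by (subst adj) auto
    moreover have "?P *\<^sub>v (?P *\<^sub>v \<psi>) = ?P *\<^sub>v \<psi>"
      by (rule Pt_idem[OF \<psi>(1)])
    ultimately have "good (Suc d) v (?P *\<^sub>v \<psi>)"
      using \<psi> v mult_mat_vec_carrier[OF Pt \<psi>(1)] by (simp add: good_def)
    then show False using dmax by (auto simp: D_def)
  qed
  then obtain x where "x \<in> carrier_vec d" "xs v d = K *\<^sub>v x"
    using fredholm_alternative[OF Kc xs_c[OF v(1), of d]] by auto
  then obtain C where C: "C \<in> carrier_mat d d" "X * K = K * C"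
    using krylov_invariant[where f = "xs v", OF X xs_c[OF v(1)] xs_Suc] unfolding K_def by auto
  have "\<nexists>\<psi>. \<psi> \<in> carrier_vec n \<and> (\<forall>j<d. \<psi> \<bullet> col F j = 0) \<and> \<psi> \<bullet> ys \<phi> d = 1"
  proof
    assume "\<exists>\<psi>. \<psi> \<in> carrier_vec n \<and> (\<forall>j<d. \<psi> \<bullet> col F j = 0) \<and> \<psi> \<bullet> ys \<phi> d = 1"
    then obtain \<psi> where \<psi>: "\<psi> \<in> carrier_vec n" "\<forall>j<d. ys \<phi> j \<bullet> \<psi> = 0" "ys \<phi> d \<bullet> \<psi> = 1"
      using ys_c[OF \<phi>(1)] by (auto simp: F_def col_cols_mat comm_scalar_prod[of _ n])
    have "\<phi> \<bullet> xs (P *\<^sub>v \<psi>) k = ys \<phi> k \<bullet> \<psi>" for k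
    proof -
      have "\<phi> \<bullet> xs (P *\<^sub>v \<psi>) k = (?P *\<^sub>v \<phi>) \<bullet> xs \<psi> k"
        unfolding P_xs[OF \<psi>(1), symmetric] using \<phi>(1) \<psi>(1) P(1) by (intro adj[symmetric] xs_c)
      then show ?thesis using shift[OF \<phi>(1) \<psi>(1), of k 0] \<phi>(2) by (simp add: xs_0)
    qed
    moreover have "P *\<^sub>v (P *\<^sub>v \<psi>) = P *\<^sub>v \<psi>"
      by (rule P_idem[OF \<psi>(1)])
    ultimately have "good (Suc d) (P *\<^sub>v \<psi>) \<phi>"
      using \<psi> \<phi> mult_mat_vec_carrier[OF P(1) \<psi>(1)] by (simp add: good_def)
    then show False using dmax by (auto simp: D_def)
  qed
  then obtain x' where "x' \<in> carrier_vec d" "ys \<phi> d = F *\<^sub>v x'"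
    using fredholm_alternative[OF Fc ys_c[OF \<phi>(1), of d]] by auto
  then obtain C' where C': "C' \<in> carrier_mat d d" "?X * F = F * C'"
    using krylov_invariant[where f = "ys \<phi>", OF Xt ys_c[OF \<phi>(1)] ys_Suc] unfolding F_def by auto
  \<comment> \<open>The Gram matrix of the two systems of iterates. By \<open>shift\<close> it
    depends on \<open>a + b\<close> only, whence the Hankel form.\<close>
  define H where "H = mat d d (\<lambda>(a, b). \<phi> \<bullet> xs v (a + b))"
  obtain Hi where Hi: "Hi \<in> carrier_mat d d" "H * Hi = 1\<^sub>m d" "Hi * H = 1\<^sub>m d"
    using hankel_invertible[where h = "\<lambda>k. \<phi> \<bullet> xs v k", OF h0 h1] unfolding H_def by auto
  let ?Kt = "transpose_mat K" and ?Ft = "transpose_mat F" and ?Hit = "transpose_mat Hi" and ?Ct = "transpose_mat C'"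
  have entry: "(?Ft * cols_mat n d f) $$ (a, b) = ys \<phi> a \<bullet> f b"
    if "a < d" "b < d" "f b \<in> carrier_vec n" for a b f
    using that ys_c[OF \<phi>(1)] by (simp add: F_def col_cols_mat)
  have FK: "?Ft * K = H"
    using shift[OF \<phi>(1) v(1)] xs_c[OF v(1)] unfolding K_def
    by (intro eq_matI) (use Fc in \<open>auto simp: entry H_def simp del: index_mult_mat(1)\<close>)
  have XK: "X * K = cols_mat n d (\<lambda>k. xs v (Suc k))"
    unfolding K_def xs_Suc using X xs_c[OF v(1)] by (intro mult_cols_mat)
  \<comment> \<open>Multiplication by \<open>C\<close> shifts the iterates by one, so
    \<open>H * C\<close> is a Hankel matrix again and therefore symmetric. This relates the
    companion matrices of \<open>X\<close> and of its transpose.\<close>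
  have HC: "(H * C) $$ (a, b) = \<phi> \<bullet> xs v (Suc (a + b))" if "a < d" "b < d" for a b
  proof -
    have "H * C = ?Ft * (X * K)" using C Fc Kc X by (simp add: mult_assoc_dim flip: FK)
    then show ?thesis using that shift[OF \<phi>(1) v(1), of a "Suc b"] xs_c[OF v(1)]
      by (simp add: XK entry del: index_mult_mat(1))
  qed
  have Hsym: "transpose_mat H = H" by (auto simp: H_def add.commute)
  have HCsym: "transpose_mat (H * C) = H * C"
    using HC C(1) by (intro eq_matI) (auto simp: add.commute H_def simp del: index_mult_mat(1))
  note [simp] = carrier_matD[OF X] carrier_matD[OF P(1)] carrier_matD[OF Kc] carrier_matD[OF Fc]
    carrier_matD[OF C(1)] carrier_matD[OF C'(1)] carrier_matD[OF Hi(1)]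
  have [simp]: "dim_row H = d" "dim_col H = d" by (simp_all add: H_def)
  have C'H: "?Ct * H = H * C"
  proof -
    have "?Ct * H = transpose_mat (F * C') * K" by (simp add: FK transpose_mult_dim mult_assoc_dim)
    also have "\<dots> = ?Ft * (X * K)" by (simp add: transpose_mult_dim mult_assoc_dim flip: C'(2))
    finally show ?thesis by (simp add: C(2) flip: FK mult_assoc_dim)
  qed
  have HitH: "?Hit * H = 1\<^sub>m d" using arg_cong[OF Hi(2), of transpose_mat]
    by (simp add: transpose_mult_dim Hsym)
  have HHit: "H * ?Hit = 1\<^sub>m d" using arg_cong[OF Hi(3), of transpose_mat]
    by (simp add: transpose_mult_dim Hsym)
  have cancel: "Hi * (H * Z) = Z" "H * (Hi * Z) = Z" "?Hit * (H * Z) = Z" "H * (?Hit * Z) = Z" 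
    if "dim_row Z = d" for Z
    using that by (simp_all add: Hi(2,3) HitH HHit mult_one_dim flip: mult_assoc_dim)
  have "?Hit * (H * Hi) = ?Hit" using Hi by simp
  then have Hit: "?Hit = Hi" by (simp add: cancel(3))
  have "?Kt * F = transpose_mat (?Ft * K)" by (simp add: transpose_mult_dim)
  then have KF: "?Kt * F = H" by (simp add: FK Hsym)
  have FK': "?Ft * (K * Z) = H * Z" "?Kt * (F * Z) = H * Z" if "dim_row Z = d" for Z
    using that by (simp_all add: FK KF flip: mult_assoc_dim)
  have HCt: "H * C' = transpose_mat (H * C)" unfolding C'H[symmetric] by (simp add: transpose_mult_dim Hsym)
  have HC': "H * C' = ?Ct * H" using HCt HCsym C'H by simp
  have CHi: "C * Hi = Hi * ?Ct"
  proof -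
    have "Hi * (?Ct * H) * Hi = Hi * (H * C) * Hi" by (simp add: C'H)
    then show ?thesis using Hi by (simp add: mult_assoc_dim cancel)
  qed
  have HiC: "C' * Hi = Hi * ?Ct"
  proof -
    have "Hi * (?Ct * H) * Hi = Hi * (H * C') * Hi" by (simp add: HC')
    then show ?thesis using Hi by (simp add: mult_assoc_dim cancel)
  qed
  have PK: "P * K = K"
    unfolding K_def using mult_cols_mat[OF P(1) xs_c[OF v(1)]] P_xs[OF v(1)] v(2) by simp
  have PF: "?P * F = F"
    unfolding F_def using mult_cols_mat[OF Pt ys_c[OF \<phi>(1)]] P_ys[OF \<phi>(1)] \<phi>(2) by simp
  have "?Ft * P = transpose_mat (?P * F)" "?Ft * X = transpose_mat (?X * F)"
    by (simp_all add: transpose_mult_dim)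
  then have FP: "?Ft * P = ?Ft" and XF: "?Ft * X = ?Ct * ?Ft"
    by (simp_all add: PF C'(2) transpose_mult_dim)
  define S where "S = F * (Hi * ?Ft)"
  \<comment> \<open>The inverse of \<open>S\<close> on the summand: \<open>?Kt * F = H\<close>
    collapses \<open>A * S\<close> to \<open>E\<close>.\<close>
  define A where "A = K * (Hi * ?Kt)"
  define E where "E = K * (Hi * ?Ft)"
  have Et: "transpose_mat E = F * (Hi * ?Kt)" by (simp add: E_def transpose_mult_dim mult_assoc_dim Hit)
  have carr: "S \<in> carrier_mat n n" "A \<in> carrier_mat n n" "E \<in> carrier_mat n n"
    by (auto simp: S_def A_def E_def intro!: carrier_matI)
  have "col (E * K) 0 = col K 0" by (simp add: E_def mult_assoc_dim FK Hi)
  then have "E *\<^sub>v xs v 0 = xs v 0"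
    using d carr(3) xs_c[OF v(1), of 0] by (simp add: K_def col_cols_mat col_mult2[of _ n n _ d])
  then have Ev: "E *\<^sub>v v = v" by (simp add: xs_0)
  have "v \<noteq> 0\<^sub>v n"
  proof
    assume v0: "v = 0\<^sub>v n"
    have "X *\<^sub>v 0\<^sub>v n = 0\<^sub>v n" by (intro eq_vecI) (auto simp: scalar_prod_def)
    then have "xs v k = 0\<^sub>v n" for k
      by (induction k) (simp_all only: xs_0 xs_Suc v0)
    then show False using h1 \<phi>(1) by simp
  qed
  moreover have "E * P = E" "P * E = E" "E * E = E"
    by (simp_all add: E_def mult_assoc_dim FP FK' cancel) (simp flip: mult_assoc_dim add: PK)
  moreover have "E * X = X * E"
  proof -
    have "X * E = K * (C * Hi * ?Ft)" by (simp add: E_def mult_assoc_dim flip: C(2)) (simp add: E_def C(2) flip: mult_assoc_dim)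
    then show ?thesis by (simp add: CHi) (simp add: E_def mult_assoc_dim XF)
  qed
  moreover have "S * X = ?X * S"
  proof -
    have "?X * S = F * (C' * Hi * ?Ft)" by (simp add: S_def C'(2) flip: mult_assoc_dim)
    then show ?thesis by (simp add: HiC) (simp add: S_def mult_assoc_dim XF)
  qed
  moreover have "A * S = E" "A * transpose_mat E = A" "transpose_mat E * S = S"
    by (simp_all add: A_def S_def E_def Et[unfolded E_def] mult_assoc_dim FK' cancel)
  ultimately show ?thesis using carr v Ev by blast
qed


text \<open>One cyclic summand \<open>E\<close> is peeled off \<open>P\<close> at a time, which
  lowers the number of fixed vectors. The last two equations of the conclusion tie \<open>A\<close>
  and \<open>S\<close> to the transpose of \<open>P\<close>; they make the mixed products of the two
  orthogonal parts vanish, so that the intertwiners can simply be added.\<close>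

lemma intertwiner_of_idempotent:
  fixes X :: "'k::{field,finite} mat"
  assumes X: "X \<in> carrier_mat n n" and "P \<in> carrier_mat n n" "P * P = P" "P * X = X * P"
  shows "\<exists>S A. S \<in> carrier_mat n n \<and> A \<in> carrier_mat n n \<and> S * X = transpose_mat X * S \<and>
    A * S = P \<and> A * transpose_mat P = A \<and> transpose_mat P * S = S"
  using assms(2-)
proof (induction "card {v \<in> carrier_vec n. P *\<^sub>v v = v}" arbitrary: P rule: less_induct)
  case (less P)
  note P = less.prems
  show ?case
  proof (cases "P = 0\<^sub>m n n")
    case True
    then show ?thesis using X by (intro exI[of _ "0\<^sub>m n n"]) simp
  next
    case False
    from cyclic_summand[OF X P False] obtain S1 A1 E v where
      c: "S1 \<in> carrier_mat n n" "A1 \<in> carrier_mat n n" "E \<in> carrier_mat n n" "v \<in> carrier_vec n"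
      and v: "v \<noteq> 0\<^sub>v n" "P *\<^sub>v v = v" "E *\<^sub>v v = v"
      and E: "E * P = E" "P * E = E" "E * E = E" "E * X = X * E"
      and S1: "S1 * X = transpose_mat X * S1" "A1 * S1 = E" "A1 * transpose_mat E = A1" "transpose_mat E * S1 = S1"
      by blast
    let ?P = "P - E"
    have P'c: "?P \<in> carrier_mat n n" by (rule minus_carrier_mat[OF c(3)])
    have PP: "P * ?P = ?P" and P'P: "?P * P = ?P"
      using mult_minus_distrib_mat[OF P(1) P(1) c(3)] minus_mult_distrib_mat[OF P(1) c(3) P(1)]
      by (simp_all only: P E)
    have EP: "E * ?P = 0\<^sub>m n n" "?P * E = 0\<^sub>m n n"
      using mult_minus_distrib_mat[OF c(3) P(1) c(3)] minus_mult_distrib_mat[OF P(1) c(3) c(3)] c(3)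
      by (simp_all add: E)
    have "?P * ?P = ?P"
      using minus_mult_distrib_mat[OF P(1) c(3) P'c] c(3) by (auto simp: PP EP)
    moreover have "?P * X = X * ?P"
      using minus_mult_distrib_mat[OF P(1) c(3) X] mult_minus_distrib_mat[OF X P(1) c(3)] by (simp only: P E)
    ultimately have P': "?P \<in> carrier_mat n n" "?P * ?P = ?P" "?P * X = X * ?P" using P'c by auto
    have "w \<in> carrier_vec n \<and> P *\<^sub>v w = w" if "w \<in> carrier_vec n" "?P *\<^sub>v w = w" for w
      using that P P' PP assoc_mult_mat_vec[of P n n ?P n w] by auto
    \<comment> \<open>\<open>v\<close> is fixed by \<open>P\<close> but killed by
      \<open>P - E\<close>; this makes the measure decrease strictly.\<close>
    moreover have "?P *\<^sub>v v \<noteq> v"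
      using v c P minus_mult_distrib_mat_vec[of P n n E v] by auto
    ultimately have "{w \<in> carrier_vec n. ?P *\<^sub>v w = w} \<subset> {w \<in> carrier_vec n. P *\<^sub>v w = w}"
      using c v by auto
    moreover have "finite {w \<in> carrier_vec n. P *\<^sub>v w = w}" by (rule finite_subset[OF _ finite_carrier_vec]) auto
    ultimately have "card {w \<in> carrier_vec n. ?P *\<^sub>v w = w} < card {w \<in> carrier_vec n. P *\<^sub>v w = w}"
      by (rule psubset_card_mono[rotated])
    from less.hyps[OF this P'] obtain S2 A2 where
      c2: "S2 \<in> carrier_mat n n" "A2 \<in> carrier_mat n n"
      and S2: "S2 * X = transpose_mat X * S2" "A2 * S2 = ?P" "A2 * transpose_mat ?P = A2" "transpose_mat ?P * S2 = S2"
      by blast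
    have t: "transpose_mat E \<in> carrier_mat n n" "transpose_mat ?P \<in> carrier_mat n n" "transpose_mat P \<in> carrier_mat n n"
      using c P by auto
    have z: "transpose_mat (0\<^sub>m n n) = 0\<^sub>m n n" for n by auto
    have tr: "transpose_mat E * transpose_mat ?P = 0\<^sub>m n n" "transpose_mat ?P * transpose_mat E = 0\<^sub>m n n"
      "transpose_mat E * transpose_mat P = transpose_mat E" "transpose_mat P * transpose_mat E = transpose_mat E"
      "transpose_mat ?P * transpose_mat P = transpose_mat ?P" "transpose_mat P * transpose_mat ?P = transpose_mat ?P"
      using transpose_mult[OF P'(1) c(3), symmetric] transpose_mult[OF c(3) P'(1), symmetric] transpose_mult[OF P(1) c(3), symmetric]
        transpose_mult[OF c(3) P(1), symmetric] transpose_mult[OF P(1) P'(1), symmetric] transpose_mult[OF P'(1) P(1), symmetric]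
      unfolding EP E PP P'P z by simp_all
    have A1S2: "A1 * S2 = 0\<^sub>m n n"
    proof -
      have "A1 * S2 = (A1 * transpose_mat E) * (transpose_mat ?P * S2)" using S1 S2 by simp
      also have "\<dots> = A1 * ((transpose_mat E * transpose_mat ?P) * S2)"
        using c c2 t by (simp add: assoc_mult_mat[of _ n n _ n _ n])
      finally show ?thesis using c c2 tr by simp
    qed
    have A2S1: "A2 * S1 = 0\<^sub>m n n"
    proof -
      have "A2 * S1 = (A2 * transpose_mat ?P) * (transpose_mat E * S1)" using S1 S2 by simp
      also have "\<dots> = A2 * ((transpose_mat ?P * transpose_mat E) * S1)"
        using c c2 t by (simp add: assoc_mult_mat[of _ n n _ n _ n])
      finally show ?thesis using c c2 tr by simp
    qed
    have a: "A1 * transpose_mat P = A1" "A2 * transpose_mat P = A2"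
      "transpose_mat P * S1 = S1" "transpose_mat P * S2 = S2"
      using S1(3,4) S2(3,4) tr c c2 t by (metis assoc_mult_mat)+
    have "(A1 + A2) * (S1 + S2) = A1 * S1 + A2 * S1 + (A1 * S2 + A2 * S2)"
      using c c2 by (simp add: add_mult_distrib_mat[of _ n n _ _ n] mult_add_distrib_mat[of _ n n _ n])
    also have "\<dots> = P" using c P by (auto simp: A1S2 A2S1 S1 S2)
    finally have "(A1 + A2) * (S1 + S2) = P" .
    moreover have "(S1 + S2) * X = transpose_mat X * (S1 + S2)"
      "(A1 + A2) * transpose_mat P = A1 + A2" "transpose_mat P * (S1 + S2) = S1 + S2"
      using c c2 t X S1 S2 a by (simp_all add: add_mult_distrib_mat[of _ n n _ _ n] mult_add_distrib_mat[of _ n n _ n])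
    ultimately show ?thesis using c c2 by (intro exI[of _ "S1 + S2"] exI[of _ "A1 + A2"]) auto
  qed
qed

text \<open>The case of the idempotent 1: \<open>A\<close> is then the inverse of the intertwiner
  \<open>S\<close>, and conjugation by it produces the transpose.\<close>

theorem transpose_similar:
  fixes X :: "'k::{field,finite} mat"
  assumes "X \<in> carrier_mat n n"
  shows "\<exists>g \<in> carrier (GL n). conj_by g X = transpose_mat X"
proof -
  obtain S A where S: "S \<in> carrier_mat n n" "A \<in> carrier_mat n n" "S * X = transpose_mat X * S" "A * S = 1\<^sub>m n"
    using intertwiner_of_idempotent[OF assms, of "1\<^sub>m n"] assms by auto
  have g: "A \<in> carrier (GL n)" and SA: "S * A = 1\<^sub>m n"
    using GL_I[OF S(2,1)] mat_mult_left_right_inverse[OF S(2,1,4)] by auto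
  have "A * transpose_mat X = A * (transpose_mat X * (S * A))" using assms S SA by simp
  also have "\<dots> = A * ((transpose_mat X * S) * A)" using assms S by (simp add: assoc_mult_mat[of _ n n _ n _ n])
  also have "\<dots> = (A * S) * X * A" using assms S(1,2) by (simp add: assoc_mult_mat[of _ n n _ n _ n] flip: S(3))
  also have "\<dots> = 1\<^sub>m n * X * A" by (simp only: S(4))
  also have "\<dots> = X * A" using assms S by simp
  finally have "X * A = A * transpose_mat X" ..
  then have "conj_by A X = transpose_mat X" using assms by (intro conj_by_eqI[OF g assms]) auto
  then show ?thesis using g by auto
qed

section \<open>Induction and restriction for the general linear groups\<close>

lemma mult_J:
  assumes "A \<in> carrier_mat n n" "r < n" "s < n"
  shows "(A * J n) $$ (r, s) = A $$ (r, n - Suc s)"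
proof -
  have "(A * J n) $$ (r, s) = (\<Sum>t<n. A $$ (r, t) * (if t = n - Suc s then 1 else 0))"
    using assms by (subst mult_mat_entry[where n = n]) (auto simp: J_def intro!: sum.cong)
  then show ?thesis using assms by (simp add: if_distrib[of "\<lambda>x. _ * x"] sum.delta cong: if_cong)
qed

lemma J_mult:
  assumes "A \<in> carrier_mat n n" "r < n" "s < n"
  shows "(J n * A) $$ (r, s) = A $$ (n - Suc r, s)"
proof -
  have "(J n * A) $$ (r, s) = (\<Sum>t<n. (if t = n - Suc r then 1 else 0) * A $$ (t, s))"
    using assms by (subst mult_mat_entry[where n = n]) (auto simp: J_def intro!: sum.cong)
  then show ?thesis using assms by (simp add: if_distrib[of "\<lambda>x. x * _"] sum.delta cong: if_cong)
qed

lemma J_carrier [simp]: "J n \<in> carrier_mat n n" "dim_row (J n) = n" "dim_col (J n) = n"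
  by (simp_all add: J_def)

lemma J_index: "r < n \<Longrightarrow> s < n \<Longrightarrow> J n $$ (r, s) = (if r + s + 1 = n then 1 else 0)"
  by (simp add: J_def)

lemma J_J: "J n * J n = (1\<^sub>m n :: 'k::field mat)"
  by (rule eq_matI) (auto simp: mult_J[where n = n] J_index simp del: index_mult_mat(1))

text \<open>Transposition followed by conjugation with \<open>J\<close>. In this form the similarity
  can be applied to block triangular matrices.\<close>

lemma flip_similar:
  fixes X :: "'k::{field,finite} mat"
  assumes X: "X \<in> carrier_mat n n"
  shows "\<exists>g \<in> carrier (GL n). conj_by g X = flip (\<lambda>x. x) X"
proof -
  obtain g where g: "g \<in> carrier (GL n)" "conj_by g X = transpose_mat X"
    using transpose_similar[OF X] by auto
  have J: "J n \<in> carrier (GL n)" by (rule GL_I[of _ _ "J n"]) (simp_all add: J_J)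
  have "transpose_mat X * J n = J n * flip (\<lambda>x. x) X"
    using X by (intro eq_matI) (auto simp: mult_J[where n = n] J_mult[where n = n] simp del: index_mult_mat(1))
  then have "conj_by (J n) (transpose_mat X) = flip (\<lambda>x. x) X"
    using X by (intro conj_by_eqI[OF J]) auto
  then show ?thesis
    using GL_mult[OF g(1) J] by (intro bexI[of _ "g * J n"]) (simp_all add: conj_by_mult[OF g(1) J X] g(2))
qed

definition field_hom :: "('k::field \<Rightarrow> 'k) \<Rightarrow> bool" where
  "field_hom f \<longleftrightarrow> (\<forall>x y. f (x + y) = f x + f y) \<and> (\<forall>x y. f (x * y) = f x * f y) \<and> f 0 = 0 \<and> f 1 = 1"

lemma field_hom_id: "field_hom (\<lambda>x. x)"
  by (simp add: field_hom_def)

lemma flip_mult':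
  "field_hom f \<Longrightarrow> A \<in> carrier_mat n n \<Longrightarrow> B \<in> carrier_mat n n \<Longrightarrow> flip f (A * B) = flip f B * flip f A"
  by (rule flip_mult) (auto simp: field_hom_def)

lemma flip_GL:
  assumes f: "field_hom f" and g: "g \<in> carrier (GL n)"
  shows "flip f g \<in> carrier (GL n)"
proof (rule GL_I)
  show "flip f (mat_inv g) * flip f g = 1\<^sub>m n"
    using f flip_mult'[OF f GL_carrier[OF g] mat_inv_props(2)[OF g]] mat_inv_props(4)[OF g]
    by (simp add: flip_one field_hom_def)
qed (use GL_carrier[OF g] mat_inv_props[OF g] in auto)

lemma conj_by_mat_inv:
  assumes "g \<in> carrier (GL n)" "X \<in> carrier_mat n n"
  shows "conj_by g X * mat_inv g = mat_inv g * X"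
proof -
  note c = GL_carrier[OF assms(1)] mat_inv_props(2)[OF assms(1)] assms(2)
  have "conj_by g X * mat_inv g = mat_inv g * (X * (g * mat_inv g))"
    unfolding conj_by_def using c by (simp add: assoc_mult_mat[of _ n n _ n _ n])
  then show ?thesis using c by (simp only: mat_inv_props(4)[OF assms(1)]) simp
qed

lemma flip_conj_by:
  assumes f: "field_hom f" and g: "g \<in> carrier (GL n)" and X: "X \<in> carrier_mat n n"
  shows "flip f (conj_by g X) = conj_by (flip f (mat_inv g)) (flip f X)"
proof (rule conj_by_eqI[symmetric])
  show "flip f (mat_inv g) \<in> carrier (GL n)" by (rule flip_GL[OF f mat_inv_props(1)[OF g]])
  have "flip f X * flip f (mat_inv g) = flip f (conj_by g X * mat_inv g)"
    using X mat_inv_props(2)[OF g] by (simp add: conj_by_mat_inv[OF g X] flip_mult'[OF f])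
  then show "flip f X * flip f (mat_inv g) = flip f (mat_inv g) * flip f (conj_by g X)"
    using X mat_inv_props(2)[OF g] conj_by_carrier[OF g X] by (simp add: flip_mult'[OF f])
qed (use X conj_by_carrier[OF g X] in auto)

section \<open>Invariant functions and induction as a sum over the whole group\<close>

definition gl_invariant :: "('k::field mat \<Rightarrow> real) \<Rightarrow> bool" where
  "gl_invariant f \<longleftrightarrow> (\<forall>n. \<forall>g \<in> carrier (GL n). \<forall>X \<in> carrier_mat n n. f (conj_by g X) = f X)"

lemma gl_invariantD:
  "gl_invariant f \<Longrightarrow> g \<in> carrier (GL n) \<Longrightarrow> X \<in> carrier_mat n n \<Longrightarrow> f (conj_by g X) = f X"
  by (auto simp: gl_invariant_def)

lemma gl_invariant_flip:
  fixes X :: "'k::{field,finite} mat"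
  assumes "gl_invariant f" "X \<in> carrier_mat n n"
  shows "f (flip (\<lambda>x. x) X) = f X"
  using flip_similar[OF assms(2)] gl_invariantD[OF assms(1) _ assms(2)] by metis

lemma bij_GL_mult_left:
  assumes s: "s \<in> carrier (GL n)"
  shows "bij_betw ((*) s) (carrier (GL n)) (carrier (GL n))"
proof -
  have "mat_inv s * (s * g) = g" "s * (mat_inv s * g) = g" if "g \<in> carrier (GL n)" for g
    using assoc_mult_mat[OF mat_inv_props(2)[OF s] GL_carrier[OF s] GL_carrier[OF that]]
      assoc_mult_mat[OF GL_carrier[OF s] mat_inv_props(2)[OF s] GL_carrier[OF that]]
      left_mult_one_mat[OF GL_carrier[OF that]]
    unfolding mat_inv_props[OF s] by simp_all
  then show ?thesis
    using s mat_inv_props(1)[OF s] by (intro bij_betwI[where g = "(*) (mat_inv s)"]) (auto simp: GL_mult)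
qed

lemma sum_conj_left:
  fixes X :: "'k::{field,finite} mat"
  assumes "s \<in> carrier (GL n)" "X \<in> carrier_mat n n"
  shows "(\<Sum>g \<in> carrier (GL n). h (conj_by g (conj_by s X))) = (\<Sum>g \<in> carrier (GL n). h (conj_by g X) :: real)"
  using sum.reindex_bij_betw[OF bij_GL_mult_left[OF assms(1)], of "\<lambda>g. h (conj_by g X)"] assms
  by (simp add: conj_by_mult[of _ n])

lemma sum_conj_right:
  fixes X :: "'k::{field,finite} mat"
  assumes s: "s \<in> carrier (GL n)" and X: "X \<in> carrier_mat n n"
  shows "(\<Sum>g \<in> carrier (GL n). h (conj_by s (conj_by g X))) = (\<Sum>g \<in> carrier (GL n). h (conj_by g X) :: real)"
proof -
  have m: "g * s * mat_inv s = g" "g * mat_inv s * s = g" if "g \<in> carrier (GL n)" for g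
    using GL_carrier[OF that] GL_carrier[OF s] mat_inv_props[OF s] by simp_all
  have "bij_betw (\<lambda>g. g * s) (carrier (GL n)) (carrier (GL n))"
    by (rule bij_betwI[where g = "\<lambda>g. g * mat_inv s"]) (auto simp: GL_mult mat_inv_props(1)[OF s] s m)
  from sum.reindex_bij_betw[OF this, of "\<lambda>g. h (conj_by g X)"] show ?thesis
    using assms by (simp add: conj_by_mult[of _ n])
qed

lemma mat_inv_inv: "g \<in> carrier (GL n) \<Longrightarrow> mat_inv (mat_inv g) = g"
  by (rule GL_cancel_left[of "mat_inv g" n])
    (auto simp: mat_inv_props mat_inv_props[OF mat_inv_props(1)] GL_carrier)

text \<open>Inversion and flip both reverse products, so
  \<open>g \<mapsto> flip (\<lambda>x. x) (mat_inv g)\<close> permutes the group. It turns the flip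
  of a conjugate into a conjugate of the flipped matrix, which is similar to
  \<open>X\<close>.\<close>

lemma sum_conj_flip:
  fixes X :: "'k::{field,finite} mat"
  assumes X: "X \<in> carrier_mat n n"
  shows "(\<Sum>g \<in> carrier (GL n). h (flip (\<lambda>x. x) (conj_by g X))) = (\<Sum>g \<in> carrier (GL n). h (conj_by g X) :: real)"
proof -
  let ?f = "flip (\<lambda>x :: 'k. x)"
  obtain s where s: "s \<in> carrier (GL n)" "conj_by s X = ?f X" using flip_similar[OF X] by auto
  have ff: "?f (?f Y) = Y" if "Y \<in> carrier_mat n n" for Y using flip_flip[OF that, of "\<lambda>x. x" "\<lambda>x. x"] by simp
  have bij: "bij_betw (\<lambda>g. ?f (mat_inv g)) (carrier (GL n)) (carrier (GL n))"
  proof (rule bij_betwI[where g = "\<lambda>g. mat_inv (?f g)"])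
  qed (auto simp: flip_GL field_hom_id mat_inv_props mat_inv_inv ff mat_inv_inv[OF flip_GL[OF field_hom_id]] GL_carrier)
  have "(\<Sum>g \<in> carrier (GL n). h (?f (conj_by g X))) = (\<Sum>g \<in> carrier (GL n). h (conj_by (?f (mat_inv g)) (?f X)))"
    using X by (intro sum.cong) (auto simp: flip_conj_by[OF field_hom_id])
  also have "\<dots> = (\<Sum>g \<in> carrier (GL n). h (conj_by g (conj_by s X)))"
    unfolding s(2) by (rule sum.reindex_bij_betw[OF bij])
  finally show ?thesis by (simp only: sum_conj_left[OF s(1) X])
qed

lemma (in mat_group) diag_part_GL:
  assumes "g \<in> carrier G" "upper \<beta> g" "{t. t < N \<and> \<beta> t = l} = {k..<k + m}" "k + m \<le> N"
  shows "diag_part k m g \<in> carrier (GL m)"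
proof (rule GL_I[where h = "diag_part k m (mat_inv g)"])
  have g: "g \<in> carrier (GL N)" using assms sub_GL by auto
  show "diag_part k m (mat_inv g) * diag_part k m g = 1\<^sub>m m"
    using diag_part_mult[OF mat_inv_props(2)[OF g] upper_inv[OF assms(1,2)] GL_carrier[OF g] assms(2,3)]
      mat_inv_props(3)[OF g] assms(4) by (simp add: diag_part_one)
qed auto

lemma (in mat_group) diag_part_conj:
  assumes "g \<in> carrier G" "upper \<beta> g" "{t. t < N \<and> \<beta> t = l} = {k..<k + m}" "k + m \<le> N"
    and "X \<in> carrier_mat N N" "upper \<beta> X"
  shows "diag_part k m (conj_by g X) = conj_by (diag_part k m g) (diag_part k m X)"
proof (rule conj_by_eqI[symmetric])
  have g: "g \<in> carrier (GL N)" using assms sub_GL by auto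
  show "diag_part k m g \<in> carrier (GL m)" by (rule diag_part_GL[OF assms(1-4)])
  have "diag_part k m X * diag_part k m g = diag_part k m (g * conj_by g X)"
    unfolding conj_by_eq[OF g assms(5)] by (rule diag_part_mult[symmetric, OF assms(5,6) GL_carrier[OF g] assms(2,3)])
  also have "\<dots> = diag_part k m g * diag_part k m (conj_by g X)"
    by (rule diag_part_mult[OF GL_carrier[OF g] assms(2) conj_by_carrier[OF g assms(5)] upper_conj[OF assms(1,2,5,6)] assms(3)])
  finally show "diag_part k m X * diag_part k m g = diag_part k m g * diag_part k m (conj_by g X)" .
qed auto

lemma block_levels2:
  "{t. t < i + j \<and> block_of [i, j] t = 0} = {0..<0 + i}"
  "{t. t < i + j \<and> block_of [i, j] t = 1} = {i..<i + j}"
  by auto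

lemma diag_part_levi_proj:
  assumes "X \<in> carrier_mat n n" "k + m \<le> n" "\<And>r. r < m \<Longrightarrow> block_of ns (k + r) = l"
  shows "diag_part k m (levi_proj ns X) = diag_part k m X"
  using assms by (intro eq_matI) (auto simp: levi_proj_def)

text \<open>The integrand takes the whole conjugated matrix and not only its Levi part, so that
  inductions can be nested and flipped under the sum.\<close>

definition induced :: "nat \<Rightarrow> nat list \<Rightarrow> ('k::{field,finite} mat \<Rightarrow> real) \<Rightarrow> 'k mat \<Rightarrow> real" where
  "induced n ns \<Theta> X = (\<Sum>g \<in> carrier (GL n).
     if upper (block_of ns) (conj_by g X) then \<Theta> (conj_by g X) else 0) / real (card (parabolic (GL n :: 'k mat monoid) ns))"

lemma induced_cong:
  assumes "\<And>Y. Y \<in> carrier_mat n n \<Longrightarrow> upper (block_of ns) Y \<Longrightarrow> \<Theta> Y = \<Theta>' Y" "X \<in> carrier_mat n n"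
  shows "induced n ns \<Theta> X = induced n ns \<Theta>' X"
  unfolding induced_def using assms by (auto intro!: sum.cong arg_cong2[of _ _ _ _ "(/)"] simp: conj_by_carrier)

lemma induced_conj:
  "s \<in> carrier (GL n) \<Longrightarrow> X \<in> carrier_mat n n \<Longrightarrow> induced n ns \<Theta> (conj_by s X) = induced n ns \<Theta> X"
  unfolding induced_def by (subst sum_conj_left[where h = "\<lambda>Y. if upper (block_of ns) Y then \<Theta> Y else 0"]) auto

lemma nabla_eq:
  fixes F :: "'k::{field,finite} mat \<Rightarrow> 'k mat \<Rightarrow> real"
  assumes inv: "\<And>Y. gl_invariant (\<lambda>X. F X Y)" "\<And>X. gl_invariant (F X)" and X: "X \<in> carrier_mat n n"
  shows "nabla (\<lambda>(A, B). F A B) X =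
    (\<Sum>(i, j) \<in> {(i, j). i + j = n}. induced n [i, j] (\<lambda>Y. F (diag_part 0 i Y) (diag_part i j Y)) X)"
proof -
  interpret mat_group n "GL n" "gl n" by (rule mat_group_GL)
  have "par_ind (GL n) (gl n) [i, j] (\<lambda>Y. F (diag_part 0 i Y) (diag_part i j Y)) X =
      induced n [i, j] (\<lambda>Y. F (diag_part 0 i Y) (diag_part i j Y)) X" if n: "n = i + j" for i j
  proof -
    have lp: "diag_part 0 i (levi_proj [i, j] Y) = diag_part 0 i Y"
      "diag_part i j (levi_proj [i, j] Y) = diag_part i j Y" if "Y \<in> carrier_mat n n" for Y :: "'k mat"
      using that n by (auto intro!: diag_part_levi_proj)
    have "par_ind (GL n) (gl n) [i, j] (\<lambda>Y. F (diag_part 0 i Y) (diag_part i j Y)) X =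
      (\<Sum>g \<in> carrier (GL n). if upper (block_of [i, j]) (conj_by g X)
         then F (diag_part 0 i (levi_proj [i, j] (conj_by g X))) (diag_part i j (levi_proj [i, j] (conj_by g X))) else 0)
       / real (card (parabolic (GL n :: 'k mat monoid) [i, j]))"
    proof (rule par_ind_eq_sum)
      fix p W :: "'k mat"
      assume p: "p \<in> carrier (GL n)" "upper (block_of [i, j]) p" and W: "W \<in> gl n" "upper (block_of [i, j]) W"
      have Wc: "W \<in> carrier_mat n n" using W by (simp add: gl_def)
      have l0: "{t. t < n \<and> block_of [i, j] t = 0} = {0..<0 + i}"
        and l1: "{t. t < n \<and> block_of [i, j] t = 1} = {i..<i + j}"
        using block_levels2 n by simp_all
      have d: "diag_part 0 i (conj_by p W) = conj_by (diag_part 0 i p) (diag_part 0 i W)"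
        "diag_part i j (conj_by p W) = conj_by (diag_part i j p) (diag_part i j W)"
        using n by (intro diag_part_conj[OF p l0 _ Wc W(2)] diag_part_conj[OF p l1 _ Wc W(2)]; simp)+
      have g: "diag_part 0 i p \<in> carrier (GL i)" "diag_part i j p \<in> carrier (GL j)"
        using n by (intro diag_part_GL[OF p l0] diag_part_GL[OF p l1]; simp)+
      show "F (diag_part 0 i (levi_proj [i, j] (conj_by p W))) (diag_part i j (levi_proj [i, j] (conj_by p W))) =
        F (diag_part 0 i (levi_proj [i, j] W)) (diag_part i j (levi_proj [i, j] W))"
        using gl_invariantD[OF inv(1) g(1)] gl_invariantD[OF inv(2) g(2)]
        by (simp add: lp conj_by_carrier[OF p(1) Wc] Wc d)
    qed (use X in \<open>simp add: gl_def\<close>)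
    then show ?thesis unfolding induced_def
      by (simp add: lp conj_by_carrier[OF _ X] cong: if_cong sum.cong)
  qed
  then show ?thesis using X by (auto simp: nabla_def Let_def gl_def intro!: sum.cong)
qed

lemma nabla_outside: "X \<notin> carrier_mat (dim_row X) (dim_row X) \<Longrightarrow> nabla F X = 0"
  by (simp add: nabla_def gl_def Let_def)

lemma gl_invariant_nabla:
  fixes F :: "'k::{field,finite} mat \<Rightarrow> 'k mat \<Rightarrow> real"
  assumes "\<And>Y. gl_invariant (\<lambda>X. F X Y)" "\<And>X. gl_invariant (F X)"
  shows "gl_invariant (nabla (\<lambda>(A, B). F A B))"
  unfolding gl_invariant_def
proof (intro allI ballI)
  fix n and g X :: "'k mat" assume "g \<in> carrier (GL n)" "X \<in> carrier_mat n n"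
  then show "nabla (\<lambda>(A, B). F A B) (conj_by g X) = nabla (\<lambda>(A, B). F A B) X"
    by (simp add: nabla_eq[OF assms, of _ n] conj_by_carrier[of _ n] induced_conj)
qed


section \<open>Induction in stages\<close>

definition diag2 :: "'k::zero mat \<Rightarrow> 'k mat \<Rightarrow> 'k mat" where
  "diag2 A B = four_block_mat A (0\<^sub>m (dim_row A) (dim_col B)) (0\<^sub>m (dim_row B) (dim_col A)) B"

lemma diag2_carrier [simp]:
  "A \<in> carrier_mat i i \<Longrightarrow> B \<in> carrier_mat j j \<Longrightarrow> diag2 A B \<in> carrier_mat (i + j) (i + j)"
  by (simp add: diag2_def)

lemma diag2_dim [simp]: "dim_row (diag2 A B) = dim_row A + dim_row B" "dim_col (diag2 A B) = dim_col A + dim_col B"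
  by (simp_all add: diag2_def)

lemma diag2_index:
  "A \<in> carrier_mat i i \<Longrightarrow> B \<in> carrier_mat j j \<Longrightarrow> r < i + j \<Longrightarrow> s < i + j \<Longrightarrow>
    diag2 A B $$ (r, s) =
      (if r < i \<and> s < i then A $$ (r, s) else if i \<le> r \<and> i \<le> s then B $$ (r - i, s - i) else 0)"
  by (auto simp: diag2_def)

lemma diag2_mult:
  fixes A :: "'k::comm_ring_1 mat"
  assumes "A \<in> carrier_mat i i" "B \<in> carrier_mat j j" "A' \<in> carrier_mat i i" "B' \<in> carrier_mat j j"
  shows "diag2 A B * diag2 A' B' = diag2 (A * A') (B * B')"
  unfolding diag2_def using assms
  by (subst mult_four_block_mat[of _ i i _ j _ j]) (auto intro!: arg_cong2[of _ _ _ _ "\<lambda>A B. four_block_mat A _ _ B"])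

lemma diag2_one: "diag2 (1\<^sub>m i) (1\<^sub>m j) = 1\<^sub>m (i + j)"
  by (rule eq_matI) (auto simp: diag2_index[of _ i _ j] diag2_def)

lemma diag2_GL:
  assumes "g \<in> carrier (GL i)" "h \<in> carrier (GL j)"
  shows "diag2 g h \<in> carrier (GL (i + j))"
proof (rule GL_I[where h = "diag2 (mat_inv g) (mat_inv h)"])
  show "diag2 (mat_inv g) (mat_inv h) * diag2 g h = 1\<^sub>m (i + j)"
    using mat_inv_props[OF assms(1)] mat_inv_props[OF assms(2)] GL_carrier[OF assms(1)] GL_carrier[OF assms(2)]
    by (simp add: diag2_mult[of _ i _ j] diag2_one)
qed (use mat_inv_props[OF assms(1)] mat_inv_props[OF assms(2)] GL_carrier[OF assms(1)] GL_carrier[OF assms(2)] in auto)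

lemma diag_part_diag2:
  assumes "A \<in> carrier_mat i i" "B \<in> carrier_mat j j"
  shows "diag_part 0 i (diag2 A B) = A" "diag_part i j (diag2 A B) = B"
  using assms by (auto intro!: eq_matI simp: diag2_index)

lemma upper_diag2:
  assumes "A \<in> carrier_mat i i" "B \<in> carrier_mat j j"
  shows "upper (block_of [i, j]) (diag2 A B)"
  using assms by (auto simp: upper_def diag2_index[OF assms])

lemma upper_block3_iff:
  assumes "Y \<in> carrier_mat (k1 + k2 + k3) (k1 + k2 + k3)"
  shows "upper (block_of [k1, k2, k3]) Y \<longleftrightarrow>
    upper (block_of [k1 + k2, k3]) Y \<and> upper (block_of [k1, k2]) (diag_part 0 (k1 + k2) Y)"
proof -
  have "block_of [k1, k2, k3] s < block_of [k1, k2, k3] r \<longleftrightarrow>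
      block_of [k1 + k2, k3] s < block_of [k1 + k2, k3] r \<or>
      r < k1 + k2 \<and> s < k1 + k2 \<and> block_of [k1, k2] s < block_of [k1, k2] r"
    if "r < k1 + k2 + k3" "s < k1 + k2 + k3" for r s
    using that by auto
  moreover have "upper (block_of [k1, k2]) (diag_part 0 (k1 + k2) Y) \<longleftrightarrow>
      (\<forall>r < k1 + k2 + k3. \<forall>s < k1 + k2 + k3. r < k1 + k2 \<and> s < k1 + k2 \<and>
        block_of [k1, k2] s < block_of [k1, k2] r \<longrightarrow> Y $$ (r, s) = 0)"
    unfolding upper_def by (simp del: block_of.simps) (meson trans_less_add1)
  ultimately show ?thesis
    using assms unfolding upper_def by (simp del: block_of.simps) blast
qed

text \<open>The fibres are left translates of the kernel. \<open>m\<close> is merely an operation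
  that computes the values at products, so the image does not have to be presented as a
  group.\<close>

lemma sum_over_fibers:
  assumes "group G" "finite (carrier G)"
    and \<psi>: "\<And>x y. x \<in> carrier G \<Longrightarrow> y \<in> carrier G \<Longrightarrow> \<psi> (x \<otimes>\<^bsub>G\<^esub> y) = m (\<psi> x) (\<psi> y)"
  shows "(\<Sum>x \<in> carrier G. f (\<psi> x)) =
    real (card {x \<in> carrier G. \<psi> x = \<psi> \<one>\<^bsub>G\<^esub>}) * (\<Sum>s \<in> \<psi> ` carrier G. f s)"
proof -
  interpret group G by fact
  have card_fiber: "card {x \<in> carrier G. \<psi> x = \<psi> x0} = card {x \<in> carrier G. \<psi> x = \<psi> \<one>\<^bsub>G\<^esub>}"
    if x0: "x0 \<in> carrier G" for x0
  proof (rule bij_betw_same_card[symmetric])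
    show "bij_betw (\<lambda>x. x0 \<otimes>\<^bsub>G\<^esub> x) {x \<in> carrier G. \<psi> x = \<psi> \<one>\<^bsub>G\<^esub>} {x \<in> carrier G. \<psi> x = \<psi> x0}"
    proof (rule bij_betwI[where g = "\<lambda>x. inv\<^bsub>G\<^esub> x0 \<otimes>\<^bsub>G\<^esub> x"])
      show "(\<lambda>x. x0 \<otimes>\<^bsub>G\<^esub> x) \<in> {x \<in> carrier G. \<psi> x = \<psi> \<one>\<^bsub>G\<^esub>} \<rightarrow> {x \<in> carrier G. \<psi> x = \<psi> x0}"
        using x0 \<psi>[OF x0 one_closed] by (auto simp: \<psi>)
      show "(\<lambda>x. inv\<^bsub>G\<^esub> x0 \<otimes>\<^bsub>G\<^esub> x) \<in> {x \<in> carrier G. \<psi> x = \<psi> x0} \<rightarrow> {x \<in> carrier G. \<psi> x = \<psi> \<one>\<^bsub>G\<^esub>}"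
        using x0 \<psi>[OF inv_closed[OF x0] x0] by (auto simp: \<psi>)
    qed (use x0 in \<open>auto simp flip: m_assoc\<close>)
  qed
  have "(\<Sum>x \<in> carrier G. f (\<psi> x)) = (\<Sum>s \<in> \<psi> ` carrier G. \<Sum>x \<in> {x \<in> carrier G. \<psi> x = s}. f (\<psi> x))"
    by (rule sum.image_gen[OF assms(2)])
  also have "\<dots> = (\<Sum>s \<in> \<psi> ` carrier G. real (card {x \<in> carrier G. \<psi> x = \<psi> \<one>\<^bsub>G\<^esub>}) * f s)"
  proof (rule sum.cong[OF refl])
    fix s assume "s \<in> \<psi> ` carrier G"
    then obtain x0 where x0: "x0 \<in> carrier G" "s = \<psi> x0" by blast
    have "(\<Sum>x \<in> {x \<in> carrier G. \<psi> x = s}. f (\<psi> x)) = (\<Sum>x \<in> {x \<in> carrier G. \<psi> x = s}. f s)"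
      by (rule sum.cong) auto
    also have "\<dots> = real (card {x \<in> carrier G. \<psi> x = s}) * f s" by (rule sum_constant)
    finally show "(\<Sum>x \<in> {x \<in> carrier G. \<psi> x = s}. f (\<psi> x)) =
        real (card {x \<in> carrier G. \<psi> x = \<psi> \<one>\<^bsub>G\<^esub>}) * f s"
      by (simp only: x0(2) card_fiber[OF x0(1)])
  qed
  finally show ?thesis by (simp add: sum_distrib_left)
qed

lemma (in mat_group) sum_subgroup_over_fibers:
  assumes R: "subgroup R G" and \<psi>: "\<And>x y. x \<in> R \<Longrightarrow> y \<in> R \<Longrightarrow> \<psi> (x * y) = m (\<psi> x) (\<psi> y)"
  shows "(\<Sum>x \<in> R. f (\<psi> x)) = real (card {x \<in> R. \<psi> x = \<psi> (1\<^sub>m N)}) * (\<Sum>s \<in> \<psi> ` R. f s)"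
  using sum_over_fibers[OF subgroup.subgroup_is_group[OF R is_group], of \<psi> m f]
    finite_subset[OF subgroup.subset[OF R] finite_G] \<psi> by auto

text \<open>The finer parabolic subgroup is the preimage of a parabolic subgroup under the
  projection of the coarser one to its first diagonal block; both projections have the same
  kernel.\<close>

lemma card_parabolic3:
  fixes ty :: "'k::{field,finite} itself"
  shows "card (parabolic (GL (k1 + k2 + k3) :: 'k mat monoid) [k1, k2, k3]) * card (carrier (GL (k1 + k2) :: 'k mat monoid)) =
    card (parabolic (GL (k1 + k2 + k3) :: 'k mat monoid) [k1 + k2, k3]) * card (parabolic (GL (k1 + k2) :: 'k mat monoid) [k1, k2])"
proof -
  let ?k = "k1 + k2" let ?n = "k1 + k2 + k3"
  interpret mat_group ?n "GL ?n :: 'k mat monoid" "gl ?n" by (rule mat_group_GL)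
  let ?P2 = "{g \<in> carrier (GL ?n :: 'k mat monoid). upper (block_of [?k, k3]) g}"
  let ?P3 = "{g \<in> carrier (GL ?n :: 'k mat monoid). upper (block_of [k1, k2, k3]) g}"
  let ?P1 = "{g \<in> carrier (GL ?k :: 'k mat monoid). upper (block_of [k1, k2]) g}"
  let ?d = "diag_part 0 ?k :: 'k mat \<Rightarrow> 'k mat"
  have P3: "?P3 = {g \<in> ?P2. upper (block_of [k1, k2]) (?d g)}"
    using upper_block3_iff GL_carrier by blast
  have mult: "?d (x * y) = ?d x * ?d y" if "x \<in> ?P2" "y \<in> ?P2" for x y
    using that by (intro diag_part_mult[of _ ?n "block_of [?k, k3]" _ 0]) (auto dest: GL_carrier)
  have im2: "?d ` ?P2 = carrier (GL ?k)"
  proof (intro equalityI subsetI)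
    fix g assume g: "g \<in> ?d ` ?P2"
    then show "g \<in> carrier (GL ?k)"
      by (auto intro!: diag_part_GL[OF _ _ block_levels2(1)])
  next
    fix g :: "'k mat" assume g: "g \<in> carrier (GL ?k)"
    show "g \<in> ?d ` ?P2"
      using diag2_GL[OF g one_GL[of k3]] upper_diag2[OF GL_carrier[OF g] one_carrier_mat[of k3]]
        diag_part_diag2(1)[OF GL_carrier[OF g] one_carrier_mat[of k3]]
      by (intro image_eqI[of _ _ "diag2 g (1\<^sub>m k3)"]) auto
  qed
  have "?d ` {g \<in> S. Q (?d g)} = {g \<in> ?d ` S. Q g}" for S Q by auto
  from this[of ?P2] have im3: "?d ` ?P3 = ?P1" unfolding P3 im2 .
  have one: "?d (1\<^sub>m ?n) = 1\<^sub>m ?k" by (rule diag_part_one) simp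
  have ker: "{x \<in> ?P3. ?d x = ?d (1\<^sub>m ?n)} = {x \<in> ?P2. ?d x = ?d (1\<^sub>m ?n)}"
    unfolding P3 one by auto
  have "card ?P2 = card {x \<in> ?P2. ?d x = ?d (1\<^sub>m ?n)} * card (carrier (GL ?k :: 'k mat monoid))"
    using sum_subgroup_over_fibers[where R = ?P2 and \<psi> = ?d and m = "(*)" and f = "\<lambda>_. 1", OF subgroup_upper mult]
    unfolding im2 by (simp flip: of_nat_mult)
  moreover have "card ?P3 = card {x \<in> ?P2. ?d x = ?d (1\<^sub>m ?n)} * card ?P1"
    using sum_subgroup_over_fibers[where R = ?P3 and \<psi> = ?d and m = "(*)" and f = "\<lambda>_. 1", OF subgroup_upper mult]
    unfolding im3 ker using P3 by (simp flip: of_nat_mult)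
  ultimately show ?thesis by (simp add: parabolic_def block_upper_eq)
qed

lemma card_parabolic_pos: "card (parabolic (GL n :: 'k::{field,finite} mat monoid) ns) > 0"
proof -
  have "1\<^sub>m n \<in> parabolic (GL n :: 'k mat monoid) ns" by (simp add: parabolic_def block_upper_eq one_GL)
  moreover have "finite (parabolic (GL n :: 'k mat monoid) ns)" by (simp add: parabolic_def)
  ultimately show ?thesis by (auto simp: card_gt_0_iff)
qed

text \<open>The inner sum over the smaller group is absorbed into the outer one: \<open>g\<close> is
  embedded as \<open>diag(g, 1)\<close> and the outer summation variable is translated by it. The
  constants match by \<open>card_parabolic3\<close>.\<close>

lemma induced_trans:
  fixes X :: "'k::{field,finite} mat"
  assumes X: "X \<in> carrier_mat (k1 + k2 + k3) (k1 + k2 + k3)"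
  shows "induced (k1 + k2 + k3) [k1 + k2, k3]
      (\<lambda>Y. induced (k1 + k2) [k1, k2] (\<lambda>Z. \<Theta> Z (diag_part (k1 + k2) k3 Y)) (diag_part 0 (k1 + k2) Y)) X =
    induced (k1 + k2 + k3) [k1, k2, k3] (\<lambda>Y. \<Theta> (diag_part 0 (k1 + k2) Y) (diag_part (k1 + k2) k3 Y)) X"
proof -
  let ?k = "k1 + k2" let ?n = "k1 + k2 + k3"
  interpret mat_group ?n "GL ?n :: 'k mat monoid" "gl ?n" by (rule mat_group_GL)
  let ?e = "\<lambda>g :: 'k mat. diag2 g (1\<^sub>m k3)"
  let ?c1 = "real (card (parabolic (GL ?k :: 'k mat monoid) [k1, k2]))"
  let ?c2 = "real (card (parabolic (GL ?n :: 'k mat monoid) [?k, k3]))"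
  define H where "H Y = (if upper (block_of [k1, k2, k3]) Y
    then \<Theta> (diag_part 0 ?k Y) (diag_part ?k k3 Y) else 0)" for Y
  have e: "?e g \<in> carrier (GL ?n)" "upper (block_of [?k, k3]) (?e g)" "diag_part 0 ?k (?e g) = g"
    "diag_part ?k k3 (?e g) = 1\<^sub>m k3" if "g \<in> carrier (GL ?k)" for g
    using diag2_GL[OF that one_GL[of k3]] upper_diag2[OF GL_carrier[OF that] one_carrier_mat[of k3]]
      diag_part_diag2[OF GL_carrier[OF that] one_carrier_mat[of k3]] by auto
  have inner: "(if upper (block_of [?k, k3]) Y then
      induced ?k [k1, k2] (\<lambda>Z. \<Theta> Z (diag_part ?k k3 Y)) (diag_part 0 ?k Y) else 0) =
      (\<Sum>g \<in> carrier (GL ?k). H (conj_by (?e g) Y)) / ?c1" if Y: "Y \<in> carrier_mat ?n ?n" for Y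
  proof (cases "upper (block_of [?k, k3]) Y")
    case True
    have "diag_part 0 ?k (conj_by (?e g) Y) = conj_by g (diag_part 0 ?k Y)"
      "diag_part ?k k3 (conj_by (?e g) Y) = diag_part ?k k3 Y" if g: "g \<in> carrier (GL ?k)" for g
      using diag_part_conj[OF e(1,2)[OF g] block_levels2(1) _ Y True] diag_part_conj[OF e(1,2)[OF g] block_levels2(2) _ Y True]
        e[OF g] conj_by_one[of "diag_part ?k k3 Y" k3] by simp_all
    then show ?thesis
      using True Y e
      by (auto simp: induced_def H_def upper_block3_iff conj_by_carrier upper_conj_iff intro!: sum.cong)
  next
    case False
    then have "H (conj_by (?e g) Y) = 0" if "g \<in> carrier (GL ?k)" for g
      using e[OF that] Y by (simp add: H_def upper_block3_iff conj_by_carrier upper_conj_iff)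
    then show ?thesis using False by simp
  qed
  have "induced ?n [?k, k3]
      (\<lambda>Y. induced ?k [k1, k2] (\<lambda>Z. \<Theta> Z (diag_part ?k k3 Y)) (diag_part 0 ?k Y)) X =
      (\<Sum>g \<in> carrier (GL ?n). (\<Sum>h \<in> carrier (GL ?k). H (conj_by (?e h) (conj_by g X))) / ?c1) / ?c2"
    unfolding induced_def[of ?n] by (simp add: inner conj_by_carrier X cong: sum.cong)
  also have "\<dots> = (\<Sum>g \<in> carrier (GL ?n). \<Sum>h \<in> carrier (GL ?k). H (conj_by (?e h) (conj_by g X))) / (?c1 * ?c2)"
    by (simp flip: sum_divide_distrib)
  also have "\<dots> = (\<Sum>h \<in> carrier (GL ?k :: 'k mat monoid). \<Sum>g \<in> carrier (GL ?n). H (conj_by g X)) / (?c1 * ?c2)"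
    by (subst sum.swap) (simp add: sum_conj_right[OF e(1) X] cong: sum.cong)
  also have "\<dots> = (\<Sum>g \<in> carrier (GL ?n). H (conj_by g X)) * (real (card (carrier (GL ?k :: 'k mat monoid))) / (?c1 * ?c2))"
    by simp
  also have "real (card (carrier (GL ?k :: 'k mat monoid))) / (?c1 * ?c2) =
      1 / real (card (parabolic (GL ?n :: 'k mat monoid) [k1, k2, k3]))"
  proof -
    have "real (card (parabolic (GL ?n :: 'k mat monoid) [k1, k2, k3])) * real (card (carrier (GL ?k :: 'k mat monoid))) = ?c2 * ?c1"
      using card_parabolic3[where 'k = 'k, of k1 k2 k3] by (simp flip: of_nat_mult)
    then show ?thesis
      using card_parabolic_pos[where 'k = 'k] by (simp add: field_simps)
  qed
  finally show ?thesis by (simp add: induced_def H_def)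
qed

section \<open>Commutativity of the product\<close>

lemma flip_id_flip_id: "X \<in> carrier_mat n n \<Longrightarrow> flip (\<lambda>x. x) (flip (\<lambda>x. x) X) = X"
  by (rule flip_flip) auto

text \<open>By \<open>rev\<close>, reading the coordinates backwards turns the levels of
  \<open>ns\<close> into those of \<open>ns'\<close> in reverse order. So the flip exchanges the two
  block shapes, and \<open>sum_conj_flip\<close> leaves the sum unchanged.\<close>

lemma induced_flip:
  fixes X :: "'k::{field,finite} mat"
  assumes X: "X \<in> carrier_mat n n"
    and rev: "\<And>r s. r < n \<Longrightarrow> s < n \<Longrightarrow>
      block_of ns s < block_of ns r \<longleftrightarrow> block_of ns' (n - Suc r) < block_of ns' (n - Suc s)"
  shows "induced n ns \<Theta> X = induced n ns' (\<lambda>Y. \<Theta> (flip (\<lambda>x. x) Y)) X"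
proof -
  have rev': "block_of ns' s < block_of ns' r \<longleftrightarrow> block_of ns (n - Suc r) < block_of ns (n - Suc s)"
    if "r < n" "s < n" for r s
    using rev[of "n - Suc s" "n - Suc r"] that by simp
  have up: "upper (block_of ns) (flip (\<lambda>x. x) Y) \<longleftrightarrow> upper (block_of ns') Y" if "Y \<in> carrier_mat n n" for Y :: "'k mat"
  proof
    assume "upper (block_of ns) (flip (\<lambda>x. x) Y)"
    then have "upper (block_of ns') (flip (\<lambda>x. x) (flip (\<lambda>x. x) Y))"
      by (rule upper_flip[OF flip_carrier[OF that]]) (simp_all add: rev')
    then show "upper (block_of ns') Y" by (simp add: flip_id_flip_id[OF that])
  next
    assume "upper (block_of ns') Y"
    then show "upper (block_of ns) (flip (\<lambda>x. x) Y)"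
      by (rule upper_flip[OF that]) (simp_all add: rev)
  qed
  have up': "upper (block_of ns') (flip (\<lambda>x. x) Y) \<longleftrightarrow> upper (block_of ns) Y" if "Y \<in> carrier_mat n n" for Y :: "'k mat"
    using up[OF flip_carrier[OF that, of "\<lambda>x. x"]] flip_id_flip_id[OF that] by simp
  have "bij_betw (flip (\<lambda>x. x)) (parabolic (GL n :: 'k mat monoid) ns') (parabolic (GL n) ns)"
    by (rule bij_betwI[where g = "flip (\<lambda>x. x)"])
      (auto simp: parabolic_def block_upper_eq up[OF GL_carrier] up'[OF GL_carrier]
        flip_GL[OF field_hom_id] flip_id_flip_id[OF GL_carrier])
  from bij_betw_same_card[OF this] show ?thesis
    unfolding induced_def
    using sum_conj_flip[OF X, of "\<lambda>Y. if upper (block_of ns) Y then \<Theta> Y else 0"]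
    by (simp add: up conj_by_carrier[OF _ X] cong: sum.cong if_cong)
qed

text \<open>The flip exchanges the two diagonal blocks and replaces each by its own flip, to which
  it is similar.\<close>

lemma nabla_commute:
  fixes F :: "'k::{field,finite} mat \<Rightarrow> 'k mat \<Rightarrow> real"
  assumes inv: "\<And>Y. gl_invariant (\<lambda>X. F X Y)" "\<And>X. gl_invariant (F X)"
  shows "nabla (\<lambda>(A, B). F A B) = nabla (\<lambda>(A, B). F B A)"
proof
  fix X :: "'k mat"
  show "nabla (\<lambda>(A, B). F A B) X = nabla (\<lambda>(A, B). F B A) X"
  proof (cases "X \<in> carrier_mat (dim_row X) (dim_row X)")
    case True
    define n where "n = dim_row X"
    have X: "X \<in> carrier_mat n n" unfolding n_def by (rule True)
    have ind: "induced n [i, j] (\<lambda>Y. F (diag_part 0 i Y) (diag_part i j Y)) X =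
        induced n [j, i] (\<lambda>Y. F (diag_part j i Y) (diag_part 0 j Y)) X" if n: "n = i + j" for i j
    proof -
      have "induced n [i, j] (\<lambda>Y. F (diag_part 0 i Y) (diag_part i j Y)) X =
        induced n [j, i] (\<lambda>Y. F (diag_part 0 i (flip (\<lambda>x. x) Y)) (diag_part i j (flip (\<lambda>x. x) Y))) X"
        using n by (intro induced_flip[OF X]) auto
      also have "\<dots> = induced n [j, i] (\<lambda>Y. F (diag_part j i Y) (diag_part 0 j Y)) X"
        using n by (intro induced_cong[OF _ X])
          (simp add: diag_part_flip[where k = 0 and k' = j and n = n] diag_part_flip[where k = i and k' = 0 and n = n]
            gl_invariant_flip[OF inv(1) diag_part_carrier] gl_invariant_flip[OF inv(2) diag_part_carrier])
      finally show ?thesis .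
    qed
    have "(\<Sum>(i, j) \<in> {(i, j). i + j = n}. induced n [i, j] (\<lambda>Y. F (diag_part 0 i Y) (diag_part i j Y)) X) =
       (\<Sum>(i, j) \<in> {(i, j). i + j = n}. induced n [i, j] (\<lambda>Y. F (diag_part i j Y) (diag_part 0 i Y)) X)"
      by (rule sum.reindex_bij_witness[of _ prod.swap prod.swap]) (use ind in auto)
    then show ?thesis
      by (simp only: nabla_eq[OF inv X] nabla_eq[of "\<lambda>A B. F B A", OF inv(2,1) X])
  qed (simp only: nabla_outside not_False_eq_True)
qed


definition nabla3 :: "('k::{field,finite} mat \<Rightarrow> 'k mat \<Rightarrow> 'k mat \<Rightarrow> real) \<Rightarrow> 'k mat \<Rightarrow> real" where
  "nabla3 F = nabla (\<lambda>(Y, C). nabla (\<lambda>(A, B). F A B C) Y)"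

lemma nabla3_eq:
  fixes F :: "'k::{field,finite} mat \<Rightarrow> 'k mat \<Rightarrow> 'k mat \<Rightarrow> real"
  assumes inv: "\<And>B C. gl_invariant (\<lambda>A. F A B C)" "\<And>A C. gl_invariant (\<lambda>B. F A B C)" "\<And>A B. gl_invariant (F A B)"
    and X: "X \<in> carrier_mat n n"
  shows "nabla3 F X = (\<Sum>(k, k3) \<in> {(k, k3). k + k3 = n}. \<Sum>(k1, k2) \<in> {(k1, k2). k1 + k2 = k}.
    induced n [k1, k2, k3] (\<lambda>Y. F (diag_part 0 k1 Y) (diag_part k1 k2 Y) (diag_part k k3 Y)) X)"
proof -
  have inv2: "gl_invariant (\<lambda>Y. nabla (\<lambda>(A, B). F A B C) Y)" for C
    using gl_invariant_nabla[of "\<lambda>A B. F A B C", OF inv(1,2)] .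
  have inv3: "gl_invariant (\<lambda>C. nabla (\<lambda>(A, B). F A B C) Y)" for Y
  proof (cases "Y \<in> carrier_mat (dim_row Y) (dim_row Y)")
    case True
    show ?thesis unfolding gl_invariant_def
      by (auto simp only: nabla_eq[OF inv(1,2) True] gl_invariantD[OF inv(3)])
  qed (simp add: gl_invariant_def nabla_outside)
  have "induced n [k, k3] (\<lambda>Y. nabla (\<lambda>(A, B). F A B (diag_part k k3 Y)) (diag_part 0 k Y)) X =
    (\<Sum>(k1, k2) \<in> {(k1, k2). k1 + k2 = k}.
      induced n [k1, k2, k3] (\<lambda>Y. F (diag_part 0 k1 Y) (diag_part k1 k2 Y) (diag_part k k3 Y)) X)"
    if n: "k + k3 = n" for k k3
  proof -
    have "induced n [k, k3] (\<lambda>Y. nabla (\<lambda>(A, B). F A B (diag_part k k3 Y)) (diag_part 0 k Y)) X =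
      induced n [k, k3] (\<lambda>Y. \<Sum>(k1, k2) \<in> {(k1, k2). k1 + k2 = k}.
        induced k [k1, k2] (\<lambda>Z. F (diag_part 0 k1 Z) (diag_part k1 k2 Z) (diag_part k k3 Y)) (diag_part 0 k Y)) X"
      by (intro induced_cong[OF _ X] nabla_eq[OF inv(1,2) diag_part_carrier])
    also have "\<dots> = (\<Sum>(k1, k2) \<in> {(k1, k2). k1 + k2 = k}. induced n [k, k3] (\<lambda>Y.
        induced k [k1, k2] (\<lambda>Z. F (diag_part 0 k1 Z) (diag_part k1 k2 Z) (diag_part k k3 Y)) (diag_part 0 k Y)) X)"
      unfolding induced_def[of n] case_prod_unfold sum_divide_distrib[symmetric]
      by (subst sum.swap) (auto intro!: sum.cong arg_cong2[of _ _ _ _ "(/)"])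
    also have "\<dots> = (\<Sum>(k1, k2) \<in> {(k1, k2). k1 + k2 = k}.
      induced n [k1, k2, k3] (\<lambda>Y. F (diag_part 0 k1 Y) (diag_part k1 k2 Y) (diag_part k k3 Y)) X)"
    proof (rule sum.cong[OF refl], clarify)
      fix k1 k2 assume k: "k = k1 + k2"
      have Xc: "X \<in> carrier_mat (k1 + k2 + k3) (k1 + k2 + k3)" using X n k by simp
      have "induced n [k, k3] (\<lambda>Y. induced k [k1, k2]
          (\<lambda>Z. F (diag_part 0 k1 Z) (diag_part k1 k2 Z) (diag_part k k3 Y)) (diag_part 0 k Y)) X =
        induced n [k1, k2, k3] (\<lambda>Y. F (diag_part 0 k1 (diag_part 0 k Y)) (diag_part k1 k2 (diag_part 0 k Y)) (diag_part k k3 Y)) X"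
        using induced_trans[OF Xc, of "\<lambda>Z D. F (diag_part 0 k1 Z) (diag_part k1 k2 Z) D"] n k by simp
      then show "induced n [k1 + k2, k3] (\<lambda>Y. induced (k1 + k2) [k1, k2]
          (\<lambda>Z. F (diag_part 0 k1 Z) (diag_part k1 k2 Z) (diag_part (k1 + k2) k3 Y)) (diag_part 0 (k1 + k2) Y)) X =
        induced n [k1, k2, k3] (\<lambda>Y. F (diag_part 0 k1 Y) (diag_part k1 k2 Y) (diag_part (k1 + k2) k3 Y)) X"
        by (simp add: k diag_part_diag_part)
    qed
    finally show ?thesis .
  qed
  then show ?thesis
    unfolding nabla3_def nabla_eq[of "\<lambda>Y C. nabla (\<lambda>(A, B). F A B C) Y", OF inv2 inv3 X]
    by (intro sum.cong) auto
qed

lemma block_of_rev3: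
  assumes "r < a + b + c"
  shows "block_of [c, b, a] (a + b + c - Suc r) = 2 - block_of [a, b, c] r" "block_of [a, b, c] r \<le> 2"
proof -
  consider "r < a" | "a \<le> r" "r < a + b" | "a + b \<le> r" "r < a + b + c" using assms by linarith
  then show "block_of [c, b, a] (a + b + c - Suc r) = 2 - block_of [a, b, c] r" by cases auto
qed (use assms in auto)

lemma block_of_rev3_less:
  assumes "r < a + b + c" "s < a + b + c"
  shows "block_of [a, b, c] s < block_of [a, b, c] r \<longleftrightarrow>
    block_of [c, b, a] (a + b + c - Suc r) < block_of [c, b, a] (a + b + c - Suc s)"
  unfolding block_of_rev3(1)[OF assms(1)] block_of_rev3(1)[OF assms(2)]
  using block_of_rev3(2)[OF assms(1)] block_of_rev3(2)[OF assms(2)] by linarith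

lemma nabla3_reverse:
  fixes F :: "'k::{field,finite} mat \<Rightarrow> 'k mat \<Rightarrow> 'k mat \<Rightarrow> real"
  assumes inv: "\<And>B C. gl_invariant (\<lambda>A. F A B C)" "\<And>A C. gl_invariant (\<lambda>B. F A B C)" "\<And>A B. gl_invariant (F A B)"
    and X: "X \<in> carrier_mat n n"
  shows "nabla3 F X = nabla3 (\<lambda>A B C. F C B A) X"
proof -
  have ind: "induced n [k1, k2, k3] (\<lambda>Y. F (diag_part 0 k1 Y) (diag_part k1 k2 Y) (diag_part (k1 + k2) k3 Y)) X =
      induced n [k3, k2, k1] (\<lambda>Y. F (diag_part (k3 + k2) k1 Y) (diag_part k3 k2 Y) (diag_part 0 k3 Y)) X"
    if n: "n = k1 + k2 + k3" for k1 k2 k3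
  proof -
    have "induced n [k1, k2, k3] (\<lambda>Y. F (diag_part 0 k1 Y) (diag_part k1 k2 Y) (diag_part (k1 + k2) k3 Y)) X =
      induced n [k3, k2, k1] (\<lambda>Y. F (diag_part 0 k1 (flip (\<lambda>x. x) Y)) (diag_part k1 k2 (flip (\<lambda>x. x) Y))
        (diag_part (k1 + k2) k3 (flip (\<lambda>x. x) Y))) X"
      by (rule induced_flip[OF X]) (unfold n, rule block_of_rev3_less)
    also have "\<dots> = induced n [k3, k2, k1] (\<lambda>Y. F (diag_part (k3 + k2) k1 Y) (diag_part k3 k2 Y) (diag_part 0 k3 Y)) X"
      using n by (intro induced_cong[OF _ X])
        (simp add: diag_part_flip[where k = 0 and k' = "k3 + k2" and n = n] diag_part_flip[where k = k1 and k' = k3 and n = n]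
          diag_part_flip[where k = "k1 + k2" and k' = 0 and n = n]
          gl_invariant_flip[OF inv(1) diag_part_carrier] gl_invariant_flip[OF inv(2) diag_part_carrier]
          gl_invariant_flip[OF inv(3) diag_part_carrier])
    finally show ?thesis .
  qed
  have triples: "(\<Sum>(k, k3) \<in> {(k, k3). k + k3 = n}. \<Sum>(k1, k2) \<in> {(k1, k2). k1 + k2 = k}. h k k1 k2 k3) =
      (\<Sum>(k1, k2, k3) \<in> {(k1, k2, k3). k1 + k2 + k3 = n}. h (k1 + k2) k1 k2 k3 :: real)" for h
  proof -
    have fin: "finite {(k :: nat, k3). k + k3 = m}" for m
      by (rule finite_subset[of _ "{..m} \<times> {..m}"]) auto
    have "(\<Sum>(k, k3) \<in> {(k, k3). k + k3 = n}. \<Sum>(k1, k2) \<in> {(k1, k2). k1 + k2 = k}. h k k1 k2 k3) =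
      (\<Sum>(x, y) \<in> (SIGMA x : {(k, k3). k + k3 = n}. {(k1, k2). k1 + k2 = fst x}). h (fst x) (fst y) (snd y) (snd x))"
      by (subst sum.Sigma[symmetric]) (auto simp: fin fin[unfolded case_prod_unfold] case_prod_unfold)
    also have "\<dots> = (\<Sum>(k1, k2, k3) \<in> {(k1, k2, k3). k1 + k2 + k3 = n}. h (k1 + k2) k1 k2 k3)"
      by (rule sum.reindex_bij_witness[where i = "\<lambda>(k1, k2, k3). ((k1 + k2, k3), (k1, k2))"
            and j = "\<lambda>((k, k3), (k1, k2)). (k1, k2, k3)"]) auto
    finally show ?thesis .
  qed
  show ?thesis
    unfolding nabla3_eq[OF inv X] nabla3_eq[of "\<lambda>A B C. F C B A", OF inv(3,2,1) X] triples
    by (rule sum.reindex_bij_witness[where i = "\<lambda>(k1, k2, k3). (k3, k2, k1)" and j = "\<lambda>(k1, k2, k3). (k3, k2, k1)"])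
      (use ind in \<open>auto simp: add_ac\<close>)
qed

text \<open>The exchange of the last two factors is the exchange of the first two conjugated by
  reversal. The exchange of the first two is commutativity of the inner product, and reversal is one
  flip of the three-block induction, so no regrouping is required.\<close>

lemma nabla3_swap_last:
  fixes F :: "'k::{field,finite} mat \<Rightarrow> 'k mat \<Rightarrow> 'k mat \<Rightarrow> real"
  assumes inv: "\<And>B C. gl_invariant (\<lambda>A. F A B C)" "\<And>A C. gl_invariant (\<lambda>B. F A B C)" "\<And>A B. gl_invariant (F A B)"
    and X: "X \<in> carrier_mat n n"
  shows "nabla3 F X = nabla3 (\<lambda>A B C. F A C B) X"
proof -
  have swap: "nabla3 G = nabla3 (\<lambda>A B C. G B A C)"
    if "\<And>B C. gl_invariant (\<lambda>A. G A B C)" "\<And>A C. gl_invariant (\<lambda>B. G A B C)" for G :: "'k mat \<Rightarrow> 'k mat \<Rightarrow> 'k mat \<Rightarrow> real"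
    unfolding nabla3_def
    by (rule arg_cong[where f = nabla], rule ext, clarify, rule fun_cong[OF nabla_commute]) (rule that)+
  have "nabla3 F X = nabla3 (\<lambda>A B C. F B A C) X" by (rule fun_cong[OF swap[OF inv(1,2)]])
  also have "\<dots> = nabla3 (\<lambda>A B C. F B C A) X" by (rule nabla3_reverse[OF inv(2,1,3) X])
  also have "\<dots> = nabla3 (\<lambda>A B C. F A C B) X" by (rule fun_cong[OF swap[OF inv(3,1)]])
  finally show ?thesis .
qed

section \<open>Restriction as an average over a fibre\<close>

definition avg :: "('a \<Rightarrow> real) \<Rightarrow> 'a set \<Rightarrow> real" where
  "avg f S = (\<Sum>x\<in>S. f x) / real (card S)"

lemma avg_reindex:
  assumes "bij_betw \<phi> S T" "\<And>x. x \<in> S \<Longrightarrow> f (\<phi> x) = g x"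
  shows "avg f T = avg g S"
  unfolding avg_def bij_betw_same_card[OF assms(1), symmetric] sum.reindex_bij_betw[OF assms(1), symmetric]
  using assms(2) by (simp cong: sum.cong)

text \<open>For square blocks this is the translate of the nilradical by \<open>diag(A, B)\<close>.
  It is described by its blocks so that the effect of conjugations and flips can be read
  off.\<close>

definition gl_fiber2 :: "nat \<Rightarrow> nat \<Rightarrow> 'k::field mat \<Rightarrow> 'k mat \<Rightarrow> 'k mat set" where
  "gl_fiber2 i j A B = {X \<in> carrier_mat (i + j) (i + j).
     upper (block_of [i, j]) X \<and> diag_part 0 i X = A \<and> diag_part i j X = B}"

definition gl_fiber3 :: "nat \<Rightarrow> nat \<Rightarrow> nat \<Rightarrow> 'k::field mat \<Rightarrow> 'k mat \<Rightarrow> 'k mat \<Rightarrow> 'k mat set" where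
  "gl_fiber3 i j k A B C = {X \<in> carrier_mat (i + j + k) (i + j + k).
     upper (block_of [i, j, k]) X \<and> diag_part 0 i X = A \<and> diag_part i j X = B \<and> diag_part (i + j) k X = C}"

lemma finite_gl_fiber [simp]:
  "finite (gl_fiber2 i j (A :: 'k::{field,finite} mat) B)" "finite (gl_fiber3 i j k A B C)"
  by (auto simp: gl_fiber2_def gl_fiber3_def intro: finite_subset[OF _ finite_carrier_mat])

lemma diag_block_mat_pair:
  "A \<in> carrier_mat i i \<Longrightarrow> B \<in> carrier_mat j j \<Longrightarrow> diag_block_mat [A, B] = diag2 A B"
  by (rule eq_matI) (auto simp: Let_def diag2_def)

lemma bij_nilradical_gl_fiber2:
  fixes A :: "'k::field mat"
  assumes A: "A \<in> carrier_mat i i" and B: "B \<in> carrier_mat j j"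
  shows "bij_betw (\<lambda>Z. diag2 A B + Z) (nilradical (gl (i + j)) [i, j]) (gl_fiber2 i j A B)"
proof (rule bij_betwI[where g = "\<lambda>X. X - diag2 A B"])
  show "(\<lambda>Z. diag2 A B + Z) \<in> nilradical (gl (i + j)) [i, j] \<rightarrow> gl_fiber2 i j A B"
  proof
    fix Z :: "'k mat" assume "Z \<in> nilradical (gl (i + j)) [i, j]"
    then have Zc: "Z \<in> carrier_mat (i + j) (i + j)"
      and Z: "\<And>r s. r < i + j \<Longrightarrow> s < i + j \<Longrightarrow> block_of [i, j] s \<le> block_of [i, j] r \<Longrightarrow> Z $$ (r, s) = 0"
      by (auto simp: nilradical_def gl_def strictly_block_upper_def simp del: block_of.simps)
    have "upper (block_of [i, j]) (diag2 A B + Z)"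
      unfolding upper_def
    proof (intro allI impI)
      fix r s assume "r < dim_row (diag2 A B + Z)" "s < dim_col (diag2 A B + Z)"
        and lt: "block_of [i, j] s < block_of [i, j] r"
      then have rs: "r < i + j" "s < i + j" using Zc by auto
      then show "(diag2 A B + Z) $$ (r, s) = 0"
        using Zc Z[OF rs less_imp_le[OF lt]] lt by (auto simp: diag2_index[OF A B] split: if_splits)
    qed
    moreover have "diag_part 0 i (diag2 A B + Z) = A"
      using Zc Z A by (intro eq_matI) (auto simp: diag2_index[OF A B])
    moreover have "diag_part i j (diag2 A B + Z) = B"
      using Zc Z B by (intro eq_matI) (auto simp: diag2_index[OF A B])
    ultimately show "diag2 A B + Z \<in> gl_fiber2 i j A B"
      using Zc by (simp add: gl_fiber2_def del: block_of.simps)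
  qed
  show "(\<lambda>X. X - diag2 A B) \<in> gl_fiber2 i j A B \<rightarrow> nilradical (gl (i + j)) [i, j]"
  proof
    fix X :: "'k mat" assume X: "X \<in> gl_fiber2 i j A B"
    then have Xc: "X \<in> carrier_mat (i + j) (i + j)" and up: "upper (block_of [i, j]) X"
      and d: "diag_part 0 i X = A" "diag_part i j X = B" by (auto simp: gl_fiber2_def)
    have "(X - diag2 A B) $$ (r, s) = 0"
      if rs: "r < i + j" "s < i + j" "block_of [i, j] s \<le> block_of [i, j] r" for r s
    proof -
      consider "r < i" "s < i" | "i \<le> r" "s < i" | "i \<le> r" "i \<le> s"
        using rs by (auto split: if_splits)
      then show ?thesis
      proof cases
        case 1
        then show ?thesis using Xc A B that diag_part_index[of r i s 0 X] d by (simp add: diag2_index[OF A B])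
      next
        case 2
        then show ?thesis using Xc A B that up by (simp add: diag2_index[OF A B] upper_def)
      next
        case 3
        then show ?thesis
          using Xc A B that diag_part_index[of "r - i" j "s - i" i X] d by (simp add: diag2_index[OF A B])
      qed
    qed
    then show "X - diag2 A B \<in> nilradical (gl (i + j)) [i, j]"
      using A B by (auto simp: nilradical_def gl_def strictly_block_upper_def simp del: block_of.simps)
  qed
qed (use A B in \<open>auto simp: nilradical_def gl_def gl_fiber2_def intro!: eq_matI\<close>)

lemma card_gl_fiber2:
  "(A :: 'k::field mat) \<in> carrier_mat i i \<Longrightarrow> B \<in> carrier_mat j j \<Longrightarrow>
    card (gl_fiber2 i j A B) = card (nilradical (gl (i + j) :: 'k::field mat set) [i, j])"
  by (rule bij_betw_same_card[symmetric, OF bij_nilradical_gl_fiber2])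

lemma Delta_eq:
  assumes "A \<in> carrier_mat i i" "B \<in> carrier_mat j j"
  shows "Delta f (A, B) = avg f (gl_fiber2 i j A B)"
  using assms avg_reindex[OF bij_nilradical_gl_fiber2[OF assms] refl, of f]
  by (auto simp: Delta_def gl_def par_res_def avg_def diag_block_mat_pair Let_def simp del: diag_block_mat.simps)

lemma Delta_outside:
  "A \<notin> carrier_mat (dim_row A) (dim_row A) \<or> B \<notin> carrier_mat (dim_row B) (dim_row B) \<Longrightarrow> Delta f (A, B) = 0"
  by (auto simp only: Delta_def gl_def Let_def split: if_splits prod.splits)

text \<open>Conjugation by \<open>diag(g, h)\<close> carries one fibre into the other, and onto it
  because both have the size of the nilradical.\<close>

lemma Delta_conj:
  fixes f :: "'k::{field,finite} mat \<Rightarrow> real"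
  assumes f: "gl_invariant f" and g: "g \<in> carrier (GL i)" "h \<in> carrier (GL j)"
    and AB: "A \<in> carrier_mat i i" "B \<in> carrier_mat j j"
  shows "Delta f (conj_by g A, conj_by h B) = Delta f (A, B)"
proof -
  interpret mat_group "i + j" "GL (i + j) :: 'k mat monoid" "gl (i + j)" by (rule mat_group_GL)
  let ?e = "diag2 g h" and ?S = "gl_fiber2 i j A B" and ?T = "gl_fiber2 i j (conj_by g A) (conj_by h B)"
  note gc = GL_carrier[OF g(1)] GL_carrier[OF g(2)]
  note e = diag2_GL[OF g] upper_diag2[OF gc]
  note AB' = conj_by_carrier[OF g(1) AB(1)] conj_by_carrier[OF g(2) AB(2)]
  have into: "conj_by ?e ` ?S \<subseteq> ?T"
    using diag_part_conj[OF e block_levels2(1)] diag_part_conj[OF e block_levels2(2)] diag_part_diag2[OF gc]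
    by (auto simp: gl_fiber2_def conj_by_carrier[OF e(1)] upper_conj[OF e] simp del: block_of.simps)
  have "inj_on (conj_by ?e) ?S"
    by (rule inj_on_inverseI[where g = "conj_by (mat_inv ?e)"]) (auto simp: gl_fiber2_def conj_by_inv[OF e(1)])
  moreover have "conj_by ?e ` ?S = ?T"
    using into card_image[OF calculation] by (intro card_subset_eq) (simp_all add: card_gl_fiber2 AB AB')
  ultimately have "bij_betw (conj_by ?e) ?S ?T" by (simp add: bij_betw_def)
  from avg_reindex[OF this, of f f] show ?thesis
    unfolding Delta_eq[OF AB] Delta_eq[OF AB'] by (auto simp: gl_fiber2_def gl_invariantD[OF f e(1)])
qed

lemma gl_invariant_Delta:
  fixes f :: "'k::{field,finite} mat \<Rightarrow> real"
  assumes f: "gl_invariant f"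
  shows "gl_invariant (\<lambda>A. Delta f (A, B))" "gl_invariant (\<lambda>B. Delta f (A, B))"
proof -
  show "gl_invariant (\<lambda>A. Delta f (A, B))"
  proof (cases "B \<in> carrier_mat (dim_row B) (dim_row B)")
    case True
    show ?thesis
      unfolding gl_invariant_def using Delta_conj[OF f _ one_GL _ True] conj_by_one[OF True] by auto
  qed (simp add: Delta_outside gl_invariant_def)
  show "gl_invariant (\<lambda>B. Delta f (A, B))"
  proof (cases "A \<in> carrier_mat (dim_row A) (dim_row A)")
    case True
    show ?thesis
      unfolding gl_invariant_def using Delta_conj[OF f one_GL _ True] conj_by_one[OF True] by auto
  qed (simp add: Delta_outside gl_invariant_def)
qed

lemma flip_gl_fiber2:
  assumes "X \<in> gl_fiber2 i j A B"
  shows "flip (\<lambda>x. x) X \<in> gl_fiber2 j i (flip (\<lambda>x. x) B) (flip (\<lambda>x. x) A)"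
proof -
  have X: "X \<in> carrier_mat (i + j) (i + j)" "upper (block_of [i, j]) X" "diag_part 0 i X = A" "diag_part i j X = B"
    using assms by (auto simp: gl_fiber2_def)
  have "upper (block_of [j, i]) (flip (\<lambda>x. x) X)"
    by (rule upper_flip[OF X(1,2)]) (auto split: if_splits)
  then show ?thesis
    using X diag_part_flip[OF X(1), where k = 0 and m = j and k' = i and f = "\<lambda>x. x"]
      diag_part_flip[OF X(1), where k = j and m = i and k' = 0 and f = "\<lambda>x. x"]
    by (simp add: gl_fiber2_def add.commute[of j i])
qed

text \<open>The flip carries the fibre over \<open>(A, B)\<close> to the fibre over the flipped
  blocks in opposite order; invariance then removes the flips.\<close>

lemma Delta_commute:
  fixes f :: "'k::{field,finite} mat \<Rightarrow> real"
  assumes f: "gl_invariant f"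
  shows "Delta f (A, B) = Delta f (B, A)"
proof (cases "A \<in> carrier_mat (dim_row A) (dim_row A) \<and> B \<in> carrier_mat (dim_row B) (dim_row B)")
  case True
  define i j where "i = dim_row A" and "j = dim_row B"
  have AB: "A \<in> carrier_mat i i" "B \<in> carrier_mat j j" using True unfolding i_def j_def by auto
  let ?f = "flip (\<lambda>x :: 'k. x)"
  have "bij_betw ?f (gl_fiber2 i j A B) (gl_fiber2 j i (?f B) (?f A))"
    using flip_gl_fiber2[of _ i j A B] flip_gl_fiber2[of _ j i "?f B" "?f A"]
    unfolding flip_id_flip_id[OF AB(1)] flip_id_flip_id[OF AB(2)]
    by (intro bij_betwI[where g = ?f]) (auto simp: gl_fiber2_def flip_id_flip_id)
  from avg_reindex[OF this, of f f] have "Delta f (?f B, ?f A) = Delta f (A, B)"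
    unfolding Delta_eq[OF AB] Delta_eq[OF flip_carrier[OF AB(2)] flip_carrier[OF AB(1)]]
    using gl_invariant_flip[OF f] unfolding gl_fiber2_def by blast
  then show ?thesis
    using gl_invariant_flip[OF gl_invariant_Delta(1)[OF f] AB(2)] gl_invariant_flip[OF gl_invariant_Delta(2)[OF f] AB(1)]
    by simp
qed (use Delta_outside in metis)

definition Delta3 :: "('k::{field,finite} mat \<Rightarrow> real) \<Rightarrow> 'k mat \<Rightarrow> 'k mat \<Rightarrow> 'k mat \<Rightarrow> real" where
  "Delta3 f A B C = left_map Delta (Delta f) ((A, B), C)"

lemma Delta3_eq_Delta: "Delta3 f A B C = Delta (\<lambda>Y. Delta f (Y, C)) (A, B)"
  by (simp add: Delta3_def left_map_def)

lemma gl_invariant_Delta3: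
  assumes "gl_invariant f"
  shows "gl_invariant (\<lambda>A. Delta3 f A B C)" "gl_invariant (\<lambda>B. Delta3 f A B C)" "gl_invariant (Delta3 f A B)"
  unfolding Delta3_eq_Delta
    apply (rule gl_invariant_Delta[OF gl_invariant_Delta(1)[OF assms]])+
  using gl_invariantD[OF gl_invariant_Delta(2)[OF assms]] by (simp add: gl_invariant_def)

text \<open>The fibre over three blocks is a disjoint union of the fibres over \<open>Y\<close> and
  \<open>C\<close>, with \<open>Y\<close> running through the fibre over \<open>A\<close> and
  \<open>B\<close>. These have equal size, so an average of averages is the average over the
  union.\<close>

lemma Delta3_eq:
  fixes f :: "'k::{field,finite} mat \<Rightarrow> real"
  assumes "A \<in> carrier_mat i i" "B \<in> carrier_mat j j" "C \<in> carrier_mat k k"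
  shows "Delta3 f A B C = avg f (gl_fiber3 i j k A B C)"
proof -
  let ?S = "gl_fiber2 i j A B"
  have fib: "gl_fiber3 i j k A B C = (\<Union>Y \<in> ?S. gl_fiber2 (i + j) k Y C)"
    using upper_block3_iff[of _ i j k]
    by (auto simp: gl_fiber3_def gl_fiber2_def diag_part_diag_part simp del: block_of.simps)
  have disj: "gl_fiber2 (i + j) k Y C \<inter> gl_fiber2 (i + j) k Y' C = {}" if "Y \<noteq> Y'" for Y Y'
    using that by (auto simp: gl_fiber2_def)
  have Yc: "Y \<in> carrier_mat (i + j) (i + j)" if "Y \<in> ?S" for Y using that by (simp add: gl_fiber2_def)
  let ?N = "card (nilradical (gl (i + j + k) :: 'k mat set) [i + j, k])"
  have "card (gl_fiber3 i j k A B C) = (\<Sum>Y\<in>?S. card (gl_fiber2 (i + j) k Y C))"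
    unfolding fib by (rule card_UN_disjoint) (auto simp: disj)
  also have "\<dots> = card ?S * ?N" using card_gl_fiber2[OF Yc assms(3)] by simp
  finally have card3: "card (gl_fiber3 i j k A B C) = card ?S * ?N" .
  have "(\<Sum>X \<in> gl_fiber3 i j k A B C. f X) = (\<Sum>Y\<in>?S. \<Sum>X \<in> gl_fiber2 (i + j) k Y C. f X)"
    unfolding fib by (rule sum.UNION_disjoint) (auto simp: disj)
  also have "\<dots> = (\<Sum>Y\<in>?S. Delta f (Y, C) * real ?N)"
  proof (rule sum.cong[OF refl])
    fix Y assume Y: "Y \<in> ?S"
    have "?N > 0" unfolding card_gt_0_iff
      by (auto simp: nilradical_def gl_def strictly_block_upper_def intro!: exI[of _ "0\<^sub>m (i + j + k) (i + j + k)"]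
        intro: finite_subset[OF _ finite_carrier_mat])
    then show "(\<Sum>X \<in> gl_fiber2 (i + j) k Y C. f X) = Delta f (Y, C) * real ?N"
      using card_gl_fiber2[OF Yc[OF Y] assms(3)] by (simp add: Delta_eq[OF Yc[OF Y] assms(3)] avg_def)
  qed
  finally have "(\<Sum>X \<in> gl_fiber3 i j k A B C. f X) = (\<Sum>Y\<in>?S. Delta f (Y, C)) * real ?N"
    by (simp add: sum_distrib_right)
  moreover have "?N > 0" unfolding card_gt_0_iff
    by (auto simp: nilradical_def gl_def strictly_block_upper_def intro!: exI[of _ "0\<^sub>m (i + j + k) (i + j + k)"]
      intro: finite_subset[OF _ finite_carrier_mat])
  ultimately show ?thesis
    unfolding Delta3_eq_Delta Delta_eq[OF assms(1,2)] avg_def card3 by simp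
qed

lemma flip_gl_fiber3:
  assumes "X \<in> gl_fiber3 i j k A B C"
  shows "flip (\<lambda>x. x) X \<in> gl_fiber3 k j i (flip (\<lambda>x. x) C) (flip (\<lambda>x. x) B) (flip (\<lambda>x. x) A)"
proof -
  have X: "X \<in> carrier_mat (i + j + k) (i + j + k)" "upper (block_of [i, j, k]) X" "diag_part 0 i X = A"
    "diag_part i j X = B" "diag_part (i + j) k X = C"
    using assms by (auto simp: gl_fiber3_def)
  have "upper (block_of [k, j, i]) (flip (\<lambda>x. x) X)"
    using block_of_rev3_less[of _ k j i] by (intro upper_flip[OF X(1,2)]) (simp_all add: ac_simps del: block_of.simps)
  then show ?thesis
    using X diag_part_flip[OF X(1), where k = 0 and m = k and k' = "i + j" and f = "\<lambda>x. x"]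
      diag_part_flip[OF X(1), where k = k and m = j and k' = i and f = "\<lambda>x. x"]
      diag_part_flip[OF X(1), where k = "k + j" and m = i and k' = 0 and f = "\<lambda>x. x"]
    by (simp add: gl_fiber3_def ac_simps del: block_of.simps)
qed

lemma Delta3_outside:
  "\<not> (A \<in> carrier_mat (dim_row A) (dim_row A) \<and> B \<in> carrier_mat (dim_row B) (dim_row B) \<and>
    C \<in> carrier_mat (dim_row C) (dim_row C)) \<Longrightarrow> Delta3 f A B C = 0"
proof (cases "C \<in> carrier_mat (dim_row C) (dim_row C)")
  case False
  then have "(\<lambda>Y. Delta f (Y, C)) = (\<lambda>_. 0)" using Delta_outside by blast
  then show ?thesis unfolding Delta3_eq_Delta by (simp only: lin_zero[OF lin_Delta])
qed (use Delta_outside Delta3_eq_Delta in metis)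

lemma Delta3_reverse:
  fixes f :: "'k::{field,finite} mat \<Rightarrow> real"
  assumes f: "gl_invariant f"
  shows "Delta3 f A B C = Delta3 f C B A"
proof (cases "A \<in> carrier_mat (dim_row A) (dim_row A) \<and> B \<in> carrier_mat (dim_row B) (dim_row B) \<and>
    C \<in> carrier_mat (dim_row C) (dim_row C)")
  case True
  define i j k where "i = dim_row A" and "j = dim_row B" and "k = dim_row C"
  have c: "A \<in> carrier_mat i i" "B \<in> carrier_mat j j" "C \<in> carrier_mat k k"
    using True unfolding i_def j_def k_def by auto
  let ?f = "flip (\<lambda>x :: 'k. x)"
  have "bij_betw ?f (gl_fiber3 i j k A B C) (gl_fiber3 k j i (?f C) (?f B) (?f A))"
    using flip_gl_fiber3[of _ i j k A B C] flip_gl_fiber3[of _ k j i "?f C" "?f B" "?f A"]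
    unfolding flip_id_flip_id[OF c(1)] flip_id_flip_id[OF c(2)] flip_id_flip_id[OF c(3)]
    by (intro bij_betwI[where g = ?f]) (auto simp: gl_fiber3_def flip_id_flip_id)
  from avg_reindex[OF this, of f f] have "Delta3 f (?f C) (?f B) (?f A) = Delta3 f A B C"
    unfolding Delta3_eq[OF c] Delta3_eq[OF flip_carrier[OF c(3)] flip_carrier[OF c(2)] flip_carrier[OF c(1)]]
    using gl_invariant_flip[OF f] unfolding gl_fiber3_def by blast
  then show ?thesis
    using gl_invariant_flip[OF gl_invariant_Delta3(1)[OF f] c(3)] gl_invariant_flip[OF gl_invariant_Delta3(2)[OF f] c(2)]
      gl_invariant_flip[OF gl_invariant_Delta3(3)[OF f] c(1)] by simp
next
  case False
  then show ?thesis using Delta3_outside[of A B C f] Delta3_outside[of C B A f] by metis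
qed

text \<open>Dual to \<open>nabla3_swap_last\<close>: the exchange of the first two places conjugated
  by reversal.\<close>

lemma Delta3_swap_last:
  fixes f :: "'k::{field,finite} mat \<Rightarrow> real"
  assumes f: "gl_invariant f"
  shows "Delta3 f A B C = Delta3 f A C B"
proof -
  have swap: "Delta3 f A B C = Delta3 f B A C" for A B C
    unfolding Delta3_eq_Delta by (rule Delta_commute[OF gl_invariant_Delta(1)[OF f]])
  show ?thesis by (metis swap Delta3_reverse[OF f])
qed

section \<open>The unitary group\<close>

text \<open>Beyond finiteness, the field enters through these facts only;
  \<open>unitary_frobenius\<close> verifies them. The name \<open>c\<close> lets the simplifier
  treat the map as an involutive automorphism instead of a power.\<close>

locale unitary =
  fixes q :: nat and c :: "'k::{field,finite} \<Rightarrow> 'k"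
  assumes c_def: "c = (\<lambda>x. x ^ q)" and odd_q: "odd q"
    and c_add: "c (x + y) = c x + c y" and c_c [simp]: "c (c x) = x" and two: "(2 :: 'k) \<noteq> 0"
begin

lemma c_mult: "c (x * y) = c x * c y"
  by (simp add: c_def power_mult_distrib)

lemma c_0 [simp]: "c 0 = 0" and c_1 [simp]: "c 1 = 1" and c_minus [simp]: "c (- x) = - c x"
  using odd_q by (auto simp: c_def power_minus_odd odd_pos)

lemma c_diff: "c (x - y) = c x - c y"
  using c_add[of x "- y"] by simp

lemma c_sum: "c (sum f S) = (\<Sum>x\<in>S. c (f x))"
  by (induction S rule: infinite_finite_induct) (auto simp: c_add)

lemma c_eq_0 [simp]: "c x = 0 \<longleftrightarrow> x = 0"
  using c_c[of x] by (metis c_0)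

lemma c_divide: "c (x / y) = c x / c y"
  by (simp add: c_def power_divide)

lemma field_hom_c: "field_hom c"
  by (simp add: field_hom_def c_add c_mult)

lemma herm_carrier [simp]: "(A :: 'k mat) \<in> carrier_mat n m \<Longrightarrow> herm q A \<in> carrier_mat m n"
  by (simp add: herm_def)

lemma herm_dim [simp]: "dim_row (herm q A) = dim_col A" "dim_col (herm q A) = dim_row A"
  by (simp_all add: herm_def)

lemma J_herm_J:
  assumes "A \<in> carrier_mat n n"
  shows "J n * herm q A * J n = flip c A"
proof (rule eq_matI)
  fix r s assume "r < dim_row (flip c A)" "s < dim_col (flip c A)"
  then have rs: "r < n" "s < n" using assms by auto
  have "J n * herm q A \<in> carrier_mat n n"
    using mult_carrier_mat[OF J_carrier(1) herm_carrier[OF assms]] .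
  then have "(J n * herm q A * J n) $$ (r, s) = herm q A $$ (n - Suc r, n - Suc s)"
    using rs assms by (simp add: mult_J[where n = n] J_mult[where n = n] del: index_mult_mat(1) assoc_mult_mat)
  then show "(J n * herm q A * J n) $$ (r, s) = flip c A $$ (r, s)"
    using assms rs by (simp add: herm_def c_def)
qed (use assms in auto)

text \<open>Multiplying the defining equation by \<open>J\<close>, whose square is 1, turns it into
  the statement that \<open>flip c g\<close> is inverse to \<open>g\<close>. Later arguments use
  this form, in which \<open>J\<close> no longer occurs.\<close>

lemma U_iff: "g \<in> carrier (U q n) \<longleftrightarrow> g \<in> carrier_mat (2 * n) (2 * n) \<and> flip c g * g = 1\<^sub>m (2 * n)"
proof -
  let ?N = "2 * n"
  have "herm q g * J ?N * g = J ?N \<longleftrightarrow> flip c g * g = 1\<^sub>m ?N" if g: "g \<in> carrier_mat ?N ?N"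
  proof -
    have JZ: "J ?N * (J ?N * Z) = Z" if "Z \<in> carrier_mat ?N ?N" for Z :: "'k mat"
      using that assoc_mult_mat[of "J ?N" ?N ?N "J ?N" ?N Z ?N] by (simp add: J_J)
    have "flip c g * g = J ?N * (herm q g * J ?N * g)"
      unfolding J_herm_J[OF g, symmetric] using g by (simp add: mult_assoc_dim del: assoc_mult_mat)
    moreover have S: "herm q g * J ?N * g \<in> carrier_mat ?N ?N" using g by (auto intro!: carrier_matI)
    ultimately show ?thesis
      using JZ[OF S] J_J[where 'k = 'k, of ?N] right_mult_one_mat[of "J ?N :: 'k mat" ?N ?N, OF J_carrier(1)] by auto
  qed
  then show ?thesis
    using GL_I[of g ?N "flip c g"] by (auto simp: U_def dest: GL_carrier)
qed

lemma u_iff: "X \<in> u q n \<longleftrightarrow> X \<in> carrier_mat (2 * n) (2 * n) \<and> flip c X = - X"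
proof -
  let ?N = "2 * n"
  have "herm q X * J ?N + J ?N * X = 0\<^sub>m ?N ?N \<longleftrightarrow> flip c X = - X" if X: "X \<in> carrier_mat ?N ?N"
  proof -
    have JZ: "J ?N * (J ?N * Z) = Z" if "Z \<in> carrier_mat ?N ?N" for Z :: "'k mat"
      using that assoc_mult_mat[of "J ?N" ?N ?N "J ?N" ?N Z ?N] by (simp add: J_J)
    let ?S = "herm q X * J ?N + J ?N * X"
    have S: "?S \<in> carrier_mat ?N ?N" using X by (auto intro!: carrier_matI)
    have "J ?N * ?S = J ?N * (herm q X * J ?N) + J ?N * (J ?N * X)"
      using X by (intro mult_add_distrib_mat[of _ ?N ?N _ ?N]) (auto intro!: carrier_matI)
    also have "\<dots> = flip c X + X" unfolding J_herm_J[OF X, symmetric] using X JZ[OF X]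
      by (simp add: mult_assoc_dim del: assoc_mult_mat)
    finally have JS: "J ?N * ?S = flip c X + X" .
    have "?S = 0\<^sub>m ?N ?N \<longleftrightarrow> J ?N * ?S = 0\<^sub>m ?N ?N"
      using JZ[OF S] right_mult_zero_mat[of "J ?N :: 'k mat" ?N ?N, OF J_carrier(1)] by auto
    also have "\<dots> \<longleftrightarrow> flip c X = - X"
      unfolding JS using X by (auto simp: mat_eq_iff eq_neg_iff_add_eq_0)
    finally show ?thesis .
  qed
  then show ?thesis by (auto simp: u_def gl_def)
qed

lemma U_carrier: "(g :: 'k mat) \<in> carrier (U q n) \<Longrightarrow> g \<in> carrier_mat (2 * n) (2 * n)"
  by (simp add: U_iff)

lemma U_GL: "(g :: 'k mat) \<in> carrier (U q n) \<Longrightarrow> g \<in> carrier (GL (2 * n))"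
  by (simp add: U_def)

lemma U_inv:
  assumes "g \<in> carrier (U q n)"
  shows "mat_inv g = flip c g"
proof (rule GL_cancel_left[OF U_GL[OF assms]])
  have "flip c g * g = 1\<^sub>m (2 * n)" "g \<in> carrier_mat (2 * n) (2 * n)" using assms by (auto simp: U_iff)
  then show "g * mat_inv g = g * flip c g"
    using mat_inv_props(4)[OF U_GL[OF assms]] mat_mult_left_right_inverse[of "flip c g" "2 * n" g] by simp
qed (use mat_inv_props[OF U_GL[OF assms]] U_carrier[OF assms] in auto)

lemma flip_c_flip_c: "X \<in> carrier_mat n n \<Longrightarrow> flip c (flip c X) = X"
  by (rule flip_flip) auto

lemma mat_group_U: "mat_group (2 * n) (U q n :: 'k mat monoid) (u q n)"
proof (rule mat_group.intro)
  interpret group "GL (2 * n) :: 'k mat monoid" by (rule group_GL)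
  have "subgroup (carrier (U q n :: 'k mat monoid)) (GL (2 * n))"
  proof (rule finite_closed_imp_subgroup[OF group_GL finite_GL])
    show "carrier (U q n :: 'k mat monoid) \<subseteq> carrier (GL (2 * n))" by (auto dest: U_GL)
    show "\<one>\<^bsub>GL (2 * n)\<^esub> \<in> carrier (U q n :: 'k mat monoid)" by (simp add: U_iff flip_one)
    fix x y :: "'k mat" assume xy: "x \<in> carrier (U q n)" "y \<in> carrier (U q n)"
    note c = U_carrier[OF xy(1)] U_carrier[OF xy(2)]
    have "flip c (x * y) * (x * y) = flip c y * ((flip c x * x) * y)"
      using c flip_carrier[OF c(1), of c] flip_carrier[OF c(2), of c]
      by (simp add: flip_mult'[OF field_hom_c c] assoc_mult_mat[of _ "2 * n" "2 * n" _ "2 * n" _ "2 * n"])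
    also have "\<dots> = 1\<^sub>m (2 * n)" using xy c by (simp add: U_iff)
    finally show "x \<otimes>\<^bsub>GL (2 * n)\<^esub> y \<in> carrier (U q n)" using c by (simp add: U_iff)
  qed
  from subgroup.subgroup_is_group[OF this group_GL] show "group (U q n :: 'k mat monoid)" by (simp add: U_def)
  show "carrier (U q n :: 'k mat monoid) \<subseteq> carrier (GL (2 * n))" by (auto dest: U_GL)
  show "x \<otimes>\<^bsub>U q n\<^esub> y = x * y" for x y :: "'k mat" by (simp add: U_def GL_def units_of_def ring_mat_def)
  show "\<one>\<^bsub>U q n\<^esub> = (1\<^sub>m (2 * n) :: 'k mat)" by (simp add: U_def GL_def units_of_def ring_mat_def)
  show "u q n \<subseteq> (carrier_mat (2 * n) (2 * n) :: 'k mat set)" by (auto simp: u_iff)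
  fix g X :: "'k mat" assume g: "g \<in> carrier (U q n)" and X: "X \<in> u q n"
  have Xc: "X \<in> carrier_mat (2 * n) (2 * n)" "flip c X = - X" using X by (auto simp: u_iff)
  have "flip c (conj_by g X) = conj_by g (- X)"
    using flip_conj_by[OF field_hom_c U_GL[OF g] Xc(1)] by (simp add: U_inv[OF g] flip_c_flip_c[OF U_carrier[OF g]] Xc(2))
  also have "\<dots> = - conj_by g X"
    using mat_inv_props(2)[OF U_GL[OF g]] U_carrier[OF g] Xc(1) by (simp add: conj_by_def)
  finally show "conj_by g X \<in> u q n" using conj_by_carrier[OF U_GL[OF g] Xc(1)] by (simp add: u_iff)
qed

text \<open>The Hermitian form \<open>v^* J w\<close>, semilinear in the first argument; it pairs
  coordinate \<open>r\<close> with coordinate \<open>N - Suc r\<close>.\<close>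

definition form :: "nat \<Rightarrow> 'k vec \<Rightarrow> 'k vec \<Rightarrow> 'k" where
  "form N v w = (\<Sum>r<N. c (v $ r) * w $ (N - Suc r))"

lemma form_add_left: "x \<in> carrier_vec N \<Longrightarrow> y \<in> carrier_vec N \<Longrightarrow> form N (x + y) z = form N x z + form N y z"
  by (simp add: form_def c_add distrib_right sum.distrib)

lemma form_add_right: "y \<in> carrier_vec N \<Longrightarrow> z \<in> carrier_vec N \<Longrightarrow> form N x (y + z) = form N x y + form N x z"
  by (simp add: form_def distrib_left sum.distrib)

lemma form_smult_left: "x \<in> carrier_vec N \<Longrightarrow> form N (a \<cdot>\<^sub>v x) z = c a * form N x z"
  by (simp add: form_def c_mult sum_distrib_left mult.assoc)

lemma form_smult_right: "z \<in> carrier_vec N \<Longrightarrow> form N x (a \<cdot>\<^sub>v z) = a * form N x z"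
  by (simp add: form_def sum_distrib_left algebra_simps)

lemma form_sym: "form N y x = c (form N x y)"
proof -
  have "c (form N x y) = (\<Sum>r<N. x $ r * c (y $ (N - Suc r)))"
    by (simp add: form_def c_sum c_mult)
  also have "\<dots> = (\<Sum>r<N. x $ (N - Suc r) * c (y $ (N - Suc (N - Suc r))))"
    by (rule sum.nat_diff_reindex[symmetric])
  also have "\<dots> = form N y x" unfolding form_def by (intro sum.cong) (auto simp: mult.commute)
  finally show ?thesis by simp
qed

lemma form_unit_left:
  assumes "r < N"
  shows "form N (unit_vec N r) x = x $ (N - Suc r)"
proof -
  have "form N (unit_vec N r) x = (\<Sum>t<N. if t = r then x $ (N - Suc t) else 0)"
    unfolding form_def by (intro sum.cong) (auto simp: assms)
  then show ?thesis using assms by simp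
qed

lemma form_unit_right: "r < N \<Longrightarrow> form N x (unit_vec N r) = c (x $ (N - Suc r))"
  using form_sym[of N x "unit_vec N r"] by (simp add: form_unit_left)

lemmas form_simps = form_add_left form_add_right form_smult_left form_smult_right

text \<open>The entry \<open>(s, t)\<close> of \<open>flip c g * g\<close> is the form evaluated at
  the columns \<open>N - Suc s\<close> and \<open>t\<close> of \<open>g\<close>, with
  \<open>N = 2 * n\<close>, so it is enough to evaluate the form at unit vectors.\<close>

lemma isometry_in_U:
  assumes g: "g \<in> carrier_mat (2 * n) (2 * n)"
    and iso: "\<And>x y. x \<in> carrier_vec (2 * n) \<Longrightarrow> y \<in> carrier_vec (2 * n) \<Longrightarrow>
      form (2 * n) (g *\<^sub>v x) (g *\<^sub>v y) = form (2 * n) x y"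
  shows "g \<in> carrier (U q n)"
proof -
  let ?N = "2 * n"
  have "(flip c g * g) $$ (s, t) = 1\<^sub>m ?N $$ (s, t)" if st: "s < ?N" "t < ?N" for s t
  proof -
    have col: "(g *\<^sub>v unit_vec ?N t) $ r = g $$ (r, t)" if "r < ?N" "t < ?N" for r t
      using g that by simp
    have "(flip c g * g) $$ (s, t) = (\<Sum>r<?N. c (g $$ (?N - Suc r, ?N - Suc s)) * g $$ (r, t))"
      using g st by (subst mult_mat_entry[where n = ?N]) auto
    also have "\<dots> = (\<Sum>r<?N. c (g $$ (?N - Suc (?N - Suc r), ?N - Suc s)) * g $$ (?N - Suc r, t))"
      by (rule sum.nat_diff_reindex[symmetric])
    also have "\<dots> = form ?N (g *\<^sub>v unit_vec ?N (?N - Suc s)) (g *\<^sub>v unit_vec ?N t)"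
      unfolding form_def by (rule sum.cong) (use st in \<open>auto simp: col simp del: index_mult_mat_vec\<close>)
    also have "\<dots> = form ?N (unit_vec ?N (?N - Suc s)) (unit_vec ?N t)" by (rule iso) auto
    also have "\<dots> = 1\<^sub>m ?N $$ (s, t)" using st by (simp add: form_unit_left)
    finally show ?thesis .
  qed
  then show ?thesis using g by (auto simp: U_iff intro!: eq_matI simp del: index_mult_mat(1) index_one_mat(1))
qed

lemma U_isometry:
  assumes g: "g \<in> carrier (U q n)" and x: "x \<in> carrier_vec (2 * n)" and y: "y \<in> carrier_vec (2 * n)"
  shows "form (2 * n) (g *\<^sub>v x) (g *\<^sub>v y) = form (2 * n) x y"
proof -
  let ?N = "2 * n"
  \<comment> \<open>\<open>flip c A\<close> is the adjoint of \<open>A\<close> for the form.\<close>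
  have adj: "form ?N (A *\<^sub>v v) w = form ?N v (flip c A *\<^sub>v w)"
    if A: "A \<in> carrier_mat ?N ?N" and v: "v \<in> carrier_vec ?N" and w: "w \<in> carrier_vec ?N" for A v w
  proof -
    have "form ?N (A *\<^sub>v v) w = (\<Sum>r<?N. \<Sum>s<?N. c (A $$ (r, s)) * c (v $ s) * w $ (?N - Suc r))"
      using A v by (simp add: form_def scalar_prod_def c_sum c_mult sum_distrib_right lessThan_atLeast0)
    also have "\<dots> = (\<Sum>s<?N. \<Sum>r<?N. c (A $$ (r, s)) * c (v $ s) * w $ (?N - Suc r))" by (rule sum.swap)
    also have "\<dots> = (\<Sum>s<?N. \<Sum>r<?N. c (A $$ (?N - Suc r, s)) * c (v $ s) * w $ (?N - Suc (?N - Suc r)))"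
      by (intro sum.cong refl sum.nat_diff_reindex[symmetric])
    also have "\<dots> = (\<Sum>s<?N. \<Sum>r<?N. c (v $ s) * (flip c A $$ (?N - Suc s, r) * w $ r))"
      using A by (intro sum.cong) auto
    also have "\<dots> = form ?N v (flip c A *\<^sub>v w)"
      using A w by (simp add: form_def scalar_prod_def sum_distrib_left lessThan_atLeast0)
    finally show ?thesis .
  qed
  note gc = U_carrier[OF g]
  have "form ?N (g *\<^sub>v x) (g *\<^sub>v y) = form ?N x (flip c g *\<^sub>v (g *\<^sub>v y))"
    using gc x y by (intro adj) auto
  also have "flip c g *\<^sub>v (g *\<^sub>v y) = y"
    using assoc_mult_mat_vec[OF flip_carrier[OF gc, of c] gc y] g y by (simp add: U_iff del: assoc_mult_mat_vec)
  finally show ?thesis .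
qed

end

section \<open>Isotropic subspaces relative to a flag\<close>

context unitary
begin

text \<open>A Siegel transformation for the vector \<open>e = unit_vec N (N - Suc p)\<close>,
  isotropic when \<open>N\<close> is even: \<open>x\<close> goes to
  \<open>x + x_p (b + \<mu> e) - form(b, x) e\<close>, where the coordinate \<open>x_p\<close> is
  the value of the form at \<open>e\<close> and \<open>x\<close>.\<close>

definition trans_mat :: "nat \<Rightarrow> nat \<Rightarrow> 'k vec \<Rightarrow> 'k \<Rightarrow> 'k mat" where
  "trans_mat N p b \<mu> = mat N N (\<lambda>(s, t). (if t = s then 1 else 0)
     + (if t = p then b $ s + (if s = N - Suc p then \<mu> else 0) else 0)
     - (if s = N - Suc p then c (b $ (N - Suc t)) else 0))"

text \<open>A unitary quasi-reflection: \<open>x\<close> goes to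
  \<open>x + \<kappa> form(w, x) w\<close>.\<close>

definition refl_mat :: "nat \<Rightarrow> 'k vec \<Rightarrow> 'k \<Rightarrow> 'k mat" where
  "refl_mat N w \<kappa> = mat N N (\<lambda>(s, t). (if t = s then 1 else 0) + \<kappa> * w $ s * c (w $ (N - Suc t)))"

lemma trans_mat_carrier [simp]: "trans_mat N p b \<mu> \<in> carrier_mat N N"
  by (simp add: trans_mat_def)

lemma refl_mat_carrier [simp]: "refl_mat N w \<kappa> \<in> carrier_mat N N"
  by (simp add: refl_mat_def)

lemma form_reindex: "form N b x = (\<Sum>t<N. c (b $ (N - Suc t)) * x $ t)"
proof -
  have "form N b x = (\<Sum>t<N. c (b $ (N - Suc (N - Suc t))) * x $ (N - Suc t))"
    unfolding form_def by (rule sum.cong) auto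
  also have "\<dots> = (\<Sum>t<N. c (b $ (N - Suc t)) * x $ t)" by (rule sum.nat_diff_reindex)
  finally show ?thesis .
qed

lemma trans_mat_vec:
  assumes p: "p < N" and b: "b \<in> carrier_vec N" and x: "x \<in> carrier_vec N"
  shows "trans_mat N p b \<mu> *\<^sub>v x =
    x + x $ p \<cdot>\<^sub>v (b + \<mu> \<cdot>\<^sub>v unit_vec N (N - Suc p)) + (- form N b x) \<cdot>\<^sub>v unit_vec N (N - Suc p)"
proof (rule eq_vecI)
  fix s assume "s < dim_vec (x + x $ p \<cdot>\<^sub>v (b + \<mu> \<cdot>\<^sub>v unit_vec N (N - Suc p)) + (- form N b x) \<cdot>\<^sub>v unit_vec N (N - Suc p))"
  then have s: "s < N" by simp
  have "(trans_mat N p b \<mu> *\<^sub>v x) $ s = (\<Sum>t<N. ((if t = s then 1 else 0)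
     + (if t = p then b $ s + (if s = N - Suc p then \<mu> else 0) else 0)
     - (if s = N - Suc p then c (b $ (N - Suc t)) else 0)) * x $ t)"
    using s x by (simp add: trans_mat_def scalar_prod_def lessThan_atLeast0)
  also have "\<dots> = (\<Sum>t<N. if t = s then x $ t else 0)
     + (\<Sum>t<N. if t = p then (b $ s + (if s = N - Suc p then \<mu> else 0)) * x $ t else 0)
     - (\<Sum>t<N. if s = N - Suc p then c (b $ (N - Suc t)) * x $ t else 0)"
    unfolding sum.distrib[symmetric] sum_subtractf[symmetric] by (rule sum.cong) (auto simp: algebra_simps)
  also have "\<dots> = x $ s + (b $ s + (if s = N - Suc p then \<mu> else 0)) * x $ p
     - (if s = N - Suc p then form N b x else 0)"
    using s p by (simp add: form_reindex)
  finally have eq: "(trans_mat N p b \<mu> *\<^sub>v x) $ s = x $ s + (b $ s + (if s = N - Suc p then \<mu> else 0)) * x $ p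
     - (if s = N - Suc p then form N b x else 0)" .
  show "(trans_mat N p b \<mu> *\<^sub>v x) $ s =
    (x + x $ p \<cdot>\<^sub>v (b + \<mu> \<cdot>\<^sub>v unit_vec N (N - Suc p)) + (- form N b x) \<cdot>\<^sub>v unit_vec N (N - Suc p)) $ s"
    unfolding eq using s p b x by (simp add: algebra_simps)
qed (use assms in \<open>simp add: trans_mat_def\<close>)

lemma refl_mat_vec:
  assumes w: "w \<in> carrier_vec N" and x: "x \<in> carrier_vec N"
  shows "refl_mat N w \<kappa> *\<^sub>v x = x + (\<kappa> * form N w x) \<cdot>\<^sub>v w"
proof (rule eq_vecI)
  fix s assume "s < dim_vec (x + (\<kappa> * form N w x) \<cdot>\<^sub>v w)"
  then have s: "s < N" using w by simp
  have "(refl_mat N w \<kappa> *\<^sub>v x) $ s = (\<Sum>t<N. ((if t = s then 1 else 0) + \<kappa> * w $ s * c (w $ (N - Suc t))) * x $ t)"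
    using s x by (simp add: refl_mat_def scalar_prod_def lessThan_atLeast0)
  also have "\<dots> = (\<Sum>t<N. if t = s then x $ t else 0) + (\<Sum>t<N. \<kappa> * w $ s * (c (w $ (N - Suc t)) * x $ t))"
    unfolding sum.distrib[symmetric] by (rule sum.cong) (auto simp: algebra_simps)
  also have "\<dots> = x $ s + \<kappa> * w $ s * form N w x"
    using s by (simp add: form_reindex sum_distrib_left)
  finally have eq: "(refl_mat N w \<kappa> *\<^sub>v x) $ s = x $ s + \<kappa> * w $ s * form N w x" .
  show "(refl_mat N w \<kappa> *\<^sub>v x) $ s = (x + (\<kappa> * form N w x) \<cdot>\<^sub>v w) $ s"
    unfolding eq using s w x by (simp add: algebra_simps)
qed (use assms in \<open>simp add: refl_mat_def\<close>)

text \<open>\<open>b $ p = 0\<close> says that \<open>b\<close> is orthogonal to the isotropic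
  vector of the transformation, and the equation for \<open>\<mu>\<close> that the image of the unit
  vector of index \<open>p\<close> is isotropic.\<close>

lemma trans_mat_U:
  assumes p: "p < 2 * n" and b: "b \<in> carrier_vec (2 * n)" "b $ p = 0"
    and \<mu>: "\<mu> + c \<mu> + form (2 * n) b b = 0"
  shows "trans_mat (2 * n) p b \<mu> \<in> carrier (U q n)"
proof (rule isometry_in_U)
  let ?N = "2 * n"
  let ?e = "unit_vec ?N (?N - Suc p) :: 'k vec"
  fix x y :: "'k vec" assume xy: "x \<in> carrier_vec ?N" "y \<in> carrier_vec ?N"
  have "?N - Suc p \<noteq> p" using p by presburger
  then have e: "form ?N ?e z = z $ p" "form ?N z ?e = c (z $ p)" "?e $ p = 0" for z
    using p by (simp_all add: form_unit_left form_unit_right)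
  have bb: "form ?N b b = - \<mu> - c \<mu>" using \<mu> by (simp add: algebra_simps eq_neg_iff_add_eq_0)
  have xb: "form ?N x b = c (form ?N b x)" by (rule form_sym)
  show "form ?N (trans_mat ?N p b \<mu> *\<^sub>v x) (trans_mat ?N p b \<mu> *\<^sub>v y) = form ?N x y"
    unfolding trans_mat_vec[OF p b(1) xy(1)] trans_mat_vec[OF p b(1) xy(2)]
    using xy b p by (simp add: form_simps e bb xb c_mult) (simp add: algebra_simps)
qed simp

lemma refl_mat_U:
  assumes w: "w \<in> carrier_vec (2 * n)" and \<kappa>: "\<kappa> + c \<kappa> + \<kappa> * c \<kappa> * form (2 * n) w w = 0"
  shows "refl_mat (2 * n) w \<kappa> \<in> carrier (U q n)"
proof (rule isometry_in_U)
  let ?N = "2 * n"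
  fix x y :: "'k vec" assume xy: "x \<in> carrier_vec ?N" "y \<in> carrier_vec ?N"
  have xw: "form ?N x w = c (form ?N w x)" by (rule form_sym)
  have "form ?N (refl_mat ?N w \<kappa> *\<^sub>v x) (refl_mat ?N w \<kappa> *\<^sub>v y) = form ?N x y
      + c (form ?N w x) * form ?N w y * (\<kappa> + c \<kappa> + \<kappa> * c \<kappa> * form ?N w w)"
    unfolding refl_mat_vec[OF w xy(1)] refl_mat_vec[OF w xy(2)]
    using xy w by (simp add: form_simps xw c_mult) (simp add: algebra_simps)
  then show "form ?N (refl_mat ?N w \<kappa> *\<^sub>v x) (refl_mat ?N w \<kappa> *\<^sub>v y) = form ?N x y" by (simp add: \<kappa>)
qed simp

end

text \<open>
  \<open>\<beta>\<close> numbers the blocks of a flag that is stable under taking orthogonal complements; \<open>I\<close> is the set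
  of the coordinates on which the matrices under consideration may act nontrivially.
\<close>

locale unitary_flag = unitary q c for q and c :: "'k::{field,finite} \<Rightarrow> 'k" +
  fixes n :: nat and \<beta> :: "nat \<Rightarrow> nat"
  assumes \<beta>_le: "r < 2 * n \<Longrightarrow> \<beta> r \<le> 2" and \<beta>_rev: "r < 2 * n \<Longrightarrow> \<beta> (2 * n - Suc r) = 2 - \<beta> r"
begin

abbreviation "N \<equiv> 2 * n"

definition coords :: "nat set \<Rightarrow> 'k vec set" where
  "coords S = {v \<in> carrier_vec N. \<forall>r < N. r \<notin> S \<longrightarrow> v $ r = 0}"

definition good :: "nat set \<Rightarrow> 'k mat \<Rightarrow> bool" where
  "good I y \<longleftrightarrow> y \<in> carrier (U q n) \<and> upper \<beta> y \<and> (\<forall>s < N. s \<notin> I \<longrightarrow> y *\<^sub>v unit_vec N s = unit_vec N s)"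

lemma good_one: "good I (1\<^sub>m N)"
  by (simp add: good_def U_iff flip_one)

lemma good_carrier: "good I y \<Longrightarrow> y \<in> carrier_mat N N"
  by (simp add: good_def U_iff)

lemma good_mult:
  assumes "good I x" "good I y"
  shows "good I (x * y)"
proof -
  interpret mat_group N "U q n :: 'k mat monoid" "u q n" by (rule mat_group_U)
  note c = good_carrier[OF assms(1)] good_carrier[OF assms(2)]
  have "x * y \<in> carrier (U q n)" using m_closed[of x y] assms by (simp add: good_def)
  then show ?thesis
    using assms upper_mult[OF c] assoc_mult_mat_vec[OF c] by (auto simp: good_def)
qed

lemma good_mono: "good I y \<Longrightarrow> I \<subseteq> I' \<Longrightarrow> good I' y"
  by (auto simp: good_def)

lemma rev_neq: "r < N \<Longrightarrow> N - Suc r \<noteq> r"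
  by presburger

text \<open>Coordinate \<open>r\<close> is the pairing with the unit vector of the mirrored index
  \<open>N - Suc r\<close>. For \<open>r\<close> outside \<open>I\<close> the matrix fixes that
  vector, so the coordinate stays 0.\<close>

lemma good_coords:
  assumes y: "good I y" and rev: "\<And>r. r \<in> I \<Longrightarrow> N - Suc r \<in> I" and x: "x \<in> coords I"
  shows "y *\<^sub>v x \<in> coords I"
proof -
  have xc: "x \<in> carrier_vec N" using x by (simp add: coords_def)
  have "(y *\<^sub>v x) $ r = 0" if r: "r < N" "r \<notin> I" for r
  proof -
    have r': "N - Suc r < N" "N - Suc r \<notin> I" using r rev[of "N - Suc r"] by auto
    have "(y *\<^sub>v x) $ r = form N (unit_vec N (N - Suc r)) (y *\<^sub>v x)"
      using r by (simp add: form_unit_left[OF r'(1)])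
    also have "unit_vec N (N - Suc r) = y *\<^sub>v unit_vec N (N - Suc r)" using y r' by (simp add: good_def)
    also have "form N (y *\<^sub>v unit_vec N (N - Suc r)) (y *\<^sub>v x) = form N (unit_vec N (N - Suc r)) x"
      using y xc by (intro U_isometry) (auto simp: good_def)
    also have "\<dots> = x $ r" using r by (simp add: form_unit_left[OF r'(1)])
    finally show ?thesis using x r by (simp add: coords_def)
  qed
  then show ?thesis using mult_mat_vec_carrier[OF good_carrier[OF y] xc] by (simp add: coords_def)
qed

lemma upper_mult_vec:
  assumes y: "y \<in> carrier_mat N N" "upper \<beta> y" and x: "x \<in> carrier_vec N" "\<And>r. r < N \<Longrightarrow> x $ r \<noteq> 0 \<Longrightarrow> \<beta> r \<le> l"
    and r: "r < N" "(y *\<^sub>v x) $ r \<noteq> 0"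
  shows "\<beta> r \<le> l"
proof (rule ccontr)
  assume l: "\<not> \<beta> r \<le> l"
  have "y $$ (r, t) * x $ t = 0" if "t < N" for t
    using x(2)[OF that] y that r(1) l unfolding upper_def by (cases "x $ t = 0") auto
  then have "(y *\<^sub>v x) $ r = 0" using y x(1) r(1) by (auto simp: scalar_prod_def intro!: sum.neutral)
  then show False using r(2) by simp
qed

text \<open>The Siegel transformation is forced. The coordinates other than \<open>r\<close> and its
  mirror \<open>r'\<close> are cleared by \<open>b = - v / v_r\<close>, and the coordinate
  \<open>r'\<close> by the choice of \<open>\<mu>\<close>. The isotropy of \<open>v\<close> is then
  exactly the condition that makes the transformation an isometry.\<close>

lemma clear_column:
  assumes I: "I \<subseteq> {..<N}" "\<And>r. r \<in> I \<Longrightarrow> N - Suc r \<in> I"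
    and v: "v \<in> coords I" "form N v v = 0" and r: "r \<in> I" "v $ r \<noteq> 0"
    and l: "\<And>t. t < N \<Longrightarrow> v $ t \<noteq> 0 \<Longrightarrow> \<beta> t \<le> \<beta> r"
  shows "\<exists>y. good I y \<and> y *\<^sub>v v = v $ r \<cdot>\<^sub>v unit_vec N r"
proof -
  define r' where "r' = N - Suc r"
  have rN: "r < N" "r' < N" "r \<noteq> r'" "N - Suc r' = r" "r' \<in> I"
    using I r rev_neq[of r] by (auto simp: r'_def)
  have vc: "v \<in> carrier_vec N" and v0: "\<And>t. t < N \<Longrightarrow> t \<notin> I \<Longrightarrow> v $ t = 0" using v by (auto simp: coords_def)
  define b where "b = vec N (\<lambda>t. if t = r \<or> t = r' then 0 else - (v $ t / v $ r))"
  have b: "b \<in> carrier_vec N" "b $ r = 0" "b $ r' = 0" using rN by (auto simp: b_def)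
  have b0: "b $ t = 0" if "t < N" "v $ t = 0" for t using that by (simp add: b_def)
  have v_eq: "v = v $ r \<cdot>\<^sub>v unit_vec N r + (- v $ r) \<cdot>\<^sub>v b + v $ r' \<cdot>\<^sub>v unit_vec N r'" (is "v = ?v")
    using rN vc r by (intro eq_vecI) (auto simp: b_def)
  have e: "form N (unit_vec N r) z = z $ r'" "form N (unit_vec N r') z = z $ r"
    "form N z (unit_vec N r) = c (z $ r')" "form N z (unit_vec N r') = c (z $ r)" for z
    using rN r'_def by (simp_all add: form_unit_left form_unit_right)
  define h where "h = form N b b"
  have "form N b ?v = - v $ r * h"
    using b rN by (simp add: form_simps e h_def)
  then have bv: "form N b v = - v $ r * h"
    using arg_cong[OF v_eq, of "form N b"] by (rule trans[rotated])
  have "form N ?v ?v = c (v $ r) * v $ r' + c (v $ r') * v $ r + c (v $ r) * v $ r * h"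
    using b rN by (simp add: form_simps e h_def[symmetric] c_mult)
  then have iso: "c (v $ r) * v $ r' + c (v $ r') * v $ r + c (v $ r) * v $ r * h = 0"
    using v(2) arg_cong2[OF v_eq v_eq, of "form N"] by (simp only:)
  define \<mu> where "\<mu> = - h - v $ r' / v $ r"
  have hc: "c h = h" unfolding h_def by (rule form_sym[symmetric])
  have "(\<mu> + c \<mu> + h) * (c (v $ r) * v $ r) = - (c (v $ r) * v $ r' + c (v $ r') * v $ r + c (v $ r) * v $ r * h)"
    using r by (simp add: \<mu>_def c_diff c_divide hc c_mult field_simps)
  then have \<mu>: "\<mu> + c \<mu> + form N b b = 0" using iso r by (simp add: h_def[symmetric])
  \<comment> \<open>For \<open>r\<close> on the lowest level its mirror is on the highest, and an
    entry \<open>\<mu>\<close> at \<open>(r', r)\<close> would break the flag. But then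
    \<open>v\<close> is supported on the lowest level, so \<open>h\<close> and \<open>v $ r'\<close>
    vanish.\<close>
  have \<mu>0: "\<mu> = 0" if "\<beta> r = 0"
  proof -
    have v_0: "v $ t = 0" if "t < N" "\<beta> t \<noteq> 0" for t using l[OF that(1)] that(2) \<open>\<beta> r = 0\<close> by auto
    have "c (b $ t) * b $ (N - Suc t) = 0" if "t < N" for t
      using that \<beta>_rev[OF that] v_0[of t] v_0[of "N - Suc t"] b0[of t] b0[of "N - Suc t"] by (cases "\<beta> t = 0") auto
    then have "h = 0" unfolding h_def form_def by (intro sum.neutral) auto
    moreover have "v $ r' = 0" using v_0[of r'] \<beta>_rev[OF rN(1)] that rN by (simp add: r'_def)
    ultimately show ?thesis by (simp add: \<mu>_def)
  qed
  let ?y = "trans_mat N r b \<mu>"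
  have "?y *\<^sub>v v = v + v $ r \<cdot>\<^sub>v (b + \<mu> \<cdot>\<^sub>v unit_vec N r') + (v $ r * h) \<cdot>\<^sub>v unit_vec N r'"
    unfolding trans_mat_vec[OF rN(1) b(1) vc] bv r'_def[symmetric] by simp
  also have "\<dots> = v $ r \<cdot>\<^sub>v unit_vec N r"
    using rN vc r by (intro eq_vecI) (auto simp: b_def \<mu>_def field_simps)
  finally have yv: "?y *\<^sub>v v = v $ r \<cdot>\<^sub>v unit_vec N r" .
  have "upper \<beta> ?y"
    unfolding upper_def
  proof (intro allI impI)
    fix s t assume "s < dim_row ?y" "t < dim_col ?y" and lt: "\<beta> t < \<beta> s"
    then have st: "s < N" "t < N" by (auto simp: trans_mat_def)
    have 1: "b $ s = 0" if "t = r" using b0[OF st(1)] l[OF st(1)] lt that by auto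
    have 2: "\<mu> = 0" if "t = r" "s = r'"
      using \<mu>0 \<beta>_rev[OF rN(1)] \<beta>_le[OF rN(1)] lt that by (auto simp: r'_def)
    have 3: "b $ (N - Suc t) = 0" if "s = r'"
      using b0[of "N - Suc t"] l[of "N - Suc t"] st \<beta>_rev[OF st(2)] \<beta>_rev[OF rN(1)] \<beta>_le[OF rN(1)] \<beta>_le[OF st(2)] lt that
      by (cases "v $ (N - Suc t) = 0") (auto simp: r'_def)
    show "?y $$ (s, t) = 0" using st lt 1 2 3 by (auto simp: trans_mat_def r'_def)
  qed
  moreover have "?y *\<^sub>v unit_vec N s = unit_vec N s" if s: "s < N" "s \<notin> I" for s
  proof -
    have "N - Suc s \<notin> I" "s \<noteq> r" using I(2)[of "N - Suc s"] s r by auto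
    then have "b $ (N - Suc s) = 0" using b0[of "N - Suc s"] v0[of "N - Suc s"] s by auto
    then show ?thesis
      unfolding trans_mat_vec[OF rN(1) b(1) unit_vec_carrier]
      using s \<open>s \<noteq> r\<close> rN b by (intro eq_vecI) (auto simp: form_unit_right)
  qed
  ultimately have "good I ?y" using trans_mat_U[OF rN(1) b(1,2) \<mu>] by (simp add: good_def)
  then show ?thesis using yv by blast
qed

text \<open>If coordinate \<open>r\<close> of \<open>v\<close> is nonzero,
  \<open>clear_column\<close> applies. Otherwise a Siegel transformation first adds coordinate
  \<open>p\<close> to coordinate \<open>r\<close>; this needs \<open>p\<close> to differ from the
  mirror of \<open>r\<close>. They can coincide only on the middle level with a nonzero mirrored
  coordinate, and there a reflection takes \<open>v\<close> to the unit vector at once.\<close>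

lemma move_to_unit_vec:
  assumes I: "I \<subseteq> {..<N}" "\<And>r. r \<in> I \<Longrightarrow> N - Suc r \<in> I"
    and v: "v \<in> coords I" "form N v v = 0" and p: "p < N" "v $ p \<noteq> 0"
    and l: "\<And>t. t < N \<Longrightarrow> v $ t \<noteq> 0 \<Longrightarrow> \<beta> t \<le> \<beta> p"
    and r: "r \<in> I" "\<beta> r = \<beta> p"
  shows "\<exists>y \<kappa>. good I y \<and> \<kappa> \<noteq> 0 \<and> y *\<^sub>v v = \<kappa> \<cdot>\<^sub>v unit_vec N r"
proof -
  have vc: "v \<in> carrier_vec N" and v0: "\<And>t. t < N \<Longrightarrow> t \<notin> I \<Longrightarrow> v $ t = 0" using v by (auto simp: coords_def)
  have pI: "p \<in> I" using v0[OF p(1)] p(2) by auto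
  have rN: "r < N" using r I by auto
  consider (direct) "v $ r \<noteq> 0" | (reflect) "\<beta> r = 1" "v $ (N - Suc r) \<noteq> 0" "v $ r = 0"
    | (add) "v $ r = 0" "\<beta> r \<noteq> 1 \<or> v $ (N - Suc r) = 0" by blast
  then show ?thesis
  proof cases
    case direct
    then show ?thesis using clear_column[OF I v r(1) direct] l r(2) by fastforce
  next
    case reflect
    \<comment> \<open>The form of \<open>w\<close> and \<open>v\<close> is \<open>- d\<close>, so
      with the coefficient \<open>1 / d\<close> the reflection subtracts exactly \<open>w\<close>
      from \<open>v\<close> and leaves the unit vector.\<close>
    define w where "w = v - unit_vec N r"
    define d where "d = v $ (N - Suc r)"
    have w: "w \<in> carrier_vec N" using vc by (simp add: w_def)
    have w_eq: "w = v + (- 1) \<cdot>\<^sub>v unit_vec N r" using vc by (intro eq_vecI) (auto simp: w_def)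
    have e: "form N (unit_vec N r) z = z $ (N - Suc r)" "form N z (unit_vec N r) = c (z $ (N - Suc r))" for z
      using rN by (simp_all add: form_unit_left form_unit_right)
    have ww: "form N w w = - d - c d"
      unfolding w_eq using vc rN rev_neq[OF rN] by (simp add: form_simps e v(2) d_def)
    have wv: "form N w v = - d"
      unfolding w_eq using vc by (simp add: form_simps e v(2) d_def)
    have d: "d \<noteq> 0" using reflect by (simp add: d_def)
    have "refl_mat N w (1 / d) \<in> carrier (U q n)"
      using d by (intro refl_mat_U[OF w], simp add: ww c_divide) (simp add: field_simps)
    moreover have wl: "\<beta> s \<le> 1" if "s < N" "w $ s \<noteq> 0" for s
      using that l[OF that(1)] r(2) reflect(1) rN vc by (cases "s = r") (auto simp: w_def)
    have "upper \<beta> (refl_mat N w (1 / d))"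
      unfolding upper_def
    proof (intro allI impI)
      fix s t assume "s < dim_row (refl_mat N w (1 / d))" "t < dim_col (refl_mat N w (1 / d))" and lt: "\<beta> t < \<beta> s"
      then have st: "s < N" "t < N" by (auto simp: refl_mat_def)
      have "w $ s = 0 \<or> w $ (N - Suc t) = 0"
        using wl[OF st(1)] wl[of "N - Suc t"] \<beta>_rev[OF st(2)] \<beta>_le[OF st(2)] st lt by fastforce
      then show "refl_mat N w (1 / d) $$ (s, t) = 0" using st lt by (auto simp: refl_mat_def)
    qed
    moreover have "refl_mat N w (1 / d) *\<^sub>v unit_vec N s = unit_vec N s" if s: "s < N" "s \<notin> I" for s
    proof -
      have "N - Suc s \<notin> I" using I(2)[of "N - Suc s"] s by auto
      moreover from this have "N - Suc s \<noteq> r" using r by auto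
      ultimately have "w $ (N - Suc s) = 0" using v0[of "N - Suc s"] s rN vc by (simp add: w_def)
      then show ?thesis unfolding refl_mat_vec[OF w unit_vec_carrier]
        using s w by (intro eq_vecI) (auto simp: form_unit_right)
    qed
    moreover have "refl_mat N w (1 / d) *\<^sub>v v = 1 \<cdot>\<^sub>v unit_vec N r"
      unfolding refl_mat_vec[OF w vc] wv using d vc by (intro eq_vecI) (auto simp: w_def)
    ultimately show ?thesis by (intro exI[of _ "refl_mat N w (1 / d)"] exI[of _ 1]) (simp add: good_def)
  next
    case add
    have pr: "p \<noteq> r" using add p by auto
    \<comment> \<open>This is what the third case was set up for: if \<open>p\<close> were the
      mirror of \<open>r\<close>, both would be on level 1 and the mirrored coordinate would be the
      nonzero \<open>v $ p\<close>.\<close>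
    have pr': "N - Suc p \<noteq> r"
    proof
      assume "N - Suc p = r"
      then have "p = N - Suc r" "\<beta> r = 2 - \<beta> p" using p(1) \<beta>_rev[OF p(1)] by auto
      then show False using add(2) p r(2) by auto
    qed
    let ?e = "unit_vec N r :: 'k vec"
    let ?y = "trans_mat N p ?e 0"
    have ee: "form N ?e ?e = 0" using rN rev_neq[OF rN] by (simp add: form_unit_left)
    have "?y \<in> carrier (U q n)" using p pr rN by (intro trans_mat_U) (auto simp: ee)
    moreover have "upper \<beta> ?y"
      unfolding upper_def
    proof (intro allI impI)
      fix s t assume "s < dim_row ?y" "t < dim_col ?y" and lt: "\<beta> t < \<beta> s"
      then have st: "s < N" "t < N" by (auto simp: trans_mat_def)
      have "t \<noteq> p \<or> s \<noteq> r" using lt r(2) by auto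
      moreover have "s \<noteq> N - Suc p \<or> N - Suc t \<noteq> r"
        using lt r(2) \<beta>_rev[OF st(2)] \<beta>_rev[OF p(1)] \<beta>_le[OF st(2)] \<beta>_le[OF p(1)] by auto
      ultimately show "?y $$ (s, t) = 0" using st lt rN by (auto simp: trans_mat_def)
    qed
    moreover have "?y *\<^sub>v unit_vec N s = unit_vec N s" if s: "s < N" "s \<notin> I" for s
    proof -
      have "s \<noteq> p" "N - Suc s \<noteq> r" using I(2)[of "N - Suc s"] s r pI by auto
      then show ?thesis unfolding trans_mat_vec[OF p(1) unit_vec_carrier unit_vec_carrier]
        using s p rN by (intro eq_vecI) (auto simp: form_unit_right)
    qed
    ultimately have y: "good I ?y" by (simp add: good_def)
    let ?v = "?y *\<^sub>v v"
    have vr: "?v $ r = v $ p"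
      unfolding trans_mat_vec[OF p(1) unit_vec_carrier vc] using rN pr' vc add(1) by simp
    have v1: "?v \<in> coords I" by (rule good_coords[OF y I(2) v(1)])
    have v2: "form N ?v ?v = 0" using U_isometry[OF _ vc vc, of ?y] y v(2) by (simp add: good_def)
    have v3: "\<beta> t \<le> \<beta> r" if "t < N" "?v $ t \<noteq> 0" for t
      using upper_mult_vec[OF good_carrier[OF y] _ vc _ that, of "\<beta> p"] y l r(2) by (auto simp: good_def)
    obtain y' where y': "good I y'" "y' *\<^sub>v ?v = ?v $ r \<cdot>\<^sub>v unit_vec N r"
      using clear_column[OF I v1 v2 r(1) _ v3] vr p(2) by auto
    have "(y' * ?y) *\<^sub>v v = v $ p \<cdot>\<^sub>v unit_vec N r"
      using assoc_mult_mat_vec[OF good_carrier[OF y'(1)] good_carrier[OF y] vc] y'(2) vr by simp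
    then show ?thesis using good_mult[OF y'(1) y] p(2) by blast
  qed
qed


text \<open>A Witt-type reduction that respects the flag. A vector of \<open>W\<close> is moved to
  the unit vector of an index \<open>r\<close>; the rest of \<open>W\<close> may be taken with
  coordinate \<open>r\<close> zero, its coordinate at the mirror of \<open>r\<close> is zero by
  isotropy, and both indices leave \<open>I\<close>. Taking \<open>r\<close> least on its level
  makes \<open>S\<close> an initial segment of every level, so that one permutation matrix per
  triple of dimensions suffices.\<close>

lemma isotropic_reduction:
  assumes "I \<subseteq> {..<N}" "\<And>r. r \<in> I \<Longrightarrow> N - Suc r \<in> I"
    and "W \<subseteq> coords I" "0\<^sub>v N \<in> W" "\<And>x y. x \<in> W \<Longrightarrow> y \<in> W \<Longrightarrow> x + y \<in> W"
    "\<And>a x. x \<in> W \<Longrightarrow> a \<cdot>\<^sub>v x \<in> W" "\<And>x y. x \<in> W \<Longrightarrow> y \<in> W \<Longrightarrow> form N x y = 0"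
  shows "\<exists>y S. good I y \<and> S \<subseteq> I \<and> (\<forall>s \<in> S. N - Suc s \<notin> S) \<and>
    (\<forall>s \<in> S. \<forall>t \<in> I. \<beta> t = \<beta> s \<and> t < s \<longrightarrow> t \<in> S) \<and> (\<lambda>v. y *\<^sub>v v) ` W = coords S"
  using assms
proof (induction "card I" arbitrary: I W rule: less_induct)
  case less
  note I = less.prems(1,2) and WI = less.prems(3) and W = less.prems(4-6) and iso = less.prems(7)
  have Wc: "x \<in> carrier_vec N" if "x \<in> W" for x using that WI by (auto simp: coords_def)
  show ?case
  proof (cases "W \<subseteq> {0\<^sub>v N}")
    case True
    then have "W = {0\<^sub>v N}" using W by auto
    moreover have "coords {} = {0\<^sub>v N}" by (auto simp: coords_def)
    ultimately show ?thesis by (intro exI[of _ "1\<^sub>m N"] exI[of _ "{}"]) (simp add: good_one)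
  next
    case False
    then obtain v where v: "v \<in> W" "v \<noteq> 0\<^sub>v N" by auto
    define L where "L = \<beta> ` {t \<in> {..<N}. v $ t \<noteq> 0}"
    have "L \<noteq> {}" using v Wc[OF v(1)] by (auto simp: L_def)
    moreover have "finite L" by (simp add: L_def)
    ultimately have L: "Max L \<in> L" "\<And>l. l \<in> L \<Longrightarrow> l \<le> Max L" by auto
    then obtain p where p: "p < N" "v $ p \<noteq> 0" "Max L = \<beta> p" unfolding L_def by blast
    then have pmax: "\<beta> t \<le> \<beta> p" if "t < N" "v $ t \<noteq> 0" for t
      using that L(2)[of "\<beta> t"] by (auto simp: L_def)
    have pI: "p \<in> I" using p v(1) WI by (auto simp: coords_def)
    define R where "R = {t \<in> I. \<beta> t = \<beta> p}"
    have finI: "finite I" using I(1) finite_subset by blast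
    then have finR: "finite R" "R \<noteq> {}" using pI by (auto simp: R_def)
    define r where "r = Min R"
    have "r \<in> R" using finR Min_in r_def by blast
    then have r: "r \<in> I" "\<beta> r = \<beta> p" by (auto simp: R_def)
    have rmin: "r \<le> t" if "t \<in> I" "\<beta> t = \<beta> p" for t
      using that finR by (auto simp: R_def r_def)
    obtain y1 \<kappa> where y1: "good I y1" and \<kappa>: "\<kappa> \<noteq> 0" "y1 *\<^sub>v v = \<kappa> \<cdot>\<^sub>v unit_vec N r"
      using move_to_unit_vec[OF I _ iso[OF v(1) v(1)] p(1,2) pmax r] v(1) WI by auto
    define r' where "r' = N - Suc r"
    have rN: "r < N" "r' < N" "r \<noteq> r'" "N - Suc r' = r" "r' \<in> I" "\<beta> r' = 2 - \<beta> r"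
      using r I rev_neq[of r] \<beta>_rev[of r] by (auto simp: r'_def)
    let ?e = "unit_vec N r :: 'k vec"
    note yc = good_carrier[OF y1]
    define W1 where "W1 = (\<lambda>v. y1 *\<^sub>v v) ` W"
    have W1I: "W1 \<subseteq> coords I" using good_coords[OF y1 I(2)] WI by (auto simp: W1_def)
    then have W1c: "x \<in> carrier_vec N" if "x \<in> W1" for x using that by (auto simp: coords_def)
    have W1add: "x + y \<in> W1" if xy1: "x \<in> W1" "y \<in> W1" for x y
    proof -
      obtain x' y' where xy: "x' \<in> W" "y' \<in> W" "x = y1 *\<^sub>v x'" "y = y1 *\<^sub>v y'" using xy1 by (auto simp: W1_def)
      then have "x + y = y1 *\<^sub>v (x' + y')" using Wc yc by (simp add: mult_add_distrib_mat_vec[of _ N N])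
      then show ?thesis using W(2) xy by (auto simp: W1_def)
    qed
    have W1smult: "a \<cdot>\<^sub>v x \<in> W1" if x1: "x \<in> W1" for a x
    proof -
      obtain x' where x: "x' \<in> W" "x = y1 *\<^sub>v x'" using x1 by (auto simp: W1_def)
      then have "a \<cdot>\<^sub>v x = y1 *\<^sub>v (a \<cdot>\<^sub>v x')" using Wc yc by (simp add: mult_mat_vec[of _ N N])
      then show ?thesis using W(3) x by (auto simp: W1_def)
    qed
    have W1iso: "form N x y = 0" if "x \<in> W1" "y \<in> W1" for x y
      using that iso U_isometry[of y1 n] y1 Wc by (auto simp: W1_def good_def)
    have e1: "a \<cdot>\<^sub>v ?e \<in> W1" for a
    proof -
      have "a \<cdot>\<^sub>v ?e = (a / \<kappa>) \<cdot>\<^sub>v (y1 *\<^sub>v v)" using \<kappa> by (auto simp: smult_smult_assoc)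
      then show ?thesis using W1smult[of "y1 *\<^sub>v v"] v by (auto simp: W1_def)
    qed
    define W' where "W' = {x \<in> W1. x $ r = 0}"
    let ?I = "I - {r, r'}"
    have split: "x = (x + (- x $ r) \<cdot>\<^sub>v ?e) + x $ r \<cdot>\<^sub>v ?e" "x + (- x $ r) \<cdot>\<^sub>v ?e \<in> W'" if "x \<in> W1" for x
    proof -
      show "x = (x + (- x $ r) \<cdot>\<^sub>v ?e) + x $ r \<cdot>\<^sub>v ?e" using W1c[OF that] by (intro eq_vecI) auto
      show "x + (- x $ r) \<cdot>\<^sub>v ?e \<in> W'"
        using W1add[OF that e1] W1c[OF that] rN by (simp add: W'_def)
    qed
    have card: "card ?I < card I" using finI r by (intro psubset_card_mono) auto
    have I2: "N - Suc t \<in> ?I" if "t \<in> ?I" for t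
    proof -
      have "t < N" "N - Suc t \<in> I" using that I by auto
      moreover have "N - Suc (N - Suc t) = t" using \<open>t < N\<close> by simp
      ultimately show ?thesis using that rN by (auto simp: r'_def)
    qed
    have W'c: "W' \<subseteq> coords ?I"
    proof
      fix x assume x: "x \<in> W'"
      then have "x $ r' = form N ?e x" using rN by (simp add: form_unit_left r'_def)
      also have "\<dots> = 0" using W1iso[OF e1[of 1]] x by (simp add: W'_def)
      finally have "x $ r' = 0" .
      then show "x \<in> coords ?I" using x W1I by (auto simp: W'_def coords_def)
    qed
    have "\<exists>y S. good ?I y \<and> S \<subseteq> ?I \<and> (\<forall>s \<in> S. N - Suc s \<notin> S) \<and>
      (\<forall>s \<in> S. \<forall>t \<in> ?I. \<beta> t = \<beta> s \<and> t < s \<longrightarrow> t \<in> S) \<and> (\<lambda>v. y *\<^sub>v v) ` W' = coords S"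
    proof (rule less.hyps[OF card])
      show "?I \<subseteq> {..<N}" using I by auto
      have "0 \<cdot>\<^sub>v ?e = 0\<^sub>v N" by (intro eq_vecI) auto
      then show "0\<^sub>v N \<in> W'" using e1[of 0] rN(1) by (simp add: W'_def)
      show "x + y \<in> W'" if "x \<in> W'" "y \<in> W'" for x y
        using that W1add W1c[of y] rN(1) by (simp add: W'_def)
      show "a \<cdot>\<^sub>v x \<in> W'" if "x \<in> W'" for a x
        using that W1smult W1c[of x] rN(1) by (simp add: W'_def)
    qed (use I2 W'c W1iso in \<open>auto simp: W'_def\<close>)
    then obtain y' S' where y': "good ?I y'" and S0: "S' \<subseteq> ?I" "\<forall>s \<in> S'. N - Suc s \<notin> S'"
      "\<forall>s \<in> S'. \<forall>t \<in> ?I. \<beta> t = \<beta> s \<and> t < s \<longrightarrow> t \<in> S'" "(\<lambda>v. y' *\<^sub>v v) ` W' = coords S'"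
      by (elim exE conjE) (rule that; assumption)
    have S': "S' \<subseteq> ?I" "\<And>s. s \<in> S' \<Longrightarrow> N - Suc s \<notin> S'"
      "\<And>s t. s \<in> S' \<Longrightarrow> t \<in> ?I \<Longrightarrow> \<beta> t = \<beta> s \<Longrightarrow> t < s \<Longrightarrow> t \<in> S'" "(\<lambda>v. y' *\<^sub>v v) ` W' = coords S'"
      by (rule S0(1), erule S0(2)[rule_format], rule S0(3)[rule_format], (simp only: simp_thms)+) (rule S0(4))
    have y'e: "y' *\<^sub>v ?e = ?e" using y' rN by (simp add: good_def)
    note y'c = good_carrier[OF y']
    let ?S = "insert r S'"
    have y'x: "y' *\<^sub>v (x + a \<cdot>\<^sub>v ?e) = y' *\<^sub>v x + a \<cdot>\<^sub>v ?e" if "x \<in> carrier_vec N" for x a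
      using that y'c y'e by (simp add: mult_add_distrib_mat_vec[of _ N N] mult_mat_vec[of _ N N])
    have im: "(\<lambda>v. y' *\<^sub>v v) ` W1 = coords ?S"
    proof (intro equalityI subsetI)
      fix z assume "z \<in> (\<lambda>v. y' *\<^sub>v v) ` W1"
      then obtain x where x: "x \<in> W1" "z = y' *\<^sub>v x" by auto
      let ?x = "x + (- x $ r) \<cdot>\<^sub>v ?e"
      have "z = y' *\<^sub>v ?x + x $ r \<cdot>\<^sub>v ?e"
        using y'x[of ?x "x $ r"] split(1)[OF x(1)] x(2) W1c[OF x(1)] by simp
      moreover have "y' *\<^sub>v ?x \<in> coords S'" using split(2)[OF x(1)] S'(4) by auto
      ultimately show "z \<in> coords ?S" using rN(1) by (auto simp: coords_def)
    next
      fix z assume z: "z \<in> coords ?S"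
      then have zc: "z \<in> carrier_vec N" by (simp add: coords_def)
      have "z + (- z $ r) \<cdot>\<^sub>v ?e \<in> coords S'" using z rN(1) by (auto simp: coords_def)
      then obtain x where x: "x \<in> W'" "z + (- z $ r) \<cdot>\<^sub>v ?e = y' *\<^sub>v x" using S'(4) by (metis imageE)
      have "y' *\<^sub>v (x + z $ r \<cdot>\<^sub>v ?e) = (z + (- z $ r) \<cdot>\<^sub>v ?e) + z $ r \<cdot>\<^sub>v ?e"
        using y'x x W1c by (simp add: W'_def)
      also have "\<dots> = z" using zc by (intro eq_vecI) auto
      finally show "z \<in> (\<lambda>v. y' *\<^sub>v v) ` W1"
        using W1add[OF _ e1] x(1) by (intro image_eqI[of _ _ "x + z $ r \<cdot>\<^sub>v ?e"]) (auto simp: W'_def)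
    qed
    have "(\<lambda>v. (y' * y1) *\<^sub>v v) ` W = (\<lambda>v. y' *\<^sub>v v) ` W1"
      unfolding W1_def image_image using assoc_mult_mat_vec[OF y'c yc] Wc by (intro image_cong) auto
    moreover have "good I (y' * y1)" using good_mult[OF good_mono[OF y'] y1] by blast
    moreover have "?S \<subseteq> I" using S'(1) r(1) by blast
    moreover have "\<forall>s \<in> ?S. N - Suc s \<notin> ?S"
    proof
      fix s assume s: "s \<in> ?S"
      have r'S: "r' \<notin> S'" "r \<notin> S'" using S'(1) by blast+
      show "N - Suc s \<notin> ?S"
      proof (cases "s = r")
        case True
        then show ?thesis using r'S rN(3) by (simp add: r'_def[symmetric])
      next
        case False
        then have sS: "s \<in> S'" using s by simp
        then have "s < N" using S'(1) I(1) by blast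
        then have "N - Suc (N - Suc s) = s" by simp
        then have "N - Suc s \<noteq> r" using sS r'S(1) unfolding r'_def by metis
        then show ?thesis using S'(2)[OF sS] by simp
      qed
    qed
    moreover have "t \<in> ?S" if "s \<in> ?S" "t \<in> I" "\<beta> t = \<beta> s" "t < s" for s t
    proof (cases "s = r")
      case True
      then show ?thesis using rmin[of t] that r by auto
    next
      case False
      then have s: "s \<in> S'" using that by auto
      show ?thesis
      proof (cases "t \<in> ?I")
        case True
        then show ?thesis using S'(3)[OF s True that(3,4)] by simp
      next
        case t: False
        \<comment> \<open>An \<open>s\<close> above the removed mirror \<open>r'\<close> on the same
          level would have its own mirror below \<open>r\<close> on the level of \<open>r\<close>,
          against the minimality of \<open>r\<close>.\<close>
        have "t \<noteq> r'"
        proof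
          assume t': "t = r'"
          have sI: "s \<in> I" "s < N" "N - Suc s \<in> I" using s S'(1) I by auto
          have "N - Suc s < r" using that(4) t' rN sI by (auto simp: r'_def)
          moreover have "\<beta> (N - Suc s) = \<beta> p"
            using \<beta>_rev[OF sI(2)] that(3) t' rN(6) \<beta>_le[OF rN(1)] r(2) by auto
          ultimately show False using rmin[OF sI(3)] by simp
        qed
        then show ?thesis using t that(2) by auto
      qed
    qed
    ultimately show ?thesis using im by (intro exI[of _ "y' * y1"] exI[of _ ?S]) auto
  qed
qed

end

section \<open>Restriction for the unitary groups\<close>

definition diag3 :: "'k::zero mat \<Rightarrow> 'k mat \<Rightarrow> 'k mat \<Rightarrow> 'k mat" where
  "diag3 A B C = diag2 A (diag2 B C)"

lemma diag3_carrier: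
  "A \<in> carrier_mat i i \<Longrightarrow> B \<in> carrier_mat (2 * j) (2 * j) \<Longrightarrow> C \<in> carrier_mat i i \<Longrightarrow>
    diag3 A B C \<in> carrier_mat (2 * (i + j)) (2 * (i + j))"
  by (auto simp: diag3_def intro!: carrier_matI)

lemma diag3_dim [simp]: "dim_row (diag3 A B C) = dim_row A + (dim_row B + dim_row C)"
  "dim_col (diag3 A B C) = dim_col A + (dim_col B + dim_col C)"
  by (simp_all add: diag3_def)

lemma diag3_index:
  assumes "A \<in> carrier_mat i i" "B \<in> carrier_mat j j" "C \<in> carrier_mat k k" "r < i + j + k" "s < i + j + k"
  shows "diag3 A B C $$ (r, s) = (if r < i \<and> s < i then A $$ (r, s)
     else if i \<le> r \<and> i \<le> s \<and> r < i + j \<and> s < i + j then B $$ (r - i, s - i)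
     else if i + j \<le> r \<and> i + j \<le> s then C $$ (r - (i + j), s - (i + j)) else 0)"
proof -
  have "diag3 A B C $$ (r, s) =
      (if r < i \<and> s < i then A $$ (r, s) else if i \<le> r \<and> i \<le> s then diag2 B C $$ (r - i, s - i) else 0)"
    unfolding diag3_def using assms by (intro diag2_index[where j = "j + k"]) auto
  moreover have "diag2 B C $$ (r - i, s - i) =
    (if r - i < j \<and> s - i < j then B $$ (r - i, s - i)
     else if j \<le> r - i \<and> j \<le> s - i then C $$ (r - i - j, s - i - j) else 0)" if "i \<le> r" "i \<le> s"
    using assms that by (intro diag2_index) auto
  ultimately show ?thesis by auto
qed

lemma diag_part_diag3:
  assumes "A \<in> carrier_mat i i" "B \<in> carrier_mat j j" "C \<in> carrier_mat k k"
  shows "diag_part 0 i (diag3 A B C) = A" "diag_part i j (diag3 A B C) = B" "diag_part (i + j) k (diag3 A B C) = C"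
  using assms by (auto intro!: eq_matI simp: diag3_index[OF assms])

lemma diag3_mult:
  fixes A :: "'k::comm_ring_1 mat"
  assumes "A \<in> carrier_mat i i" "B \<in> carrier_mat j j" "C \<in> carrier_mat k k"
    "A' \<in> carrier_mat i i" "B' \<in> carrier_mat j j" "C' \<in> carrier_mat k k"
  shows "diag3 A B C * diag3 A' B' C' = diag3 (A * A') (B * B') (C * C')"
  using assms by (simp add: diag3_def diag2_mult[of _ i _ "j + k"] diag2_mult[of _ j _ k])

lemma diag3_one: "diag3 (1\<^sub>m i) (1\<^sub>m j) (1\<^sub>m k) = 1\<^sub>m (i + (j + k))"
  by (simp add: diag3_def diag2_one)

lemma flip_diag3:
  assumes "A \<in> carrier_mat i i" "B \<in> carrier_mat j j" "C \<in> carrier_mat i i" "f 0 = 0"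
  shows "flip f (diag3 A B C) = diag3 (flip f C) (flip f B) (flip f A)"
proof (rule eq_matI)
  fix r s assume "r < dim_row (diag3 (flip f C) (flip f B) (flip f A))" "s < dim_col (diag3 (flip f C) (flip f B) (flip f A))"
  then have rs: "r < i + j + i" "s < i + j + i" using assms by auto
  define r' s' where "r' = i + j + i - Suc r" and "s' = i + j + i - Suc s"
  then have e: "r' + Suc r = i + j + i" "s' + Suc s = i + j + i" using rs by auto
  then have rs': "r' < i + j + i" "s' < i + j + i" by auto
  have l: "flip f (diag3 A B C) $$ (r, s) = f (diag3 A B C $$ (s', r'))"
    using rs assms by (auto simp: r'_def s'_def ac_simps)
  note L = diag3_index[OF assms(1-3) rs'(2,1)]
  note R = diag3_index[OF flip_carrier[OF assms(3)] flip_carrier[OF assms(2)] flip_carrier[OF assms(1)] rs, of f f f]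
  consider (1) "r < i" "s < i" | (2) "i \<le> r" "r < i + j" "i \<le> s" "s < i + j" | (3) "i + j \<le> r" "i + j \<le> s"
    | (4) "\<not> (r < i \<and> s < i)" "\<not> (i \<le> r \<and> r < i + j \<and> i \<le> s \<and> s < i + j)" "\<not> (i + j \<le> r \<and> i + j \<le> s)"
    by linarith
  then show "flip f (diag3 A B C) $$ (r, s) = diag3 (flip f C) (flip f B) (flip f A) $$ (r, s)"
  proof cases
    case 1
    have "r' - (i + j) = i - Suc r" "s' - (i + j) = i - Suc s" "i + j \<le> r'" "i + j \<le> s'" using e 1 by auto
    then show ?thesis unfolding l L R using 1 assms by simp
  next
    case 2
    have "r' - i = j - Suc (r - i)" "s' - i = j - Suc (s - i)" "r - i < j" "s - i < j"
      "i \<le> r'" "i \<le> s'" "r' < i + j" "s' < i + j" using e 2 by auto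
    then show ?thesis unfolding l L R using 2 assms by simp
  next
    case 3
    have "r' = i - Suc (r - (i + j))" "s' = i - Suc (s - (i + j))" "r - (i + j) < i" "s - (i + j) < i" "r' < i" "s' < i"
      using e 3 by auto
    then show ?thesis unfolding l L R using 3 assms by simp
  next
    case 4
    have "\<not> (s' < i \<and> r' < i)" "\<not> (i \<le> s' \<and> i \<le> r' \<and> s' < i + j \<and> r' < i + j)" "\<not> (i + j \<le> s' \<and> i + j \<le> r')"
      using e 4 by linarith+
    then show ?thesis unfolding l L R using 4 assms(4) by auto
  qed
qed (use assms in auto)

lemma upper_diag3_iff:
  assumes c: "A \<in> carrier_mat i i" "B \<in> carrier_mat j j" "C \<in> carrier_mat k k"
  shows "upper \<gamma> (diag3 A B C) \<longleftrightarrow> upper \<gamma> A \<and> upper (\<lambda>r. \<gamma> (i + r)) B \<and> upper (\<lambda>r. \<gamma> (i + j + r)) C"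
proof (intro iffI conjI)
  note D = diag3_index[OF c]
  assume u: "upper \<gamma> (diag3 A B C)"
  have u': "diag3 A B C $$ (r, s) = 0" if "r < i + j + k" "s < i + j + k" "\<gamma> s < \<gamma> r" for r s
    using u c that unfolding upper_def by auto
  show "upper \<gamma> A" unfolding upper_def
  proof (intro allI impI)
    fix r s assume "r < dim_row A" "s < dim_col A" "\<gamma> s < \<gamma> r"
    then show "A $$ (r, s) = 0" using u'[of r s] c by (simp add: D)
  qed
  show "upper (\<lambda>r. \<gamma> (i + r)) B" unfolding upper_def
  proof (intro allI impI)
    fix r s assume "r < dim_row B" "s < dim_col B" "\<gamma> (i + s) < \<gamma> (i + r)"
    then show "B $$ (r, s) = 0" using u'[of "i + r" "i + s"] c by (simp add: D)
  qed
  show "upper (\<lambda>r. \<gamma> (i + j + r)) C" unfolding upper_def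
  proof (intro allI impI)
    fix r s assume "r < dim_row C" "s < dim_col C" "\<gamma> (i + j + s) < \<gamma> (i + j + r)"
    then show "C $$ (r, s) = 0" using u'[of "i + j + r" "i + j + s"] c by (simp add: D)
  qed
next
  assume u: "upper \<gamma> A \<and> upper (\<lambda>r. \<gamma> (i + r)) B \<and> upper (\<lambda>r. \<gamma> (i + j + r)) C"
  show "upper \<gamma> (diag3 A B C)"
    unfolding upper_def
  proof (intro allI impI)
    fix r s assume "r < dim_row (diag3 A B C)" "s < dim_col (diag3 A B C)" and lt: "\<gamma> s < \<gamma> r"
    then have rs: "r < i + j + k" "s < i + j + k" using c by auto
    have "B $$ (r - i, s - i) = 0" if "i \<le> r" "i \<le> s" "r < i + j" "s < i + j"
      using u that lt c unfolding upper_def by auto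
    moreover have "C $$ (r - (i + j), s - (i + j)) = 0" if "i + j \<le> r" "i + j \<le> s"
      using u that lt c rs unfolding upper_def by auto
    moreover have "A $$ (r, s) = 0" if "r < i" "s < i"
      using u that lt c unfolding upper_def by auto
    ultimately show "diag3 A B C $$ (r, s) = 0" by (simp add: diag3_index[OF c rs])
  qed
qed

lemma diag_block_mat_triple:
  assumes "A \<in> carrier_mat i i" "B \<in> carrier_mat j j" "C \<in> carrier_mat k k"
  shows "diag_block_mat [A, B, C] = diag3 A B C"
proof -
  have "diag_block_mat [A, B, C] = diag2 A (diag_block_mat [B, C])"
    by (simp only: diag_block_mat.simps(2)[of A] Let_def diag2_def)
  then show ?thesis using diag_block_mat_pair[OF assms(2,3)] by (simp add: diag3_def)
qed

lemma upper_const [simp]: "upper (\<lambda>_. l) X"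
  by (simp add: upper_def)

lemma mat_add_minus:
  fixes A :: "'k::ab_group_add mat"
  assumes "A \<in> carrier_mat n m" "B \<in> carrier_mat n m"
  shows "A + B - A = B" "A + (B - A) = B"
  using assms by (auto intro!: eq_matI)

context unitary
begin

abbreviation \<omega> :: "'k mat \<Rightarrow> 'k mat" where
  "\<omega> X \<equiv> - flip c X"

text \<open>The condition \<open>upper \<gamma>\<close> cuts out the part of a fibre that lies in a
  second parabolic subalgebra. A constant \<open>\<gamma>\<close> imposes nothing and gives the
  fibre over which restriction averages.\<close>

definition u_fiber :: "nat \<Rightarrow> nat \<Rightarrow> (nat \<Rightarrow> nat) \<Rightarrow> 'k mat \<Rightarrow> 'k mat \<Rightarrow> 'k mat set" where
  "u_fiber i j \<gamma> A B = {X \<in> u q (i + j). upper (block_of [i, 2 * j, i]) X \<and> upper \<gamma> X \<and>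
     diag_part 0 i X = A \<and> diag_part i (2 * j) X = B}"

definition u_nil :: "nat \<Rightarrow> nat \<Rightarrow> (nat \<Rightarrow> nat) \<Rightarrow> 'k mat set" where
  "u_nil i j \<gamma> = {Z \<in> nilradical (u q (i + j)) [i, 2 * j, i]. upper \<gamma> Z}"

lemma finite_u [simp]: "finite (u q n :: 'k mat set)"
  by (rule finite_subset[OF _ finite_carrier_mat[of "2 * n" "2 * n"]]) (auto simp: u_iff)

lemma finite_u_fiber [simp]: "finite (u_fiber i j \<gamma> A B)"
  by (simp add: u_fiber_def)

lemma flip_c_add: "X \<in> carrier_mat n n \<Longrightarrow> Y \<in> carrier_mat n n \<Longrightarrow> flip c (X + Y) = flip c X + flip c Y"
  by (auto intro!: eq_matI simp: c_add)

lemma flip_c_uminus: "X \<in> carrier_mat n n \<Longrightarrow> flip c (- X) = - flip c X"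
  by (auto intro!: eq_matI)

lemma flip_c_minus: "X \<in> carrier_mat n n \<Longrightarrow> Y \<in> carrier_mat n n \<Longrightarrow> flip c (X - Y) = flip c X - flip c Y"
  by (auto intro!: eq_matI simp: c_diff)

lemma \<omega>_carrier [simp]: "X \<in> carrier_mat n n \<Longrightarrow> \<omega> X \<in> carrier_mat n n"
  by simp

lemma u_iff_\<omega>: "X \<in> u q n \<longleftrightarrow> X \<in> carrier_mat (2 * n) (2 * n) \<and> \<omega> X = X"
  unfolding u_iff by (metis uminus_uminus_mat)

lemma u_add: "(X :: 'k mat) \<in> u q n \<Longrightarrow> Y \<in> u q n \<Longrightarrow> X + Y \<in> u q n"
  by (auto simp: u_iff flip_c_add[of _ "2 * n"] intro!: eq_matI)

lemma u_minus: "(X :: 'k mat) \<in> u q n \<Longrightarrow> Y \<in> u q n \<Longrightarrow> X - Y \<in> u q n"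
  by (auto simp: u_iff flip_c_minus[of _ "2 * n"] intro!: eq_matI)

lemma diag3_u:
  assumes A: "A \<in> carrier_mat i i" and B: "B \<in> u q j"
  shows "diag3 A B (\<omega> A) \<in> u q (i + j)"
proof -
  have Bc: "B \<in> carrier_mat (2 * j) (2 * j)" "flip c B = - B" using B by (auto simp: u_iff)
  have "flip c (diag3 A B (\<omega> A)) = diag3 (flip c (\<omega> A)) (flip c B) (flip c A)"
    using A Bc by (intro flip_diag3) auto
  also have "\<dots> = diag3 (- A) (- B) (- \<omega> A)"
    using A Bc by (simp add: flip_c_uminus[of _ i] flip_c_flip_c[of _ i])
  also have "\<dots> = - diag3 A B (\<omega> A)"
    using A Bc by (intro eq_matI) (auto simp: diag3_index[of _ i _ "2 * j" _ i])
  finally show ?thesis using diag3_carrier[OF A Bc(1) \<omega>_carrier[OF A]] by (simp add: u_iff)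
qed

text \<open>The origin of the twist: a matrix in \<open>u\<close> is fixed by
  \<open>\<omega>\<close>, and \<open>\<omega>\<close> exchanges mirrored diagonal blocks up to
  twisting them.\<close>

lemma diag_part_\<omega>:
  assumes "(X :: 'k mat) \<in> u q n" "k + m + k' = 2 * n"
  shows "diag_part k m X = \<omega> (diag_part k' m X)"
proof -
  have X: "X \<in> carrier_mat (2 * n) (2 * n)" "\<omega> X = X" using assms(1) by (auto simp: u_iff_\<omega>)
  have "diag_part k m X = diag_part k m (\<omega> X)" by (simp add: X)
  also have "\<dots> = - diag_part k m (flip c X)" using X(1) assms(2) by (intro eq_matI) auto
  finally show ?thesis using diag_part_flip[OF X(1) assms(2)] by simp
qed

lemma diag_part_u: "(X :: 'k mat) \<in> u q n \<Longrightarrow> k + 2 * m + k = 2 * n \<Longrightarrow> diag_part k (2 * m) X \<in> u q m"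
  using diag_part_\<omega>[of X n k "2 * m" k] by (simp add: u_iff_\<omega>)

text \<open>Translation by the Levi element. Whenever that element satisfies the second
  triangularity condition, the size of the fibre is therefore independent of \<open>A\<close> and
  \<open>B\<close>.\<close>

lemma bij_u_nil_fiber:
  assumes A: "A \<in> carrier_mat i i" and B: "B \<in> u q j" and up: "upper \<gamma> (diag3 A B (\<omega> A))"
  shows "bij_betw (\<lambda>Z. diag3 A B (\<omega> A) + Z) (u_nil i j \<gamma>) (u_fiber i j \<gamma> A B)"
proof -
  let ?L = "diag3 A B (\<omega> A)" and ?N = "2 * (i + j)" and ?b = "block_of [i, 2 * j, i]"
  have Bc: "B \<in> carrier_mat (2 * j) (2 * j)" using B by (auto simp: u_iff)
  have L: "?L \<in> u q (i + j)" by (rule diag3_u[OF A B])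
  have Lc: "?L \<in> carrier_mat ?N ?N" using L by (simp add: u_iff)
  have Li: "?L $$ (r, s) = (if r < i \<and> s < i then A $$ (r, s)
     else if i \<le> r \<and> i \<le> s \<and> r < i + 2 * j \<and> s < i + 2 * j then B $$ (r - i, s - i)
     else if i + 2 * j \<le> r \<and> i + 2 * j \<le> s then \<omega> A $$ (r - (i + 2 * j), s - (i + 2 * j)) else 0)"
    if "r < ?N" "s < ?N" for r s
    using that by (intro diag3_index[OF A Bc \<omega>_carrier[OF A]]) auto
  have up': "?L $$ (r, s) = 0" if "r < ?N" "s < ?N" "\<gamma> s < \<gamma> r" for r s
    using up that carrier_matD[OF Lc] unfolding upper_def by metis
  show ?thesis
  proof (rule bij_betwI[where g = "\<lambda>X. X - ?L"])
    show "(\<lambda>Z. ?L + Z) \<in> u_nil i j \<gamma> \<rightarrow> u_fiber i j \<gamma> A B"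
    proof
      fix Z assume Z: "Z \<in> u_nil i j \<gamma>"
      then have Zu: "Z \<in> u q (i + j)" "upper \<gamma> Z" and "strictly_block_upper [i, 2 * j, i] Z"
        by (auto simp: u_nil_def nilradical_def)
      moreover have Zc: "Z \<in> carrier_mat ?N ?N" using Zu by (simp add: u_iff)
      ultimately have Z0: "Z $$ (r, s) = 0" if "r < ?N" "s < ?N" "?b s \<le> ?b r" for r s
        using that by (simp add: strictly_block_upper_def del: block_of.simps)
      have "upper ?b (?L + Z)" unfolding upper_def
      proof (intro allI impI)
        fix r s assume "r < dim_row (?L + Z)" "s < dim_col (?L + Z)" and lt: "?b s < ?b r"
        then have rs: "r < ?N" "s < ?N" using Zc by auto
        then show "(?L + Z) $$ (r, s) = 0"
          using Zc Lc Z0[OF rs less_imp_le[OF lt]] lt by (auto simp: Li split: if_splits)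
      qed
      moreover have "upper \<gamma> (?L + Z)"
        using up' Zu(2) Zc Lc unfolding upper_def by (auto simp del: diag3_dim)
      moreover have "diag_part 0 i (?L + Z) = A"
        using Zc Z0 A Lc by (intro eq_matI) (auto simp: Li)
      moreover have "diag_part i (2 * j) (?L + Z) = B"
        using Zc Z0 Bc Lc by (intro eq_matI) (auto simp: Li)
      ultimately show "?L + Z \<in> u_fiber i j \<gamma> A B"
        using u_add[OF L Zu(1)] by (simp add: u_fiber_def del: block_of.simps)
    qed
    show "(\<lambda>X. X - ?L) \<in> u_fiber i j \<gamma> A B \<rightarrow> u_nil i j \<gamma>"
    proof
      fix X assume X: "X \<in> u_fiber i j \<gamma> A B"
      then have Xu: "X \<in> u q (i + j)" and ux: "upper ?b X" "upper \<gamma> X"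
        and d: "diag_part 0 i X = A" "diag_part i (2 * j) X = B" by (auto simp: u_fiber_def)
      have Xc: "X \<in> carrier_mat ?N ?N" using Xu by (simp add: u_iff)
      have d3: "diag_part (i + 2 * j) i X = \<omega> A"
        using diag_part_\<omega>[OF Xu, of "i + 2 * j" i 0] d(1) by simp
      have "(X - ?L) $$ (r, s) = 0" if rs: "r < ?N" "s < ?N" "?b s \<le> ?b r" for r s
      proof -
        have XL: "(X - ?L) $$ (r, s) = X $$ (r, s) - ?L $$ (r, s)"
          using rs(1,2) carrier_matD[OF Lc] by (intro index_minus_mat(1)) (simp_all only:)
        have be: "?b t = (if t < i then 0 else if t < i + 2 * j then 1 else 2)" if "t < ?N" for t
          using that by auto
        consider "?b s < ?b r" | "r < i" "s < i" | "i \<le> r" "i \<le> s" "r < i + 2 * j" "s < i + 2 * j"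
          | "i + 2 * j \<le> r" "i + 2 * j \<le> s"
          using rs(3) unfolding be[OF rs(1)] be[OF rs(2)]
          by (cases "s < i"; cases "r < i"; cases "s < i + 2 * j"; cases "r < i + 2 * j"; simp)
        then show ?thesis
        proof cases
          case 1
          then have "X $$ (r, s) = 0"
            using ux(1) rs carrier_matD[OF Xc] unfolding upper_def by (simp del: block_of.simps)
          moreover have "?L $$ (r, s) = 0"
            using 1 unfolding be[OF rs(1)] be[OF rs(2)] Li[OF rs(1,2)] by (simp split: if_splits)
          ultimately show ?thesis unfolding XL by simp
        next
          case 2
          then show ?thesis unfolding XL Li[OF rs(1,2)] using diag_part_index[of r i s 0 X] d(1) by simp
        next
          case 3
          then have "r - i < 2 * j" "s - i < 2 * j" by auto
          then show ?thesis unfolding XL Li[OF rs(1,2)]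
            using 3 diag_part_index[of "r - i" "2 * j" "s - i" i X] d(2) by simp
        next
          case 4
          then have "r - (i + 2 * j) < i" "s - (i + 2 * j) < i" using rs by auto
          then show ?thesis
            unfolding XL Li[OF rs(1,2)]
            using 4 diag_part_index[of "r - (i + 2 * j)" i "s - (i + 2 * j)" "i + 2 * j" X] d3 by simp
        qed
      qed
      moreover have "upper \<gamma> (X - ?L)"
        using up' ux(2) Xc Lc unfolding upper_def by (auto simp del: diag3_dim)
      ultimately show "X - ?L \<in> u_nil i j \<gamma>"
        using u_minus[OF Xu L] carrier_matD[OF minus_carrier_mat[OF Lc, of X]]
        unfolding u_nil_def nilradical_def strictly_block_upper_def by (simp del: block_of.simps index_minus_mat)
    qed
  qed (auto simp: u_nil_def nilradical_def u_fiber_def u_iff mat_add_minus[OF Lc])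
qed

lemma Delta_u_eq:
  assumes A: "A \<in> carrier_mat i i" and B: "B \<in> u q j"
  shows "Delta_u q f (A, B) = avg f (u_fiber i j (\<lambda>_. 0) A B)"
proof -
  have Bc: "B \<in> carrier_mat (2 * j) (2 * j)" using B by (simp add: u_iff)
  have "u_nil i j (\<lambda>_. 0) = nilradical (u q (i + j)) [i, 2 * j, i]" by (simp add: u_nil_def)
  then show ?thesis
    using avg_reindex[OF bij_u_nil_fiber[OF A B upper_const] refl, of f] A B Bc
      diag_block_mat_triple[OF A Bc \<omega>_carrier[OF A]]
    by (simp add: Delta_u_def gl_def par_res_def avg_def J_herm_J[OF A] Let_def del: diag_block_mat.simps)
qed

lemma Delta_u_outside:
  "A \<notin> carrier_mat (dim_row A) (dim_row A) \<or> B \<notin> u q (dim_row B div 2) \<Longrightarrow> Delta_u q f (A, B) = 0"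
  by (auto simp only: Delta_u_def gl_def Let_def split: if_splits prod.splits)

text \<open>The embedding of the two factors as the Levi subgroup; the third block is the one that
  unitarity forces.\<close>

definition lev :: "'k mat \<Rightarrow> 'k mat \<Rightarrow> 'k mat" where
  "lev g h = diag3 g h (flip c (mat_inv g))"

lemma lev_U:
  assumes g: "g \<in> carrier (GL i)" and h: "h \<in> carrier (U q j)"
  shows "lev g h \<in> carrier (U q (i + j))"
proof -
  note c = GL_carrier[OF g] U_carrier[OF h] mat_inv_props(2)[OF g]
  have "flip c (lev g h) = diag3 (mat_inv g) (flip c h) (flip c g)"
    unfolding lev_def using c flip_c_flip_c[OF c(3)] by (subst flip_diag3[of _ i _ "2 * j"]) auto
  then have "flip c (lev g h) * lev g h = diag3 (mat_inv g * g) (flip c h * h) (flip c g * flip c (mat_inv g))"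
    unfolding lev_def using c by (simp add: diag3_mult[of _ i _ "2 * j" _ i])
  also have "\<dots> = 1\<^sub>m (i + (2 * j + i))"
  proof -
    have "flip c g * flip c (mat_inv g) = 1\<^sub>m i"
      unfolding flip_mult'[OF field_hom_c c(3,1), symmetric] mat_inv_props(3)[OF g] by (simp add: flip_one)
    moreover have "flip c h * h = 1\<^sub>m (2 * j)" using h by (simp add: U_iff)
    ultimately show ?thesis by (simp only: mat_inv_props(3)[OF g] diag3_one)
  qed
  finally show ?thesis
    using diag3_carrier[OF c(1,2) flip_carrier[OF c(3)]] by (simp add: U_iff lev_def)
qed

lemma diag_part_lev:
  assumes g: "g \<in> carrier (GL i)" and h: "h \<in> carrier (U q j)"
  shows "diag_part 0 i (lev g h) = g" "diag_part i (2 * j) (lev g h) = h"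
  unfolding lev_def
  using diag_part_diag3[OF GL_carrier[OF g] U_carrier[OF h] flip_carrier[OF mat_inv_props(2)[OF g]]] by auto

lemma upper_lev:
  assumes g: "g \<in> carrier (GL i)" and h: "h \<in> carrier (U q j)"
  shows "upper (block_of [i, 2 * j, i]) (lev g h)"
  unfolding lev_def upper_diag3_iff[OF GL_carrier[OF g] U_carrier[OF h] flip_carrier[OF mat_inv_props(2)[OF g]]]
  using GL_carrier[OF g] U_carrier[OF h] mat_inv_props(2)[OF g] by (auto simp: upper_def)

lemma u_levels:
  "{t. t < 2 * (i + j) \<and> block_of [i, 2 * j, i] t = 0} = {0..<0 + i}"
  "{t. t < 2 * (i + j) \<and> block_of [i, 2 * j, i] t = 1} = {i..<i + 2 * j}"
  by auto

lemma u_diag_parts_conj: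
  fixes y X :: "'k mat"
  assumes y: "y \<in> carrier (U q (i + j))" "upper (block_of [i, 2 * j, i]) y"
    and X: "X \<in> carrier_mat (2 * (i + j)) (2 * (i + j))" "upper (block_of [i, 2 * j, i]) X"
  shows "diag_part 0 i y \<in> carrier (GL i)" "diag_part i (2 * j) y \<in> carrier (U q j)"
    "diag_part 0 i (conj_by y X) = conj_by (diag_part 0 i y) (diag_part 0 i X)"
    "diag_part i (2 * j) (conj_by y X) = conj_by (diag_part i (2 * j) y) (diag_part i (2 * j) X)"
proof -
  interpret mat_group "2 * (i + j)" "U q (i + j) :: 'k mat monoid" "u q (i + j)" by (rule mat_group_U)
  show "diag_part 0 i y \<in> carrier (GL i)" by (rule diag_part_GL[OF y u_levels(1)]) simp
  show "diag_part 0 i (conj_by y X) = conj_by (diag_part 0 i y) (diag_part 0 i X)"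
    by (rule diag_part_conj[OF y u_levels(1) _ X]) simp
  show "diag_part i (2 * j) (conj_by y X) = conj_by (diag_part i (2 * j) y) (diag_part i (2 * j) X)"
    by (rule diag_part_conj[OF y u_levels(2) _ X]) simp
  note yc = U_carrier[OF y(1)]
  have "flip c (diag_part i (2 * j) y) = diag_part i (2 * j) (mat_inv y)"
    using diag_part_flip[OF yc, of i "2 * j" i c] by (simp add: U_inv[OF y(1)])
  then have "flip c (diag_part i (2 * j) y) * diag_part i (2 * j) y = diag_part i (2 * j) (mat_inv y * y)"
    using diag_part_mult[OF mat_inv_props(2)[OF U_GL[OF y(1)]] upper_inv[OF y] yc y(2) u_levels(2)] by simp
  also have "\<dots> = 1\<^sub>m (2 * j)" using mat_inv_props(3)[OF U_GL[OF y(1)]] by (simp add: diag_part_one)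
  finally show "diag_part i (2 * j) y \<in> carrier (U q j)" by (simp add: U_iff)
qed

lemma conj_u_fiber:
  assumes y: "y \<in> carrier (U q (i + j))" "upper (block_of [i, 2 * j, i]) y"
    and A: "A \<in> carrier_mat i i" and B: "B \<in> u q j"
  shows "bij_betw (conj_by y) (u_fiber i j (\<lambda>_. 0) A B)
    (u_fiber i j (\<lambda>_. 0) (conj_by (diag_part 0 i y) A) (conj_by (diag_part i (2 * j) y) B))"
proof -
  interpret mat_group "2 * (i + j)" "U q (i + j) :: 'k mat monoid" "u q (i + j)" by (rule mat_group_U)
  let ?A = "conj_by (diag_part 0 i y) A" and ?B = "conj_by (diag_part i (2 * j) y) B"
  let ?S = "u_fiber i j (\<lambda>_. 0) A B" and ?T = "u_fiber i j (\<lambda>_. 0) ?A ?B"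
  note g = u_diag_parts_conj(1,2)[OF y one_carrier_mat upper_one]
  have AB': "?A \<in> carrier_mat i i" "?B \<in> u q j"
    using conj_by_carrier[OF g(1) A] mat_group.lie_closed[OF mat_group_U g(2) B] by auto
  have into: "conj_by y ` ?S \<subseteq> ?T"
    using y lie_closed u_diag_parts_conj[OF y] lie_carrier upper_conj[OF y]
    by (auto simp: u_fiber_def u_iff simp del: block_of.simps)
  have inj: "inj_on (conj_by y) ?S"
    by (rule inj_on_inverseI[where g = "conj_by (mat_inv y)"]) (auto simp: u_fiber_def u_iff conj_by_inv[OF U_GL[OF y(1)]])
  have "card ?S = card (u_nil i j (\<lambda>_. 0))"
    by (rule bij_betw_same_card[symmetric, OF bij_u_nil_fiber[OF A B upper_const]])
  moreover have "card ?T = card (u_nil i j (\<lambda>_. 0))"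
    by (rule bij_betw_same_card[symmetric, OF bij_u_nil_fiber[OF AB' upper_const]])
  ultimately have "conj_by y ` ?S = ?T"
    using into card_image[OF inj] by (intro card_subset_eq) simp_all
  then show ?thesis using inj by (simp add: bij_betw_def)
qed

lemma Delta_u_conj:
  fixes b :: "'k mat \<Rightarrow> real"
  assumes b: "\<And>y X. y \<in> carrier (U q (i + j)) \<Longrightarrow> X \<in> u q (i + j) \<Longrightarrow> b (conj_by y X) = b X"
    and g: "g \<in> carrier (GL i)" and h: "h \<in> carrier (U q j)"
    and A: "A \<in> carrier_mat i i" and B: "B \<in> u q j"
  shows "Delta_u q b (conj_by g A, conj_by h B) = Delta_u q b (A, B)"
proof -
  have AB': "conj_by g A \<in> carrier_mat i i" "conj_by h B \<in> u q j"
    using conj_by_carrier[OF g A] mat_group.lie_closed[OF mat_group_U h B] by auto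
  show ?thesis
    unfolding Delta_u_eq[OF A B] Delta_u_eq[OF AB']
    using avg_reindex[OF conj_u_fiber[OF lev_U[OF g h] upper_lev[OF g h] A B], of b b]
      b[OF lev_U[OF g h]] by (auto simp: diag_part_lev[OF g h] u_fiber_def)
qed

end

section \<open>Orders of unipotent subgroups\<close>

definition strict :: "nat \<Rightarrow> (nat \<Rightarrow> nat) \<Rightarrow> 'k::zero mat \<Rightarrow> bool" where
  "strict N b A \<longleftrightarrow> (\<forall>r < N. \<forall>s < N. b s \<le> b r \<longrightarrow> A $$ (r, s) = 0)"

text \<open>With three levels, two strict steps must lead from level 0 over 1 to 2, so a product of
  two strict matrices lives in the corner \<open>(0, 2)\<close>.\<close>

lemma strict_mult_entry:
  fixes A :: "'k::comm_ring_1 mat"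
  assumes "A \<in> carrier_mat N N" "B \<in> carrier_mat N N" "strict N b A" "strict N b B"
    and b: "\<And>r. r < N \<Longrightarrow> b r \<le> 2" and rs: "r < N" "s < N" "\<not> (b r = 0 \<and> b s = 2)"
  shows "(A * B) $$ (r, s) = 0"
proof -
  have "A $$ (r, t) * B $$ (t, s) = 0" if t: "t < N" for t
  proof -
    consider "b t \<le> b r" | "b s \<le> b t" | "b r < b t" "b t < b s" by linarith
    then show ?thesis
    proof cases
      case 3
      then have "b r = 0 \<and> b s = 2" using b[OF rs(2)] b[OF t] by linarith
      then show ?thesis using rs(3) by simp
    qed (use assms t in \<open>auto simp: strict_def\<close>)
  qed
  then show ?thesis unfolding mult_mat_entry[OF assms(1,2) rs(1,2)] by (intro sum.neutral) simp
qed

text \<open>A middle index that contributes lies on level 1, so the corner entries of the factors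
  never enter the product.\<close>

lemma strict_mult_cong:
  fixes A :: "'k::comm_ring_1 mat"
  assumes c: "A \<in> carrier_mat N N" "B \<in> carrier_mat N N" "A' \<in> carrier_mat N N" "B' \<in> carrier_mat N N"
    and st: "strict N b A" "strict N b B" "strict N b A'" "strict N b B'"
    and b: "\<And>r. r < N \<Longrightarrow> b r \<le> 2"
    and eqA: "\<And>r s. r < N \<Longrightarrow> s < N \<Longrightarrow> \<not> (b r = 0 \<and> b s = 2) \<Longrightarrow> A $$ (r, s) = A' $$ (r, s)"
    and eqB: "\<And>r s. r < N \<Longrightarrow> s < N \<Longrightarrow> \<not> (b r = 0 \<and> b s = 2) \<Longrightarrow> B $$ (r, s) = B' $$ (r, s)"
  shows "A * B = A' * B'"
proof (rule eq_matI)
  fix r s assume "r < dim_row (A' * B')" "s < dim_col (A' * B')"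
  then have rs: "r < N" "s < N" using c by auto
  have "A $$ (r, t) * B $$ (t, s) = A' $$ (r, t) * B' $$ (t, s)" if t: "t < N" for t
  proof -
    consider "b t \<le> b r" | "b s \<le> b t" | "b r < b t" "b t < b s" by linarith
    then show ?thesis
    proof cases
      case 3
      then have "b t = 1" using b[OF rs(2)] by linarith
      then show ?thesis using eqA[OF rs(1) t] eqB[OF t rs(2)] by simp
    qed (use st t rs in \<open>auto simp: strict_def\<close>)
  qed
  then show "(A * B) $$ (r, s) = (A' * B') $$ (r, s)"
    unfolding mult_mat_entry[OF c(1,2) rs] mult_mat_entry[OF c(3,4) rs] by (intro sum.cong) auto
qed (use c in auto)

lemma strict_cube_zero:
  fixes A :: "'k::comm_ring_1 mat"
  assumes "A \<in> carrier_mat N N" "strict N b A" and b: "\<And>r. r < N \<Longrightarrow> b r \<le> 2"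
  shows "A * (A * A) = 0\<^sub>m N N"
proof (rule eq_matI)
  have AA: "A * A \<in> carrier_mat N N" using assms by simp
  fix r s assume "r < dim_row (0\<^sub>m N N)" "s < dim_col (0\<^sub>m N N)"
  then have rs: "r < N" "s < N" by auto
  have "A $$ (r, t) * (A * A) $$ (t, s) = 0" if t: "t < N" for t
  proof (cases "b t = 0 \<and> b s = 2")
    case True
    then show ?thesis using assms(2) rs t by (auto simp: strict_def)
  next
    case False
    then show ?thesis using strict_mult_entry[OF assms(1,1,2,2) b t rs(2)] by simp
  qed
  then show "(A * (A * A)) $$ (r, s) = 0\<^sub>m N N $$ (r, s)"
    unfolding mult_mat_entry[OF assms(1) AA rs] using rs by (simp add: sum.neutral)
qed (use assms in auto)

context unitary
begin

lemma double_cancel: "x + x = y + y \<longleftrightarrow> x = (y :: 'k)"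
  using two by (simp flip: mult_2)

text \<open>For the \<open>\<gamma>\<close> of a double coset this is the kernel of the projection
  of \<open>Q \<inter> w P w\<inverse>\<close> to the Levi subgroup of \<open>Q\<close>; unitarity
  makes the third diagonal block 1 as well.\<close>

definition U_ker :: "nat \<Rightarrow> nat \<Rightarrow> (nat \<Rightarrow> nat) \<Rightarrow> 'k mat set" where
  "U_ker i j \<gamma> = {y \<in> carrier (U q (i + j)). upper (block_of [i, 2 * j, i]) y \<and> upper \<gamma> y \<and>
     diag_part 0 i y = 1\<^sub>m i \<and> diag_part i (2 * j) y = 1\<^sub>m (2 * j)}"

lemma finite_U [simp]: "finite (carrier (U q n :: 'k mat monoid))"
  by (rule finite_subset[OF _ finite_GL[of "2 * n"]]) (auto dest: U_GL)

lemma block_of_u: "t < 2 * (i + j) \<Longrightarrow>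
    block_of [i, 2 * j, i] t = (if t < i then 0 else if t < i + 2 * j then 1 else 2)"
  by auto

text \<open>
  \<open>Z \<mapsto> 1 + 2Z + 2Z\<^sup>2 = (1 + Z) (1 - Z)\<^sup>-\<^sup>1\<close> and \<open>y \<mapsto> y - y\<^sup>-\<^sup>1\<close> are injections between the two sets; this
  is where odd characteristic enters.
\<close>

lemma card_U_ker:
  assumes \<gamma>: "\<And>r s. r < 2 * (i + j) \<Longrightarrow> s < 2 * (i + j) \<Longrightarrow> \<gamma> s < \<gamma> r \<Longrightarrow>
    \<gamma> (2 * (i + j) - Suc r) < \<gamma> (2 * (i + j) - Suc s)"
  shows "card (U_ker i j \<gamma>) = card (u_nil i j \<gamma>)"
proof (rule antisym)
  let ?N = "2 * (i + j)" let ?b = "block_of [i, 2 * j, i]"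
  have b2: "?b r \<le> 2" if "r < ?N" for r using block_of_u[OF that] by simp
  have fin: "finite (u_nil i j \<gamma>)" by (simp add: u_nil_def nilradical_def)
  have nilD: "Z \<in> carrier_mat ?N ?N" "flip c Z = - Z" "strict ?N ?b Z" "upper \<gamma> Z" if "Z \<in> u_nil i j \<gamma>" for Z
    using that by (auto simp: u_nil_def nilradical_def u_iff strictly_block_upper_def strict_def simp del: block_of.simps)
  show "card (u_nil i j \<gamma>) \<le> card (U_ker i j \<gamma>)"
  proof (rule card_inj_on_le)
    let ?\<phi> = "\<lambda>Z :: 'k mat. 1\<^sub>m ?N + (Z + Z) + (Z * Z + Z * Z)"
    show "finite (U_ker i j \<gamma>)" by (simp add: U_ker_def)
    show "inj_on ?\<phi> (u_nil i j \<gamma>)"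
    proof (rule inj_onI)
      fix Z Z' assume Z: "Z \<in> u_nil i j \<gamma>" and Z': "Z' \<in> u_nil i j \<gamma>" and eq: "?\<phi> Z = ?\<phi> Z'"
      note z = nilD[OF Z] and z' = nilD[OF Z']
      have zz: "Z * Z \<in> carrier_mat ?N ?N" "Z' * Z' \<in> carrier_mat ?N ?N" using z z' by auto
      have e: "Z $$ (r, s) + Z $$ (r, s) + ((Z * Z) $$ (r, s) + (Z * Z) $$ (r, s)) =
          Z' $$ (r, s) + Z' $$ (r, s) + ((Z' * Z') $$ (r, s) + (Z' * Z') $$ (r, s))"
        if "r < ?N" "s < ?N" for r s
        using arg_cong[OF eq, of "\<lambda>M. M $$ (r, s)"] that z(1) z'(1) zz by (simp del: index_mult_mat(1) add: add.assoc)
      \<comment> \<open>Off the corner the squares vanish and 2 can be cancelled. By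
        \<open>strict_mult_cong\<close> this already forces equal squares, after which the corners
        agree too.\<close>
      have agree: "Z $$ (r, s) = Z' $$ (r, s)" if "r < ?N" "s < ?N" "\<not> (?b r = 0 \<and> ?b s = 2)" for r s
        using e[OF that(1,2)] strict_mult_entry[OF z(1,1,3,3) b2 that] strict_mult_entry[OF z'(1,1,3,3) b2 that]
        by (simp add: double_cancel two del: index_mult_mat(1) block_of.simps)
      have "Z * Z = Z' * Z'"
        by (rule strict_mult_cong[OF z(1,1) z'(1,1) z(3,3) z'(3,3) b2 agree agree])
      then show "Z = Z'"
        using e z(1) z'(1) by (intro eq_matI) (auto simp: double_cancel two simp del: index_mult_mat(1))
    qed
    show "?\<phi> ` u_nil i j \<gamma> \<subseteq> U_ker i j \<gamma>"
    proof
      fix y assume "y \<in> ?\<phi> ` u_nil i j \<gamma>"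
      then obtain Z where Z: "Z \<in> u_nil i j \<gamma>" and y: "y = ?\<phi> Z" by auto
      note z = nilD[OF Z]
      define S T where "S = Z + Z" and "T = Z * Z + Z * Z"
      have zz: "Z * Z \<in> carrier_mat ?N ?N" using z by auto
      have ST: "S \<in> carrier_mat ?N ?N" "T \<in> carrier_mat ?N ?N" using z by (auto simp: S_def T_def)
      have y': "y = 1\<^sub>m ?N + S + T" by (simp add: y S_def T_def)
      have yc: "y \<in> carrier_mat ?N ?N" using ST by (simp add: y')
      have z3: "Z * (Z * Z) = 0\<^sub>m ?N ?N" by (rule strict_cube_zero[OF z(1,3) b2])
      have z3': "Z * Z * Z = 0\<^sub>m ?N ?N" using z3 z(1) by simp
      have z4: "Z * Z * (Z * Z) = 0\<^sub>m ?N ?N"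
        using z3 z(1) zz assoc_mult_mat[OF z(1) z(1) zz] by simp
      note dist = add_mult_distrib_mat[of _ ?N ?N _ _ ?N] mult_add_distrib_mat[of _ ?N ?N _ ?N]
      have SS: "S * S = T + T"
        unfolding S_def T_def using z(1) zz by (simp add: dist)
      have ST0: "S * T = 0\<^sub>m ?N ?N" "T * S = 0\<^sub>m ?N ?N" "T * T = 0\<^sub>m ?N ?N"
        unfolding S_def T_def using z(1) zz z3 z3' z4 by (simp_all add: dist del: assoc_mult_mat)
      have flipS: "flip c S = - S" unfolding S_def using z by (auto simp: flip_c_add[of _ ?N] intro!: eq_matI)
      have "flip c (Z * Z) = Z * Z"
        using z(1,2) by (simp add: flip_mult'[OF field_hom_c z(1,1)])
      then have flipT: "flip c T = T" unfolding T_def using zz by (simp add: flip_c_add[of _ ?N])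
      have flipy: "flip c y = 1\<^sub>m ?N + - S + T"
        unfolding y' using ST flipS flipT by (simp add: flip_c_add[of _ ?N] flip_one)
      have "flip c y * y = 1\<^sub>m ?N + - S + T + (S + - (T + T)) + (T + - 0\<^sub>m ?N ?N)"
        unfolding flipy unfolding y' using ST SS ST0 by (simp add: dist)
      also have "\<dots> = 1\<^sub>m ?N" using ST by (intro eq_matI) auto
      finally have yU: "y \<in> carrier (U q (i + j))" using yc by (simp add: U_iff)
      have yi: "y $$ (r, s) = (if r = s then 1 else 0)" if "r < ?N" "s < ?N" "?b s \<le> ?b r" for r s
      proof -
        have "(Z * Z) $$ (r, s) = 0" using that by (intro strict_mult_entry[OF z(1,1,3,3) b2]) auto
        moreover have "Z $$ (r, s) = 0" using z(3) that by (simp add: strict_def del: block_of.simps)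
        ultimately show ?thesis using that z(1) zz by (simp add: y del: index_mult_mat(1) block_of.simps)
      qed
      have "upper ?b y" unfolding upper_def using yi yc by (auto simp del: block_of.simps)
      moreover have "upper \<gamma> y"
        using z(4) upper_mult[OF z(1,1,4,4)] z(1) zz unfolding y upper_def by (auto simp del: index_mult_mat(1))
      moreover have "diag_part 0 i y = 1\<^sub>m i" "diag_part i (2 * j) y = 1\<^sub>m (2 * j)"
        using yi by (auto intro!: eq_matI)
      ultimately show "y \<in> U_ker i j \<gamma>" using yU by (simp add: U_ker_def del: block_of.simps)
    qed
  qed
  show "card (U_ker i j \<gamma>) \<le> card (u_nil i j \<gamma>)"
  proof (rule card_inj_on_le[OF _ _ fin])
    let ?\<psi> = "\<lambda>y :: 'k mat. y - flip c y"
    have kerD: "y \<in> carrier_mat ?N ?N" "flip c y * y = 1\<^sub>m ?N" "upper \<gamma> y"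
      "strict ?N ?b (y - 1\<^sub>m ?N)" "strict ?N ?b (flip c y - 1\<^sub>m ?N)" if y: "y \<in> U_ker i j \<gamma>" for y
    proof -
      show yc: "y \<in> carrier_mat ?N ?N" and yy: "flip c y * y = 1\<^sub>m ?N" and "upper \<gamma> y" using y by (auto simp: U_ker_def U_iff)
      have up: "upper ?b y" and d: "diag_part 0 i y = 1\<^sub>m i" "diag_part i (2 * j) y = 1\<^sub>m (2 * j)" using y by (auto simp: U_ker_def)
      have yU: "y \<in> carrier (U q (i + j))" using y by (simp add: U_ker_def)
      interpret mat_group ?N "U q (i + j) :: 'k mat monoid" "u q (i + j)" by (rule mat_group_U)
      have upf: "upper ?b (flip c y)" using upper_inv[OF yU up] by (simp add: U_inv[OF yU])
      have f: "diag_part 0 i (flip c y) = 1\<^sub>m i" "diag_part i (2 * j) (flip c y) = 1\<^sub>m (2 * j)"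
      proof -
        have e: "diag_part 0 i (flip c y) * diag_part 0 i y = diag_part 0 i (flip c y * y)"
          by (rule diag_part_mult[symmetric, OF flip_carrier[OF yc] upf yc up u_levels(1)])
        then show "diag_part 0 i (flip c y) = 1\<^sub>m i" unfolding yy d by (simp add: diag_part_one)
        have "diag_part i (2 * j) (flip c y) * diag_part i (2 * j) y = diag_part i (2 * j) (flip c y * y)"
          by (rule diag_part_mult[symmetric, OF flip_carrier[OF yc] upf yc up u_levels(2)])
        then show "diag_part i (2 * j) (flip c y) = 1\<^sub>m (2 * j)" unfolding yy d by (simp add: diag_part_one)
      qed
      have last: "diag_part (i + 2 * j) i y = 1\<^sub>m i" "diag_part (i + 2 * j) i (flip c y) = 1\<^sub>m i"
      proof -
        have "diag_part (i + 2 * j) i (flip c y) = flip c (diag_part 0 i y)" by (rule diag_part_flip[OF yc]) simp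
        then show "diag_part (i + 2 * j) i (flip c y) = 1\<^sub>m i" by (simp add: d flip_one)
        have "diag_part (i + 2 * j) i (flip c (flip c y)) = flip c (diag_part 0 i (flip c y))"
          by (rule diag_part_flip[OF flip_carrier[OF yc]]) simp
        then show "diag_part (i + 2 * j) i y = 1\<^sub>m i" by (simp add: f flip_one flip_c_flip_c[OF yc])
      qed
      have st: "strict ?N ?b (x - 1\<^sub>m ?N)"
        if xc: "x \<in> carrier_mat ?N ?N" and x: "upper ?b x" and xd: "diag_part 0 i x = 1\<^sub>m i"
          "diag_part i (2 * j) x = 1\<^sub>m (2 * j)" "diag_part (i + 2 * j) i x = 1\<^sub>m i" for x :: "'k mat"
        unfolding strict_def
      proof (intro allI impI)
        fix r s assume rs: "r < ?N" "s < ?N" "?b s \<le> ?b r"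
        consider (1) "?b s < ?b r" | (2) "r < i" "s < i" | (3) "i \<le> r" "i \<le> s" "r < i + 2 * j" "s < i + 2 * j"
          | (4) "i + 2 * j \<le> r" "i + 2 * j \<le> s"
          using rs(3) unfolding block_of_u[OF rs(1)] block_of_u[OF rs(2)]
          by (cases "s < i"; cases "r < i"; cases "s < i + 2 * j"; cases "r < i + 2 * j"; simp)
        then have "x $$ (r, s) = (if r = s then 1 else 0)"
        proof cases
          case 1
          then show ?thesis using x xc rs unfolding upper_def by auto
        next
          case 2
          then show ?thesis using diag_part_index[of r i s 0 x] xd(1) by simp
        next
          case 3
          then have "r - i < 2 * j" "s - i < 2 * j" "r - i = s - i \<longleftrightarrow> r = s" by auto
          then show ?thesis using 3 diag_part_index[of "r - i" "2 * j" "s - i" i x] xd(2) by simp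
        next
          case 4
          then have "r - (i + 2 * j) < i" "s - (i + 2 * j) < i" "r - (i + 2 * j) = s - (i + 2 * j) \<longleftrightarrow> r = s"
            using rs by auto
          then show ?thesis using 4 diag_part_index[of "r - (i + 2 * j)" i "s - (i + 2 * j)" "i + 2 * j" x] xd(3) by simp
        qed
        then show "(x - 1\<^sub>m ?N) $$ (r, s) = 0" using rs by simp
      qed
      show "strict ?N ?b (y - 1\<^sub>m ?N)" by (rule st[OF yc up d last(1)])
      show "strict ?N ?b (flip c y - 1\<^sub>m ?N)" by (rule st[OF flip_carrier[OF yc] upf f last(2)])
    qed
    \<comment> \<open>This is \<open>y\<inverse> y = 1\<close> in terms of the strict parts of
      \<open>y\<inverse>\<close> and \<open>y\<close>. The left side depends only on entries off the
      corner, so their sum does too; sum and difference together determine \<open>y\<close>, because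
      2 is invertible.\<close>
    have key: "(flip c y - 1\<^sub>m ?N) * (y - 1\<^sub>m ?N) = - ((flip c y - 1\<^sub>m ?N) + (y - 1\<^sub>m ?N))" if y: "y \<in> U_ker i j \<gamma>" for y
    proof -
      note k = kerD[OF y]
      have fc: "flip c y \<in> carrier_mat ?N ?N" using k by simp
      have "(flip c y - 1\<^sub>m ?N) * (y - 1\<^sub>m ?N) = flip c y * (y - 1\<^sub>m ?N) - 1\<^sub>m ?N * (y - 1\<^sub>m ?N)"
        using k fc by (intro minus_mult_distrib_mat) auto
      also have "flip c y * (y - 1\<^sub>m ?N) = 1\<^sub>m ?N - flip c y"
        unfolding mult_minus_distrib_mat[OF fc k(1) one_carrier_mat] k(2) right_mult_one_mat[OF fc] ..
      also have "1\<^sub>m ?N - flip c y - 1\<^sub>m ?N * (y - 1\<^sub>m ?N) = - ((flip c y - 1\<^sub>m ?N) + (y - 1\<^sub>m ?N))"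
        using k(1) fc left_mult_one_mat[OF minus_carrier_mat[OF one_carrier_mat], of ?N y] by (intro eq_matI) auto
      finally show ?thesis .
    qed
    show "inj_on ?\<psi> (U_ker i j \<gamma>)"
    proof (rule inj_onI)
      fix y y' assume y: "y \<in> U_ker i j \<gamma>" and y': "y' \<in> U_ker i j \<gamma>" and eq: "?\<psi> y = ?\<psi> y'"
      define M F where "M = y - 1\<^sub>m ?N" and "F = flip c y - 1\<^sub>m ?N"
      define M' F' where "M' = y' - 1\<^sub>m ?N" and "F' = flip c y' - 1\<^sub>m ?N"
      have st: "strict ?N ?b M" "strict ?N ?b F" "strict ?N ?b M'" "strict ?N ?b F'"
        using kerD[OF y] kerD[OF y'] by (auto simp: M_def F_def M'_def F'_def)
      have cc: "M \<in> carrier_mat ?N ?N" "F \<in> carrier_mat ?N ?N" "M' \<in> carrier_mat ?N ?N" "F' \<in> carrier_mat ?N ?N"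
        by (auto simp: M_def F_def M'_def F'_def)
      have FM: "F * M = - (F + M)" "F' * M' = - (F' + M')"
        using key[OF y] key[OF y'] by (auto simp: M_def F_def M'_def F'_def)
      have MF: "M - F = M' - F'"
      proof -
        have "M - F = ?\<psi> y" "M' - F' = ?\<psi> y'"
          unfolding M_def F_def M'_def F'_def using kerD(1)[OF y] kerD(1)[OF y'] by (auto intro!: eq_matI)
        then show ?thesis using eq by simp
      qed
      have e: "M $$ (r, s) - F $$ (r, s) = M' $$ (r, s) - F' $$ (r, s)" if "r < ?N" "s < ?N" for r s
      proof -
        have "(M - F) $$ (r, s) = (M' - F') $$ (r, s)" by (simp only: MF)
        then show ?thesis using that cc by simp
      qed
      have fm: "(F * M) $$ (r, s) = - (F $$ (r, s) + M $$ (r, s))" "(F' * M') $$ (r, s) = - (F' $$ (r, s) + M' $$ (r, s))"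
        if "r < ?N" "s < ?N" for r s
        using that cc by (simp_all add: FM del: index_mult_mat(1))
      have agree: "F $$ (r, s) = F' $$ (r, s) \<and> M $$ (r, s) = M' $$ (r, s)"
        if rs: "r < ?N" "s < ?N" "\<not> (?b r = 0 \<and> ?b s = 2)" for r s
      proof -
        have "F $$ (r, s) + M $$ (r, s) = 0" "F' $$ (r, s) + M' $$ (r, s) = 0"
          using fm[OF rs(1,2)] strict_mult_entry[OF cc(2,1) st(2,1) b2 rs] strict_mult_entry[OF cc(4,3) st(4,3) b2 rs]
          by (metis neg_equal_0_iff_equal)+
        then have "F $$ (r, s) = - M $$ (r, s)" "F' $$ (r, s) = - M' $$ (r, s)"
          by (simp_all only: eq_neg_iff_add_eq_0)
        then show ?thesis using e[OF rs(1,2)] by (simp add: double_cancel two)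
      qed
      have "F * M = F' * M'"
        by (rule strict_mult_cong[OF cc(2,1,4,3) st(2,1,4,3) b2]) (use agree in blast)+
      then have sumFM: "F $$ (r, s) + M $$ (r, s) = F' $$ (r, s) + M' $$ (r, s)" if "r < ?N" "s < ?N" for r s
        using fm[OF that] by (metis neg_equal_iff_equal)
      have "M $$ (r, s) = M' $$ (r, s)" if "r < ?N" "s < ?N" for r s
      proof -
        have "M $$ (r, s) + M $$ (r, s) = (F $$ (r, s) + M $$ (r, s)) + (M $$ (r, s) - F $$ (r, s))" by simp
        also have "\<dots> = (F' $$ (r, s) + M' $$ (r, s)) + (M' $$ (r, s) - F' $$ (r, s))"
          by (simp only: sumFM[OF that] e[OF that])
        also have "\<dots> = M' $$ (r, s) + M' $$ (r, s)" by simp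
        finally have "M $$ (r, s) + M $$ (r, s) = M' $$ (r, s) + M' $$ (r, s)" .
        then show ?thesis by (simp add: double_cancel two)
      qed
      then show "y = y'" using kerD(1)[OF y] kerD(1)[OF y'] by (intro eq_matI) (auto simp: M_def M'_def)
    qed
    show "?\<psi> ` U_ker i j \<gamma> \<subseteq> u_nil i j \<gamma>"
    proof
      fix Z assume "Z \<in> ?\<psi> ` U_ker i j \<gamma>"
      then obtain y where y: "y \<in> U_ker i j \<gamma>" and Z: "Z = y - flip c y" by auto
      note k = kerD[OF y]
      have fc: "flip c y \<in> carrier_mat ?N ?N" using k by simp
      have "flip c Z = - Z" unfolding Z
        using k(1) fc by (auto simp: flip_c_minus[OF k(1) fc] flip_c_flip_c[OF k(1)] intro!: eq_matI)
      moreover have "Z $$ (r, s) = 0" if "r < ?N" "s < ?N" "?b s \<le> ?b r" for r s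
      proof -
        have "(y - 1\<^sub>m ?N) $$ (r, s) = 0" "(flip c y - 1\<^sub>m ?N) $$ (r, s) = 0"
          using k(4,5) that by (auto simp: strict_def simp del: block_of.simps index_minus_mat)
        then show ?thesis using that k(1) fc by (simp add: Z)
      qed
      moreover have "upper \<gamma> Z"
        using k(3) upper_flip[where f = c and X = y and \<beta>' = \<gamma>, OF k(1,3) c_0] \<gamma> k(1) fc unfolding Z upper_def by auto
      ultimately show "Z \<in> u_nil i j \<gamma>"
        using fc k(1) by (auto simp: u_nil_def nilradical_def u_iff strictly_block_upper_def Z simp del: block_of.simps)
    qed
  qed
qed

text \<open>The projection to the two Levi factors is multiplicative with kernel
  \<open>U_ker\<close>, which has the size of \<open>u_nil\<close>. On the Levi subgroup the
  condition \<open>upper \<gamma>\<close> splits into one condition for each factor, so the image is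
  a product.\<close>

lemma sum_parabolic:
  assumes \<gamma>: "\<And>r s. r < 2 * (i + j) \<Longrightarrow> s < 2 * (i + j) \<Longrightarrow> \<gamma> s < \<gamma> r \<Longrightarrow>
    \<gamma> (2 * (i + j) - Suc r) < \<gamma> (2 * (i + j) - Suc s)"
  shows "(\<Sum>y \<in> {y \<in> carrier (U q (i + j) :: 'k mat monoid). upper (block_of [i, 2 * j, i]) y \<and> upper \<gamma> y}.
      F (diag_part 0 i y) (diag_part i (2 * j) y)) =
    real (card (u_nil i j \<gamma>)) * (\<Sum>g \<in> {g \<in> carrier (GL i). upper \<gamma> g}.
      \<Sum>h \<in> {h \<in> carrier (U q j). upper (\<lambda>r. \<gamma> (i + r)) h}. F g h)"
proof -
  let ?N = "2 * (i + j)" and ?b = "block_of [i, 2 * j, i]"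
  interpret mat_group ?N "U q (i + j) :: 'k mat monoid" "u q (i + j)" by (rule mat_group_U)
  let ?R = "{y \<in> carrier (U q (i + j) :: 'k mat monoid). upper ?b y \<and> upper \<gamma> y}"
  let ?\<psi> = "\<lambda>y :: 'k mat. (diag_part 0 i y, diag_part i (2 * j) y)"
  have R: "subgroup ?R (U q (i + j))"
    using m_closed one_closed U_carrier
    by (intro finite_closed_imp_subgroup) (auto intro!: upper_mult[of _ ?N] group)
  have mult: "?\<psi> (x * y) = (\<lambda>(a, b) (a', b'). (a * a', b * b')) (?\<psi> x) (?\<psi> y)" if "x \<in> ?R" "y \<in> ?R" for x y
  proof -
    have xy: "x \<in> carrier_mat ?N ?N" "upper ?b x" "y \<in> carrier_mat ?N ?N" "upper ?b y"
      using that U_carrier[of x "i + j"] U_carrier[of y "i + j"] by simp_all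
    show ?thesis using diag_part_mult[OF xy u_levels(1)] diag_part_mult[OF xy u_levels(2)] by simp
  qed
  have ker: "{y \<in> ?R. ?\<psi> y = ?\<psi> (1\<^sub>m ?N)} = U_ker i j \<gamma>"
    by (auto simp: U_ker_def diag_part_one simp del: block_of.simps)
  have im: "?\<psi> ` ?R = {g \<in> carrier (GL i). upper \<gamma> g} \<times> {h \<in> carrier (U q j). upper (\<lambda>r. \<gamma> (i + r)) h}"
  proof (intro equalityI subsetI)
    fix p assume "p \<in> ?\<psi> ` ?R"
    then obtain y where y: "y \<in> carrier (U q (i + j))" "upper ?b y" "upper \<gamma> y" and p: "p = ?\<psi> y" by auto
    have "upper \<gamma> (diag_part 0 i y)" "upper (\<lambda>r. \<gamma> (i + r)) (diag_part i (2 * j) y)"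
      using y(3) U_carrier[OF y(1)] by (auto simp: upper_def)
    then show "p \<in> {g \<in> carrier (GL i). upper \<gamma> g} \<times> {h \<in> carrier (U q j). upper (\<lambda>r. \<gamma> (i + r)) h}"
      using u_diag_parts_conj(1,2)[OF y(1,2) one_carrier_mat upper_one] p by simp
  next
    fix p assume "p \<in> {g \<in> carrier (GL i :: 'k mat monoid). upper \<gamma> g} \<times>
      {h \<in> carrier (U q j :: 'k mat monoid). upper (\<lambda>r. \<gamma> (i + r)) h}"
    then obtain g h where g: "g \<in> carrier (GL i)" "upper \<gamma> g" and h: "h \<in> carrier (U q j)" "upper (\<lambda>r. \<gamma> (i + r)) h"
      and p: "p = (g, h)" by auto
    have gi: "mat_inv g \<in> carrier_mat i i" "upper \<gamma> (mat_inv g)"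
      using mat_inv_props(2)[OF g(1)] mat_group.upper_inv[OF mat_group_GL g] by auto
    \<comment> \<open>The third block needs no condition of its own: it is a flipped inverse, and by
      hypothesis mirroring the indices reverses the order of the levels.\<close>
    have "upper (\<lambda>r. \<gamma> (i + 2 * j + r)) (flip c (mat_inv g))"
    proof (rule upper_flip[where f = c and X = "mat_inv g", OF gi c_0])
      fix r s assume rs: "r < i" "s < i" "\<gamma> (i + 2 * j + s) < \<gamma> (i + 2 * j + r)"
      have "?N - Suc (i + 2 * j + r) = i - Suc r" "?N - Suc (i + 2 * j + s) = i - Suc s" using rs by auto
      then show "\<gamma> (i - Suc r) < \<gamma> (i - Suc s)" using \<gamma>[OF _ _ rs(3)] rs by simp
    qed
    then have "upper \<gamma> (lev g h)"
      unfolding lev_def upper_diag3_iff[OF GL_carrier[OF g(1)] U_carrier[OF h(1)] flip_carrier[OF gi(1)]]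
      using g h by simp
    then show "p \<in> ?\<psi> ` ?R"
      using lev_U[OF g(1) h(1)] upper_lev[OF g(1) h(1)] diag_part_lev[OF g(1) h(1)] p
      by (intro image_eqI[of _ _ "lev g h"]) (auto simp del: block_of.simps)
  qed
  have "(\<Sum>y \<in> ?R. F (diag_part 0 i y) (diag_part i (2 * j) y)) = (\<Sum>y \<in> ?R. case_prod F (?\<psi> y))" by simp
  also have "\<dots> = real (card (U_ker i j \<gamma>)) * (\<Sum>p \<in> ?\<psi> ` ?R. case_prod F p)"
    using sum_subgroup_over_fibers[OF R, of ?\<psi> "\<lambda>(a, b) (a', b'). (a * a', b * b')" "case_prod F"] mult
    unfolding ker by blast
  finally show ?thesis
    unfolding im sum.cartesian_product using card_U_ker[where i = i and j = j and \<gamma> = \<gamma>, OF \<gamma>] by simp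
qed

end

section \<open>Double cosets of parabolic subgroups\<close>

text \<open>
  The permutation takes the coordinates, grouped in blocks of sizes
  \<open>k1, k2, k3 | m, 2 * l, m | k3, k2, k1\<close>, to the same coordinates grouped in blocks of sizes
  \<open>k1, m, k3 | k2, 2 * l, k2 | k3, m, k1\<close>; it transposes the 3 by 3 grid of blocks.
\<close>

definition perm :: "nat \<Rightarrow> nat \<Rightarrow> nat \<Rightarrow> nat \<Rightarrow> nat \<Rightarrow> nat \<Rightarrow> nat" where
  "perm k1 k2 k3 m l r =
    (let i = k1 + m + k3; j = k2 + l; k = k1 + k2 + k3 in
     if r < k1 then r
     else if r < k1 + k2 then i + (r - k1)
     else if r < k then i + 2 * j + (r - (k1 + k2))
     else if r < k + m then k1 + (r - k)
     else if r < k + m + 2 * l then i + k2 + (r - (k + m))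
     else if r < k + 2 * m + 2 * l then i + 2 * j + k3 + (r - (k + m + 2 * l))
     else if r < k + 2 * m + 2 * l + k3 then k1 + m + (r - (k + 2 * m + 2 * l))
     else if r < k + 2 * m + 2 * l + k3 + k2 then i + k2 + 2 * l + (r - (k + 2 * m + 2 * l + k3))
     else i + 2 * j + k3 + m + (r - (k + 2 * m + 2 * l + k3 + k2)))"

definition perm_inv :: "nat \<Rightarrow> nat \<Rightarrow> nat \<Rightarrow> nat \<Rightarrow> nat \<Rightarrow> nat \<Rightarrow> nat" where
  "perm_inv k1 k2 k3 m l t =
    (let i = k1 + m + k3; j = k2 + l; k = k1 + k2 + k3 in
     if t < k1 then t
     else if t < k1 + m then k + (t - k1)
     else if t < i then k + 2 * m + 2 * l + (t - (k1 + m))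
     else if t < i + k2 then k1 + (t - i)
     else if t < i + k2 + 2 * l then k + m + (t - (i + k2))
     else if t < i + 2 * j then k + 2 * m + 2 * l + k3 + (t - (i + k2 + 2 * l))
     else if t < i + 2 * j + k3 then k1 + k2 + (t - (i + 2 * j))
     else if t < i + 2 * j + k3 + m then k + m + 2 * l + (t - (i + 2 * j + k3))
     else k + 2 * m + 2 * l + k3 + k2 + (t - (i + 2 * j + k3 + m)))"

locale grid =
  fixes k1 k2 k3 m l :: nat
begin

abbreviation "i \<equiv> k1 + m + k3"
abbreviation "j \<equiv> k2 + l"
abbreviation "k \<equiv> k1 + k2 + k3"
abbreviation "N \<equiv> 2 * (i + j)"
abbreviation "\<pi> \<equiv> perm k1 k2 k3 m l"
abbreviation "\<pi>' \<equiv> perm_inv k1 k2 k3 m l"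
abbreviation "\<beta>Q \<equiv> block_of [i, 2 * j, i]"
abbreviation "\<beta>P \<equiv> block_of [k, 2 * (m + l), k]"

text \<open>The levels of \<open>P\<close> seen in the coordinates of \<open>Q\<close>: by
  \<open>upper_minor_perm\<close>, \<open>upper \<gamma>\<close> is the condition of being upper
  triangular for \<open>P\<close> after conjugation by \<open>wmat\<close>.\<close>

definition \<gamma> :: "nat \<Rightarrow> nat" where "\<gamma> t = \<beta>P (\<pi>' t)"

text \<open>Each of the nine intervals is parametrised by an offset \<open>a\<close>, so that the
  case distinctions inside \<open>perm\<close> and \<open>perm_inv\<close> are settled by
  simplification.\<close>

lemma P_cases:
  assumes "r < N"
  obtains (1) a where "r = a" "a < k1" | (2) a where "r = k1 + a" "a < k2" | (3) a where "r = k1 + k2 + a" "a < k3"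
    | (4) a where "r = k + a" "a < m" | (5) a where "r = k + m + a" "a < 2 * l" | (6) a where "r = k + m + 2 * l + a" "a < m"
    | (7) a where "r = k + 2 * m + 2 * l + a" "a < k3" | (8) a where "r = k + 2 * m + 2 * l + k3 + a" "a < k2"
    | (9) a where "r = k + 2 * m + 2 * l + k3 + k2 + a" "a < k1"
proof -
  consider "r < k1" | "k1 \<le> r" "r < k1 + k2" | "k1 + k2 \<le> r" "r < k" | "k \<le> r" "r < k + m"
    | "k + m \<le> r" "r < k + m + 2 * l" | "k + m + 2 * l \<le> r" "r < k + 2 * m + 2 * l"
    | "k + 2 * m + 2 * l \<le> r" "r < k + 2 * m + 2 * l + k3"
    | "k + 2 * m + 2 * l + k3 \<le> r" "r < k + 2 * m + 2 * l + k3 + k2" | "k + 2 * m + 2 * l + k3 + k2 \<le> r"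
    by linarith
  then show thesis
  proof cases
    case 1 then show thesis using that(1)[of r] by simp
  next
    case 2 then show thesis using that(2)[of "r - k1"] by simp
  next
    case 3 then show thesis using that(3)[of "r - (k1 + k2)"] by simp
  next
    case 4 then show thesis using that(4)[of "r - k"] by simp
  next
    case 5 then show thesis using that(5)[of "r - (k + m)"] by simp
  next
    case 6 then show thesis using that(6)[of "r - (k + m + 2 * l)"] by simp
  next
    case 7 then show thesis using that(7)[of "r - (k + 2 * m + 2 * l)"] by simp
  next
    case 8 then show thesis using that(8)[of "r - (k + 2 * m + 2 * l + k3)"] by simp
  next
    case 9 then show thesis using that(9)[of "r - (k + 2 * m + 2 * l + k3 + k2)"] assms by simp
  qed
qed

lemma Q_cases:
  assumes "t < N"
  obtains (1) a where "t = a" "a < k1" | (2) a where "t = k1 + a" "a < m" | (3) a where "t = k1 + m + a" "a < k3"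
    | (4) a where "t = i + a" "a < k2" | (5) a where "t = i + k2 + a" "a < 2 * l" | (6) a where "t = i + k2 + 2 * l + a" "a < k2"
    | (7) a where "t = i + 2 * j + a" "a < k3" | (8) a where "t = i + 2 * j + k3 + a" "a < m"
    | (9) a where "t = i + 2 * j + k3 + m + a" "a < k1"
proof -
  consider "t < k1" | "k1 \<le> t" "t < k1 + m" | "k1 + m \<le> t" "t < i" | "i \<le> t" "t < i + k2"
    | "i + k2 \<le> t" "t < i + k2 + 2 * l" | "i + k2 + 2 * l \<le> t" "t < i + 2 * j"
    | "i + 2 * j \<le> t" "t < i + 2 * j + k3"
    | "i + 2 * j + k3 \<le> t" "t < i + 2 * j + k3 + m" | "i + 2 * j + k3 + m \<le> t"
    by linarith
  then show thesis
  proof cases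
    case 1 then show thesis using that(1)[of t] by simp
  next
    case 2 then show thesis using that(2)[of "t - k1"] by simp
  next
    case 3 then show thesis using that(3)[of "t - (k1 + m)"] by simp
  next
    case 4 then show thesis using that(4)[of "t - i"] by simp
  next
    case 5 then show thesis using that(5)[of "t - (i + k2)"] by simp
  next
    case 6 then show thesis using that(6)[of "t - (i + k2 + 2 * l)"] by simp
  next
    case 7 then show thesis using that(7)[of "t - (i + 2 * j)"] by simp
  next
    case 8 then show thesis using that(8)[of "t - (i + 2 * j + k3)"] by simp
  next
    case 9 then show thesis using that(9)[of "t - (i + 2 * j + k3 + m)"] assms by simp
  qed
qed

lemma perm_bound_inv:
  assumes "r < N"
  shows "\<pi> r < N \<and> \<pi>' (\<pi> r) = r"
  using assms by (cases rule: P_cases) (simp_all add: perm_def perm_inv_def Let_def)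

lemma perm_rev:
  assumes "r < N"
  shows "\<pi> (N - Suc r) = N - Suc (\<pi> r)"
  using assms by (cases rule: P_cases) (simp_all add: perm_def Let_def, arith+)

lemma perm_props:
  assumes "r < N"
  shows "\<pi> r < N \<and> \<pi>' (\<pi> r) = r \<and> \<pi> (N - Suc r) = N - Suc (\<pi> r)"
  using perm_bound_inv[OF assms] perm_rev[OF assms] by blast

lemma perm_inv_props:
  assumes "t < N"
  shows "\<pi>' t < N \<and> \<pi> (\<pi>' t) = t"
  using assms by (cases rule: Q_cases) (simp_all add: perm_def perm_inv_def Let_def)

lemma perm_inv_rev: "t < N \<Longrightarrow> \<pi>' (N - Suc t) = N - Suc (\<pi>' t)"
  using perm_inv_props[of t] perm_props[of "\<pi>' t"] perm_props[of "N - Suc (\<pi>' t)"] by simp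

text \<open>On the two Levi factors of \<open>P\<close> the flag of \<open>Q\<close> becomes the
  block structure for which \<open>a\<close> and \<open>b\<close> get restricted.\<close>

lemma \<beta>Q_perm:
  "r < k \<Longrightarrow> \<beta>Q (\<pi> r) = block_of [k1, k2, k3] r"
  "r < 2 * (m + l) \<Longrightarrow> \<beta>Q (\<pi> (k + r)) = block_of [m, 2 * l, m] r"
proof -
  assume "r < k"
  then consider "r < k1" | "k1 \<le> r" "r < k1 + k2" | "k1 + k2 \<le> r" "r < k" by linarith
  then show "\<beta>Q (\<pi> r) = block_of [k1, k2, k3] r" by cases (simp_all add: perm_def Let_def)
next
  assume "r < 2 * (m + l)"
  then consider "r < m" | "m \<le> r" "r < m + 2 * l" | "m + 2 * l \<le> r" "r < 2 * (m + l)" by linarith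
  then show "\<beta>Q (\<pi> (k + r)) = block_of [m, 2 * l, m] r" by cases (simp_all add: perm_def Let_def, arith?)
qed

text \<open>Conversely, on the two Levi factors of \<open>Q\<close> the flag of \<open>P\<close>
  becomes the flag of a parabolic subgroup; these are the subgroups from which the twisted action
  induces.\<close>

lemma \<gamma>_blocks:
  "r < i \<Longrightarrow> \<gamma> r = block_of [k1, m, k3] r"
  "r < 2 * j \<Longrightarrow> \<gamma> (i + r) = block_of [k2, 2 * l, k2] r"
proof -
  assume "r < i"
  then consider "r < k1" | "k1 \<le> r" "r < k1 + m" | "k1 + m \<le> r" "r < i" by linarith
  then show "\<gamma> r = block_of [k1, m, k3] r" by cases (simp_all add: perm_inv_def Let_def \<gamma>_def)
next
  assume "r < 2 * j"
  then consider "r < k2" | "k2 \<le> r" "r < k2 + 2 * l" | "k2 + 2 * l \<le> r" "r < 2 * j" by linarith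
  then show "\<gamma> (i + r) = block_of [k2, 2 * l, k2] r" by cases (simp_all add: perm_inv_def Let_def \<gamma>_def, arith?)
qed

text \<open>The span of the first \<open>k\<close> unit vectors goes to a coordinate subspace that
  meets each level in an initial segment, which is the normal form reached by
  \<open>isotropic_reduction\<close>.\<close>

lemma perm_image: "\<pi> ` {..<k} = {0..<k1} \<union> {i..<i + k2} \<union> {i + 2 * j..<i + 2 * j + k3}"
proof (intro equalityI subsetI)
  fix t assume "t \<in> \<pi> ` {..<k}"
  then obtain r where r: "r < k" "t = \<pi> r" by auto
  consider "r < k1" | "k1 \<le> r" "r < k1 + k2" | "k1 + k2 \<le> r" "r < k" using r(1) by linarith
  then show "t \<in> {0..<k1} \<union> {i..<i + k2} \<union> {i + 2 * j..<i + 2 * j + k3}"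
    unfolding r(2) by cases (simp_all add: perm_def Let_def)
next
  fix t assume "t \<in> {0..<k1} \<union> {i..<i + k2} \<union> {i + 2 * j..<i + 2 * j + k3}"
  then consider "t < k1" | "i \<le> t" "t < i + k2" | "i + 2 * j \<le> t" "t < i + 2 * j + k3" by auto
  then have "\<pi>' t < k \<and> t < N" by cases (simp_all add: perm_inv_def Let_def)
  then show "t \<in> \<pi> ` {..<k}" using perm_inv_props[of t] by (intro image_eqI[of _ _ "\<pi>' t"]) auto
qed

lemma \<beta>P_rev: "r < N \<Longrightarrow> \<beta>P (N - Suc r) = 2 - \<beta>P r" and \<beta>P_le: "r < N \<Longrightarrow> \<beta>P r \<le> 2"
proof -
  assume "r < N"
  then have r: "r < k + 2 * (m + l) + k" by simp
  have "k + 2 * (m + l) + k - Suc r = N - Suc r" by simp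
  then show "\<beta>P (N - Suc r) = 2 - \<beta>P r" "\<beta>P r \<le> 2" using block_of_rev3[OF r] by (simp_all del: block_of.simps)
qed

lemma \<gamma>_rev_less:
  assumes "r < N" "s < N" "\<gamma> s < \<gamma> r"
  shows "\<gamma> (N - Suc r) < \<gamma> (N - Suc s)"
  using assms perm_inv_props[OF assms(1)] perm_inv_props[OF assms(2)]
    \<beta>P_rev[of "\<pi>' r"] \<beta>P_rev[of "\<pi>' s"] \<beta>P_le[of "\<pi>' r"] \<beta>P_le[of "\<pi>' s"]
  unfolding \<gamma>_def perm_inv_rev[OF assms(1)] perm_inv_rev[OF assms(2)] by linarith

definition wmat :: "'k::field mat" where
  "wmat = mat N N (\<lambda>(r, s). if r = \<pi> s then 1 else 0)"

lemma wmat_carrier [simp]: "wmat \<in> carrier_mat N N"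
  by (simp add: wmat_def)

lemma mult_wmat:
  assumes "A \<in> carrier_mat N N" "r < N" "s < N"
  shows "(A * wmat) $$ (r, s) = A $$ (r, \<pi> s)"
proof -
  have "(A * wmat) $$ (r, s) = (\<Sum>t<N. if t = \<pi> s then A $$ (r, t) else 0)"
    unfolding mult_mat_entry[OF assms(1) wmat_carrier assms(2,3)]
    using assms(3) by (intro sum.cong) (auto simp: wmat_def)
  also have "\<dots> = A $$ (r, \<pi> s)" using perm_props[OF assms(3)] by (simp only: sum.delta finite_lessThan) simp
  finally show ?thesis .
qed

lemma wmat_mult:
  assumes "A \<in> carrier_mat N N" "r < N" "s < N"
  shows "(wmat * A) $$ (r, s) = A $$ (\<pi>' r, s)"
proof -
  have e: "r = \<pi> t \<longleftrightarrow> t = \<pi>' r" if "t < N" for t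
    using perm_props[OF that] perm_inv_props[OF assms(2)] by metis
  have "(wmat * A) $$ (r, s) = (\<Sum>t<N. if t = \<pi>' r then A $$ (t, s) else 0)"
    unfolding mult_mat_entry[OF wmat_carrier assms(1) assms(2,3)]
    using assms(2) e by (intro sum.cong) (auto simp: wmat_def)
  also have "\<dots> = A $$ (\<pi>' r, s)" using perm_inv_props[OF assms(2)] by (simp only: sum.delta finite_lessThan) simp
  finally show ?thesis .
qed

text \<open>Conjugation by \<open>wmat\<close> is a relabelling of the indices.\<close>

lemma wmat_mult_minor:
  assumes "A \<in> carrier_mat N N"
  shows "wmat * minor N \<pi> A = A * wmat"
proof (rule eq_matI)
  fix r s assume "r < dim_row (A * wmat)" "s < dim_col (A * wmat)"
  then have rs: "r < N" "s < N" using assms by (auto simp: wmat_def)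
  show "(wmat * minor N \<pi> A) $$ (r, s) = (A * wmat) $$ (r, s)"
    unfolding wmat_mult[OF minor_carrier rs] mult_wmat[OF assms rs]
    using perm_inv_props[OF rs(1)] rs by (simp add: minor_def)
qed (use assms in \<open>auto simp: wmat_def minor_def\<close>)

lemma upper_minor_perm:
  assumes "A \<in> carrier_mat N N"
  shows "upper \<beta>P (minor N \<pi> A) \<longleftrightarrow> upper \<gamma> A"
proof
  assume u: "upper \<beta>P (minor N \<pi> A)"
  show "upper \<gamma> A" unfolding upper_def
  proof (intro allI impI)
    fix r s assume "r < dim_row A" "s < dim_col A" and lt: "\<gamma> s < \<gamma> r"
    then have rs: "r < N" "s < N" using assms by auto
    note p = perm_inv_props[OF rs(1)] perm_inv_props[OF rs(2)]
    have "minor N \<pi> A $$ (\<pi>' r, \<pi>' s) = 0"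
      using u[unfolded upper_def, rule_format, of "\<pi>' r" "\<pi>' s"] p lt
      unfolding \<gamma>_def by (simp add: minor_def del: block_of.simps)
    then show "A $$ (r, s) = 0" using p by (simp add: minor_def)
  qed
next
  assume u: "upper \<gamma> A"
  show "upper \<beta>P (minor N \<pi> A)" unfolding upper_def
  proof (intro allI impI)
    fix r s assume "r < dim_row (minor N \<pi> A)" "s < dim_col (minor N \<pi> A)" and lt: "\<beta>P s < \<beta>P r"
    then have rs: "r < N" "s < N" by (auto simp: minor_def)
    note p = perm_props[OF rs(1)] perm_props[OF rs(2)]
    have "A $$ (\<pi> r, \<pi> s) = 0"
      using u[unfolded upper_def, rule_format, of "\<pi> r" "\<pi> s"] p lt assms
      unfolding \<gamma>_def by (simp del: block_of.simps)
    then show "minor N \<pi> A $$ (r, s) = 0" using rs by (simp add: minor_def)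
  qed
qed

end

context unitary
begin

text \<open>The permutation commutes with the reversal of the indices (\<open>perm_rev\<close>), so
  its matrix preserves the form.\<close>

lemma wmat_U: "(grid.wmat k1 k2 k3 m l :: 'k mat) \<in> carrier (U q (k1 + m + k3 + (k2 + l)))"
proof -
  interpret grid k1 k2 k3 m l .
  have "flip c wmat * wmat = 1\<^sub>m N"
  proof (rule eq_matI)
    fix r s assume "r < dim_row (1\<^sub>m N)" "s < dim_col (1\<^sub>m N)"
    then have rs: "r < N" "s < N" by auto
    note p = perm_props[OF rs(1)] perm_props[OF rs(2)]
    have "(flip c wmat * wmat) $$ (r, s) = flip c wmat $$ (r, \<pi> s)"
      by (rule mult_wmat[OF flip_carrier[OF wmat_carrier] rs])
    also have "\<dots> = c (if N - Suc (\<pi> s) = \<pi> (N - Suc r) then 1 else 0)"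
      using rs p by (simp add: wmat_def)
    also have "N - Suc (\<pi> s) = \<pi> (N - Suc r) \<longleftrightarrow> r = s"
    proof
      assume "N - Suc (\<pi> s) = \<pi> (N - Suc r)"
      then have "\<pi> s = \<pi> r" using p by (simp only:) linarith
      then show "r = s" using p by metis
    qed (use p in simp)
    finally show "(flip c wmat * wmat) $$ (r, s) = 1\<^sub>m N $$ (r, s)" using rs by simp
  qed (auto simp: wmat_def)
  then show ?thesis unfolding U_iff using wmat_carrier by blast
qed

end

text \<open>The group \<open>Q \<inter> w P w\<inverse>\<close> acts simply transitively on the
  pairs \<open>(y, p)\<close> with a given product \<open>y w p\<close>, so all fibres of this map
  have its order.\<close>

lemma (in group) sum_double_coset:
  assumes fin: "finite (carrier G)" and Q: "subgroup Q G" and P: "subgroup P G" and w: "w \<in> carrier G"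
    and f: "\<And>g p. g \<in> carrier G \<Longrightarrow> p \<in> P \<Longrightarrow> f (g \<otimes> p) = (f g :: real)"
  shows "real (card {z \<in> Q. inv w \<otimes> z \<otimes> w \<in> P}) * (\<Sum>g \<in> (\<lambda>(y, p). y \<otimes> w \<otimes> p) ` (Q \<times> P). f g) =
    real (card P) * (\<Sum>y \<in> Q. f (y \<otimes> w))"
proof -
  let ?R = "{z \<in> Q. inv w \<otimes> z \<otimes> w \<in> P}" and ?\<phi> = "\<lambda>(y, p). y \<otimes> w \<otimes> p"
  have canc: "x \<otimes> (inv x \<otimes> y) = y" "inv x \<otimes> (x \<otimes> y) = y" if "x \<in> carrier G" "y \<in> carrier G" for x y
    using that by (simp_all flip: m_assoc)
  note Qc = subgroup.mem_carrier[OF Q] and Pc = subgroup.mem_carrier[OF P]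
  have finQP: "finite (Q \<times> P)" using finite_subset[OF subgroup.subset[OF Q] fin] finite_subset[OF subgroup.subset[OF P] fin] by simp
  have fiber: "card {x \<in> Q \<times> P. ?\<phi> x = g} = card ?R" if g: "g \<in> ?\<phi> ` (Q \<times> P)" for g
  proof -
    obtain y0 p0 where y0: "y0 \<in> Q" and p0: "p0 \<in> P" and g: "g = y0 \<otimes> w \<otimes> p0" using g by auto
    have "bij_betw (\<lambda>z. (y0 \<otimes> z, inv (inv w \<otimes> z \<otimes> w) \<otimes> p0)) ?R {x \<in> Q \<times> P. ?\<phi> x = g}"
    proof (rule bij_betwI[where g = "\<lambda>(y, p). inv y0 \<otimes> y"])
      show "(\<lambda>z. (y0 \<otimes> z, inv (inv w \<otimes> z \<otimes> w) \<otimes> p0)) \<in> ?R \<rightarrow> {x \<in> Q \<times> P. ?\<phi> x = g}"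
      proof
        fix z assume z: "z \<in> ?R"
        have "y0 \<otimes> z \<otimes> w \<otimes> (inv (inv w \<otimes> z \<otimes> w) \<otimes> p0) = y0 \<otimes> w \<otimes> p0"
          using z y0 p0 w Qc Pc by (simp add: inv_mult_group m_assoc canc)
        then show "(y0 \<otimes> z, inv (inv w \<otimes> z \<otimes> w) \<otimes> p0) \<in> {x \<in> Q \<times> P. ?\<phi> x = g}"
          using z y0 p0 g subgroup.m_closed[OF Q] subgroup.m_closed[OF P] subgroup.m_inv_closed[OF P] by auto
      qed
      show "(\<lambda>(y, p). inv y0 \<otimes> y) \<in> {x \<in> Q \<times> P. ?\<phi> x = g} \<rightarrow> ?R"
      proof
        fix x assume "x \<in> {x \<in> Q \<times> P. ?\<phi> x = g}"
        then obtain y p where x: "x = (y, p)" "y \<in> Q" "p \<in> P" and e: "y \<otimes> w \<otimes> p = y0 \<otimes> w \<otimes> p0" using g by auto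
        have c: "y \<in> carrier G" "p \<in> carrier G" "y0 \<in> carrier G" "p0 \<in> carrier G" using x y0 p0 Qc Pc by auto
        have "y \<otimes> w = y0 \<otimes> w \<otimes> p0 \<otimes> inv p" using e c w by (metis inv_solve_right m_closed)
        then have "inv w \<otimes> (inv y0 \<otimes> y) \<otimes> w = inv w \<otimes> (inv y0 \<otimes> (y0 \<otimes> w \<otimes> p0 \<otimes> inv p))"
          using c w by (simp add: m_assoc)
        also have "\<dots> = p0 \<otimes> inv p" using c w by (simp add: m_assoc canc)
        finally have "inv w \<otimes> (inv y0 \<otimes> y) \<otimes> w = p0 \<otimes> inv p" .
        then show "(\<lambda>(y, p). inv y0 \<otimes> y) x \<in> ?R"
          using x y0 p0 subgroup.m_closed[OF Q] subgroup.m_inv_closed[OF Q] subgroup.m_closed[OF P] subgroup.m_inv_closed[OF P]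
          by simp
      qed
      show "(\<lambda>(y, p). inv y0 \<otimes> y) (y0 \<otimes> z, inv (inv w \<otimes> z \<otimes> w) \<otimes> p0) = z" if "z \<in> ?R" for z
        using that y0 Qc by (simp flip: m_assoc)
      fix x assume "x \<in> {x \<in> Q \<times> P. ?\<phi> x = g}"
      then obtain y p where x: "x = (y, p)" "y \<in> Q" "p \<in> P" and e: "y \<otimes> w \<otimes> p = y0 \<otimes> w \<otimes> p0" using g by auto
      have c: "y \<in> carrier G" "p \<in> carrier G" "y0 \<in> carrier G" "p0 \<in> carrier G" using x y0 p0 Qc Pc by auto
      have 1: "y0 \<otimes> (inv y0 \<otimes> y) = y" using c by (simp flip: m_assoc)
      have "inv (inv w \<otimes> (inv y0 \<otimes> y) \<otimes> w) \<otimes> p0 = inv (y \<otimes> w) \<otimes> (y0 \<otimes> w \<otimes> p0)"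
        using c w by (simp add: inv_mult_group m_assoc)
      also have "\<dots> = p" unfolding e[symmetric] using canc(2)[of "y \<otimes> w" p] c w by simp
      finally show "(\<lambda>z. (y0 \<otimes> z, inv (inv w \<otimes> z \<otimes> w) \<otimes> p0)) ((\<lambda>(y, p). inv y0 \<otimes> y) x) = x"
        using 1 x by simp
    qed
    from bij_betw_same_card[OF this] show ?thesis by simp
  qed
  have "real (card P) * (\<Sum>y \<in> Q. f (y \<otimes> w)) = (\<Sum>y \<in> Q. \<Sum>p \<in> P. f (y \<otimes> w \<otimes> p))"
    using f Qc w by (simp add: sum_distrib_left)
  also have "\<dots> = (\<Sum>x \<in> Q \<times> P. f (?\<phi> x))" by (simp add: sum.cartesian_product case_prod_unfold)
  also have "\<dots> = (\<Sum>g \<in> ?\<phi> ` (Q \<times> P). \<Sum>x \<in> {x \<in> Q \<times> P. ?\<phi> x = g}. f (?\<phi> x))"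
    by (rule sum.image_gen[OF finQP])
  also have "\<dots> = (\<Sum>g \<in> ?\<phi> ` (Q \<times> P). real (card ?R) * f g)"
  proof (rule sum.cong[OF refl])
    fix g assume g: "g \<in> ?\<phi> ` (Q \<times> P)"
    have "(\<Sum>x \<in> {x \<in> Q \<times> P. ?\<phi> x = g}. f (?\<phi> x)) = (\<Sum>x \<in> {x \<in> Q \<times> P. ?\<phi> x = g}. f g)"
      by (rule sum.cong) auto
    then show "(\<Sum>x \<in> {x \<in> Q \<times> P. ?\<phi> x = g}. f (?\<phi> x)) = real (card ?R) * f g"
      by (simp only: sum_constant fiber[OF g])
  qed
  finally show ?thesis by (simp add: sum_distrib_left)
qed

lemma initial_segment:
  assumes "A \<subseteq> {a..<b}" and down: "\<And>s t. s \<in> A \<Longrightarrow> a \<le> t \<Longrightarrow> t < s \<Longrightarrow> t \<in> A"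
  shows "A = {a..<a + card A}"
proof (cases "A = {}")
  case False
  have fin: "finite A" using assms(1) finite_subset by blast
  have "A = {a..<Suc (Max A)}"
  proof (intro equalityI subsetI)
    fix t assume "t \<in> {a..<Suc (Max A)}"
    then show "t \<in> A" using down[OF Max_in[OF fin False], of t] Max_in[OF fin False] by (cases "t = Max A") auto
  qed (use assms(1) Max_ge[OF fin] in \<open>auto simp: less_Suc_eq_le\<close>)
  moreover from this have "card A = Suc (Max A) - a" by (metis card_atLeastLessThan)
  moreover have "a \<le> Max A" using Max_in[OF fin False] assms(1) by auto
  ultimately show ?thesis by simp
qed simp

lemma card_field: "CARD('k::{field,finite}) > 1"
  using card_mono[of UNIV "{0, 1 :: 'k}"] by simp

section \<open>Double cosets as relative positions of an isotropic subspace and a flag\<close>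

context unitary_flag
begin

lemma card_coords:
  assumes "S \<subseteq> {..<N}"
  shows "card (coords S) = CARD('k) ^ card S"
proof -
  have fin: "finite S" using assms finite_subset by blast
  have "bij_betw (\<lambda>v. restrict (\<lambda>r. v $ r) S) (coords S) (S \<rightarrow>\<^sub>E (UNIV :: 'k set))"
    by (rule bij_betwI[where g = "\<lambda>f. vec N (\<lambda>r. if r \<in> S then f r else 0)"])
      (use assms in \<open>auto simp: coords_def PiE_def extensional_def restrict_def fun_eq_iff intro!: eq_vecI\<close>)
  from bij_betw_same_card[OF this] show ?thesis by (simp add: card_PiE[OF fin])
qed

lemma finite_coords [simp]: "finite (coords S)"
  by (rule finite_subset[OF _ finite_carrier_vec[of N]]) (auto simp: coords_def)

lemma U_inj: "(y :: 'k mat) \<in> carrier (U q n) \<Longrightarrow> inj_on (\<lambda>x. y *\<^sub>v x) (carrier_vec N)"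
proof (rule inj_on_inverseI[where g = "\<lambda>x. mat_inv y *\<^sub>v x"])
  fix x :: "'k vec" assume y: "y \<in> carrier (U q n)" and x: "x \<in> carrier_vec N"
  show "mat_inv y *\<^sub>v (y *\<^sub>v x) = x"
    using assoc_mult_mat_vec[OF mat_inv_props(2)[OF U_GL[OF y]] U_carrier[OF y] x]
    unfolding mat_inv_props(3)[OF U_GL[OF y]] using x by simp
qed

text \<open>Dimensions of coordinate subspaces are compared by counting their vectors over the
  finite field.\<close>

lemma coords_card_le:
  assumes S: "S \<subseteq> {..<N}" "S' \<subseteq> {..<N}" and y: "y \<in> carrier (U q n)"
    and sub: "\<And>x. x \<in> coords S \<Longrightarrow> y *\<^sub>v x \<in> coords S'"
  shows "card S \<le> card S'"
proof -
  have "inj_on (\<lambda>x. y *\<^sub>v x) (coords S)"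
    using U_inj[OF y] by (rule inj_on_subset) (auto simp: coords_def)
  then have "card (coords S) \<le> card (coords S')" using sub by (intro card_inj_on_le) auto
  then show ?thesis unfolding card_coords[OF S(1)] card_coords[OF S(2)] using card_field[where 'k = 'k] by simp
qed

lemma coords_entries:
  assumes y: "y \<in> carrier_mat N N" and S: "S \<subseteq> {..<N}" and x: "x \<in> coords S"
    and zero: "\<And>r t. r < N \<Longrightarrow> r \<notin> S' \<Longrightarrow> t \<in> S \<Longrightarrow> y $$ (r, t) = 0"
  shows "y *\<^sub>v x \<in> coords S'"
proof -
  have xc: "x \<in> carrier_vec N" using x by (simp add: coords_def)
  have "(y *\<^sub>v x) $ r = 0" if r: "r < N" "r \<notin> S'" for r
  proof -
    have "y $$ (r, t) * x $ t = 0" if "t < N" for t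
      using zero[OF r] x that by (cases "t \<in> S") (auto simp: coords_def)
    then show ?thesis using y xc r by (auto simp: scalar_prod_def intro!: sum.neutral)
  qed
  then show ?thesis using mult_mat_vec_carrier[OF y xc] by (simp add: coords_def)
qed

end

lemma mat_mult_unit_vec_index:
  fixes M :: "'a::semiring_1 mat"
  assumes "M \<in> carrier_mat n n" "r < n" "s < n"
  shows "(M *\<^sub>v unit_vec n s) $ r = M $$ (r, s)"
  using assms by simp

context unitary
begin

lemma unitary_flag_block: "unitary_flag q c (i + j) (block_of [i, 2 * j, i])"
proof
  fix r assume r: "r < 2 * (i + j)"
  then have r': "r < i + 2 * j + i" by simp
  have e: "i + 2 * j + i - Suc r = 2 * (i + j) - Suc r" by simp
  show "block_of [i, 2 * j, i] r \<le> 2" by (rule block_of_rev3(2)[OF r'])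
  show "block_of [i, 2 * j, i] (2 * (i + j) - Suc r) = 2 - block_of [i, 2 * j, i] r"
    using block_of_rev3(1)[OF r'] unfolding e .
qed

text \<open>The middle block sizes \<open>m\<close> and \<open>l\<close> of the grid are recovered
  as truncated differences; every use supplies the bounds \<open>k1 + k3 \<le> i\<close> and
  \<open>k2 \<le> j\<close>.\<close>

definition dcoset :: "nat \<Rightarrow> nat \<Rightarrow> nat \<Rightarrow> nat \<Rightarrow> nat \<Rightarrow> 'k mat set" where
  "dcoset i j k1 k2 k3 = (\<lambda>(y, p). y * grid.wmat k1 k2 k3 (i - k1 - k3) (j - k2) * p) `
     (parabolic (U q (i + j)) [i, 2 * j, i] \<times>
      parabolic (U q (i + j)) [k1 + k2 + k3, 2 * (i + j - (k1 + k2 + k3)), k1 + k2 + k3])"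

text \<open>\<open>k1\<close> and \<open>k1 + k2\<close> are the dimensions in which the isotropic
  subspace belonging to \<open>w\<close> meets the first and the second step of the flag of
  \<open>Q\<close>. The element \<open>z\<close> preserves the flag and, by \<open>eq\<close>, maps
  this subspace into the one belonging to \<open>w'\<close>, so the numbers cannot decrease.\<close>

lemma grid_le:
  fixes z p :: "'k mat"
  assumes ij: "k1 + m + k3 = i" "k2 + l = j" "k1' + m' + k3' = i" "k2' + l' = j" "k1 + k2 + k3 = k1' + k2' + k3'"
    and z: "z \<in> carrier (U q (i + j))" "upper (block_of [i, 2 * j, i]) z"
    and p: "p \<in> carrier_mat (2 * (i + j)) (2 * (i + j))" "upper (block_of [k1 + k2 + k3, 2 * (m + l), k1 + k2 + k3]) p"
    and eq: "z * grid.wmat k1 k2 k3 m l = grid.wmat k1' k2' k3' m' l' * p"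
  shows "k1 \<le> k1' \<and> k1 + k2 \<le> k1' + k2'"
proof -
  interpret G: grid k1 k2 k3 m l .
  interpret G': grid k1' k2' k3' m' l' .
  interpret F: unitary_flag q c "i + j" "block_of [i, 2 * j, i]" by (rule unitary_flag_block)
  let ?N = "2 * (i + j)" and ?k = "k1 + k2 + k3"
  have GN: "2 * (k1 + m + k3 + (k2 + l)) = ?N" "2 * (k1' + m' + k3' + (k2' + l')) = ?N" using ij by auto
  let ?S = "G.\<pi> ` {..<?k}" and ?S' = "G'.\<pi> ` {..<?k}"
  note zc = U_carrier[OF z(1)]
  have S: "?S = {0..<k1} \<union> {i..<i + k2} \<union> {i + 2 * j..<i + 2 * j + k3}"
    using G.perm_image unfolding ij .
  have S': "?S' = {0..<k1'} \<union> {i..<i + k2'} \<union> {i + 2 * j..<i + 2 * j + k3'}"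
    using G'.perm_image unfolding ij .
  have zero: "z $$ (r, t) = 0" if r: "r < ?N" "r \<notin> ?S'" and t: "t \<in> ?S" for r t
  proof -
    obtain s where s: "s < ?k" "t = G.\<pi> s" using t by auto
    have sN: "s < ?N" using s(1) ij by simp
    have r': "G'.\<pi>' r < ?N" "G'.\<pi> (G'.\<pi>' r) = r" using G'.perm_inv_props[of r] r(1) unfolding GN by auto
    then have nk: "\<not> G'.\<pi>' r < ?k" using r(2) by (metis imageI lessThan_iff)
    have "z $$ (r, t) = (z * G.wmat) $$ (r, s)"
      using G.mult_wmat[of z r s] zc r(1) sN s(2) unfolding GN by simp
    also have "\<dots> = p $$ (G'.\<pi>' r, s)"
      using G'.wmat_mult[of p r s] p(1) r(1) sN unfolding GN eq by simp
    also have "\<dots> = 0"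
      using p(2)[unfolded upper_def, rule_format, of "G'.\<pi>' r" s] p(1) r'(1) sN nk s(1) by simp
    finally show ?thesis .
  qed
  have lev: "z $$ (r, t) = 0" if "r < ?N" "t < ?N" "block_of [i, 2 * j, i] t < block_of [i, 2 * j, i] r" for r t
    using z(2) zc that unfolding upper_def by (auto simp del: block_of.simps)
  have "card {0..<k1} \<le> card {0..<k1'}"
  proof (rule F.coords_card_le[OF _ _ z(1)])
    show "z *\<^sub>v x \<in> F.coords {0..<k1'}" if "x \<in> F.coords {0..<k1}" for x
    proof (rule F.coords_entries[OF zc _ that])
      fix r t assume r: "r < ?N" "r \<notin> {0..<k1'}" and t: "t \<in> {0..<k1}"
      show "z $$ (r, t) = 0"
      proof (cases "r < i")
        case True
        have "r \<notin> ?S'" unfolding S' using r True by auto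
        moreover have "t \<in> ?S" unfolding S using t by auto
        ultimately show ?thesis using r(1) by (intro zero)
      next
        case False
        then show ?thesis using r t ij by (intro lev) auto
      qed
    qed (use ij in auto)
  qed (use ij in auto)
  moreover have "card ({0..<k1} \<union> {i..<i + k2}) \<le> card ({0..<k1'} \<union> {i..<i + k2'})"
  proof (rule F.coords_card_le[OF _ _ z(1)])
    show "z *\<^sub>v x \<in> F.coords ({0..<k1'} \<union> {i..<i + k2'})" if "x \<in> F.coords ({0..<k1} \<union> {i..<i + k2})" for x
    proof (rule F.coords_entries[OF zc _ that])
      fix r t assume r: "r < ?N" "r \<notin> {0..<k1'} \<union> {i..<i + k2'}" and t: "t \<in> {0..<k1} \<union> {i..<i + k2}"
      show "z $$ (r, t) = 0"
      proof (cases "r < i + 2 * j")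
        case True
        have "r \<notin> ?S'" unfolding S' using r True by auto
        moreover have "t \<in> ?S" unfolding S using t by auto
        ultimately show ?thesis using r(1) by (intro zero)
      next
        case False
        then show ?thesis using r t ij by (intro lev) auto
      qed
    qed (use ij in auto)
  qed (use ij in auto)
  moreover have "card ({0..<k1} \<union> {i..<i + k2}) = k1 + k2" "card ({0..<k1'} \<union> {i..<i + k2'}) = k1' + k2'"
    using ij by (subst card_Un_disjoint; auto)+
  ultimately show ?thesis by simp
qed

text \<open>Two representations of \<open>g\<close> can be rearranged to the equation of
  \<open>grid_le\<close> in either direction, and the resulting inequalities determine the
  triple.\<close>

lemma dcoset_disjoint:
  assumes le: "k1 + k3 \<le> i" "k2 \<le> j" "k1' + k3' \<le> i" "k2' \<le> j" and k: "k1 + k2 + k3 = k1' + k2' + k3'"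
    and g: "g \<in> dcoset i j k1 k2 k3" "g \<in> dcoset i j k1' k2' k3'"
  shows "(k1, k2, k3) = (k1', k2', k3')"
proof -
  interpret mat_group "2 * (i + j)" "U q (i + j) :: 'k mat monoid" "u q (i + j)" by (rule mat_group_U)
  define m l m' l' where "m = i - k1 - k3" and "l = j - k2" and "m' = i - k1' - k3'" and "l' = j - k2'"
  have ij: "k1 + m + k3 = i" "k2 + l = j" "k1' + m' + k3' = i" "k2' + l' = j"
    using le by (auto simp: m_def l_def m'_def l'_def)
  let ?w = "grid.wmat k1 k2 k3 m l :: 'k mat" and ?w' = "grid.wmat k1' k2' k3' m' l' :: 'k mat"
  let ?Q = "{g \<in> carrier (U q (i + j) :: 'k mat monoid). upper (block_of [i, 2 * j, i]) g}"
  let ?P = "{g \<in> carrier (U q (i + j) :: 'k mat monoid). upper (block_of [k1 + k2 + k3, 2 * (m + l), k1 + k2 + k3]) g}"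
  have ml: "i + j - (k1 + k2 + k3) = m + l" "i + j - (k1' + k2' + k3') = m + l" using ij k by auto
  have w: "?w \<in> carrier (U q (i + j))" "?w' \<in> carrier (U q (i + j))"
    using wmat_U[of k1 k2 k3 m l] wmat_U[of k1' k2' k3' m' l'] unfolding ij .
  obtain y p where y: "y \<in> ?Q" and p: "p \<in> ?P" and g1: "g = y * ?w * p"
    using g(1) unfolding dcoset_def ml parabolic_def block_upper_eq m_def[symmetric] l_def[symmetric] by auto
  obtain y' p' where y': "y' \<in> ?Q" and p': "p' \<in> ?P" and g2: "g = y' * ?w' * p'"
    using g(2) unfolding dcoset_def ml parabolic_def block_upper_eq m'_def[symmetric] l'_def[symmetric] k[symmetric] by auto
  note Q = subgroup_upper[of "block_of [i, 2 * j, i]"]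
  note P = subgroup_upper[of "block_of [k1 + k2 + k3, 2 * (m + l), k1 + k2 + k3]"]
  have c: "y \<in> carrier (U q (i + j))" "p \<in> carrier (U q (i + j))" "y' \<in> carrier (U q (i + j))" "p' \<in> carrier (U q (i + j))"
    using y p y' p' by auto
  have move: "(inv\<^bsub>U q (i + j)\<^esub> b \<otimes>\<^bsub>U q (i + j)\<^esub> a) \<otimes>\<^bsub>U q (i + j)\<^esub> v = v' \<otimes>\<^bsub>U q (i + j)\<^esub> (d \<otimes>\<^bsub>U q (i + j)\<^esub> inv\<^bsub>U q (i + j)\<^esub> e)"
    if "a \<otimes>\<^bsub>U q (i + j)\<^esub> v \<otimes>\<^bsub>U q (i + j)\<^esub> e = b \<otimes>\<^bsub>U q (i + j)\<^esub> v' \<otimes>\<^bsub>U q (i + j)\<^esub> d"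
      and "a \<in> carrier (U q (i + j))" "v \<in> carrier (U q (i + j))" "e \<in> carrier (U q (i + j))"
        "b \<in> carrier (U q (i + j))" "v' \<in> carrier (U q (i + j))" "d \<in> carrier (U q (i + j))" for a b v v' d e :: "'k mat"
  proof -
    have "a \<otimes>\<^bsub>U q (i + j)\<^esub> v = b \<otimes>\<^bsub>U q (i + j)\<^esub> v' \<otimes>\<^bsub>U q (i + j)\<^esub> d \<otimes>\<^bsub>U q (i + j)\<^esub> inv\<^bsub>U q (i + j)\<^esub> e"
      using that by (metis inv_solve_right m_closed)
    then show ?thesis using that by (metis inv_closed inv_solve_left m_assoc m_closed)
  qed
  have e1: "(inv\<^bsub>U q (i + j)\<^esub> y' * y) * ?w = ?w' * (p' * inv\<^bsub>U q (i + j)\<^esub> p)"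
    using move[of y ?w p y' ?w' p'] g1 g2 c w by simp
  have e2: "(inv\<^bsub>U q (i + j)\<^esub> y * y') * ?w' = ?w * (p * inv\<^bsub>U q (i + j)\<^esub> p')"
    using move[of y' ?w' p' y ?w p] g1 g2 c w by simp
  have m1: "inv\<^bsub>U q (i + j)\<^esub> y' * y \<in> ?Q" "inv\<^bsub>U q (i + j)\<^esub> y * y' \<in> ?Q"
    using subgroup.m_closed[OF Q subgroup.m_inv_closed[OF Q y'] y] subgroup.m_closed[OF Q subgroup.m_inv_closed[OF Q y] y'] by simp_all
  have m2: "p' * inv\<^bsub>U q (i + j)\<^esub> p \<in> ?P" "p * inv\<^bsub>U q (i + j)\<^esub> p' \<in> ?P"
    using subgroup.m_closed[OF P p' subgroup.m_inv_closed[OF P p]] subgroup.m_closed[OF P p subgroup.m_inv_closed[OF P p']] by simp_all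
  have ml': "m + l = m' + l'" using ij k by simp
  have "k1 \<le> k1' \<and> k1 + k2 \<le> k1' + k2'"
    using m1(1) m2(1) by (intro grid_le[OF ij k _ _ _ _ e1]) (auto dest: U_carrier simp del: block_of.simps)
  moreover have "k1' \<le> k1 \<and> k1' + k2' \<le> k1 + k2"
    using m1(2) m2(2) unfolding k ml' by (intro grid_le[OF ij(3,4,1,2) k[symmetric] _ _ _ _ e2]) (auto dest: U_carrier simp del: block_of.simps)
  ultimately show ?thesis using k by auto
qed

text \<open>\<open>g\<close> maps the span of the first \<open>k\<close> unit vectors to a totally
  isotropic subspace, which some \<open>y\<close> in \<open>Q\<close> brings into normal form. Then
  \<open>w\<inverse> y g\<close> preserves that span and, being unitary, also its orthogonal
  complement, so it lies in \<open>P\<close>.\<close>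

lemma in_dcoset:
  assumes g: "g \<in> carrier (U q (i + j))" and k: "k \<le> i + j"
  shows "\<exists>k1 k2 k3. k1 + k2 + k3 = k \<and> k1 + k3 \<le> i \<and> k2 \<le> j \<and> g \<in> dcoset i j k1 k2 k3"
proof -
  interpret mat_group "2 * (i + j)" "U q (i + j) :: 'k mat monoid" "u q (i + j)" by (rule mat_group_U)
  interpret F: unitary_flag q c "i + j" "block_of [i, 2 * j, i]" by (rule unitary_flag_block)
  let ?N = "2 * (i + j)" and ?b = "block_of [i, 2 * j, i]"
  note gc = U_carrier[OF g]
  define W where "W = (\<lambda>x. g *\<^sub>v x) ` F.coords {..<k}"
  have cc: "x \<in> carrier_vec ?N" if "x \<in> F.coords S" for x S using that by (simp add: F.coords_def)
  have iso0: "form ?N x y = 0" if "x \<in> F.coords {..<k}" "y \<in> F.coords {..<k}" for x y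
  proof -
    have "c (x $ r) * y $ (?N - Suc r) = 0" if "r < ?N" for r
      using \<open>x \<in> _\<close> \<open>y \<in> _\<close> that k by (cases "r < k") (auto simp: F.coords_def)
    then show ?thesis unfolding form_def by (intro sum.neutral) simp
  qed
  have "\<exists>y S. F.good {..<?N} y \<and> S \<subseteq> {..<?N} \<and> (\<forall>s \<in> S. ?N - Suc s \<notin> S) \<and>
    (\<forall>s \<in> S. \<forall>t \<in> {..<?N}. ?b t = ?b s \<and> t < s \<longrightarrow> t \<in> S) \<and> (\<lambda>v. y *\<^sub>v v) ` W = F.coords S"
  proof (rule F.isotropic_reduction)
    show "W \<subseteq> F.coords {..<?N}" using gc cc by (auto simp: W_def F.coords_def)
    have "g *\<^sub>v 0\<^sub>v ?N = 0\<^sub>v ?N" using gc by (intro eq_vecI) (auto simp: scalar_prod_def)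
    then show "0\<^sub>v ?N \<in> W" by (auto simp: W_def F.coords_def intro!: image_eqI[of _ _ "0\<^sub>v ?N"])
    show "x + y \<in> W" if xy: "x \<in> W" "y \<in> W" for x y
    proof -
      obtain x' y' where *: "x' \<in> F.coords {..<k}" "y' \<in> F.coords {..<k}" "x = g *\<^sub>v x'" "y = g *\<^sub>v y'"
        using xy by (auto simp: W_def)
      then have "x + y = g *\<^sub>v (x' + y')" using gc cc by (simp add: mult_add_distrib_mat_vec[of _ ?N ?N])
      moreover have "x' + y' \<in> F.coords {..<k}" using * by (auto simp: F.coords_def)
      ultimately show ?thesis by (auto simp: W_def)
    qed
    show "a \<cdot>\<^sub>v x \<in> W" if x: "x \<in> W" for a x
    proof -
      obtain x' where *: "x' \<in> F.coords {..<k}" "x = g *\<^sub>v x'" using x by (auto simp: W_def)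
      then have "a \<cdot>\<^sub>v x = g *\<^sub>v (a \<cdot>\<^sub>v x')" using gc cc by (simp add: mult_mat_vec[of _ ?N ?N])
      moreover have "a \<cdot>\<^sub>v x' \<in> F.coords {..<k}" using * by (auto simp: F.coords_def)
      ultimately show ?thesis by (auto simp: W_def)
    qed
    show "form ?N x y = 0" if "x \<in> W" "y \<in> W" for x y
      using that iso0 U_isometry[OF g cc cc] by (auto simp: W_def)
  qed auto
  then obtain y S where y: "F.good {..<?N} y" and S: "S \<subseteq> {..<?N}" "\<forall>s \<in> S. ?N - Suc s \<notin> S"
    "\<forall>s \<in> S. \<forall>t \<in> {..<?N}. ?b t = ?b s \<and> t < s \<longrightarrow> t \<in> S" and im: "(\<lambda>v. y *\<^sub>v v) ` W = F.coords S"
    by (elim exE conjE) (rule that; assumption)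
  have yU: "y \<in> carrier (U q (i + j))" "upper ?b y" using y by (auto simp: F.good_def)
  note yc = U_carrier[OF yU(1)]
  let ?h = "y * g"
  have hU: "?h \<in> carrier (U q (i + j))" using m_closed[OF yU(1) g] by simp
  have im': "(\<lambda>x. ?h *\<^sub>v x) ` F.coords {..<k} = F.coords S"
    unfolding im[symmetric] W_def image_image using assoc_mult_mat_vec[OF yc gc cc] by (intro image_cong) auto
  have kN: "{..<k} \<subseteq> {..<?N}" using k by auto
  have "card (F.coords S) = card (F.coords {..<k})"
    unfolding im'[symmetric] by (intro card_image inj_on_subset[OF F.U_inj[OF hU]] subsetI) (rule cc)
  then have cardS: "card S = k"
    unfolding F.card_coords[OF S(1)] F.card_coords[OF kN] using card_field[where 'k = 'k] by simp
  define k1 k2 k3 where "k1 = card (S \<inter> {0..<i})" and "k2 = card (S \<inter> {i..<i + 2 * j})"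
    and "k3 = card (S \<inter> {i + 2 * j..<?N})"
  have down: "t \<in> S" if "s \<in> S" "t < s" "t < ?N" "?b t = ?b s" for s t
    using S(3) that by blast
  have down': "t \<in> S" if "s \<in> S" "t < s" "s < i \<or> i \<le> t \<and> s < i + 2 * j \<or> i + 2 * j \<le> t" for s t
  proof -
    have "s < ?N" using S(1) that(1) by blast
    then show ?thesis
      using that by (intro down[OF that(1,2)]) (auto simp: block_of_u simp del: block_of.simps)
  qed
  have S1: "S \<inter> {0..<i} = {0..<0 + k1}" unfolding k1_def
    by (rule initial_segment[of _ 0 i]) (use S(1) in \<open>auto intro: down'\<close>)
  have S2: "S \<inter> {i..<i + 2 * j} = {i..<i + k2}" unfolding k2_def
    by (rule initial_segment[of _ i "i + 2 * j"]) (use S(1) in \<open>auto intro: down'\<close>)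
  have S3: "S \<inter> {i + 2 * j..<?N} = {i + 2 * j..<i + 2 * j + k3}" unfolding k3_def
    by (rule initial_segment[of _ "i + 2 * j" ?N]) (use S(1) in \<open>auto intro: down'\<close>)
  have S_eq: "S = {0..<k1} \<union> {i..<i + k2} \<union> {i + 2 * j..<i + 2 * j + k3}"
  proof -
    have "S = (S \<inter> {0..<i}) \<union> (S \<inter> {i..<i + 2 * j}) \<union> (S \<inter> {i + 2 * j..<?N})" using S(1) by auto
    then show ?thesis unfolding S1 S2 S3 by simp
  qed
  have rev: "?N - Suc s \<notin> S" if "s \<in> S" for s using S(2) that by blast
  have bounds: "k1 \<le> i" "k2 \<le> 2 * j" "k3 \<le> i"
    using card_mono[of "{0..<i}" "S \<inter> {0..<i}"] card_mono[of "{i..<i + 2 * j}" "S \<inter> {i..<i + 2 * j}"]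
      card_mono[of "{i + 2 * j..<?N}" "S \<inter> {i + 2 * j..<?N}"] by (auto simp: k1_def k2_def k3_def)
  have k13: "k1 + k3 \<le> i"
  proof (rule ccontr)
    assume "\<not> k1 + k3 \<le> i"
    \<comment> \<open>If the first and third segments were too long, the last index of the first one
      would have its mirror in the third.\<close>
    then have "k1 - 1 \<in> S" "?N - Suc (k1 - 1) \<in> S" using bounds unfolding S_eq by auto
    then show False using rev by blast
  qed
  have k2j: "k2 \<le> j"
  proof (rule ccontr)
    assume "\<not> k2 \<le> j"
    \<comment> \<open>Here the offending mirror pair consists of the two middle indices.\<close>
    then have "i + j \<in> S" "?N - Suc (i + j) \<in> S" using bounds unfolding S_eq by auto
    then show False using rev by blast
  qed
  have ksum: "k1 + k2 + k3 = k"
  proof -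
    have "card S = card ({0..<k1} \<union> {i..<i + k2}) + card {i + 2 * j..<i + 2 * j + k3}"
      unfolding S_eq using k13 k2j by (intro card_Un_disjoint) auto
    also have "card ({0..<k1} \<union> {i..<i + k2}) = k1 + k2" using k13 by (subst card_Un_disjoint) auto
    finally show ?thesis using cardS by simp
  qed
  define m l where "m = i - k1 - k3" and "l = j - k2"
  have ij: "k1 + m + k3 = i" "k2 + l = j" using k13 k2j by (auto simp: m_def l_def)
  interpret G: grid k1 k2 k3 m l .
  have GN: "2 * (k1 + m + k3 + (k2 + l)) = ?N" using ij by simp
  have Sp: "S = G.\<pi> ` {..<k}" using G.perm_image unfolding ij ksum S_eq by simp
  have wU: "(G.wmat :: 'k mat) \<in> carrier (U q (i + j))" using wmat_U[of k1 k2 k3 m l] unfolding ij .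
  define p where "p = mat_inv G.wmat * ?h"
  have pU: "p \<in> carrier (U q (i + j))" unfolding p_def using m_closed[OF inv_closed'[OF wU] hU] by simp
  note pc = U_carrier[OF pU] and wc = U_carrier[OF wU] and hc = U_carrier[OF hU]
  have wp: "G.wmat * p = ?h"
    unfolding p_def assoc_mult_mat[OF wc mat_inv_props(2)[OF U_GL[OF wU]] hc, symmetric]
    unfolding mat_inv_props(4)[OF U_GL[OF wU]] by (rule left_mult_one_mat[OF hc])
  have pz: "p $$ (r, s) = 0" if r: "r < ?N" "k \<le> r" and s: "s < k" for r s
  proof -
    have sN: "s < ?N" using s k by simp
    have pr: "G.\<pi> r < ?N" "G.\<pi>' (G.\<pi> r) = r" using G.perm_props[of r] r(1) unfolding GN by auto
    have "G.\<pi> r \<notin> S"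
    proof
      assume "G.\<pi> r \<in> S"
      then obtain t where t: "t < k" "G.\<pi> r = G.\<pi> t" unfolding Sp by auto
      then have "G.\<pi>' (G.\<pi> t) = t" using G.perm_props[of t] k unfolding GN by auto
      then show False using t pr r by simp
    qed
    moreover have "?h *\<^sub>v unit_vec ?N s \<in> F.coords S"
      unfolding im'[symmetric] using s by (auto simp: F.coords_def)
    ultimately have "(?h *\<^sub>v unit_vec ?N s) $ (G.\<pi> r) = 0" using pr(1) by (simp add: F.coords_def)
    then have "?h $$ (G.\<pi> r, s) = 0" unfolding mat_mult_unit_vec_index[OF hc pr(1) sN] .
    then show ?thesis using G.wmat_mult[of p "G.\<pi> r" s] pc pr sN unfolding GN wp by simp
  qed
  have up1: "upper (\<lambda>r. if r < k then 0 else 1) p"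
    using pz pc unfolding upper_def by auto
  \<comment> \<open>The inverse of \<open>p\<close> is \<open>flip c p\<close>. Flipping it back
    turns invariance of the span into invariance of the orthogonal complement, spanned by the first
    \<open>?N - k\<close> unit vectors.\<close>
  have "upper (\<lambda>r. if r < k then 0 else 1) (flip c p)"
    using upper_inv[OF pU up1] by (simp add: U_inv[OF pU])
  then have "upper (\<lambda>r. if r < ?N - k then 0 else 1) (flip c (flip c p))"
    by (rule upper_flip[where f = c and X = "flip c p" and n = ?N, OF flip_carrier[OF pc] _ c_0]) (use k in \<open>auto split: if_splits\<close>)
  then have up2: "upper (\<lambda>r. if r < ?N - k then 0 else 1) p" by (simp add: flip_c_flip_c[OF pc])
  have "upper (block_of [k, 2 * (i + j - k), k]) p"
    unfolding upper_def
  proof (intro allI impI)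
    fix r s assume rs: "r < dim_row p" "s < dim_col p" and lt: "block_of [k, 2 * (i + j - k), k] s < block_of [k, 2 * (i + j - k), k] r"
    then have N: "r < ?N" "s < ?N" using pc by auto
    have b: "block_of [k, 2 * (i + j - k), k] t = (if t < k then 0 else if t < ?N - k then 1 else 2)" if "t < ?N" for t
      using that k by auto
    have "s < k \<and> k \<le> r \<or> s < ?N - k \<and> ?N - k \<le> r"
      using lt unfolding b[OF N(1)] b[OF N(2)] by (simp split: if_splits)
    then show "p $$ (r, s) = 0"
      using up1[unfolded upper_def, rule_format, OF rs] up2[unfolded upper_def, rule_format, OF rs] by auto
  qed
  then have pP: "p \<in> parabolic (U q (i + j)) [k1 + k2 + k3, 2 * (i + j - (k1 + k2 + k3)), k1 + k2 + k3]"
    using pU unfolding ksum by (simp add: parabolic_def block_upper_eq)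
  have yQ: "mat_inv y \<in> parabolic (U q (i + j)) [i, 2 * j, i]"
    using inv_closed'[OF yU(1)] upper_inv[OF yU] by (simp add: parabolic_def block_upper_eq)
  have "mat_inv y * G.wmat * p = mat_inv y * (y * g)"
    using assoc_mult_mat[OF mat_inv_props(2)[OF U_GL[OF yU(1)]] wc pc] by (simp only: wp)
  also have "\<dots> = g"
    unfolding assoc_mult_mat[OF mat_inv_props(2)[OF U_GL[OF yU(1)]] yc gc, symmetric]
    unfolding mat_inv_props(3)[OF U_GL[OF yU(1)]] by (rule left_mult_one_mat[OF gc])
  finally have "g \<in> dcoset i j k1 k2 k3"
    unfolding dcoset_def using pP yQ unfolding m_def l_def by (intro image_eqI[of _ _ "(mat_inv y, p)"]) auto
  then show ?thesis using ksum k13 k2j by blast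
qed

end

text \<open>If the pair \<open>(\<theta>1, \<theta>2)\<close> takes all values equally often, the
  sum of products factors. \<open>unif\<close> is an inequality for all pairs of values, which by
  symmetry is an equality; so one injection between fibres is all that has to be found.\<close>

lemma sum_uniform_fibers:
  fixes f :: "'a \<Rightarrow> real" and g :: "'b \<Rightarrow> real"
  assumes fin: "finite S" "finite T1" "finite T2"
    and into: "\<And>x. x \<in> S \<Longrightarrow> \<theta>1 x \<in> T1 \<and> \<theta>2 x \<in> T2"
    and unif: "\<And>t1 t2 t1' t2'. t1 \<in> T1 \<Longrightarrow> t2 \<in> T2 \<Longrightarrow> t1' \<in> T1 \<Longrightarrow> t2' \<in> T2 \<Longrightarrow>
      card {x \<in> S. \<theta>1 x = t1 \<and> \<theta>2 x = t2} \<le> card {x \<in> S. \<theta>1 x = t1' \<and> \<theta>2 x = t2'}"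
  shows "(\<Sum>x\<in>S. f (\<theta>1 x) * g (\<theta>2 x)) = real (card S) * (avg f T1 * avg g T2)"
proof (cases "T1 = {} \<or> T2 = {}")
  case True
  then have "S = {}" using into by auto
  then show ?thesis by simp
next
  case False
  then obtain u1 u2 where u: "u1 \<in> T1" "u2 \<in> T2" by auto
  define K where "K = card {x \<in> S. \<theta>1 x = u1 \<and> \<theta>2 x = u2}"
  have K: "card {x \<in> S. (\<theta>1 x, \<theta>2 x) = t} = K" if "t \<in> T1 \<times> T2" for t
    using unif[of "fst t" "snd t" u1 u2] unif[of u1 u2 "fst t" "snd t"] that u
    by (cases t) (simp add: K_def le_antisym)
  have part: "(\<Sum>x\<in>S. h (\<theta>1 x, \<theta>2 x)) = real K * (\<Sum>t \<in> T1 \<times> T2. h t)" for h :: "'a \<times> 'b \<Rightarrow> real"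
  proof -
    have "(\<Sum>x\<in>S. h (\<theta>1 x, \<theta>2 x)) = (\<Sum>t \<in> T1 \<times> T2. \<Sum>x \<in> {x \<in> S. (\<theta>1 x, \<theta>2 x) = t}. h (\<theta>1 x, \<theta>2 x))"
      using fin into by (intro sum.group[symmetric]) auto
    also have "\<dots> = (\<Sum>t \<in> T1 \<times> T2. real K * h t)"
    proof (rule sum.cong[OF refl])
      fix t assume t: "t \<in> T1 \<times> T2"
      have "(\<Sum>x \<in> {x \<in> S. (\<theta>1 x, \<theta>2 x) = t}. h (\<theta>1 x, \<theta>2 x)) = (\<Sum>x \<in> {x \<in> S. (\<theta>1 x, \<theta>2 x) = t}. h t)"
        by (rule sum.cong) auto
      then show "(\<Sum>x \<in> {x \<in> S. (\<theta>1 x, \<theta>2 x) = t}. h (\<theta>1 x, \<theta>2 x)) = real K * h t"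
        by (simp only: sum_constant K[OF t])
    qed
    finally show ?thesis by (simp add: sum_distrib_left)
  qed
  have "real (card S) = real K * (real (card T1) * real (card T2))"
    using part[of "\<lambda>_. 1"] by (simp add: card_cartesian_product)
  moreover have "(\<Sum>x\<in>S. f (\<theta>1 x) * g (\<theta>2 x)) = real K * (sum f T1 * sum g T2)"
    using part[of "\<lambda>(a, b). f a * g b"] by (simp add: sum_product sum.cartesian_product)
  moreover have "card T1 \<noteq> 0" "card T2 \<noteq> 0" using False fin by auto
  ultimately show ?thesis by (simp add: avg_def)
qed

lemma agree_on_blocks:
  assumes X: "X \<in> carrier_mat n n" "upper (block_of [a, b, d]) X" and Y: "Y \<in> carrier_mat n n" "upper (block_of [a, b, d]) Y"
    and n: "n = a + b + d"
    and eq: "diag_part 0 a X = diag_part 0 a Y" "diag_part a b X = diag_part a b Y" "diag_part (a + b) d X = diag_part (a + b) d Y"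
    and rs: "r < n" "s < n" "block_of [a, b, d] s \<le> block_of [a, b, d] r"
  shows "X $$ (r, s) = Y $$ (r, s)"
proof -
  have be: "block_of [a, b, d] t = (if t < a then 0 else if t < a + b then 1 else 2)" if "t < n" for t
    using that n by auto
  consider (1) "block_of [a, b, d] s < block_of [a, b, d] r" | (2) "r < a" "s < a"
    | (3) "a \<le> r" "a \<le> s" "r < a + b" "s < a + b" | (4) "a + b \<le> r" "a + b \<le> s"
    using rs(3) unfolding be[OF rs(1)] be[OF rs(2)]
    by (cases "s < a"; cases "r < a"; cases "s < a + b"; cases "r < a + b"; simp)
  then show ?thesis
  proof cases
    case 1
    then show ?thesis using X Y rs unfolding upper_def by (auto simp del: block_of.simps)
  next
    case 2
    then show ?thesis using diag_part_index[of r a s 0 X] diag_part_index[of r a s 0 Y] eq(1) by simp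
  next
    case 3
    then have "r - a < b" "s - a < b" by auto
    then show ?thesis
      using 3 diag_part_index[of "r - a" b "s - a" a X] diag_part_index[of "r - a" b "s - a" a Y] eq(2) by simp
  next
    case 4
    then have "r - (a + b) < d" "s - (a + b) < d" using rs n by auto
    then show ?thesis
      using 4 diag_part_index[of "r - (a + b)" d "s - (a + b)" "a + b" X]
        diag_part_index[of "r - (a + b)" d "s - (a + b)" "a + b" Y] eq(3) by simp
  qed
qed

locale unitary_grid = unitary q c + grid k1 k2 k3 m l
  for q and c :: "'k::{field,finite} \<Rightarrow> 'k" and k1 k2 k3 m l
begin

lemma sizes: "k + (m + l) = i + j"
  by simp

lemma \<beta>Q_rev: "r < N \<Longrightarrow> \<beta>Q (N - Suc r) = 2 - \<beta>Q r" and \<beta>Q_le: "r < N \<Longrightarrow> \<beta>Q r \<le> 2"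
proof -
  assume "r < N"
  then have r: "r < i + 2 * j + i" by simp
  have e: "i + 2 * j + i - Suc r = N - Suc r" by simp
  show "\<beta>Q (N - Suc r) = 2 - \<beta>Q r" using block_of_rev3(1)[OF r] unfolding e .
  show "\<beta>Q r \<le> 2" by (rule block_of_rev3(2)[OF r])
qed

lemma minor_u:
  fixes X :: "'k mat"
  assumes X: "X \<in> u q (i + j)" and \<rho>: "\<And>r. r < N \<Longrightarrow> \<rho> r < N \<and> \<rho> (N - Suc r) = N - Suc (\<rho> r)"
  shows "minor N \<rho> X \<in> u q (i + j)"
proof -
  have Xc: "X \<in> carrier_mat N N" and \<omega>X: "flip c X = - X" using X by (auto simp: u_iff)
  have "flip c (minor N \<rho> X) $$ (r, s) = (- minor N \<rho> X) $$ (r, s)" if rs: "r < N" "s < N" for r s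
  proof -
    have "flip c (minor N \<rho> X) $$ (r, s) = c (X $$ (N - Suc (\<rho> s), N - Suc (\<rho> r)))"
      using rs \<rho>[OF rs(1)] \<rho>[OF rs(2)] by (simp add: minor_def)
    also have "\<dots> = flip c X $$ (\<rho> r, \<rho> s)" using Xc \<rho>[OF rs(1)] \<rho>[OF rs(2)] by simp
    also have "\<dots> = - X $$ (\<rho> r, \<rho> s)" unfolding \<omega>X using Xc \<rho>[OF rs(1)] \<rho>[OF rs(2)] by simp
    finally show ?thesis using rs by (simp add: minor_def)
  qed
  then have "flip c (minor N \<rho> X) = - minor N \<rho> X" by (intro eq_matI) (auto simp: minor_def)
  then show ?thesis by (simp add: u_iff)
qed

text \<open>After conjugation by \<open>wmat\<close>, \<open>\<theta>1\<close> and
  \<open>\<theta>2\<close> are the Levi components for \<open>P\<close>. \<open>T1\<close> and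
  \<open>T2\<close> are the fibres over which \<open>Delta3\<close> and \<open>Delta_u\<close>
  average. The third block of \<open>T1\<close> is twisted, because that piece is taken from the
  last diagonal block of \<open>X\<close>.\<close>

abbreviation "\<theta>1 X \<equiv> diag_part 0 k (minor N \<pi> X)"
abbreviation "\<theta>2 X \<equiv> diag_part k (2 * (m + l)) (minor N \<pi> X)"
abbreviation "T1 A B \<equiv> gl_fiber3 k1 k2 k3 (diag_part 0 k1 A) (diag_part 0 k2 B) (\<omega> (diag_part (k1 + m) k3 A))"
abbreviation "T2 A B \<equiv> u_fiber m l (\<lambda>_. 0) (diag_part k1 m A) (diag_part k2 (2 * l) B)"

lemma perm_values:
  "r < k1 \<Longrightarrow> \<pi> r = r" "r < k2 \<Longrightarrow> \<pi> (k1 + r) = i + r" "r < k3 \<Longrightarrow> \<pi> (k1 + k2 + r) = i + 2 * j + r"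
  "r < m \<Longrightarrow> \<pi> (k + r) = k1 + r" "r < 2 * l \<Longrightarrow> \<pi> (k + (m + r)) = i + (k2 + r)"
  by (simp_all add: perm_def Let_def)

lemma \<theta>_fibers:
  assumes X: "X \<in> u_fiber i j \<gamma> A B"
  shows "\<theta>1 X \<in> T1 A B" "\<theta>2 X \<in> T2 A B"
proof -
  have Xu: "X \<in> u q (i + j)" and up: "upper \<beta>Q X" and d: "diag_part 0 i X = A" "diag_part i (2 * j) X = B"
    using X by (auto simp: u_fiber_def)
  have Xc: "X \<in> carrier_mat N N" using Xu by (simp add: u_iff)
  have A: "A \<in> carrier_mat i i" using d(1) by auto
  have d3: "diag_part (i + 2 * j) i X = \<omega> A" using diag_part_\<omega>[OF Xu, of "i + 2 * j" i 0] d(1) by simp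
  have Xz: "X $$ (\<pi> r, \<pi> s) = 0" if "r < N" "s < N" "\<beta>Q (\<pi> s) < \<beta>Q (\<pi> r)" for r s
    using up[unfolded upper_def, rule_format, of "\<pi> r" "\<pi> s"] Xc perm_props[OF that(1)] perm_props[OF that(2)] that(3)
    by (simp del: block_of.simps)
  have "upper (block_of [k1, k2, k3]) (\<theta>1 X)" unfolding upper_def
  proof (intro allI impI)
    fix r s assume "r < dim_row (\<theta>1 X)" "s < dim_col (\<theta>1 X)" and lt: "block_of [k1, k2, k3] s < block_of [k1, k2, k3] r"
    then have rs: "r < k" "s < k" by auto
    then show "\<theta>1 X $$ (r, s) = 0"
      using Xz[of r s] lt unfolding \<beta>Q_perm(1)[OF rs(1)] \<beta>Q_perm(1)[OF rs(2)] by (simp add: minor_def del: block_of.simps)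
  qed
  moreover have "diag_part 0 k1 (\<theta>1 X) = diag_part 0 k1 A"
    unfolding d(1)[symmetric] by (intro eq_matI) (auto simp: minor_def perm_values)
  moreover have "diag_part k1 k2 (\<theta>1 X) = diag_part 0 k2 B"
    unfolding d(2)[symmetric] by (intro eq_matI) (auto simp: minor_def perm_values)
  moreover have "diag_part (k1 + k2) k3 (\<theta>1 X) = \<omega> (diag_part (k1 + m) k3 A)"
  proof -
    have "diag_part (k1 + k2) k3 (\<theta>1 X) = diag_part 0 k3 (diag_part (i + 2 * j) i X)"
      by (intro eq_matI) (auto simp: minor_def perm_values)
    also have "\<dots> = - diag_part 0 k3 (flip c A)" unfolding d3 using A by (intro eq_matI) auto
    also have "diag_part 0 k3 (flip c A) = flip c (diag_part (k1 + m) k3 A)" by (rule diag_part_flip[OF A]) simp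
    finally show ?thesis .
  qed
  ultimately show "\<theta>1 X \<in> T1 A B" by (simp add: gl_fiber3_def)
  have Mu: "minor N \<pi> X \<in> u q (i + j)" using perm_props by (intro minor_u[OF Xu]) auto
  have "\<theta>2 X \<in> u q (m + l)" by (rule diag_part_u[OF Mu]) simp
  moreover have "upper (block_of [m, 2 * l, m]) (\<theta>2 X)" unfolding upper_def
  proof (intro allI impI)
    fix r s assume "r < dim_row (\<theta>2 X)" "s < dim_col (\<theta>2 X)" and lt: "block_of [m, 2 * l, m] s < block_of [m, 2 * l, m] r"
    then have rs: "r < 2 * (m + l)" "s < 2 * (m + l)" by auto
    then show "\<theta>2 X $$ (r, s) = 0"
      using Xz[of "k + r" "k + s"] lt unfolding \<beta>Q_perm(2)[OF rs(1)] \<beta>Q_perm(2)[OF rs(2)]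
      by (simp add: minor_def del: block_of.simps)
  qed
  moreover have "diag_part 0 m (\<theta>2 X) = diag_part k1 m A"
    unfolding d(1)[symmetric] by (intro eq_matI) (auto simp: minor_def perm_values)
  moreover have "diag_part m (2 * l) (\<theta>2 X) = diag_part k2 (2 * l) B"
    unfolding d(2)[symmetric] by (intro eq_matI) (auto simp: minor_def perm_values)
  ultimately show "\<theta>2 X \<in> T2 A B" by (simp add: u_fiber_def)
qed

text \<open>The witness is the Levi element of \<open>P\<close> built from \<open>D1\<close> and
  \<open>D2\<close>, carried back to the coordinates of \<open>Q\<close>. The vanishing required in
  its third block follows from that in the first, since the matrix is fixed by
  \<open>\<omega>\<close>.\<close>

lemma lift_strict:
  fixes D1 D2 :: "'k mat"
  assumes D1: "D1 \<in> carrier_mat k k" "\<And>r s. r < k \<Longrightarrow> s < k \<Longrightarrow> block_of [k1, k2, k3] s \<le> block_of [k1, k2, k3] r \<Longrightarrow> D1 $$ (r, s) = 0"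
    and D2: "D2 \<in> u q (m + l)" "\<And>r s. r < 2 * (m + l) \<Longrightarrow> s < 2 * (m + l) \<Longrightarrow>
      block_of [m, 2 * l, m] s \<le> block_of [m, 2 * l, m] r \<Longrightarrow> D2 $$ (r, s) = 0"
  shows "\<exists>Z \<in> u q (i + j). (\<forall>r < N. \<forall>s < N. \<beta>Q s \<le> \<beta>Q r \<longrightarrow> Z $$ (r, s) = 0) \<and> upper \<gamma> Z \<and> \<theta>1 Z = D1 \<and> \<theta>2 Z = D2"
proof -
  define L where "L = diag3 D1 D2 (\<omega> D1)"
  define Z where "Z = minor N \<pi>' L"
  have D2c: "D2 \<in> carrier_mat (2 * (m + l)) (2 * (m + l))" using D2 by (simp add: u_iff)
  have Lu: "L \<in> u q (i + j)" unfolding L_def using diag3_u[OF D1(1) D2(1)] unfolding sizes .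
  have Lc: "L \<in> carrier_mat N N" using Lu by (simp add: u_iff)
  have Li: "L $$ (r, s) = (if r < k \<and> s < k then D1 $$ (r, s)
     else if k \<le> r \<and> k \<le> s \<and> r < k + 2 * (m + l) \<and> s < k + 2 * (m + l) then D2 $$ (r - k, s - k)
     else if k + 2 * (m + l) \<le> r \<and> k + 2 * (m + l) \<le> s then \<omega> D1 $$ (r - (k + 2 * (m + l)), s - (k + 2 * (m + l))) else 0)"
    if "r < N" "s < N" for r s
    unfolding L_def using that by (intro diag3_index[OF D1(1) D2c \<omega>_carrier[OF D1(1)]]) auto
  have Zu: "Z \<in> u q (i + j)"
    unfolding Z_def using perm_inv_props perm_inv_rev by (intro minor_u[OF Lu]) auto
  have mZ: "minor N \<pi> Z = L"
    using Lc perm_props by (intro eq_matI) (auto simp: Z_def minor_def)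
  have zero: "L $$ (r, s) = 0" if rs: "r < N" "s < N" and le: "\<beta>Q (\<pi> s) \<le> \<beta>Q (\<pi> r)" and sm: "r < k + 2 * (m + l) \<or> s < k + 2 * (m + l)" for r s
  proof -
    consider "r < k" "s < k" | "k \<le> r" "k \<le> s" "r < k + 2 * (m + l)" "s < k + 2 * (m + l)"
      | "\<not> (r < k \<and> s < k)" "\<not> (k \<le> r \<and> k \<le> s \<and> r < k + 2 * (m + l) \<and> s < k + 2 * (m + l))" by blast
    then show ?thesis
    proof cases
      case 1
      then show ?thesis unfolding Li[OF rs] using D1(2)[OF 1] le \<beta>Q_perm(1)[OF 1(1)] \<beta>Q_perm(1)[OF 1(2)]
        by (simp del: block_of.simps)
    next
      case 2
      then have lt: "r - k < 2 * (m + l)" "s - k < 2 * (m + l)" and e: "k + (r - k) = r" "k + (s - k) = s" by auto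
      have "D2 $$ (r - k, s - k) = 0"
        using D2(2)[OF lt] le unfolding \<beta>Q_perm(2)[OF lt(1), unfolded e, symmetric] \<beta>Q_perm(2)[OF lt(2), unfolded e, symmetric] .
      then show ?thesis unfolding Li[OF rs] using 2 by simp
    next
      case 3
      then show ?thesis unfolding Li[OF rs] using sm by auto
    qed
  qed
  have zero': "L $$ (r, s) = 0" if rs: "r < N" "s < N" and le: "\<beta>Q (\<pi> s) \<le> \<beta>Q (\<pi> r)" for r s
  proof (cases "r < k + 2 * (m + l) \<or> s < k + 2 * (m + l)")
    case False
    have rs': "N - Suc s < N" "N - Suc r < N" "N - Suc s < k + 2 * (m + l)" using rs False by auto
    have "flip c L $$ (r, s) = c (L $$ (N - Suc s, N - Suc r))" using Lc rs by simp
    also have "L $$ (N - Suc s, N - Suc r) = 0"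
    proof (rule zero[OF rs'(1,2)])
      note p = perm_props[OF rs(1)] perm_props[OF rs(2)]
      have e: "\<beta>Q (\<pi> (N - Suc r)) = 2 - \<beta>Q (\<pi> r)" "\<beta>Q (\<pi> (N - Suc s)) = 2 - \<beta>Q (\<pi> s)"
        using p \<beta>Q_rev[of "\<pi> r"] \<beta>Q_rev[of "\<pi> s"] by metis+
      show "\<beta>Q (\<pi> (N - Suc r)) \<le> \<beta>Q (\<pi> (N - Suc s))" unfolding e using le by (rule diff_le_mono2)
    qed (use rs'(3) in blast)
    finally have "flip c L $$ (r, s) = 0" by simp
    moreover have "flip c L = - L" using Lu by (simp add: u_iff)
    ultimately show ?thesis using Lc rs by simp
  qed (rule zero[OF rs le])
  have "Z $$ (r, s) = 0" if rs: "r < N" "s < N" and le: "\<beta>Q s \<le> \<beta>Q r" for r s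
  proof -
    note p = perm_inv_props[OF rs(1)] perm_inv_props[OF rs(2)]
    have "\<beta>Q (\<pi> (\<pi>' s)) \<le> \<beta>Q (\<pi> (\<pi>' r))" using le p by (simp only:)
    then have "L $$ (\<pi>' r, \<pi>' s) = 0" using p by (intro zero') auto
    then show ?thesis using rs by (simp add: Z_def minor_def)
  qed
  moreover have "upper \<gamma> Z"
  proof -
    have be: "\<beta>P t = (if t < k then 0 else if t < k + 2 * (m + l) then 1 else 2)" if "t < N" for t
      using that by auto
    have "upper \<beta>P L" unfolding upper_def
    proof (intro allI impI)
      fix r s assume "r < dim_row L" "s < dim_col L" and lt: "\<beta>P s < \<beta>P r"
      then have rs: "r < N" "s < N" using Lc by auto
      show "L $$ (r, s) = 0" unfolding Li[OF rs] using lt unfolding be[OF rs(1)] be[OF rs(2)] by (auto split: if_splits)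
    qed
    moreover have "Z \<in> carrier_mat N N" using Zu by (simp only: u_iff)
    ultimately show ?thesis using upper_minor_perm[of Z] by (simp only: mZ)
  qed
  moreover have "\<theta>1 Z = D1" "\<theta>2 Z = D2"
    unfolding mZ L_def by (rule diag_part_diag3[OF D1(1) D2c \<omega>_carrier[OF D1(1)]])+
  ultimately show ?thesis using Zu by blast
qed

text \<open>Two points of the same target fibre have equal diagonal blocks, so they differ by a
  strict matrix; translation by a lift of the differences injects one fibre into the other.\<close>

lemma \<theta>_fiber_card_le:
  fixes A B t1 t1' t2 t2' :: "'k mat"
  assumes t: "t1 \<in> T1 A B" "t2 \<in> T2 A B" "t1' \<in> T1 A B" "t2' \<in> T2 A B"
  shows "card {X \<in> u_fiber i j \<gamma> A B. \<theta>1 X = t1 \<and> \<theta>2 X = t2} \<le>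
    card {X \<in> u_fiber i j \<gamma> A B. \<theta>1 X = t1' \<and> \<theta>2 X = t2'}"
proof -
  have c1: "t1 \<in> carrier_mat k k" "t1' \<in> carrier_mat k k" using t by (auto simp: gl_fiber3_def)
  have c2: "t2 \<in> u q (m + l)" "t2' \<in> u q (m + l)" using t by (auto simp: u_fiber_def)
  have c2': "t2 \<in> carrier_mat (2 * (m + l)) (2 * (m + l))" "t2' \<in> carrier_mat (2 * (m + l)) (2 * (m + l))"
    using c2 by (auto simp: u_iff)
  have s1: "(t1' - t1) $$ (r, s) = 0" if "r < k" "s < k" "block_of [k1, k2, k3] s \<le> block_of [k1, k2, k3] r" for r s
    using agree_on_blocks[OF c1(2) _ c1(1) _ refl _ _ _ that] t that c1 by (simp add: gl_fiber3_def del: block_of.simps)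
  have l3: "diag_part (m + 2 * l) m t2' = diag_part (m + 2 * l) m t2"
    using diag_part_\<omega>[OF c2(1), of "m + 2 * l" m 0] diag_part_\<omega>[OF c2(2), of "m + 2 * l" m 0] t by (simp add: u_fiber_def)
  have s2: "(t2' - t2) $$ (r, s) = 0" if "r < 2 * (m + l)" "s < 2 * (m + l)" "block_of [m, 2 * l, m] s \<le> block_of [m, 2 * l, m] r" for r s
    using agree_on_blocks[OF c2'(2) _ c2'(1) _ _ _ _ l3 that] t that c2' by (simp add: u_fiber_def del: block_of.simps)
  have Dc: "t1' - t1 \<in> carrier_mat k k" by (rule minus_carrier_mat[OF c1(1)])
  have "\<exists>Z \<in> u q (i + j). (\<forall>r < N. \<forall>s < N. \<beta>Q s \<le> \<beta>Q r \<longrightarrow> Z $$ (r, s) = 0) \<and> upper \<gamma> Z \<and>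
      \<theta>1 Z = t1' - t1 \<and> \<theta>2 Z = t2' - t2"
    by (rule lift_strict[OF Dc _ u_minus[OF c2(2,1)]]) ((rule s1; assumption) | (rule s2; assumption))+
  then
  obtain Z where Z: "Z \<in> u q (i + j)" "\<forall>r < N. \<forall>s < N. \<beta>Q s \<le> \<beta>Q r \<longrightarrow> Z $$ (r, s) = 0" "upper \<gamma> Z"
    "\<theta>1 Z = t1' - t1" "\<theta>2 Z = t2' - t2"
    by (elim bexE conjE) (rule that; assumption)
  have Zc: "Z \<in> carrier_mat N N" using Z by (simp add: u_iff)
  show ?thesis
  proof (rule card_inj_on_le[where f = "\<lambda>X. X + Z"])
    show "finite {X \<in> u_fiber i j \<gamma> A B. \<theta>1 X = t1' \<and> \<theta>2 X = t2'}" by simp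
    show "inj_on (\<lambda>X. X + Z) {X \<in> u_fiber i j \<gamma> A B. \<theta>1 X = t1 \<and> \<theta>2 X = t2}"
      by (rule inj_on_inverseI[where g = "\<lambda>Y. Y - Z"]) (use Zc in \<open>auto simp: u_fiber_def u_iff intro!: eq_matI\<close>)
    show "(\<lambda>X. X + Z) ` {X \<in> u_fiber i j \<gamma> A B. \<theta>1 X = t1 \<and> \<theta>2 X = t2} \<subseteq> {X \<in> u_fiber i j \<gamma> A B. \<theta>1 X = t1' \<and> \<theta>2 X = t2'}"
    proof clarify
      fix X assume X: "X \<in> u_fiber i j \<gamma> A B" and t1: "t1 = \<theta>1 X" and t2: "t2 = \<theta>2 X"
      have Xu: "X \<in> u q (i + j)" "upper \<beta>Q X" "upper \<gamma> X" and d: "diag_part 0 i X = A" "diag_part i (2 * j) X = B"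
        using X by (auto simp: u_fiber_def)
      have Xc: "X \<in> carrier_mat N N" using Xu by (simp add: u_iff)
      have "upper \<beta>Q (X + Z)"
        unfolding upper_def
      proof (intro allI impI)
        fix r s assume "r < dim_row (X + Z)" "s < dim_col (X + Z)" and lt: "\<beta>Q s < \<beta>Q r"
        then have rs: "r < N" "s < N" using Zc by auto
        then show "(X + Z) $$ (r, s) = 0"
          using Xu(2)[unfolded upper_def, rule_format, of r s] Z(2)[rule_format, OF rs less_imp_le[OF lt]] lt Xc Zc
          by (simp del: block_of.simps)
      qed
      moreover have "upper \<gamma> (X + Z)" using Xu(3) Z(3) Xc Zc unfolding upper_def by auto
      moreover have "diag_part 0 i (X + Z) = A"
        unfolding d(1)[symmetric] using Z(2) Xc Zc by (intro eq_matI) auto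
      moreover have "diag_part i (2 * j) (X + Z) = B"
        unfolding d(2)[symmetric] using Z(2) Xc Zc by (intro eq_matI) auto
      ultimately have "X + Z \<in> u_fiber i j \<gamma> A B"
        using u_add[OF Xu(1) Z(1)] by (simp add: u_fiber_def del: block_of.simps)
      moreover have mn: "minor N \<pi> (X + Z) = minor N \<pi> X + minor N \<pi> Z"
        using Xc Zc perm_props by (intro eq_matI) (auto simp: minor_def)
      have "\<theta>1 (X + Z) = \<theta>1 X + \<theta>1 Z" "\<theta>2 (X + Z) = \<theta>2 X + \<theta>2 Z"
        unfolding mn by (intro eq_matI; simp add: minor_def)+
      then have "\<theta>1 (X + Z) = t1'" "\<theta>2 (X + Z) = t2'"
        unfolding Z(4,5) t1[symmetric] t2[symmetric] using mat_add_minus(2)[OF c1] mat_add_minus(2)[OF c2'] by auto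
      ultimately show "X + Z \<in> u_fiber i j \<gamma> A B \<and> \<theta>1 (X + Z) = t1' \<and> \<theta>2 (X + Z) = t2'" by blast
    qed
  qed
qed

lemma sum_u_fiber:
  fixes f g :: "'k mat \<Rightarrow> real"
  shows "(\<Sum>X \<in> u_fiber i j \<gamma> A B. f (\<theta>1 X) * g (\<theta>2 X)) =
    real (card (u_fiber i j \<gamma> A B)) * (avg f (T1 A B) * avg g (T2 A B))"
  by (rule sum_uniform_fibers) (use \<theta>_fibers \<theta>_fiber_card_le in auto)

text \<open>Supplies the hypothesis of \<open>bij_u_nil_fiber\<close>: whenever both components are
  block triangular, the fibre with levels \<open>\<gamma>\<close> is nonempty and has the size of
  \<open>u_nil\<close>.\<close>

lemma upper_\<gamma>_levi:
  assumes A: "A \<in> carrier_mat i i" "upper (block_of [k1, m, k3]) A"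
    and B: "B \<in> u q j" "upper (block_of [k2, 2 * l, k2]) B"
  shows "upper \<gamma> (diag3 A B (\<omega> A))"
proof -
  have Bc: "B \<in> carrier_mat (2 * j) (2 * j)" using B by (simp add: u_iff)
  have uA: "upper \<gamma> A" using A by (auto simp: upper_def \<gamma>_blocks(1) simp del: block_of.simps)
  have "upper (\<lambda>r. \<gamma> (i + r)) B" using B(2) Bc by (auto simp: upper_def \<gamma>_blocks(2) simp del: block_of.simps)
  moreover have "upper (\<lambda>r. \<gamma> (i + 2 * j + r)) (flip c A)"
  proof (rule upper_flip[where f = c and X = A, OF A(1) uA c_0])
    fix r s assume rs: "r < i" "s < i" "\<gamma> (i + 2 * j + s) < \<gamma> (i + 2 * j + r)"
    have "N - Suc (i + 2 * j + r) = i - Suc r" "N - Suc (i + 2 * j + s) = i - Suc s" using rs by auto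
    then show "\<gamma> (i - Suc r) < \<gamma> (i - Suc s)" using \<gamma>_rev_less[OF _ _ rs(3)] rs by simp
  qed
  then have "upper (\<lambda>r. \<gamma> (i + 2 * j + r)) (\<omega> A)" using A by (auto simp: upper_def)
  ultimately show ?thesis
    unfolding upper_diag3_iff[OF A(1) Bc \<omega>_carrier[OF A(1)]] using uA by simp
qed

end

section \<open>The Mackey decomposition\<close>

context unitary
begin

definition u_invariant :: "('k mat \<Rightarrow> real) \<Rightarrow> bool" where
  "u_invariant b \<longleftrightarrow> (\<forall>n. \<forall>y \<in> carrier (U q n). \<forall>X \<in> u q n. b (conj_by y X) = b X)"

lemma u_invariantD:
  "u_invariant b \<Longrightarrow> y \<in> carrier (U q n) \<Longrightarrow> X \<in> u q n \<Longrightarrow> b (conj_by y X) = b X"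
  by (simp add: u_invariant_def)

text \<open>The contribution of one double coset to both sides of the compatibility.\<close>

definition cell_value :: "('k mat \<Rightarrow> real) \<Rightarrow> ('k mat \<Rightarrow> real) \<Rightarrow>
    nat \<Rightarrow> nat \<Rightarrow> nat \<Rightarrow> nat \<Rightarrow> nat \<Rightarrow> 'k mat \<Rightarrow> 'k mat \<Rightarrow> real" where
  "cell_value a b k1 m k3 k2 l A B =
    (\<Sum>g \<in> carrier (GL (k1 + m + k3)). \<Sum>h \<in> carrier (U q (k2 + l)).
      if upper (block_of [k1, m, k3]) (conj_by g A) \<and> upper (block_of [k2, 2 * l, k2]) (conj_by h B)
      then Delta3 a (diag_part 0 k1 (conj_by g A)) (diag_part 0 k2 (conj_by h B))
          (\<omega> (diag_part (k1 + m) k3 (conj_by g A))) *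
        Delta_u q b (diag_part k1 m (conj_by g A), diag_part k2 (2 * l) (conj_by h B))
      else 0) /
    (real (card (parabolic (GL (k1 + m + k3) :: 'k mat monoid) [k1, m, k3])) *
     real (card (parabolic (U q (k2 + l) :: 'k mat monoid) [k2, 2 * l, k2])))"

end

context unitary_grid
begin

text \<open>The double coset sum becomes a sum over \<open>Q\<close> by
  \<open>sum_double_coset\<close>, then over the Levi subgroup of \<open>Q\<close> by
  \<open>sum_parabolic\<close>, and the remaining sum over a fibre factors by
  \<open>sum_u_fiber\<close>. The sizes of \<open>u_nil\<close> for \<open>\<gamma>\<close> and for
  constant levels each occur twice and cancel; the orders of the two smaller parabolic subgroups
  survive.\<close>

lemma sum_cell:
  fixes a b :: "'k mat \<Rightarrow> real" and A B :: "'k mat"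
  assumes a: "gl_invariant a" and b: "u_invariant b" and A: "A \<in> carrier_mat i i" and B: "B \<in> u q j"
  defines "Q \<equiv> {g \<in> carrier (U q (i + j) :: 'k mat monoid). upper \<beta>Q g}"
    and "P \<equiv> {g \<in> carrier (U q (i + j) :: 'k mat monoid). upper \<beta>P g}"
    and "\<Psi> \<equiv> \<lambda>Y. if upper \<beta>P Y then a (diag_part 0 k Y) * b (diag_part k (2 * (m + l)) Y) else 0"
  shows "(\<Sum>g \<in> (\<lambda>(y, p). y * wmat * p) ` (Q \<times> P). \<Sum>X \<in> u_fiber i j (\<lambda>_. 0) A B. \<Psi> (conj_by g X)) /
      real (card P) / real (card (u_fiber i j (\<lambda>_. 0) A B)) = cell_value a b k1 m k3 k2 l A B"
proof -
  interpret mat_group N "U q (i + j) :: 'k mat monoid" "u q (i + j)" by (rule mat_group_U)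
  let ?w = "wmat :: 'k mat" and ?fib = "u_fiber i j (\<lambda>_. 0) A B"
  let ?GA = "{g \<in> carrier (GL i :: 'k mat monoid). upper \<gamma> g}"
  let ?UB = "{h \<in> carrier (U q j :: 'k mat monoid). upper (\<lambda>r. \<gamma> (i + r)) h}"
  define f where "f g = (\<Sum>X \<in> ?fib. \<Psi> (conj_by g X))" for g
  define H where "H g h = (\<Sum>X \<in> u_fiber i j (\<lambda>_. 0) (conj_by g A) (conj_by h B). \<Psi> (minor N \<pi> X))" for g h :: "'k mat"
  have w: "?w \<in> carrier (U q (i + j))" by (rule wmat_U)
  have Qs: "subgroup Q (U q (i + j))" and Ps: "subgroup P (U q (i + j))"
    unfolding Q_def P_def by (rule subgroup_upper)+
  have QU: "y \<in> carrier (U q (i + j))" "upper \<beta>Q y" if "y \<in> Q" for y using that by (auto simp: Q_def)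
  have fibu: "X \<in> u q (i + j)" "X \<in> carrier_mat N N" if "X \<in> ?fib" for X
    using that by (auto simp only: u_fiber_def u_iff mem_Collect_eq)
  have conj_w: "conj_by ?w X = minor N \<pi> X" if "X \<in> carrier_mat N N" for X :: "'k mat"
    by (rule conj_by_eqI[OF U_GL[OF w] that]) (simp_all only: minor_carrier wmat_mult_minor[OF that])
  have inv: "f (g \<otimes>\<^bsub>U q (i + j)\<^esub> p) = f g" if g: "g \<in> carrier (U q (i + j))" and p: "p \<in> P" for g p
    unfolding f_def
  proof (rule sum.cong[OF refl])
    fix X assume "X \<in> ?fib"
    note X = fibu[OF this]
    have p': "p \<in> carrier (U q (i + j))" "upper \<beta>P p" using p by (auto simp only: P_def mem_Collect_eq)
    define Y where "Y = conj_by g X"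
    have Y: "Y \<in> u q (i + j)" "Y \<in> carrier_mat N N"
      using lie_closed[OF g X(1)] conj_by_carrier[OF U_GL[OF g] X(2)] unfolding Y_def by auto
    have e: "conj_by (g \<otimes>\<^bsub>U q (i + j)\<^esub> p) X = conj_by p Y"
      unfolding Y_def using conj_by_mult[OF U_GL[OF g] U_GL[OF p'(1)] X(2)] by simp
    have "\<Psi> (conj_by p Y) = \<Psi> Y"
    proof (cases "upper \<beta>P Y")
      case True
      note d = u_diag_parts_conj[of p k "m + l" Y, unfolded sizes, OF p' Y(2) True]
      have "diag_part k (2 * (m + l)) Y \<in> u q (m + l)" by (rule diag_part_u[OF Y(1)]) simp
      then have "b (diag_part k (2 * (m + l)) (conj_by p Y)) = b (diag_part k (2 * (m + l)) Y)"
        unfolding d(4) by (rule u_invariantD[OF b d(2)])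
      moreover have "a (diag_part 0 k (conj_by p Y)) = a (diag_part 0 k Y)"
        unfolding d(3) by (rule gl_invariantD[OF a d(1)]) (simp add: diag_part_def)
      ultimately show ?thesis
        unfolding \<Psi>_def upper_conj_iff[OF p' Y(2)] by (simp only:)
    next
      case False
      then show ?thesis unfolding \<Psi>_def upper_conj_iff[OF p' Y(2)] by (simp only: if_False)
    qed
    then show "\<Psi> (conj_by (g \<otimes>\<^bsub>U q (i + j)\<^esub> p) X) = \<Psi> (conj_by g X)" unfolding e Y_def .
  qed
  \<comment> \<open>The group \<open>Q \<inter> w P w\<inverse>\<close> in terms of levels.\<close>
  have Req: "{z \<in> Q. inv\<^bsub>U q (i + j)\<^esub> ?w \<otimes>\<^bsub>U q (i + j)\<^esub> z \<otimes>\<^bsub>U q (i + j)\<^esub> ?w \<in> P} =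
    {z \<in> carrier (U q (i + j)). upper \<beta>Q z \<and> upper \<gamma> z}"
  proof -
    have "inv\<^bsub>U q (i + j)\<^esub> ?w \<otimes>\<^bsub>U q (i + j)\<^esub> z \<otimes>\<^bsub>U q (i + j)\<^esub> ?w \<in> P \<longleftrightarrow> upper \<gamma> z"
      if z: "z \<in> carrier (U q (i + j))" for z
    proof -
      have "inv\<^bsub>U q (i + j)\<^esub> ?w \<otimes>\<^bsub>U q (i + j)\<^esub> z \<otimes>\<^bsub>U q (i + j)\<^esub> ?w = minor N \<pi> z"
        unfolding mult_eq inv_eq[OF w] conj_w[OF U_carrier[OF z], symmetric] conj_by_def ..
      moreover have "inv\<^bsub>U q (i + j)\<^esub> ?w \<otimes>\<^bsub>U q (i + j)\<^esub> z \<otimes>\<^bsub>U q (i + j)\<^esub> ?w \<in> carrier (U q (i + j))"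
        by (rule m_closed[OF m_closed[OF inv_closed[OF w] z] w])
      ultimately show ?thesis unfolding P_def mem_Collect_eq using upper_minor_perm[OF U_carrier[OF z]] by argo
    qed
    then show ?thesis unfolding Q_def by blast
  qed
  have up_cong: "upper \<alpha> X \<longleftrightarrow> upper \<alpha>' X" if "X \<in> carrier_mat n n" "\<And>r. r < n \<Longrightarrow> \<alpha> r = \<alpha>' r"
    for \<alpha> \<alpha>' n and X :: "'k mat"
    using that by (auto simp: upper_def)
  have GA: "?GA = parabolic (GL i) [k1, m, k3]"
    unfolding parabolic_def block_upper_eq
    by (intro Collect_cong conj_cong refl up_cong[OF GL_carrier \<gamma>_blocks(1)])
  have UB: "?UB = parabolic (U q j) [k2, 2 * l, k2]"
    unfolding parabolic_def block_upper_eq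
    by (intro Collect_cong conj_cong refl up_cong[OF U_carrier \<gamma>_blocks(2)])
  let ?c = "real (card (parabolic (GL i :: 'k mat monoid) [k1, m, k3])) *
    real (card (parabolic (U q j :: 'k mat monoid) [k2, 2 * l, k2]))"
  have one_R: "(1\<^sub>m N :: 'k mat) \<in> {z \<in> carrier (U q (i + j)). upper \<beta>Q z \<and> upper \<gamma> z}"
    using one_closed by (simp only: one_eq upper_one mem_Collect_eq simp_thms)
  have card_R: "real (card {z \<in> carrier (U q (i + j) :: 'k mat monoid). upper \<beta>Q z \<and> upper \<gamma> z}) =
      real (card (u_nil i j \<gamma>)) * ?c"
    using sum_parabolic[of i j \<gamma> "\<lambda>_ _. 1", OF \<gamma>_rev_less] unfolding GA UB by simp
  have card_ne: "real (card S) \<noteq> 0" if "finite S" "x \<in> S" for S and x :: "'k mat" using that by auto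
  have R_pos: "real (card {z \<in> carrier (U q (i + j) :: 'k mat monoid). upper \<beta>Q z \<and> upper \<gamma> z}) \<noteq> 0"
  proof -
    have "finite {z \<in> carrier (U q (i + j) :: 'k mat monoid). upper \<beta>Q z \<and> upper \<gamma> z}"
      by (rule finite_subset[OF _ finite_U]) blast
    then show ?thesis by (rule card_ne[OF _ one_R])
  qed
  have card_fib: "card ?fib = card (u_nil i j (\<lambda>_. 0))"
    by (rule bij_betw_same_card[OF bij_u_nil_fiber[OF A B upper_const], symmetric])
  have Q_eq: "Q = {y \<in> carrier (U q (i + j)). upper \<beta>Q y \<and> upper (\<lambda>_. 0) y}" by (simp add: Q_def)
  have nil_pos: "real (card (u_nil i j (\<lambda>_. 0))) \<noteq> 0"
  proof
    assume "real (card (u_nil i j (\<lambda>_. 0))) = 0"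
    then have "real (card Q) = 0" using sum_parabolic[of i j "\<lambda>_. 0" "\<lambda>_ _. 1"] unfolding Q_eq by simp
    moreover have "finite Q" by (simp add: Q_def)
    ultimately show False using subgroup.one_closed[OF Qs] by auto
  qed
  \<comment> \<open>Conjugation by \<open>y\<close> maps the fibre over \<open>(A, B)\<close> onto
    the fibre over the conjugated pair, so only the Levi components of \<open>y\<close>
    matter.\<close>
  have f_yw: "f (y \<otimes>\<^bsub>U q (i + j)\<^esub> ?w) = H (diag_part 0 i y) (diag_part i (2 * j) y)" if "y \<in> Q" for y
  proof -
    note y = QU[OF that]
    have "f (y \<otimes>\<^bsub>U q (i + j)\<^esub> ?w) = (\<Sum>X \<in> ?fib. \<Psi> (minor N \<pi> (conj_by y X)))"
      unfolding f_def
    proof (rule sum.cong[OF refl])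
      fix X assume "X \<in> ?fib"
      note X = fibu(2)[OF this]
      show "\<Psi> (conj_by (y \<otimes>\<^bsub>U q (i + j)\<^esub> ?w) X) = \<Psi> (minor N \<pi> (conj_by y X))"
        unfolding mult_eq conj_by_mult[OF U_GL[OF y(1)] U_GL[OF w] X] conj_w[OF conj_by_carrier[OF U_GL[OF y(1)] X]] ..
    qed
    also have "\<dots> = H (diag_part 0 i y) (diag_part i (2 * j) y)"
      unfolding H_def by (rule sum.reindex_bij_betw[OF conj_u_fiber[OF y A B]])
    finally show ?thesis .
  qed
  define V where "V g h = (if upper (block_of [k1, m, k3]) (conj_by g A) \<and> upper (block_of [k2, 2 * l, k2]) (conj_by h B)
      then Delta3 a (diag_part 0 k1 (conj_by g A)) (diag_part 0 k2 (conj_by h B))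
          (\<omega> (diag_part (k1 + m) k3 (conj_by g A))) *
        Delta_u q b (diag_part k1 m (conj_by g A), diag_part k2 (2 * l) (conj_by h B))
      else 0)" for g h :: "'k mat"
  have H: "H g h = real (card (u_nil i j \<gamma>)) * V g h" if g: "g \<in> carrier (GL i)" and h: "h \<in> carrier (U q j)" for g h
  proof -
    define A' B' where "A' = conj_by g A" and "B' = conj_by h B"
    have A': "A' \<in> carrier_mat i i" unfolding A'_def by (rule conj_by_carrier[OF g A])
    have B': "B' \<in> u q j" unfolding B'_def by (rule mat_group.lie_closed[OF mat_group_U h B])
    have "H g h = (\<Sum>X \<in> u_fiber i j \<gamma> A' B'. a (\<theta>1 X) * b (\<theta>2 X))"
      unfolding H_def A'_def[symmetric] B'_def[symmetric]
    proof (rule sum.mono_neutral_cong_right)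
      show "u_fiber i j \<gamma> A' B' \<subseteq> u_fiber i j (\<lambda>_. 0) A' B'" by (auto simp: u_fiber_def)
      have up: "upper \<beta>P (minor N \<pi> X) \<longleftrightarrow> upper \<gamma> X" if "X \<in> u_fiber i j (\<lambda>_. 0) A' B'" for X
        using that by (intro upper_minor_perm) (simp only: u_fiber_def u_iff mem_Collect_eq)
      show "\<forall>X \<in> u_fiber i j (\<lambda>_. 0) A' B' - u_fiber i j \<gamma> A' B'. \<Psi> (minor N \<pi> X) = 0"
      proof
        fix X assume X: "X \<in> u_fiber i j (\<lambda>_. 0) A' B' - u_fiber i j \<gamma> A' B'"
        then have "\<not> upper \<gamma> X" by (auto simp: u_fiber_def)
        then show "\<Psi> (minor N \<pi> X) = 0" using up[of X] X unfolding \<Psi>_def by (simp only: if_False DiffD1)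
      qed
      fix X assume X: "X \<in> u_fiber i j \<gamma> A' B'"
      then have "upper \<gamma> X" and X0: "X \<in> u_fiber i j (\<lambda>_. 0) A' B'" by (auto simp: u_fiber_def)
      then show "\<Psi> (minor N \<pi> X) = a (\<theta>1 X) * b (\<theta>2 X)" unfolding \<Psi>_def up[OF X0] by (simp only: if_True)
    qed simp
    also have "\<dots> = real (card (u_fiber i j \<gamma> A' B')) * (avg a (T1 A' B') * avg b (T2 A' B'))"
      by (rule sum_u_fiber)
    also have "\<dots> = real (card (u_nil i j \<gamma>)) * V g h"
    proof (cases "upper (block_of [k1, m, k3]) A' \<and> upper (block_of [k2, 2 * l, k2]) B'")
      case True
      have "card (u_nil i j \<gamma>) = card (u_fiber i j \<gamma> A' B')"
        by (rule bij_betw_same_card[OF bij_u_nil_fiber[OF A' B' upper_\<gamma>_levi[OF A' _ B']]]) (use True in blast)+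
      moreover have "avg a (T1 A' B') = Delta3 a (diag_part 0 k1 A') (diag_part 0 k2 B') (\<omega> (diag_part (k1 + m) k3 A'))"
        by (rule Delta3_eq[symmetric]) (simp_all add: diag_part_def)
      moreover have "avg b (T2 A' B') = Delta_u q b (diag_part k1 m A', diag_part k2 (2 * l) B')"
        by (rule Delta_u_eq[symmetric]) (simp add: diag_part_def, rule diag_part_u[OF B'], simp)
      ultimately show ?thesis unfolding V_def A'_def[symmetric] B'_def[symmetric] using True by (simp only: if_True simp_thms)
    next
      case False
      \<comment> \<open>The diagonal blocks of an \<open>X\<close> in the fibre would inherit the
        levels; so where \<open>V\<close> is 0 by definition, the fibre is empty.\<close>
      have "X \<notin> u_fiber i j \<gamma> A' B'" for X
      proof
        assume "X \<in> u_fiber i j \<gamma> A' B'"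
        then have X: "X \<in> carrier_mat N N" "upper \<gamma> X" and d: "diag_part 0 i X = A'" "diag_part i (2 * j) X = B'"
          by (auto simp only: u_fiber_def u_iff mem_Collect_eq)
        have "upper (block_of [k1, m, k3]) A'"
          unfolding d(1)[symmetric] using X \<gamma>_blocks(1) by (auto simp: upper_def diag_part_def simp del: block_of.simps)
        moreover have "upper (block_of [k2, 2 * l, k2]) B'"
          unfolding d(2)[symmetric] using X \<gamma>_blocks(2) by (auto simp: upper_def diag_part_def simp del: block_of.simps)
        ultimately show False using False by blast
      qed
      then have "u_fiber i j \<gamma> A' B' = {}" by blast
      then show ?thesis unfolding V_def A'_def[symmetric] B'_def[symmetric] using False by (simp only: if_False card.empty of_nat_0 mult_zero_left mult_zero_right)
    qed
    finally show ?thesis .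
  qed
  define S where "S = (\<Sum>g \<in> (\<lambda>(y, p). y * wmat * p) ` (Q \<times> P). f g)"
  have "real (card (u_nil i j \<gamma>)) * ?c * S = real (card P) * (\<Sum>y \<in> Q. f (y \<otimes>\<^bsub>U q (i + j)\<^esub> ?w))"
  proof -
    have "f (g \<otimes>\<^bsub>U q (i + j)\<^esub> p) = f g" if "g \<in> carrier (U q (i + j))" "p \<in> P" for g p
      by (rule inv[OF that])
    from sum_double_coset[where f = f, OF finite_U Qs Ps w this] show ?thesis
      unfolding Req card_R unfolding S_def mult_eq by (simp only:)
  qed
  also have "(\<Sum>y \<in> Q. f (y \<otimes>\<^bsub>U q (i + j)\<^esub> ?w)) = (\<Sum>y \<in> Q. H (diag_part 0 i y) (diag_part i (2 * j) y))"
    by (rule sum.cong[OF refl f_yw])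
  also have "\<dots> = real (card (u_nil i j (\<lambda>_. 0))) * (\<Sum>g \<in> carrier (GL i). \<Sum>h \<in> carrier (U q j). H g h)"
    unfolding Q_eq using sum_parabolic[of i j "\<lambda>_. 0" H] by simp
  also have "(\<Sum>g \<in> carrier (GL i). \<Sum>h \<in> carrier (U q j). H g h) =
      real (card (u_nil i j \<gamma>)) * (\<Sum>g \<in> carrier (GL i). \<Sum>h \<in> carrier (U q j). V g h)"
    unfolding sum_distrib_left by (intro sum.cong refl H)
  finally have main: "real (card (u_nil i j \<gamma>)) * ?c * S = real (card P) * (real (card (u_nil i j (\<lambda>_. 0))) *
      (real (card (u_nil i j \<gamma>)) * (\<Sum>g \<in> carrier (GL i). \<Sum>h \<in> carrier (U q j). V g h)))" .
  have P_pos: "real (card P) \<noteq> 0"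
    using subgroup.one_closed[OF Ps] finite_subset[OF subgroup.subset[OF Ps] finite_U] by auto
  have arith: "s / p / n0 = v / c" if "ng * c * s = p * (n0 * (ng * v))" "ng * c \<noteq> 0" "p \<noteq> 0" "n0 \<noteq> 0" for ng c s p n0 v :: real
    using that by (simp add: field_simps)
  have "S / real (card P) / real (card (u_nil i j (\<lambda>_. 0))) =
      (\<Sum>g \<in> carrier (GL i). \<Sum>h \<in> carrier (U q j). V g h) / ?c"
    by (rule arith[OF main _ P_pos nil_pos]) (use R_pos card_R in argo)
  then show ?thesis unfolding S_def f_def card_fib V_def cell_value_def .
qed

end

text \<open>\<open>class_funs\<close> conjugates as \<open>g X g\<inverse>\<close> and
  \<open>conj_by\<close> the other way round, hence the passage to the inverse.\<close>

lemma (in mat_group) class_funs_conj: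
  assumes f: "f \<in> class_funs G \<G>" and g: "g \<in> carrier G" and X: "X \<in> \<G>"
  shows "f (conj_by g X) = f X"
proof -
  have "f (inv\<^bsub>G\<^esub> g * X * inv\<^bsub>G\<^esub> (inv\<^bsub>G\<^esub> g)) = f X"
    using f X inv_closed[OF g] unfolding class_funs_def by blast
  then show ?thesis unfolding inv_inv[OF g] unfolding inv_eq[OF g] conj_by_def .
qed

text \<open>Matrices of different degrees have different sizes, so at \<open>X\<close> and at its
  conjugate only the component of degree \<open>n\<close> counts.\<close>

lemma direct_sum_conj:
  fixes G :: "nat \<Rightarrow> 'k::{field,finite} mat monoid"
  assumes f: "f \<in> direct_sum (\<lambda>n. class_funs (G n) (\<G> n))" and G: "\<And>n. mat_group (N n) (G n) (\<G> n)"
    and N: "inj N" and g: "g \<in> carrier (G n)" and X: "X \<in> \<G> n"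
  shows "f (conj_by g X) = f X"
  using f unfolding direct_sum_def mem_Collect_eq
proof (elim exE conjE)
  fix S h assume hS: "\<forall>n \<in> S. h n \<in> class_funs (G n) (\<G> n)" and f_eq: "f = (\<lambda>X. \<Sum>n\<in>S. h n X)"
  have X': "conj_by g X \<in> \<G> n" by (rule mat_group.lie_closed[OF G[of n] g X])
  have out: "Y \<notin> \<G> n'" if "Y \<in> \<G> n" "n' \<noteq> n" for Y n'
  proof
    assume "Y \<in> \<G> n'"
    then have "Y \<in> carrier_mat (N n') (N n')" "Y \<in> carrier_mat (N n) (N n)"
      using subsetD[OF mat_group.lie_carrier[OF G[of n']]] subsetD[OF mat_group.lie_carrier[OF G[of n]] that(1)] by simp_all
    then have "N n' = N n" by (metis carrier_matD(1))
    then show False using injD[OF N, of n' n] that(2) by simp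
  qed
  have "h n' (conj_by g X) = h n' X" if "n' \<in> S" for n'
  proof (cases "n' = n")
    case True
    show ?thesis
      unfolding True by (rule mat_group.class_funs_conj[OF G[of n] bspec[OF hS that, unfolded True] g X])
  next
    case False
    then show ?thesis using bspec[OF hS that] out[OF X False] out[OF X' False] by (simp add: class_funs_def)
  qed
  then show "f (conj_by g X) = f X" unfolding f_eq by (intro sum.cong refl)
qed

lemma A_space_invariant:
  fixes a :: "'k::{field,finite} mat \<Rightarrow> real"
  assumes "a \<in> A_space"
  shows "gl_invariant a"
  unfolding gl_invariant_def gl_def[symmetric]
proof (intro allI ballI)
  fix n and g X :: "'k mat" assume gX: "g \<in> carrier (GL n)" "X \<in> gl n"
  show "a (conj_by g X) = a X"
    by (rule direct_sum_conj[where N = "\<lambda>n. n", OF assms[unfolded A_space_def] mat_group_GL _ gX]) simp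
qed

lemma nabla_cmult: "nabla (\<lambda>x. r * f x) X = r * nabla f X"
  using lin_nabla unfolding lin_def by blast

lemma sum_pairs:
  "(\<Sum>(k, l) \<in> {(k, l). k + l = n}. f k l) = (\<Sum>k \<le> n. f k (n - k))" for f :: "nat \<Rightarrow> nat \<Rightarrow> real"
  by (rule sum.reindex_bij_witness[of _ "\<lambda>k. (k, n - k)" fst]) auto

lemma sum_triples:
  fixes f :: "nat \<Rightarrow> nat \<Rightarrow> nat \<Rightarrow> nat \<Rightarrow> real"
  shows "(\<Sum>(k, k3) \<in> {(k, k3). k + k3 = n}. \<Sum>(k1, m) \<in> {(k1, m). k1 + m = k}. f k k3 k1 m) =
    (\<Sum>(k1, k3) \<in> {(k1, k3). k1 + k3 \<le> n}. f (n - k3) k3 k1 (n - k1 - k3))"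
proof -
  have "(\<Sum>(k, k3) \<in> {(k, k3). k + k3 = n}. \<Sum>(k1, m) \<in> {(k1, m). k1 + m = k}. f k k3 k1 m) =
      (\<Sum>k \<le> n. \<Sum>k1 \<le> k. f k (n - k) k1 (k - k1))"
    by (simp only: sum_pairs)
  also have "\<dots> = (\<Sum>(k, k1) \<in> (SIGMA k:{..n}. {..k}). f k (n - k) k1 (k - k1))"
    by (rule sum.Sigma) auto
  also have "\<dots> = (\<Sum>(k1, k3) \<in> {(k1, k3). k1 + k3 \<le> n}. f (n - k3) k3 k1 (n - k1 - k3))"
    by (rule sum.reindex_bij_witness[of _ "\<lambda>(k1, k3). (n - k3, k1)" "\<lambda>(k, k1). (k1, n - k)"])
      (auto simp: diff_diff_eq ac_simps)
  finally show ?thesis .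
qed

context unitary
begin

lemma B_space_invariant:
  assumes "b \<in> B_space q"
  shows "u_invariant b"
  unfolding u_invariant_def
proof (intro allI ballI)
  fix n and y X :: "'k mat" assume yX: "y \<in> carrier (U q n)" "X \<in> u q n"
  show "b (conj_by y X) = b X"
    by (rule direct_sum_conj[where N = "\<lambda>n. 2 * n", OF assms[unfolded B_space_def] mat_group_U _ yX])
      (simp add: inj_def)
qed

lemma nabla_u_eq:
  fixes F :: "'k mat \<Rightarrow> 'k mat \<Rightarrow> real"
  assumes inv: "\<And>B. gl_invariant (\<lambda>A. F A B)" "\<And>A. u_invariant (F A)" and X: "X \<in> u q n"
  shows "nabla_u q (\<lambda>(A, B). F A B) X = (\<Sum>(k, l) \<in> {(k, l). k + l = n}.
    (\<Sum>g \<in> carrier (U q n). if upper (block_of [k, 2 * l, k]) (conj_by g X)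
      then F (diag_part 0 k (conj_by g X)) (diag_part k (2 * l) (conj_by g X)) else 0) /
    real (card (parabolic (U q n :: 'k mat monoid) [k, 2 * l, k])))"
proof -
  interpret mat_group "2 * n" "U q n :: 'k mat monoid" "u q n" by (rule mat_group_U)
  have Xc: "X \<in> carrier_mat (2 * n) (2 * n)" using X by (simp add: u_iff)
  have n: "dim_row X div 2 = n" using Xc by simp
  have "par_ind (U q n) (u q n) [k, 2 * l, k] (\<lambda>Y. F (diag_part 0 k Y) (diag_part k (2 * l) Y)) X =
    (\<Sum>g \<in> carrier (U q n). if upper (block_of [k, 2 * l, k]) (conj_by g X)
      then F (diag_part 0 k (conj_by g X)) (diag_part k (2 * l) (conj_by g X)) else 0) /
    real (card (parabolic (U q n :: 'k mat monoid) [k, 2 * l, k]))" (is "par_ind _ _ ?ns ?\<Phi> X = _")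
    if kl: "k + l = n" for k l
  proof -
    have lp: "?\<Phi> (levi_proj ?ns W) = ?\<Phi> W" if W: "W \<in> carrier_mat (2 * n) (2 * n)" for W
    proof -
      have "diag_part 0 k (levi_proj ?ns W) = diag_part 0 k W"
        by (rule diag_part_levi_proj[OF W, where l = 0]) (use kl in auto)
      moreover have "diag_part k (2 * l) (levi_proj ?ns W) = diag_part k (2 * l) W"
        by (rule diag_part_levi_proj[OF W, where l = 1]) (use kl in auto)
      ultimately show ?thesis by simp
    qed
    have gc: "conj_by g W \<in> carrier_mat (2 * n) (2 * n)"
      if "g \<in> carrier (U q n)" "W \<in> carrier_mat (2 * n) (2 * n)" for g W :: "'k mat"
      by (rule conj_by_carrier[OF U_GL[OF that(1)] that(2)])
    have "?\<Phi> (levi_proj ?ns (conj_by p W)) = ?\<Phi> (levi_proj ?ns W)"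
      if p: "p \<in> carrier (U q n)" "upper (block_of ?ns) p" and W: "W \<in> u q n" "upper (block_of ?ns) W" for p W :: "'k mat"
    proof -
      have Wc: "W \<in> carrier_mat (2 * n) (2 * n)" using W(1) by (simp add: u_iff)
      note d = u_diag_parts_conj[of p k l W, unfolded kl, OF p Wc W(2)]
      have Wu: "diag_part k (2 * l) W \<in> u q l" by (rule diag_part_u[OF W(1)]) (use kl in simp)
      have Wk: "diag_part 0 k W \<in> carrier_mat k k" by (simp add: diag_part_def)
      have "?\<Phi> (conj_by p W) = ?\<Phi> W"
        unfolding d(3,4) by (rule trans[OF u_invariantD[OF inv(2) d(2) Wu] gl_invariantD[OF inv(1) d(1) Wk]])
      then show ?thesis unfolding lp[OF Wc] lp[OF gc[OF p(1) Wc]] .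
    qed
    from par_ind_eq_sum[of ?ns ?\<Phi>, OF this X] show ?thesis
      unfolding lp[OF gc[OF _ Xc]] by (simp only: lp[OF gc[OF _ Xc]] cong: sum.cong)
  qed
  then show ?thesis
    unfolding nabla_u_def Let_def n using X by (auto simp del: block_of.simps intro!: sum.cong)
qed

lemma sum_grid:
  fixes a b :: "'k mat \<Rightarrow> real" and A B :: "'k mat"
  assumes a: "gl_invariant a" and b: "u_invariant b" and A: "A \<in> carrier_mat i i" and B: "B \<in> u q j"
    and le: "k1 + k3 \<le> i" "k2 \<le> j" and k: "k1 + k2 + k3 = k"
  shows "(\<Sum>g \<in> dcoset i j k1 k2 k3. \<Sum>X \<in> u_fiber i j (\<lambda>_. 0) A B.
        if upper (block_of [k, 2 * (i + j - k), k]) (conj_by g X)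
        then a (diag_part 0 k (conj_by g X)) * b (diag_part k (2 * (i + j - k)) (conj_by g X)) else 0) /
      real (card (parabolic (U q (i + j) :: 'k mat monoid) [k, 2 * (i + j - k), k])) /
      real (card (u_fiber i j (\<lambda>_. 0) A B)) =
    cell_value a b k1 (i - k1 - k3) k3 k2 (j - k2) A B"
proof -
  define m l where "m = i - k1 - k3" and "l = j - k2"
  have ij: "k1 + m + k3 = i" "k2 + l = j" using le by (auto simp: m_def l_def)
  have ml: "i + j - k = m + l" using ij k by auto
  interpret G: unitary_grid q c k1 k2 k3 m l ..
  note main = G.sum_cell[OF a b, unfolded ij k, OF A B]
  show ?thesis
    using main unfolding dcoset_def parabolic_def block_upper_eq k m_def[symmetric] l_def[symmetric] ml .
qed

text \<open>After the sums are interchanged, for each \<open>k\<close> the group is cut into the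
  double cosets with \<open>k1 + k2 + k3 = k\<close>, and \<open>sum_grid\<close> evaluates each of
  them. Summation over \<open>k\<close> removes that constraint, so that only the bounds by
  \<open>i\<close> and \<open>j\<close> remain.\<close>

lemma Delta_u_nabla_u:
  fixes a b :: "'k mat \<Rightarrow> real" and A B :: "'k mat"
  assumes a: "gl_invariant a" and b: "u_invariant b" and A: "A \<in> carrier_mat i i" and B: "B \<in> u q j"
  shows "Delta_u q (nabla_u q (tens a b)) (A, B) =
    (\<Sum>(k1, k2, k3) \<in> {(k1, k2, k3). k1 + k3 \<le> i \<and> k2 \<le> j}. cell_value a b k1 (i - k1 - k3) k3 k2 (j - k2) A B)"
proof -
  interpret mat_group "2 * (i + j)" "U q (i + j) :: 'k mat monoid" "u q (i + j)" by (rule mat_group_U)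
  let ?n = "i + j" and ?fib = "u_fiber i j (\<lambda>_. 0) A B"
  define \<Psi> where "\<Psi> k Y = (if upper (block_of [k, 2 * (?n - k), k]) Y
    then a (diag_part 0 k Y) * b (diag_part k (2 * (?n - k)) Y) else 0)" for k and Y :: "'k mat"
  define p where "p k = real (card (parabolic (U q ?n :: 'k mat monoid) [k, 2 * (?n - k), k]))" for k
  define C where "C = {(k1, k2, k3). k1 + k3 \<le> i \<and> k2 \<le> j}"
  define deg where "deg = (\<lambda>(k1 :: nat, k2, k3). k1 + k2 + k3)"
  define D where "D = (\<lambda>(k1, k2, k3). dcoset i j k1 k2 k3)"
  define V where "V = (\<lambda>(k1, k2, k3). cell_value a b k1 (i - k1 - k3) k3 k2 (j - k2) A B)"
  have finC: "finite C"
    by (rule finite_subset[of _ "{..i} \<times> {..j} \<times> {..i}"]) (auto simp: C_def)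
  have fibu: "X \<in> u q ?n" if "X \<in> ?fib" for X using that by (simp add: u_fiber_def)
  have ind: "nabla_u q (tens a b) X = (\<Sum>k \<le> ?n. (\<Sum>g \<in> carrier (U q ?n). \<Psi> k (conj_by g X)) / p k)"
    if X: "X \<in> u q ?n" for X
  proof -
    have "gl_invariant (\<lambda>A. a A * b B)" "u_invariant (\<lambda>B. a A * b B)" for A B
      using a b by (simp_all add: gl_invariant_def u_invariant_def)
    from nabla_u_eq[of "\<lambda>A B. a A * b B", OF this X] show ?thesis
      unfolding tens_def sum_pairs \<Psi>_def p_def .
  qed
  have DU: "D t \<subseteq> carrier (U q ?n)" if t_C: "t \<in> C" for t
  proof -
    obtain k1 k2 k3 where t: "t = (k1, k2, k3)" and le: "k1 + k3 \<le> i" "k2 \<le> j" using t_C by (cases t) (auto simp: C_def)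
    have "k1 + (i - k1 - k3) + k3 + (k2 + (j - k2)) = ?n" using le by auto
    then have "grid.wmat k1 k2 k3 (i - k1 - k3) (j - k2) \<in> carrier (U q ?n :: 'k mat monoid)"
      using wmat_U[of k1 k2 k3 "i - k1 - k3" "j - k2"] by (simp only:)
    from m_closed[OF m_closed[OF _ this]]
    have prod: "y * grid.wmat k1 k2 k3 (i - k1 - k3) (j - k2) * z \<in> carrier (U q ?n)"
      if "y \<in> carrier (U q ?n)" "z \<in> carrier (U q ?n)" for y z :: "'k mat"
      using that unfolding mult_eq by blast
    show ?thesis
    proof
      fix g assume "g \<in> D t"
      then obtain y z where "y \<in> carrier (U q ?n)" "z \<in> carrier (U q ?n)"
        and g: "g = y * grid.wmat k1 k2 k3 (i - k1 - k3) (j - k2) * z"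
        unfolding t D_def prod.case dcoset_def parabolic_def by auto
      then show "g \<in> carrier (U q ?n)" unfolding g using prod by blast
    qed
  qed
  have split: "(\<Sum>g \<in> carrier (U q ?n). f g) = (\<Sum>t \<in> {t \<in> C. deg t = k}. \<Sum>g \<in> D t. f g)"
    if k: "k \<le> ?n" for k and f :: "'k mat \<Rightarrow> real"
  proof -
    have U_eq: "carrier (U q ?n) = (\<Union>t \<in> {t \<in> C. deg t = k}. D t)"
    proof
      show "carrier (U q ?n) \<subseteq> (\<Union>t \<in> {t \<in> C. deg t = k}. D t)"
      proof
        fix g :: "'k mat" assume "g \<in> carrier (U q ?n)"
        from in_dcoset[OF this k] obtain k1 k2 k3 where
          "k1 + k2 + k3 = k" "k1 + k3 \<le> i" "k2 \<le> j" "g \<in> dcoset i j k1 k2 k3" by blast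
        then show "g \<in> (\<Union>t \<in> {t \<in> C. deg t = k}. D t)"
          by (intro UN_I[of "(k1, k2, k3)"]) (simp_all add: C_def deg_def D_def)
      qed
    qed (use DU in blast)
    have disj: "D t \<inter> D t' = {}" if "t \<in> C" "deg t = k" "t' \<in> C" "deg t' = k" "t \<noteq> t'" for t t'
    proof -
      obtain k1 k2 k3 k1' k2' k3' where t: "t = (k1, k2, k3)" "t' = (k1', k2', k3')"
        by (cases t, cases t') blast
      have le: "k1 + k3 \<le> i" "k2 \<le> j" "k1' + k3' \<le> i" "k2' \<le> j" "k1 + k2 + k3 = k1' + k2' + k3'"
        using that unfolding t by (auto simp: C_def deg_def)
      show ?thesis using dcoset_disjoint[OF le] that(5) unfolding t D_def prod.case by blast
    qed
    have finD: "finite (D t)" if "t \<in> C" for t by (rule finite_subset[OF DU[OF that] finite_U])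
    have "(\<Sum>g \<in> (\<Union>t \<in> {t \<in> C. deg t = k}. D t). f g) = (\<Sum>t \<in> {t \<in> C. deg t = k}. \<Sum>g \<in> D t. f g)"
    proof (rule sum.UNION_disjoint)
      show "finite {t \<in> C. deg t = k}" using finC by simp
      show "\<forall>t \<in> {t \<in> C. deg t = k}. finite (D t)" using finD by blast
      show "\<forall>t \<in> {t \<in> C. deg t = k}. \<forall>t' \<in> {t \<in> C. deg t = k}. t \<noteq> t' \<longrightarrow> D t \<inter> D t' = {}" using disj by blast
    qed
    then show ?thesis unfolding U_eq .
  qed
  have cell: "(\<Sum>g \<in> D t. \<Sum>X \<in> ?fib. \<Psi> k (conj_by g X)) / p k / real (card ?fib) = V t"
    if t: "t \<in> C" "deg t = k" for t k
  proof -
    obtain k1 k2 k3 where e: "t = (k1, k2, k3)" and le: "k1 + k3 \<le> i" "k2 \<le> j" and k: "k1 + k2 + k3 = k"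
      using t by (cases t) (auto simp: C_def deg_def)
    show ?thesis unfolding e D_def V_def prod.case \<Psi>_def p_def by (rule sum_grid[OF a b A B le k])
  qed
  have div_div: "sum F T / x / y = (\<Sum>t \<in> T. F t / x / y)" for F :: "nat \<times> nat \<times> nat \<Rightarrow> real" and T x y
    by (simp add: sum_divide_distrib)
  have "Delta_u q (nabla_u q (tens a b)) (A, B) =
      (\<Sum>X \<in> ?fib. \<Sum>k \<le> ?n. (\<Sum>g \<in> carrier (U q ?n). \<Psi> k (conj_by g X)) / p k) / real (card ?fib)"
    unfolding Delta_u_eq[OF A B] avg_def by (simp only: ind[OF fibu] cong: sum.cong)
  also have "\<dots> = (\<Sum>k \<le> ?n. (\<Sum>g \<in> carrier (U q ?n). \<Sum>X \<in> ?fib. \<Psi> k (conj_by g X)) / p k / real (card ?fib))"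
  proof -
    have "(\<Sum>X \<in> ?fib. \<Sum>k \<le> ?n. (\<Sum>g \<in> carrier (U q ?n). \<Psi> k (conj_by g X)) / p k) =
        (\<Sum>k \<le> ?n. (\<Sum>g \<in> carrier (U q ?n). \<Sum>X \<in> ?fib. \<Psi> k (conj_by g X)) / p k)"
    proof (rule trans[OF sum.swap], rule sum.cong[OF refl])
      fix k
      show "(\<Sum>X \<in> ?fib. (\<Sum>g \<in> carrier (U q ?n). \<Psi> k (conj_by g X)) / p k) =
          (\<Sum>g \<in> carrier (U q ?n). \<Sum>X \<in> ?fib. \<Psi> k (conj_by g X)) / p k"
        unfolding sum_divide_distrib[symmetric] by (rule arg_cong[where f = "\<lambda>x. x / p k"], rule sum.swap)
    qed
    then show ?thesis by (simp only: sum_divide_distrib[of _ "{..?n}"])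
  qed
  also have "\<dots> = (\<Sum>k \<le> ?n. \<Sum>t \<in> {t \<in> C. deg t = k}. V t)"
  proof (rule sum.cong[OF refl])
    fix k assume "k \<in> {..?n}"
    then have k: "k \<le> ?n" by simp
    show "(\<Sum>g \<in> carrier (U q ?n). \<Sum>X \<in> ?fib. \<Psi> k (conj_by g X)) / p k / real (card ?fib) =
        (\<Sum>t \<in> {t \<in> C. deg t = k}. V t)"
      unfolding split[OF k] div_div by (rule sum.cong[OF refl]) (rule cell; simp)
  qed
  also have "\<dots> = sum V C"
    by (rule sum.group[OF finC]) (auto simp: C_def deg_def)
  finally show ?thesis unfolding V_def C_def .
qed

end

lemma sum_mult_indicator:
  fixes f :: "'a \<Rightarrow> 'b \<Rightarrow> real"
  shows "(\<Sum>h \<in> H. (if P h then 1 / p else 0) * ((\<Sum>g \<in> G. if Q g then f g h else 0) / p')) =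
    (\<Sum>g \<in> G. \<Sum>h \<in> H. if Q g \<and> P h then f g h else 0) / (p' * p)"
proof -
  have "(\<Sum>g \<in> G. \<Sum>h \<in> H. if Q g \<and> P h then f g h else 0) / (p' * p) =
      (\<Sum>h \<in> H. (\<Sum>g \<in> G. if Q g \<and> P h then f g h else 0) / (p' * p))"
    unfolding sum_divide_distrib[symmetric] by (rule arg_cong[where f = "\<lambda>x. x / (p' * p)"], rule sum.swap)
  also have "\<dots> = (\<Sum>h \<in> H. (if P h then 1 / p else 0) * ((\<Sum>g \<in> G. if Q g then f g h else 0) / p'))"
  proof (rule sum.cong[OF refl])
    fix h
    show "(\<Sum>g \<in> G. if Q g \<and> P h then f g h else 0) / (p' * p) =
        (if P h then 1 / p else 0) * ((\<Sum>g \<in> G. if Q g then f g h else 0) / p')"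
      by (cases "P h") simp_all
  qed
  finally show ?thesis by (rule sym)
qed

section \<open>The twisted action as a sum over the same cells\<close>

context unitary
begin

lemma gl_invariant_Delta_u:
  fixes b :: "'k mat \<Rightarrow> real" and B :: "'k mat"
  assumes b: "u_invariant b"
  shows "gl_invariant (\<lambda>A. Delta_u q b (A, B))"
  unfolding gl_invariant_def
proof (intro allI ballI)
  fix n and g X :: "'k mat" assume g: "g \<in> carrier (GL n)" and X: "X \<in> carrier_mat n n"
  note gX = conj_by_carrier[OF g X]
  show "Delta_u q b (conj_by g X, B) = Delta_u q b (X, B)"
  proof (cases "B \<in> u q (dim_row B div 2)")
    case True
    interpret mat_group "2 * (dim_row B div 2)" "U q (dim_row B div 2) :: 'k mat monoid" "u q (dim_row B div 2)"
      by (rule mat_group_U)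
    have one: "(1\<^sub>m (2 * (dim_row B div 2)) :: 'k mat) \<in> carrier (U q (dim_row B div 2))"
      using one_closed by (simp only: one_eq)
    have B1: "conj_by (1\<^sub>m (2 * (dim_row B div 2))) B = B"
      by (rule conj_by_one) (use True in \<open>simp only: u_iff\<close>)
    show ?thesis using Delta_u_conj[OF u_invariantD[OF b] g one X True] unfolding B1 .
  next
    case False
    show ?thesis unfolding Delta_u_outside[OF disjI2[OF False]] ..
  qed
qed

lemma u_invariant_Delta_u:
  fixes b :: "'k mat \<Rightarrow> real" and A :: "'k mat"
  assumes b: "u_invariant b"
  shows "u_invariant (\<lambda>B. Delta_u q b (A, B))"
  unfolding u_invariant_def
proof (intro allI ballI)
  fix n and y X :: "'k mat" assume y: "y \<in> carrier (U q n)" and X: "X \<in> u q n"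
  show "Delta_u q b (A, conj_by y X) = Delta_u q b (A, X)"
  proof (cases "A \<in> carrier_mat (dim_row A) (dim_row A)")
    case True
    show ?thesis using Delta_u_conj[OF u_invariantD[OF b] one_GL y True X] unfolding conj_by_one[OF True] .
  next
    case False
    show ?thesis unfolding Delta_u_outside[OF disjI1[OF False]] ..
  qed
qed

lemma omega_eq: "omega q f X = (if X \<in> carrier_mat (dim_row X) (dim_row X) then f (\<omega> X) else 0)"
  for X :: "'k mat"
proof (cases "X \<in> carrier_mat (dim_row X) (dim_row X)")
  case True
  show ?thesis unfolding omega_def Let_def gl_def J_herm_J[OF True] ..
next
  case False
  then show ?thesis unfolding omega_def Let_def gl_def by (simp only: if_False)
qed

text \<open>The flip reverses products, so the twist turns conjugation by \<open>g\<close> into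
  conjugation by \<open>flip c (mat_inv g)\<close>.\<close>

lemma gl_invariant_omega:
  fixes f :: "'k mat \<Rightarrow> real"
  assumes f: "gl_invariant f"
  shows "gl_invariant (omega q f)"
  unfolding gl_invariant_def
proof (intro allI ballI)
  fix n and g X :: "'k mat" assume g: "g \<in> carrier (GL n)" and X: "X \<in> carrier_mat n n"
  define g' where "g' = flip c (mat_inv g)"
  have g': "g' \<in> carrier (GL n)" unfolding g'_def by (rule flip_GL[OF field_hom_c mat_inv_props(1)[OF g]])
  note cs = GL_carrier[OF g'] mat_inv_props(2)[OF g'] flip_carrier[OF X, of c]
  have e1: "mat_inv g' * - flip c X = - (mat_inv g' * flip c X)"
    by (rule uminus_mult_right_mat) (use cs in auto)
  have e2: "- (mat_inv g' * flip c X) * g' = - (mat_inv g' * flip c X * g')"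
    by (rule uminus_mult_left_mat) (use cs in auto)
  have e3: "conj_by g' (\<omega> X) = - conj_by g' (flip c X)" unfolding conj_by_def e1 e2 ..
  have "\<omega> (conj_by g X) = conj_by g' (\<omega> X)"
    unfolding e3 unfolding flip_conj_by[OF field_hom_c g X] g'_def ..
  then have "f (\<omega> (conj_by g X)) = f (\<omega> X)"
    using gl_invariantD[OF f g' \<omega>_carrier[OF X]] by (simp only:)
  moreover have "X \<in> carrier_mat (dim_row X) (dim_row X)" "conj_by g X \<in> carrier_mat (dim_row (conj_by g X)) (dim_row (conj_by g X))"
    using X conj_by_carrier[OF g X] by auto
  ultimately show "omega q f (conj_by g X) = omega q f X" unfolding omega_eq by (simp only: if_True)
qed

lemma twist_coeff_eq:
  "twist_coeff q a (Y, B) = nabla (\<lambda>(X1, X2). omega q (\<lambda>X. Delta3 a X1 X B) X2) Y" for a :: "'k mat \<Rightarrow> real"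
  unfolding twist_coeff_def left_map_def right_map_def Delta3_def by (simp add: case_prod_unfold)

lemma twisted_act_eq:
  "twisted_act q a t (A, B) =
    nabla (\<lambda>x. nabla_u q (\<lambda>(B1, B2). twist_coeff q a (fst x, B1) * t (snd x, B2)) B) A"
  for a :: "'k mat \<Rightarrow> real"
  unfolding twisted_act_def left_map_def right_map_def middle_swap_def tens_def by (simp add: case_prod_unfold)

lemma gl_invariant_twist_coeff:
  fixes a :: "'k mat \<Rightarrow> real"
  assumes a: "gl_invariant a"
  shows "gl_invariant (\<lambda>B. twist_coeff q a (Y, B))"
  unfolding gl_invariant_def
proof (intro allI ballI)
  fix n and g X :: "'k mat" assume "g \<in> carrier (GL n)" "X \<in> carrier_mat n n"
  then have "Delta3 a X1 X2 (conj_by g X) = Delta3 a X1 X2 X" for X1 X2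
    by (rule gl_invariantD[OF gl_invariant_Delta3(3)[OF a]])
  then show "twist_coeff q a (Y, conj_by g X) = twist_coeff q a (Y, X)" unfolding twist_coeff_eq by simp
qed

text \<open>Cocommutativity of \<open>\<Delta>\<close> and commutativity of \<open>\<nabla>\<close> bring the middle factor \<open>\<omega>(a\<^sub>2)\<close> to the last place.\<close>

lemma nabla_twist_coeff:
  fixes a b :: "'k mat \<Rightarrow> real" and A B1 B2 :: "'k mat"
  assumes a: "gl_invariant a" and b: "u_invariant b" and A: "A \<in> carrier_mat i i"
  shows "nabla (\<lambda>x. twist_coeff q a (fst x, B1) * Delta_u q b (snd x, B2)) A =
    (\<Sum>(k1, k3) \<in> {(k1, k3). k1 + k3 \<le> i}. induced i [k1, i - k1 - k3, k3] (\<lambda>Y.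
      Delta3 a (diag_part 0 k1 Y) B1 (\<omega> (diag_part (i - k3) k3 Y)) * Delta_u q b (diag_part k1 (i - k1 - k3) Y, B2)) A)"
proof -
  define F where "F X1 X2 X3 = omega q (\<lambda>X. Delta3 a X1 X B1) X2 * Delta_u q b (X3, B2)" for X1 X2 X3 :: "'k mat"
  have inv1: "gl_invariant (\<lambda>X1. F X1 X2 X3)" for X2 X3
    unfolding gl_invariant_def
  proof (intro allI ballI)
    fix n and g X :: "'k mat" assume "g \<in> carrier (GL n)" "X \<in> carrier_mat n n"
    then have "Delta3 a (conj_by g X) Z B1 = Delta3 a X Z B1" for Z
      by (rule gl_invariantD[OF gl_invariant_Delta3(1)[OF a]])
    then show "F (conj_by g X) X2 X3 = F X X2 X3" unfolding F_def by simp
  qed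
  have inv2: "gl_invariant (\<lambda>X2. F X1 X2 X3)" for X1 X3
    using gl_invariant_omega[OF gl_invariant_Delta3(2)[OF a]] unfolding F_def gl_invariant_def by simp
  have inv3: "gl_invariant (F X1 X2)" for X1 X2
    using gl_invariant_Delta_u[OF b] unfolding F_def gl_invariant_def by simp
  have tw: "nabla (\<lambda>(X1, X2). F X1 X2 X3) Y = twist_coeff q a (Y, B1) * Delta_u q b (X3, B2)" for X3 Y
    using nabla_cmult[of "Delta_u q b (X3, B2)" "\<lambda>(X1, X2). omega q (\<lambda>X. Delta3 a X1 X B1) X2" Y]
    unfolding twist_coeff_eq F_def by (simp add: case_prod_unfold mult.commute)
  have "nabla (\<lambda>x. twist_coeff q a (fst x, B1) * Delta_u q b (snd x, B2)) A = nabla3 F A"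
    unfolding nabla3_def tw by (simp add: case_prod_unfold)
  also have "\<dots> = nabla3 (\<lambda>X1 X3 X2. F X1 X2 X3) A"
    by (rule nabla3_swap_last[OF inv1 inv2 inv3 A])
  also have "\<dots> = (\<Sum>(k, k3) \<in> {(k, k3). k + k3 = i}. \<Sum>(k1, m) \<in> {(k1, m). k1 + m = k}.
      induced i [k1, m, k3] (\<lambda>Y. F (diag_part 0 k1 Y) (diag_part k k3 Y) (diag_part k1 m Y)) A)"
    by (rule nabla3_eq[OF inv1 inv3 inv2 A])
  also have "\<dots> = (\<Sum>(k1, k3) \<in> {(k1, k3). k1 + k3 \<le> i}. induced i [k1, i - k1 - k3, k3]
      (\<lambda>Y. F (diag_part 0 k1 Y) (diag_part (i - k3) k3 Y) (diag_part k1 (i - k1 - k3) Y)) A)"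
    by (rule sum_triples)
  finally have main: "nabla (\<lambda>x. twist_coeff q a (fst x, B1) * Delta_u q b (snd x, B2)) A = \<dots>" .
  have F_eq: "F X1 (diag_part r s Y) X3 = Delta3 a X1 B1 (\<omega> (diag_part r s Y)) * Delta_u q b (X3, B2)" for X1 X3 r s Y
  proof -
    have sq: "diag_part r s Y \<in> carrier_mat (dim_row (diag_part r s Y)) (dim_row (diag_part r s Y))"
      by (simp add: diag_part_def)
    show ?thesis unfolding F_def omega_eq if_P[OF sq] Delta3_swap_last[OF a, of X1 B1] ..
  qed
  show ?thesis unfolding main F_eq ..
qed

text \<open>\<open>w\<close> collects the indicator and the normalisation of the induction on the
  unitary side. It is independent of the variable of \<open>nabla\<close>, which therefore passes
  through the finite sums by linearity and meets only \<open>K\<close>, where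
  \<open>nabla_twist_coeff\<close> applies.\<close>

lemma twisted_act_Delta_u:
  fixes a b :: "'k mat \<Rightarrow> real" and A B :: "'k mat"
  assumes a: "gl_invariant a" and b: "u_invariant b" and A: "A \<in> carrier_mat i i" and B: "B \<in> u q j"
  shows "twisted_act q a (Delta_u q b) (A, B) =
    (\<Sum>(k1, k2, k3) \<in> {(k1, k2, k3). k1 + k3 \<le> i \<and> k2 \<le> j}. cell_value a b k1 (i - k1 - k3) k3 k2 (j - k2) A B)"
proof -
  let ?E = "{(k1, k3). k1 + k3 \<le> i}" and ?U = "carrier (U q j :: 'k mat monoid)"
  define K where "K k2 h x = twist_coeff q a (fst x, diag_part 0 k2 (conj_by h B)) *
    Delta_u q b (snd x, diag_part k2 (2 * (j - k2)) (conj_by h B))" for k2 h and x :: "'k mat \<times> 'k mat"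
  define w where "w k2 h = (if upper (block_of [k2, 2 * (j - k2), k2]) (conj_by h B)
    then 1 / real (card (parabolic (U q j :: 'k mat monoid) [k2, 2 * (j - k2), k2])) else 0)" for k2 and h :: "'k mat"
  define I where "I k2 h = (\<lambda>(k1, k3). induced i [k1, i - k1 - k3, k3] (\<lambda>Y.
      Delta3 a (diag_part 0 k1 Y) (diag_part 0 k2 (conj_by h B)) (\<omega> (diag_part (i - k3) k3 Y)) *
      Delta_u q b (diag_part k1 (i - k1 - k3) Y, diag_part k2 (2 * (j - k2)) (conj_by h B))) A)" for k2 and h :: "'k mat"
  have ind: "nabla_u q (\<lambda>(B1, B2). twist_coeff q a (fst x, B1) * Delta_u q b (snd x, B2)) B =
      (\<Sum>k2 \<le> j. \<Sum>h \<in> ?U. w k2 h * K k2 h x)" for x :: "'k mat \<times> 'k mat"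
  proof -
    have i1: "gl_invariant (\<lambda>B1. twist_coeff q a (fst x, B1) * Delta_u q b (snd x, B2))" for B2
      using gl_invariant_twist_coeff[OF a] unfolding gl_invariant_def by simp
    have i2: "u_invariant (\<lambda>B2. twist_coeff q a (fst x, B1) * Delta_u q b (snd x, B2))" for B1
      using u_invariant_Delta_u[OF b] unfolding u_invariant_def by simp
    have wK: "(if upper (block_of [k2, 2 * (j - k2), k2]) (conj_by h B)
        then twist_coeff q a (fst x, diag_part 0 k2 (conj_by h B)) *
          Delta_u q b (snd x, diag_part k2 (2 * (j - k2)) (conj_by h B)) else 0) /
        real (card (parabolic (U q j :: 'k mat monoid) [k2, 2 * (j - k2), k2])) = w k2 h * K k2 h x" for k2 h
      unfolding w_def K_def by (simp del: block_of.simps)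
    show ?thesis
      unfolding nabla_u_eq[of "\<lambda>B1 B2. twist_coeff q a (fst x, B1) * Delta_u q b (snd x, B2)", OF i1 i2 B]
        sum_pairs sum_divide_distrib wK ..
  qed
  have K: "nabla (K k2 h) A = sum (I k2 h) ?E" for k2 h
    unfolding K_def I_def by (rule nabla_twist_coeff[OF a b A])
  have cell: "(\<Sum>h \<in> ?U. w k2 h * I k2 h (k1, k3)) = cell_value a b k1 (i - k1 - k3) k3 k2 (j - k2) A B"
    if le: "k1 + k3 \<le> i" "k2 \<le> j" for k1 k2 k3
  proof -
    have ij: "k1 + (i - k1 - k3) + k3 = i" "k2 + (j - k2) = j" "k1 + (i - k1 - k3) = i - k3" "i - k3 + k3 = i"
      using le by auto
    show ?thesis
      unfolding w_def I_def prod.case induced_def cell_value_def ij by (rule sum_mult_indicator)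
  qed
  have "twisted_act q a (Delta_u q b) (A, B) = (\<Sum>k2 \<le> j. \<Sum>h \<in> ?U. w k2 h * sum (I k2 h) ?E)"
    unfolding twisted_act_eq ind lin_sum[OF lin_nabla] nabla_cmult K ..
  also have "\<dots> = (\<Sum>k2 \<le> j. \<Sum>e \<in> ?E. \<Sum>h \<in> ?U. w k2 h * I k2 h e)"
    unfolding sum_distrib_left by (intro sum.cong refl sum.swap)
  also have "\<dots> = (\<Sum>(k2, e) \<in> {..j} \<times> ?E. \<Sum>h \<in> ?U. w k2 h * I k2 h e)"
    by (rule sum.cartesian_product)
  also have "\<dots> = (\<Sum>(k1, k2, k3) \<in> {(k1, k2, k3). k1 + k3 \<le> i \<and> k2 \<le> j}.
      cell_value a b k1 (i - k1 - k3) k3 k2 (j - k2) A B)"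
    by (rule sum.reindex_bij_witness[of _ "\<lambda>(k1, k2, k3). (k2, (k1, k3))" "\<lambda>(k2, (k1, k3)). (k1, k2, k3)"])
      (auto simp: cell)
  finally show ?thesis .
qed

lemma Delta_u_nabla_u_eq_twisted_act:
  fixes a b :: "'k mat \<Rightarrow> real"
  assumes "a \<in> A_space" "b \<in> B_space q"
  shows "Delta_u q (nabla_u q (tens a b)) = twisted_act q a (Delta_u q b)"
proof
  fix p :: "'k mat \<times> 'k mat"
  obtain A B where p: "p = (A, B)" by (cases p)
  show "Delta_u q (nabla_u q (tens a b)) p = twisted_act q a (Delta_u q b) p"
  proof (cases "A \<in> carrier_mat (dim_row A) (dim_row A) \<and> B \<in> u q (dim_row B div 2)")
    case True
    then have A: "A \<in> carrier_mat (dim_row A) (dim_row A)" and B: "B \<in> u q (dim_row B div 2)" by blast+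
    note inv = A_space_invariant[OF assms(1)] B_space_invariant[OF assms(2)]
    show ?thesis unfolding p Delta_u_nabla_u[OF inv A B] twisted_act_Delta_u[OF inv A B] ..
  next
    \<comment> \<open>Tensors are extended by 0, so both sides vanish unless \<open>A\<close> is
      square and \<open>B\<close> lies in some \<open>u q n\<close>.\<close>
    case False
    then have "Delta_u q (nabla_u q (tens a b)) (A, B) = 0" by (intro Delta_u_outside) blast
    moreover have "twisted_act q a (Delta_u q b) (A, B) = 0"
    proof (cases "A \<in> carrier_mat (dim_row A) (dim_row A)")
      case True
      then have "B \<notin> u q (dim_row B div 2)" using False by blast
      then have "nabla_u q F B = 0" for F by (simp add: nabla_u_def Let_def)
      then show ?thesis unfolding twisted_act_eq by (simp add: lin_zero[OF lin_nabla])
    next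
      case False
      then show ?thesis unfolding twisted_act_eq by (rule nabla_outside)
    qed
    ultimately show ?thesis unfolding p by simp
  qed
qed

end

text \<open>Multiplication by a nonzero \<open>x\<close> permutes the nonzero elements; their
  product stays the same but gains the factor \<open>x\<close> once for each of them.\<close>

lemma power_card_field:
  fixes x :: "'k::{field,finite}"
  shows "x ^ CARD('k) = x"
proof (cases "x = 0")
  case False
  let ?S = "UNIV - {0 :: 'k}"
  have "(\<Prod>y \<in> ?S. x * y) = (\<Prod>y \<in> ?S. y)"
    by (rule prod.reindex_bij_witness[of _ "\<lambda>y. y / x" "\<lambda>y. x * y"]) (use False in auto)
  then have "x ^ card ?S * (\<Prod>y \<in> ?S. y) = (\<Prod>y \<in> ?S. y)" by (simp only: prod.distrib prod_constant)
  moreover have "(\<Prod>y \<in> ?S. y) \<noteq> 0" by (simp add: prod_zero_iff)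
  ultimately have one: "x ^ card ?S = 1" by (simp only: mult_cancel_right2 simp_thms)
  have card: "CARD('k) = Suc (card ?S)" by (rule card_Suc_Diff1[symmetric]) simp_all
  show ?thesis unfolding card power_Suc one by (rule mult_1_right)
qed simp

text \<open>The map is additive because \<open>q\<close> is a power of the characteristic, and an
  involution because \<open>x\<close> to the power \<open>q^2\<close> is \<open>x\<close>;
  \<open>q\<close> being odd excludes characteristic 2.\<close>

lemma unitary_frobenius:
  assumes q: "primepow q" "odd q" and card: "CARD('k::{field,finite}) = q ^ 2"
  shows "unitary q (\<lambda>x :: 'k. x ^ q)"
proof -
  obtain p n where p: "prime p" "n > 0" "q = p ^ n" using q(1) unfolding primepow_def by blast
  have pos: "CHAR('k) > 0" by (rule finite_imp_CHAR_pos) simp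
  have prime: "prime CHAR('k)" by (rule prime_CHAR_semidom[OF pos])
  \<comment> \<open>Translation by 1 permutes the field, so the number of its elements is 0 in it.
    This identifies the characteristic with the prime dividing \<open>q\<close>.\<close>
  have "(\<Sum>x \<in> (UNIV :: 'k set). x + 1) = (\<Sum>x \<in> UNIV. x)"
    by (rule sum.reindex_bij_witness[of _ "\<lambda>x. x - 1" "\<lambda>x. x + 1"]) auto
  then have "of_nat CARD('k) = (0 :: 'k)" by (simp add: sum.distrib)
  then have "CHAR('k) dvd p ^ (n * 2)" unfolding of_nat_eq_0_iff_char_dvd card p(3) power_mult .
  then have char: "CHAR('k) = p" by (rule primes_dvd_imp_eq[OF prime p(1) prime_dvd_power[OF prime]])
  show ?thesis
  proof
    show "(x + y) ^ q = x ^ q + y ^ q" for x y :: 'k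
      by (rule freshmans_dream'[OF prime]) (simp add: char p(3))
    show "(x ^ q) ^ q = x" for x :: 'k
      using power_card_field[of x] unfolding card power2_eq_square power_mult .
    show "(2 :: 'k) \<noteq> 0"
    proof
      assume "(2 :: 'k) = 0"
      then have "of_nat 2 = (0 :: 'k)" by simp
      then have "p dvd 2" unfolding of_nat_eq_0_iff_char_dvd char .
      then have "p = 2" by (rule primes_dvd_imp_eq[OF p(1) two_is_prime_nat])
      then show False using q(2) p(2,3) by simp
    qed
  qed (simp_all add: q(2))
qed

theorem theorem13:
  fixes q :: nat and a b :: "'k::{field,finite} mat \<Rightarrow> real"
  assumes "primepow q" and "odd q" and "CARD('k) = q ^ 2"
    and "a \<in> A_space" and "b \<in> B_space q"
  shows "Delta_u q (nabla_u q (tens a b)) = twisted_act q a (Delta_u q b)"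
  by (rule unitary.Delta_u_nabla_u_eq_twisted_act[OF unitary_frobenius[OF assms(1-3)] assms(4,5)])

end
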